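(* Let $N\ge 2$, let $\Omega\subset\mathbb{R}^N$ be a bounded open set with smooth boundary, and let $\delta,\eta>0$ be fixed. There exists $\gamma_0>0$ such that, if $\gamma\in[0,\gamma_0]$, the following holds. Let $n,m\in\mathbb{N}\setminus\{0\}$, $s_1,\dots,s_n\in[0,1]$, $p_1,\dots,p_m\in(1,N)$, $\overline s:=\max\{s_1,\dots,s_n\}\in(0,1]$, $\widehat p:=\max\{p_1,\dots,p_m\}$. Let $\mu_s^-$ be a finite nonnegative Borel measure on $[0,1]$, put $\mu_s^+:=\sum_{i=1}^n\delta_{s_i}$, $\mu_p:=\sum_{j=1}^m\delta_{p_j}$ and $$\mu:=\mu_s^+\times\mu_p-\mu_s^-\times\mu_p=\sum_{i=1}^n\sum_{j=1}^m\delta_{(s_i,p_j)}-\mu_s^-\times\sum_{j=1}^m\delta_{p_j}.$$ Assume that $\mu_s^-([\overline s,1])=0$, that $\mu_s^-([0,\overline s))\le\gamma\,\mu_s^+([\overline s,1])$, and that $\operatorname{supp}(\mu_p)\subset[1+\delta,N-\eta]$. Let $g\in L^{\widehat p/(\widehat p-1)}(\Omega)$. Then there exists a weak solution $u\in\mathcal{X}_\mu(\Omega)$ of the problem $$\begin{cases}\displaystyle\sum_{i=1}^n\sum_{j=1}^m(-\Delta)^{s_i}_{p_j}u-\sum_{j=1}^m\int_{[0,1]}(-\Delta)^s_{p_j}u\,d\mu_s^-(s)=g(x)&\text{in }\Omega,\\ u=0&\text{in }\mathbb{R}^N\setminus\Omega,\end{cases}$$ which is a global minimizer over $\mathcal{X}_\mu(\Omega)$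 of the associated energy functional $J$. Moreover, if $\mu_s^-\equiv0$, then the solution is unique.
   Context: For $s\in(0,1)$ and $p\in(1,N)$ set $c_{N,s,p}:=\dfrac{s\,2^{2s}\,\Gamma\left(\frac{ps+p+N-2}{2}\right)}{\pi^{N/2}\,\Gamma(1-s)}$ and $$(-\Delta)^s_pu(x):=c_{N,s,p}\lim_{\varepsilon\searrow0}\int_{\mathbb{R}^N\setminus B_\varepsilon(x)}\frac{|u(x)-u(y)|^{p-2}(u(x)-u(y))}{|x-y|^{N+sp}}\,dy .$$ The case $s=1$ is the $p$-Laplacian $-\Delta_pu=-\operatorname{div}(|\nabla u|^{p-2}\nabla u)$ and $s=0$ is a zero-order term; equations are understood in the weak sense below. Seminorms: $[u]_{0,p}:=\|u\|_{L^p(\mathbb{R}^N)}$, $[u]_{s,p}:=\Big(c_{N,s,p}\iint_{\mathbb{R}^{2N}}\frac{|u(x)-u(y)|^p}{|x-y|^{N+sp}}\,dx\,dy\Big)^{1/p}$ for $s\in(0,1)$, $[u]_{1,p}:=\|\nabla u\|_{L^p(\mathbb{R}^N)}$. $\mathcal{X}_\mu(\Omega)$ is the completion of $C_0^\infty(\Omega)$ with respect to the norm $\|u\|_\mu:=\sum_{i=1}^n\sum_{j=1}^m[u]_{s_i,p_j}$ (its elements are regarded as functions on $\mathbb{R}^N$ vanishing a.e. outside $\Omega$). Put $\mathcal{E}_{s,p}(u,v):=\frac{c_{N,s,p}}{2}\iint_{\mathbb{R}^{2N}}\frac{|u(x)-u(y)|^{p-2}(u(x)-u(y))(v(x)-v(y))}{|x-y|^{N+sp}}\,dx\,dy$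 for $s\in(0,1)$, $\mathcal{E}_{1,p}(u,v):=\frac12\int_\Omega|\nabla u|^{p-2}\nabla u\cdot\nabla v\,dx$, $\mathcal{E}_{0,p}(u,v):=\frac12\int_\Omega|u|^{p-2}uv\,dx$. $u\in\mathcal{X}_\mu(\Omega)$ is a weak solution of the problem if for all $v\in\mathcal{X}_\mu(\Omega)$ $$\sum_{i=1}^n\sum_{j=1}^m\mathcal{E}_{s_i,p_j}(u,v)-\sum_{j=1}^m\int_{[0,\overline s)}\mathcal{E}_{s,p_j}(u,v)\,d\mu_s^-(s)=\int_\Omega g\,v\,dx.$$ The energy functional $J:\mathcal{X}_\mu(\Omega)\to\mathbb{R}$ is $$J(u):=\sum_{i=1}^n\sum_{j=1}^m\frac1{2p_j}[u]^{p_j}_{s_i,p_j}-\sum_{j=1}^m\int_{[0,\overline s)}\frac1{2p_j}[u]^{p_j}_{s,p_j}\,d\mu_s^-(s)-\int_\Omega g\,u\,dx.$$ *)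

theory Defs
  imports "HOL-Analysis.Analysis"
begin

section \<open>Smooth functions and domains\<close>

text \<open>\<open>C_k k S f\<close> is meant for open \<open>S\<close>. In the step case continuity of the lower order
  derivatives follows from differentiability.\<close>

primrec C_k :: "nat \<Rightarrow> 'a::euclidean_space set \<Rightarrow> ('a \<Rightarrow> real) \<Rightarrow> bool" where
  "C_k 0 S f \<longleftrightarrow> continuous_on S f"
| "C_k (Suc k) S f \<longleftrightarrow>
     (\<forall>x\<in>S. f differentiable (at x)) \<and>
     (\<forall>b\<in>Basis. C_k k S (\<lambda>x. frechet_derivative f (at x) b))"

definition smooth_on :: "'a::euclidean_space set \<Rightarrow> ('a \<Rightarrow> real) \<Rightarrow> bool" where
  "smooth_on S f \<longleftrightarrow> (\<forall>k. C_k k S f)"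

definition test_functions :: "'a::euclidean_space set \<Rightarrow> ('a \<Rightarrow> real) set" where
  "test_functions \<Omega> =
     {\<phi>. smooth_on UNIV \<phi> \<and> compact (closure {x. \<phi> x \<noteq> 0}) \<and> closure {x. \<phi> x \<noteq> 0} \<subseteq> \<Omega>}"

text \<open>Near each boundary point the set is the strict epigraph, in some direction \<open>e\<close>, of a smooth
  function of the component orthogonal to \<open>e\<close>. A smooth function on the hyperplane orthogonal
  to \<open>e\<close> is represented here by a smooth function on the whole space, of which only the values
  on that hyperplane are used.\<close>

definition smooth_boundary :: "'a::euclidean_space set \<Rightarrow> bool" where
  "smooth_boundary \<Omega> \<longleftrightarrow>
     (\<forall>x\<^sub>0\<in>frontier \<Omega>. \<exists>r>0. \<exists>e h. norm e = 1 \<and> smooth_on UNIV h \<and>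
        \<Omega> \<inter> ball x\<^sub>0 r = {x \<in> ball x\<^sub>0 r. x \<bullet> e > h (x - (x \<bullet> e) *\<^sub>R e)})"

section \<open>Weak gradients\<close>

definition locally_integrable :: "('a::euclidean_space \<Rightarrow> 'b::euclidean_space) \<Rightarrow> bool" where
  "locally_integrable f \<longleftrightarrow> (\<forall>K. compact K \<longrightarrow> integrable (lebesgue_on K) f)"

definition has_weak_gradient ::
    "('a::euclidean_space \<Rightarrow> real) \<Rightarrow> ('a \<Rightarrow> 'a) \<Rightarrow> bool" where
  "has_weak_gradient u G \<longleftrightarrow> locally_integrable u \<and> locally_integrable G \<and>
     (\<forall>\<phi>\<in>test_functions UNIV. \<forall>b\<in>Basis.
        (LINT x|lebesgue. u x * frechet_derivative \<phi> (at x) b)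
          = - (LINT x|lebesgue. (G x \<bullet> b) * \<phi> x))"

text \<open>The weak gradient is determined almost everywhere, and it is used only under integrals.\<close>

definition weak_gradient :: "('a::euclidean_space \<Rightarrow> real) \<Rightarrow> 'a \<Rightarrow> 'a" where
  "weak_gradient u = (SOME G. has_weak_gradient u G)"

section \<open>Seminorms\<close>

definition c_const :: "real \<Rightarrow> real \<Rightarrow> real \<Rightarrow> real" where
  "c_const N s p =
     s * 2 powr (2 * s) * Gamma ((p * s + p + N - 2) / 2) / (pi powr (N / 2) * Gamma (1 - s))"

text \<open>Bochner integrals are \<open>0\<close> when they diverge, so finiteness of \<open>[u]\<^sub>s\<^sub>,\<^sub>p\<close> is stated separately.
  The double integrals are taken with respect to the Lebesgue measure of the product space.\<close>

definition seminorm_finite :: "real \<Rightarrow> real \<Rightarrow> (real^'n \<Rightarrow> real) \<Rightarrow> bool" where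
  "seminorm_finite s p u \<longleftrightarrow>
     (if s = 0 then integrable lebesgue (\<lambda>x. \<bar>u x\<bar> powr p)
      else if s = 1 then
        (\<exists>G. has_weak_gradient u G) \<and> integrable lebesgue (\<lambda>x. norm (weak_gradient u x) powr p)
      else integrable lebesgue
        (\<lambda>(x :: real^'n, y :: real^'n).
           \<bar>u x - u y\<bar> powr p / norm (x - y) powr (real CARD('n) + s * p)))"

definition seminorm :: "real \<Rightarrow> real \<Rightarrow> (real^'n \<Rightarrow> real) \<Rightarrow> real" where
  "seminorm s p u =
     (if s = 0 then (LINT x|lebesgue. \<bar>u x\<bar> powr p) powr (1 / p)
      else if s = 1 then (LINT x|lebesgue. norm (weak_gradient u x) powr p) powr (1 / p)
      else (c_const (real CARD('n)) s p *
        integral\<^sup>L lebesgue (\<lambda>(x :: real^'n, y :: real^'n).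
           \<bar>u x - u y\<bar> powr p / norm (x - y) powr (real CARD('n) + s * p))) powr (1 / p))"

section \<open>The function space\<close>

text \<open>The positive part of the signed measure is given by the finite families
  \<open>s\<^sub>1, \<dots>, s\<^sub>n\<close> and \<open>p\<^sub>1, \<dots>, p\<^sub>m\<close> (repetitions allowed), and the norm depends only on it.\<close>

definition mu_norm ::
    "nat \<Rightarrow> (nat \<Rightarrow> real) \<Rightarrow> nat \<Rightarrow> (nat \<Rightarrow> real) \<Rightarrow> (real^'n \<Rightarrow> real) \<Rightarrow> real" where
  "mu_norm n s m p u = (\<Sum>i=1..n. \<Sum>j=1..m. seminorm (s i) (p j) u)"

text \<open>The completion of \<open>C\<^sub>0\<^sup>\<infinity>(\<Omega>)\<close>, realised by functions: the closure of \<open>C\<^sub>0\<^sup>\<infinity>(\<Omega>)\<close> among the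
  Lebesgue measurable functions that vanish almost everywhere outside \<open>\<Omega>\<close> and have finite norm.
  For bounded \<open>\<Omega>\<close> and \<open>max s\<^sub>i > 0\<close> this ambient space, modulo equality almost everywhere, is
  complete. Members are representatives, so two of them that agree almost everywhere are the same
  element of the completion. The vanishing condition is needed, as constants are invisible to
  the seminorms with \<open>s > 0\<close>.\<close>

definition X_space ::
    "nat \<Rightarrow> (nat \<Rightarrow> real) \<Rightarrow> nat \<Rightarrow> (nat \<Rightarrow> real) \<Rightarrow> (real^'n) set \<Rightarrow> (real^'n \<Rightarrow> real) set" where
  "X_space n s m p \<Omega> =
     {u \<in> borel_measurable lebesgue.
        (AE x in lebesgue. x \<notin> \<Omega> \<longrightarrow> u x = 0) \<and>
        (\<forall>i\<in>{1..n}. \<forall>j\<in>{1..m}. seminorm_finite (s i) (p j) u) \<and>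
        (\<exists>\<phi>. (\<forall>k. \<phi> k \<in> test_functions \<Omega>) \<and>
             (\<lambda>k. mu_norm n s m p (\<lambda>x. \<phi> k x - u x)) \<longlonglongrightarrow> 0)}"

section \<open>Weak solutions and the energy\<close>

definition E_form ::
    "(real^'n) set \<Rightarrow> real \<Rightarrow> real \<Rightarrow> (real^'n \<Rightarrow> real) \<Rightarrow> (real^'n \<Rightarrow> real) \<Rightarrow> real" where
  "E_form \<Omega> s p u v =
     (if s = 0 then 1 / 2 * (LINT x|lebesgue_on \<Omega>. \<bar>u x\<bar> powr (p - 2) * u x * v x)
      else if s = 1 then
        1 / 2 * (LINT x|lebesgue_on \<Omega>. norm (weak_gradient u x) powr (p - 2) *
                   (weak_gradient u x \<bullet> weak_gradient v x))
      else c_const (real CARD('n)) s p / 2 *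
        integral\<^sup>L lebesgue (\<lambda>(x :: real^'n, y :: real^'n).
           \<bar>u x - u y\<bar> powr (p - 2) * (u x - u y) * (v x - v y)
             / norm (x - y) powr (real CARD('n) + s * p)))"

definition s_bar :: "nat \<Rightarrow> (nat \<Rightarrow> real) \<Rightarrow> real" where
  "s_bar n s = Max (s ` {1..n})"

definition weak_solution ::
    "nat \<Rightarrow> (nat \<Rightarrow> real) \<Rightarrow> nat \<Rightarrow> (nat \<Rightarrow> real) \<Rightarrow> real measure \<Rightarrow> (real^'n) set \<Rightarrow>
     (real^'n \<Rightarrow> real) \<Rightarrow> (real^'n \<Rightarrow> real) \<Rightarrow> bool" where
  "weak_solution n s m p \<mu>neg \<Omega> g u \<longleftrightarrow>
     u \<in> X_space n s m p \<Omega> \<and>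
     (\<forall>v\<in>X_space n s m p \<Omega>.
        (\<Sum>i=1..n. \<Sum>j=1..m. E_form \<Omega> (s i) (p j) u v)
        - (\<Sum>j=1..m. LINT t:{0..<s_bar n s}|\<mu>neg. E_form \<Omega> t (p j) u v)
        = (LINT x|lebesgue_on \<Omega>. g x * v x))"

definition energy ::
    "nat \<Rightarrow> (nat \<Rightarrow> real) \<Rightarrow> nat \<Rightarrow> (nat \<Rightarrow> real) \<Rightarrow> real measure \<Rightarrow> (real^'n) set \<Rightarrow>
     (real^'n \<Rightarrow> real) \<Rightarrow> (real^'n \<Rightarrow> real) \<Rightarrow> real" where
  "energy n s m p \<mu>neg \<Omega> g u =
     (\<Sum>i=1..n. \<Sum>j=1..m. 1 / (2 * p j) * seminorm (s i) (p j) u powr p j)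
     - (\<Sum>j=1..m. LINT t:{0..<s_bar n s}|\<mu>neg. 1 / (2 * p j) * seminorm t (p j) u powr p j)
     - (LINT x|lebesgue_on \<Omega>. g x * u x)"

definition global_minimizer_on :: "'a set \<Rightarrow> ('a \<Rightarrow> real) \<Rightarrow> 'a \<Rightarrow> bool" where
  "global_minimizer_on X J u \<longleftrightarrow> u \<in> X \<and> (\<forall>w\<in>X. J u \<le> J w)"

section \<open>Measures and data\<close>

text \<open>The sum of the Dirac measures at \<open>a\<^sub>1, \<dots>, a\<^sub>k\<close> is the image of the counting measure
  on the index set.\<close>

definition dirac_sum :: "nat \<Rightarrow> (nat \<Rightarrow> real) \<Rightarrow> real measure" where
  "dirac_sum k a = distr (count_space {1..k}) borel a"

lemma emeasure_dirac_sum: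
  assumes "A \<in> sets borel"
  shows "emeasure (dirac_sum k a) A = (\<Sum>i=1..k. indicator A (a i))"
proof -
  have "emeasure (dirac_sum k a) A = of_nat (card (a -` A \<inter> {1..k}))"
    unfolding dirac_sum_def using assms
    by (subst emeasure_distr) (auto simp: emeasure_count_space_finite)
  also have "\<dots> = (\<Sum>i=1..k. indicator A (a i))"
    by (simp add: indicator_def sum.If_cases Int_def vimage_def conj_commute)
  finally show ?thesis .
qed

definition measure_supp :: "'a::topological_space measure \<Rightarrow> 'a set" where
  "measure_supp M = {x. \<forall>U. open U \<and> x \<in> U \<longrightarrow> emeasure M U > 0}"

definition in_Lp :: "'a::euclidean_space set \<Rightarrow> real \<Rightarrow> ('a \<Rightarrow> real) \<Rightarrow> bool" where
  "in_Lp \<Omega> q g \<longleftrightarrow> g \<in> borel_measurable (lebesgue_on \<Omega>) \<and>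
     integrable (lebesgue_on \<Omega>) (\<lambda>x. \<bar>g x\<bar> powr q)"

end

theory Submission
  imports Defs
begin

text \<open>The minimizer is found by the direct method. For functions vanishing outside a fixed ball,
  \<open>[u]\<^sub>t\<^sup>p \<le> C [u]\<^sub>S\<^sup>p\<close> for \<open>t \<le> S\<close> with \<open>C\<close> independent of \<open>t\<close>, \<open>S\<close> and \<open>p\<close>: the normalising constant behaves
  like \<open>s (1 - s)\<close>, which is exactly the weight that makes the dyadic pieces of the Gagliardo energy
  comparable. Hence \<open>\<gamma>\<^sub>0 = 1 / (2 C)\<close> makes the energy coercive.

  The negative part destroys convexity, so weak lower semicontinuity is replaced by a midpoint
  argument. A minimizing sequence of test functions is bounded in the top order, so by Rellich it
  has a subsequence that is Cauchy in \<open>L\<^sup>p\<close> and therefore in every order below the top one; the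
  midpoint defect of the negative part then tends to \<open>0\<close>. Minimality forces the midpoint defect of
  the positive part to tend to \<open>0\<close> as well, and uniform convexity of the powers of the seminorms
  makes the sequence Cauchy in the whole space. The weak equation is the vanishing of the
  derivative of the energy along lines. Without negative part the energy is convex, so solutions
  are minimizers, and two of them have zero midpoint defect, hence coincide.\<close>

section \<open>Powers of norms\<close>

text \<open>Three obstacles shape the development. The normalising constant degenerates at both ends
  of (0,1): its zero at s = 0 is balanced by the interaction of distant points, its zero at s = 1 by
  that of close points, so the energy is cut into dyadic shells of the shift h and the two regimes
  are estimated separately. Doubling a shift costs at most a factor 2^p, which makes the suitably
  scaled shell energies monotone; passing to a larger order then only moves the weights of a
  geometric average towards larger terms, and no constant blows up. Order 1 lies outside this
  scheme: there the comparison is proved for test functions, by iterating the same doubling towards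
  small shifts, and reaches the whole space by density. Finally, the negative measure may have mass
  arbitrarily close to the top order, so no rate of convergence is uniform over its orders;
  convergence is pointwise in the order and is integrated by dominated convergence. \<open>C\<close>
  depends only on the dimension and on a ball containing \<Omega>, hence is fixed before orders,
  exponents and measures.\<close>

lemma powr_gt_tangent:
  fixes t p :: real
  assumes "p > 1" "t \<ge> 0" "t \<noteq> 1"
  shows "1 + p * (t - 1) < t powr p"
proof (cases "t = 0")
  case True then show ?thesis using assms by simp
next
  case False
  then have t: "t > 0" using assms by simp
  have "t powr p - 1 > p * (t - 1)"
  proof (cases "t > 1")
    case True
    have "\<exists>z>1. z < t \<and> t powr p - 1 powr p = (t - 1) * (p * z powr (p - 1))"
      using True by (intro MVT2 has_real_derivative_powr) auto
    then obtain z where z: "z > 1" "t powr p - 1 = (t - 1) * (p * z powr (p - 1))" by auto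
    have "z powr (p - 1) > 1" using z assms by (simp add: gr_one_powr)
    then have "(t - 1) * (p * z powr (p - 1)) > (t - 1) * (p * 1)"
      using True assms by (intro mult_strict_left_mono) auto
    then show ?thesis using z by (simp add: mult_ac)
  next
    case False
    then have t1: "t < 1" using assms by simp
    have "\<exists>z>t. z < 1 \<and> 1 powr p - t powr p = (1 - t) * (p * z powr (p - 1))"
      using t t1 by (intro MVT2 has_real_derivative_powr) auto
    then obtain z where z: "z > t" "z < 1" "1 - t powr p = (1 - t) * (p * z powr (p - 1))" by auto
    have "z powr (p - 1) < 1" using powr_less_mono2[of "p - 1" z 1] z assms t by simp
    then have "(1 - t) * (p * z powr (p - 1)) < (1 - t) * (p * 1)"
      using t1 assms by (intro mult_strict_left_mono) auto
    moreover have "(1-t) * (p * 1) = - (p * (t - 1))" by (simp add: algebra_simps)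
    ultimately show ?thesis using z by linarith
  qed
  then show ?thesis by simp
qed

text \<open>The open half-line is \<open>powr_convex\<close>; at an endpoint 0 the claim reduces to
  \<open>t powr p \<le> t\<close> for t in (0,1).\<close>

lemma convex_on_powr_nonneg: "p \<ge> 1 \<Longrightarrow> convex_on {0..} (\<lambda>x::real. x powr p)"
proof (rule convex_onI)
  fix t x y :: real
  assume p: "p \<ge> 1" and t: "0 < t" "t < 1" and xy: "x \<in> {0..}" "y \<in> {0..}"
  have le: "r powr p \<le> r" if "0 < r" "r < 1" for r
    using powr_mono'[of 1 p r] that p by simp
  consider "x = 0" | "y = 0" | "x > 0" "y > 0" using xy by force
  then show "((1 - t) *\<^sub>R x + t *\<^sub>R y) powr p \<le> (1 - t) * x powr p + t * y powr p"
  proof cases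
    case 1 then show ?thesis using le[of t] t xy by (simp add: powr_mult mult_right_mono)
  next
    case 2 then show ?thesis using le[of "1-t"] t xy by (simp add: powr_mult mult_right_mono)
  next
    case 3 then show ?thesis using convex_onD[OF powr_convex[OF p], of t x y] t by simp
  qed
qed auto

lemma norm_powr_convex:
  fixes a b :: "'v::real_normed_vector"
  assumes "p \<ge> 1" "t \<in> {0..1}"
  shows "norm ((1 - t) *\<^sub>R a + t *\<^sub>R b) powr p \<le> (1 - t) * norm a powr p + t * norm b powr p"
proof -
  have "norm ((1 - t) *\<^sub>R a + t *\<^sub>R b) \<le> (1 - t) * norm a + t * norm b"
    using assms by (intro order_trans[OF norm_triangle_ineq]) auto
  then have "norm ((1 - t) *\<^sub>R a + t *\<^sub>R b) powr p \<le> ((1 - t) * norm a + t * norm b) powr p"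
    using assms by (intro powr_mono2) auto
  also have "\<dots> \<le> (1 - t) * norm a powr p + t * norm b powr p"
    using convex_onD[OF convex_on_powr_nonneg[OF assms(1)], of t "norm a" "norm b"] assms by simp
  finally show ?thesis .
qed

lemma norm_powr_add_le:
  fixes a b :: "'v::real_normed_vector"
  assumes "p \<ge> 1"
  shows "norm (a + b) powr p \<le> 2 powr p * (norm a powr p + norm b powr p)"
proof -
  have "norm (a + b) powr p \<le> (2 * max (norm a) (norm b)) powr p"
    by (intro powr_mono2) (use assms norm_triangle_ineq[of a b] in auto)
  also have "\<dots> = 2 powr p * max (norm a) (norm b) powr p" by (simp add: powr_mult)
  also have "\<dots> \<le> 2 powr p * (norm a powr p + norm b powr p)"
    by (intro mult_left_mono) (auto simp: max_def)
  finally show ?thesis .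
qed

text \<open>Strictness has two sources. If the norms differ, it is the strict convexity of the real
  power; if they agree, it is the strictness of the triangle inequality, since equality in an inner
  product space would make \<open>a\<close> and \<open>b\<close> parallel of equal norm, hence
  equal.\<close>

lemma norm_powr_strict_midpoint:
  fixes a b :: "'v::real_inner"
  assumes p: "p > 1" and "a \<noteq> b"
  shows "norm ((1/2) *\<^sub>R (a + b)) powr p < (norm a powr p + norm b powr p) / 2"
proof -
  define x y where "x = norm a" "y = norm b"
  define m where "m = (x + y) / 2"
  have nn: "x \<ge> 0" "y \<ge> 0" by (auto simp: x_y_def)
  have m: "m > 0"
  proof -
    have "a \<noteq> 0 \<or> b \<noteq> 0" using assms by auto
    then show ?thesis unfolding m_def x_y_def by (auto simp: add_pos_nonneg add_nonneg_pos)
  qed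
  \<comment> \<open>Tangent to the power at the mean \<open>m\<close>, written in the scaled
    variable \<open>r / m\<close>. For \<open>r = x\<close> and \<open>r = y\<close> the linear
    terms cancel, which is \<open>sum\<close>.\<close>
  have tang: "m powr p * (1 + p * (r / m - 1)) \<le> r powr p"
    "r \<noteq> m \<Longrightarrow> m powr p * (1 + p * (r / m - 1)) < r powr p" if "r \<ge> 0" for r
  proof -
    have eq: "m powr p * (r / m) powr p = r powr p"
      using m that by (simp flip: powr_mult)
    show *: "m powr p * (1 + p * (r / m - 1)) < r powr p" if "r \<noteq> m"
      using powr_gt_tangent[of p "r/m"] m p \<open>r \<ge> 0\<close> that
      by (subst eq[symmetric]) (intro mult_strict_left_mono, auto)
    show "m powr p * (1 + p * (r / m - 1)) \<le> r powr p"
      using * m by (cases "r = m") auto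
  qed
  have sum: "m powr p * (1 + p * (x / m - 1)) + m powr p * (1 + p * (y / m - 1)) = 2 * m powr p"
  proof -
    have "x / m + y / m = (2 * m) / m" by (simp add: m_def add_divide_distrib)
    then have xy: "x / m = 2 - y / m" using m by simp
    show ?thesis unfolding xy by (simp add: algebra_simps)
  qed
  have le: "norm ((1/2) *\<^sub>R (a + b)) \<le> m"
    using norm_triangle_ineq[of a b] by (simp add: m_def x_y_def)
  show ?thesis
  proof (cases "x = y")
    case False
    have "x \<noteq> m" using False by (auto simp: m_def)
    then have "2 * m powr p < x powr p + y powr p"
      using tang(2)[of x] tang(1)[of y] nn sum by linarith
    moreover have "norm ((1/2) *\<^sub>R (a + b)) powr p \<le> m powr p"
      using le p by (intro powr_mono2) auto
    ultimately show ?thesis by (simp add: x_y_def)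
  next
    case True
    have "norm (a + b) \<noteq> norm a + norm b"
      using True m assms(2) unfolding norm_triangle_eq by (auto simp: x_y_def m_def)
    then have "norm ((1/2) *\<^sub>R (a + b)) < m"
      using norm_triangle_ineq[of a b] by (simp add: m_def x_y_def)
    then have "norm ((1/2) *\<^sub>R (a + b)) powr p < m powr p"
      using p by (intro powr_less_mono2) auto
    then show ?thesis using True by (simp add: m_def x_y_def)
  qed
qed

text \<open>By homogeneity it suffices to treat \<open>\<bar>a\<bar>\<^sup>p + \<bar>b\<bar>\<^sup>p = 1\<close>, where \<open>\<bar>a - b\<bar>\<^sup>p \<ge> \<epsilon>\<close> defines a compact
  set on which the midpoint defect is positive.\<close>

lemma norm_powr_uniformly_convex:
  assumes p: "p > 1" and "\<epsilon> > 0"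
  shows "\<exists>C\<ge>0. \<forall>a b :: 'v::euclidean_space. norm (a - b) powr p \<le>
    \<epsilon> * (norm a powr p + norm b powr p) +
    C * ((norm a powr p + norm b powr p) / 2 - norm ((1/2) *\<^sub>R (a + b)) powr p)"
proof -
  define D where "D = (\<lambda>z::'v\<times>'v. (norm (fst z) powr p + norm (snd z) powr p) / 2
     - norm ((1/2) *\<^sub>R (fst z + snd z)) powr p)"
  define K where "K = {z::'v\<times>'v. norm (fst z) powr p + norm (snd z) powr p = 1} \<inter>
     {z. \<epsilon> \<le> norm (fst z - snd z) powr p}"
  have contD: "continuous_on UNIV D"
    unfolding D_def using p by (intro continuous_intros continuous_on_powr') auto
  have Dnn: "D z \<ge> 0" for z
    using norm_powr_strict_midpoint[OF p, of "fst z" "snd z"]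
    by (cases "fst z = snd z") (auto simp: D_def scaleR_2[symmetric])
  have "closed K"
    unfolding K_def using p
    by (intro closed_Int closed_Collect_eq closed_Collect_le continuous_intros continuous_on_powr') auto
  moreover have "bounded K"
  proof (rule boundedI)
    fix z assume "z \<in> K"
    then have *: "norm (fst z) powr p + norm (snd z) powr p = 1" by (auto simp: K_def)
    have aux: "r \<le> 1" if "r powr p \<le> 1" "r \<ge> 0" for r
      using gr_one_powr[of r p] that p by linarith
    have "norm (fst z) powr p \<le> 1" "norm (snd z) powr p \<le> 1"
      using * powr_ge_zero[of "norm (fst z)" p] powr_ge_zero[of "norm (snd z)" p] by linarith+
    then have "norm (fst z) \<le> 1" "norm (snd z) \<le> 1" using aux norm_ge_zero by blast+
    then show "norm z \<le> 2" using norm_Pair_le[of "fst z" "snd z"] by simp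
  qed
  ultimately have K: "compact K" by (simp add: compact_eq_bounded_closed)
  have "\<exists>m>0. \<forall>z\<in>K. m \<le> D z"
  proof (cases "K = {}")
    case True then show ?thesis by (intro exI[of _ 1]) auto
  next
    case False
    obtain z where z: "z \<in> K" "\<forall>y\<in>K. D z \<le> D y"
      using continuous_attains_inf[OF K False continuous_on_subset[OF contD]] by auto
    have "fst z \<noteq> snd z" using z(1) \<open>\<epsilon> > 0\<close> by (auto simp: K_def)
    then have "D z > 0" using norm_powr_strict_midpoint[OF p] by (auto simp: D_def)
    then show ?thesis using z by blast
  qed
  then obtain m where m: "m > 0" "\<And>z. z \<in> K \<Longrightarrow> m \<le> D z" by blast
  \<comment> \<open>On \<open>K\<close> the defect is at least \<open>m\<close>, while the power of
    the difference is at most \<open>2 powr p\<close> once the powers of the norms sum to 1.\<close>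
  define C where "C = 2 powr p / m"
  have C: "C \<ge> 0" using m by (simp add: C_def)
  have main: "norm (a - b) powr p \<le> \<epsilon> * (norm a powr p + norm b powr p) + C * D (a, b)" for a b :: 'v
  proof -
    define S where "S = norm a powr p + norm b powr p"
    show ?thesis
    proof (cases "S = 0")
      case True
      then have "norm a powr p = 0" "norm b powr p = 0"
        using powr_ge_zero[of "norm a" p] powr_ge_zero[of "norm b" p] unfolding S_def by linarith+
      then have "a = 0" "b = 0" by simp_all
      then show ?thesis by (simp add: D_def)
    next
      case False
      then have S: "S > 0"
        using powr_ge_zero[of "norm a" p] powr_ge_zero[of "norm b" p] unfolding S_def by linarith
      \<comment> \<open>Scaling by \<open>l\<close> brings the sum \<open>S\<close> of the powers to
        1, as \<open>l powr p = 1 / S\<close>.\<close>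
      define l where "l = (1 / S) powr (1/p)"
      have l: "l > 0" using S by (simp add: l_def)
      have lp: "l powr p = 1 / S" using S p unfolding l_def powr_powr by simp
      have sc: "norm (l *\<^sub>R x) powr p = norm x powr p / S" for x :: 'v
        using l lp by (simp add: powr_mult)
      have Dsc: "D (l *\<^sub>R a, l *\<^sub>R b) = D (a,b) / S"
        unfolding D_def fst_conv snd_conv scaleR_add_right[symmetric] scaleR_left_commute[of "1/2" l] sc
        by (simp add: diff_divide_distrib add_divide_distrib)
      have one: "norm (l *\<^sub>R a) powr p + norm (l *\<^sub>R b) powr p = 1"
        unfolding sc using S by (simp add: S_def add_divide_distrib[symmetric])
      have "norm (a - b) powr p / S \<le> \<epsilon> + C * (D (a,b) / S)"
      proof (cases "(l *\<^sub>R a, l *\<^sub>R b) \<in> K")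
        case False
        then have "norm (l *\<^sub>R (a - b)) powr p < \<epsilon>"
          using one by (auto simp: K_def scaleR_diff_right)
        then show ?thesis unfolding sc using mult_nonneg_nonneg[OF C divide_nonneg_pos[OF Dnn[of "(a,b)"] S]] by linarith
      next
        case True
        then have "m \<le> D (a,b) / S" using m(2) Dsc by force
        then have "C * m \<le> C * (D (a,b) / S)" using C by (intro mult_left_mono) auto
        then have "2 powr p \<le> C * (D (a,b) / S)" using m by (simp add: C_def)
        moreover have "norm (a - b) powr p / S \<le> 2 powr p"
          using norm_powr_add_le[of p a "-b"] p S by (simp add: S_def field_simps)
        ultimately show ?thesis using \<open>\<epsilon> > 0\<close> by linarith
      qed
      then have "norm (a - b) powr p \<le> (\<epsilon> + C * (D (a,b) / S)) * S"
        using S by (simp only: pos_divide_le_eq)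
      also have "\<dots> = \<epsilon> * S + C * D (a,b)" using S by (simp add: field_simps)
      finally show ?thesis by (simp add: S_def)
    qed
  qed
  show ?thesis using main C by (auto simp: D_def)
qed

text \<open>At \<open>a = 0\<close> the difference quotient is of order |t|^(p-1), which vanishes
  because p > 1; the formula agrees there for every p, as \<open>0 powr (p - 2)\<close> is 0.
  Otherwise the norm is the square root of a quadratic polynomial in t that is positive at 0, and
  the chain rule applies.\<close>

lemma norm_powr_has_derivative_at_0:
  fixes a b :: "'v::real_inner"
  assumes p: "p > 1"
  shows "((\<lambda>t. norm (a + t *\<^sub>R b) powr p) has_real_derivative (p * (norm a powr (p - 2) * (a \<bullet> b)))) (at 0)"
proof (cases "a = 0")
  case True
  have "((\<lambda>t::real. (\<bar>t\<bar> powr (p - 1)) * norm b powr p) \<longlongrightarrow> 0) (at 0)"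
    using p by (auto intro!: tendsto_eq_intros tendsto_powr' )
  then have "((\<lambda>t::real. norm ((\<bar>t\<bar> powr (p - 1)) * norm b powr p)) \<longlongrightarrow> 0) (at 0)"
    using tendsto_norm_zero by blast
  moreover have "norm ((\<bar>t\<bar> powr (p - 1)) * norm b powr p) = norm ((norm (a + t *\<^sub>R b) powr p) / t)" if "t \<noteq> 0" for t
    using True that p by (simp add: powr_mult powr_diff abs_mult)
  then have "eventually (\<lambda>t. norm ((\<bar>t\<bar> powr (p - 1)) * norm b powr p) = norm ((norm (a + t *\<^sub>R b) powr p) / t)) (at 0)"
    unfolding eventually_at by (intro exI[of _ 1]) auto
  ultimately have "((\<lambda>t. norm ((norm (a + t *\<^sub>R b) powr p) / t)) \<longlongrightarrow> 0) (at 0)"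
    using tendsto_cong by fastforce
  then have "((\<lambda>t. (norm (a + t *\<^sub>R b) powr p) / t) \<longlongrightarrow> 0) (at 0)"
    by (rule tendsto_norm_zero_cancel)
  then show ?thesis using True p by (simp add: DERIV_def)
next
  case False
  have eq: "norm (a + t *\<^sub>R b) powr p = ((a + t *\<^sub>R b) \<bullet> (a + t *\<^sub>R b)) powr (p/2)" for t
    by (simp add: norm_eq_sqrt_inner powr_half_sqrt[symmetric] powr_powr)
  have n: "(a \<bullet> a) powr (p/2 - 1) = norm a powr (p - 2)"
    by (simp add: norm_eq_sqrt_inner powr_half_sqrt[symmetric] powr_powr diff_divide_distrib)
  have "((\<lambda>t. (a + t *\<^sub>R b) \<bullet> (a + t *\<^sub>R b)) has_real_derivative (2 * (a \<bullet> b))) (at 0)"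
    by (simp add: inner_add_left inner_add_right)
       (auto intro!: derivative_eq_intros simp: inner_commute)
  then have "((\<lambda>t. ((a + t *\<^sub>R b) \<bullet> (a + t *\<^sub>R b)) powr (p/2)) has_real_derivative
     (p * (norm a powr (p - 2) * (a \<bullet> b)))) (at 0)"
    using False by (auto intro!: derivative_eq_intros simp: n)
  then show ?thesis by (simp add: eq)
qed

section \<open>Functionals of power type\<close>

definition Lp_on :: "'m measure \<Rightarrow> real \<Rightarrow> ('m \<Rightarrow> 'v::euclidean_space) \<Rightarrow> bool" where
  "Lp_on M p a \<longleftrightarrow> a \<in> borel_measurable M \<and> integrable M (\<lambda>x. norm (a x) powr p)"

lemma Lp_on_measurable: "Lp_on M p a \<Longrightarrow> a \<in> borel_measurable M"
  and Lp_on_integrable: "Lp_on M p a \<Longrightarrow> integrable M (\<lambda>x. norm (a x) powr p)"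
  by (auto simp: Lp_on_def)

lemma Lp_on_AE_cong:
  assumes "Lp_on M p a" "b \<in> borel_measurable M" "AE x in M. a x = b x"
  shows "Lp_on M p b" "(LINT x|M. norm (b x) powr p) = (LINT x|M. norm (a x) powr p)"
proof -
  note [measurable] = assms(2) Lp_on_measurable[OF assms(1)]
  have eq: "AE x in M. norm (a x) powr p = norm (b x) powr p" using assms(3) by eventually_elim simp
  have "integrable M (\<lambda>x. norm (b x) powr p)"
    by (rule integrable_cong_AE_imp[OF Lp_on_integrable[OF assms(1)]]) (measurable, rule eq)
  then show "Lp_on M p b" using assms(2) unfolding Lp_on_def by blast
  show "(LINT x|M. norm (b x) powr p) = (LINT x|M. norm (a x) powr p)"
    by (rule integral_cong_AE[symmetric]) (measurable, rule eq)
qed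

lemma Lp_on_lincomb:
  assumes p: "p \<ge> 1" and "Lp_on M p a" "Lp_on M p b"
  shows "Lp_on M p (\<lambda>x. s *\<^sub>R a x + t *\<^sub>R b x)"
proof -
  note [measurable] = Lp_on_measurable[OF assms(2)] Lp_on_measurable[OF assms(3)]
  have "integrable M (\<lambda>x. norm (s *\<^sub>R a x + t *\<^sub>R b x) powr p)"
  proof (rule Bochner_Integration.integrable_bound)
    show "integrable M (\<lambda>x. 2 powr p * (\<bar>s\<bar> powr p * norm (a x) powr p + \<bar>t\<bar> powr p * norm (b x) powr p))"
      using assms by (auto simp: Lp_on_def)
    show "AE x in M. norm (norm (s *\<^sub>R a x + t *\<^sub>R b x) powr p)
        \<le> norm (2 powr p * (\<bar>s\<bar> powr p * norm (a x) powr p + \<bar>t\<bar> powr p * norm (b x) powr p))"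
      using norm_powr_add_le[OF p, of "s *\<^sub>R a _" "t *\<^sub>R b _"] by (auto simp: powr_mult)
  qed measurable
  then show ?thesis by (auto simp: Lp_on_def)
qed

text \<open>Slopes of chords through 0 increase for a convex function, so all difference quotients
  lie between those at -1 and 1. This yields a majorant that uses only three values of
  \<open>f\<close>.\<close>

lemma difference_quotient_convex_bound:
  fixes f :: "real \<Rightarrow> real"
  assumes "convex_on {-1..1} f" "h \<noteq> 0" "\<bar>h\<bar> \<le> 1"
  shows "\<bar>(f h - f 0) / h\<bar> \<le> \<bar>f 1 - f 0\<bar> + \<bar>f (-1) - f 0\<bar>"
proof -
  have conv: "f ((1-t) * x + t * y) \<le> (1-t) * f x + t * f y"
    if "t \<in> {0..1}" "x \<in> {-1..1}" "y \<in> {-1..1}" for t x y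
    using convex_onD[OF assms(1), of t x y] that by simp
  have up: "f h - f 0 \<le> h * (f 1 - f 0)" if "0 < h" "h \<le> 1" for h
    using conv[of h 0 1] that by (simp add: algebra_simps)
  have upm: "f (- h) - f 0 \<le> h * (f (-1) - f 0)" if "0 < h" "h \<le> 1" for h
    using conv[of h 0 "-1"] that by (simp add: algebra_simps)
  have lo: "2 * f 0 \<le> f h + f (- h)" if "0 < h" "h \<le> 1" for h
    using conv[of "1/2" h "-h"] that by simp
  have "\<bar>f h - f 0\<bar> \<le> \<bar>h\<bar> * (\<bar>f 1 - f 0\<bar> + \<bar>f (-1) - f 0\<bar>)"
  proof -
    define k where "k = \<bar>h\<bar>"
    have k: "0 < k" "k \<le> 1" using assms by (auto simp: k_def)
    have "k * (f 1 - f 0) \<le> k * \<bar>f 1 - f 0\<bar>" "k * (f (-1) - f 0) \<le> k * \<bar>f (-1) - f 0\<bar>"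
      "0 \<le> k * \<bar>f 1 - f 0\<bar>" "0 \<le> k * \<bar>f (-1) - f 0\<bar>"
      using k by (auto intro: mult_left_mono)
    with up[of k] upm[of k] lo[of k] k
    have "\<bar>f k - f 0\<bar> \<le> k * (\<bar>f 1 - f 0\<bar> + \<bar>f (-1) - f 0\<bar>)"
      "\<bar>f (-k) - f 0\<bar> \<le> k * (\<bar>f 1 - f 0\<bar> + \<bar>f (-1) - f 0\<bar>)"
      unfolding distrib_left abs_le_iff right_diff_distrib by linarith+
    then show ?thesis unfolding k_def by (cases "h \<ge> 0") auto
  qed
  then show ?thesis using assms(2) by (simp add: field_simps)
qed

text \<open>Dominated convergence with the majorant of
  \<open>difference_quotient_convex_bound\<close>. Convexity replaces any bound on the derivative,
  and the integrability of \<open>d\<close> comes out as a result; this matters where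
  \<open>d\<close> is a nonlinear form about which nothing is known beforehand.\<close>

lemma has_derivative_integral_convex:
  fixes f :: "'m \<Rightarrow> real \<Rightarrow> real"
  assumes int: "\<And>t. t \<in> {-1..1} \<Longrightarrow> integrable M (\<lambda>x. f x t)"
    and conv: "\<And>x. x \<in> space M \<Longrightarrow> convex_on {-1..1} (f x)"
    and der: "\<And>x. x \<in> space M \<Longrightarrow> (f x has_real_derivative d x) (at 0)"
  shows "integrable M d" "((\<lambda>t. LINT x|M. f x t) has_real_derivative (LINT x|M. d x)) (at 0)"
proof -
  define w where "w x = \<bar>f x 1 - f x 0\<bar> + \<bar>f x (-1) - f x 0\<bar>" for x
  have w: "integrable M w" unfolding w_def by (intro Bochner_Integration.integrable_add integrable_abs Bochner_Integration.integrable_diff int) auto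
  have key: "integrable M d \<and> (\<lambda>k. LINT x|M. (f x (X k) - f x 0) / X k) \<longlonglongrightarrow> (LINT x|M. d x)"
    if X: "X \<longlonglongrightarrow> 0" "\<And>k. X k \<noteq> 0" "\<And>k. \<bar>X k\<bar> \<le> 1" for X
  proof -
    have meas: "(\<lambda>x. (f x (X k) - f x 0) / X k) \<in> borel_measurable M" for k
      using X(3)[of k] int[of "X k"] int[of 0] by (auto simp: abs_le_iff)
    have lim: "(\<lambda>k. (f x (X k) - f x 0) / X k) \<longlonglongrightarrow> d x" if "x \<in> space M" for x
    proof -
      have "((\<lambda>h. (f x h - f x 0) / h) \<longlongrightarrow> d x) (at 0)"
        using der[OF that] by (simp add: DERIV_def)
      then show ?thesis using X unfolding tendsto_at_iff_sequentially by (auto simp: o_def)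
    qed
    have md: "d \<in> borel_measurable M"
      by (rule borel_measurable_LIMSEQ_real[OF lim meas])
    have bd: "norm ((f x (X k) - f x 0) / X k) \<le> w x" if "x \<in> space M" for x k
      using difference_quotient_convex_bound[OF conv[OF that] X(2,3)] by (simp add: w_def)
    show ?thesis
      using integrable_dominated_convergence[OF md meas w, OF AE_I2[OF lim] AE_I2[OF bd]]
        integral_dominated_convergence[OF md meas w, OF AE_I2[OF lim] AE_I2[OF bd]] lim bd
      by auto
  qed
  have "integrable M d"
    using key[of "\<lambda>k. inverse (real (Suc k))"] LIMSEQ_inverse_real_of_nat
    by (simp add: inverse_le_1_iff del: of_nat_Suc)
  then show "integrable M d" .
  have "((\<lambda>h. ((LINT x|M. f x h) - (LINT x|M. f x 0)) / h) \<longlongrightarrow> (LINT x|M. d x)) (at 0)"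
    unfolding tendsto_at_iff_sequentially o_def
  proof (intro allI impI)
    fix X :: "nat \<Rightarrow> real" assume X: "\<forall>i. X i \<in> UNIV - {0}" "X \<longlonglongrightarrow> 0"
    have "eventually (\<lambda>k. \<bar>X k\<bar> < 1) sequentially"
      using tendstoD[OF X(2), of 1] by simp
    then obtain K where K: "\<And>k. k \<ge> K \<Longrightarrow> \<bar>X k\<bar> < 1" by (auto simp: eventually_sequentially)
    \<comment> \<open>\<open>key\<close> wants increments of size at most 1, which is guaranteed
      only from the index \<open>K\<close> on.\<close>
    have "(\<lambda>k. LINT x|M. (f x (X (k + K)) - f x 0) / X (k + K)) \<longlonglongrightarrow> (LINT x|M. d x)"
      using key[of "\<lambda>k. X (k + K)"] LIMSEQ_ignore_initial_segment[OF X(2), of K] X(1) K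
      by (simp add: less_imp_le)
    moreover have "(LINT x|M. (f x (X (k + K)) - f x 0) / X (k + K)) =
       ((LINT x|M. f x (X (k+K))) - (LINT x|M. f x 0)) / X (k+K)" for k
    proof -
      have "integrable M (\<lambda>x. f x (X (k+K)))" "integrable M (\<lambda>x. f x 0)"
        using K[of "k+K"] by (auto intro!: int simp: abs_less_iff)
      then show ?thesis by simp
    qed
    ultimately have "(\<lambda>k. ((LINT x|M. f x (X (k+K))) - (LINT x|M. f x 0)) / X (k+K)) \<longlonglongrightarrow> (LINT x|M. d x)"
      by (simp only:)
    then show "(\<lambda>k. ((LINT x|M. f x (X k)) - (LINT x|M. f x 0)) / X k) \<longlonglongrightarrow> (LINT x|M. d x)"
      by (rule LIMSEQ_offset)
  qed
  then show "((\<lambda>t. LINT x|M. f x t) has_real_derivative (LINT x|M. d x)) (at 0)"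
    by (simp add: DERIV_def)
qed

section \<open>Convex functionals homogeneous of degree p\<close>

definition fun_subspace :: "('x \<Rightarrow> real) set \<Rightarrow> bool" where
  "fun_subspace V \<longleftrightarrow> (\<lambda>_. 0) \<in> V \<and> (\<forall>u\<in>V. \<forall>v\<in>V. \<forall>a b. (\<lambda>x. a * u x + b * v x) \<in> V)"

lemma fun_subspaceD:
  assumes "fun_subspace V" "u \<in> V" "v \<in> V"
  shows "(\<lambda>x. a * u x + b * v x) \<in> V" "(\<lambda>x. u x + v x) \<in> V" "(\<lambda>x. u x - v x) \<in> V"
    "(\<lambda>x. a * u x) \<in> V" "(\<lambda>x. u x + b * v x) \<in> V" "(\<lambda>x. 1/2 * (u x + v x)) \<in> V"
proof -
  have *: "(\<lambda>x. a * u x + b * v x) \<in> V" for a b using assms by (auto simp: fun_subspace_def)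
  show "(\<lambda>x. a * u x + b * v x) \<in> V" "(\<lambda>x. u x + v x) \<in> V" "(\<lambda>x. u x - v x) \<in> V"
    "(\<lambda>x. a * u x) \<in> V" "(\<lambda>x. u x + b * v x) \<in> V" "(\<lambda>x. 1/2 * (u x + v x)) \<in> V"
    using *[of a b] *[of 1 1] *[of 1 "-1"] *[of a 0] *[of 1 b] *[of "1/2" "1/2"]
    by (simp_all add: distrib_left)
qed

lemma fun_subspace_0: "fun_subspace V \<Longrightarrow> (\<lambda>_. 0) \<in> V"
  by (simp add: fun_subspace_def)

text \<open>The properties shared by the p-th powers of the seminorms and by their integral over the
  negative measure. The latter is not presented as an L^p norm of one operator, so continuity is
  derived from homogeneity and convexity alone.\<close>

definition power_functional :: "real \<Rightarrow> ('x \<Rightarrow> real) set \<Rightarrow> (('x \<Rightarrow> real) \<Rightarrow> real) \<Rightarrow> bool" where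
  "power_functional p V \<Phi> \<longleftrightarrow>
     (\<forall>u\<in>V. 0 \<le> \<Phi> u) \<and> (\<forall>u\<in>V. \<forall>c. \<Phi> (\<lambda>x. c * u x) = \<bar>c\<bar> powr p * \<Phi> u) \<and>
     (\<forall>u\<in>V. \<forall>v\<in>V. \<forall>t\<in>{0..1}. \<Phi> (\<lambda>x. (1 - t) * u x + t * v x) \<le> (1 - t) * \<Phi> u + t * \<Phi> v)"

lemma power_functionalD:
  assumes "power_functional p V \<Phi>"
  shows "u \<in> V \<Longrightarrow> 0 \<le> \<Phi> u" "u \<in> V \<Longrightarrow> \<Phi> (\<lambda>x. c * u x) = \<bar>c\<bar> powr p * \<Phi> u"
    "u \<in> V \<Longrightarrow> v \<in> V \<Longrightarrow> t \<in> {0..1} \<Longrightarrow> \<Phi> (\<lambda>x. (1 - t) * u x + t * v x) \<le> (1 - t) * \<Phi> u + t * \<Phi> v"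
  using assms by (auto simp: power_functional_def)

lemma power_functional_0:
  assumes "fun_subspace V" "power_functional p V \<Phi>" shows "\<Phi> (\<lambda>_. 0) = 0"
  using power_functionalD(2)[OF assms(2) fun_subspace_0[OF assms(1)], of 0] by simp

lemma power_functional_minus:
  assumes "power_functional p V \<Phi>" "fun_subspace V" "u \<in> V" "v \<in> V"
  shows "\<Phi> (\<lambda>x. v x - u x) = \<Phi> (\<lambda>x. u x - v x)"
  using power_functionalD(2)[OF assms(1) fun_subspaceD(3)[OF assms(2-4)], of "-1"] by simp

text \<open>Write u + v as (1 - t) (u / (1 - t)) + t (v / t) and use convexity and homogeneity. For
  small \<open>t\<close> the factor of \<open>\<Phi> u\<close> is close to 1, at the price of a
  large factor for \<open>\<Phi> v\<close>.\<close>

lemma power_functional_add_split: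
  assumes V: "fun_subspace V" and \<Phi>: "power_functional p V \<Phi>" and uv: "u \<in> V" "v \<in> V"
    and t: "0 < t" "t < 1"
  shows "\<Phi> (\<lambda>x. u x + v x) \<le> (1 - t) powr (1 - p) * \<Phi> u + t powr (1 - p) * \<Phi> v"
proof -
  have m: "(\<lambda>x. (1/(1-t)) * u x) \<in> V" "(\<lambda>x. (1/t) * v x) \<in> V"
    by (rule fun_subspaceD(4)[OF V uv(1,1)], rule fun_subspaceD(4)[OF V uv(2,2)])
  have "\<Phi> (\<lambda>x. u x + v x) = \<Phi> (\<lambda>x. (1 - t) * ((1/(1-t)) * u x) + t * ((1/t) * v x))"
    using t by simp
  also have "\<dots> \<le> (1 - t) * (\<bar>1/(1-t)\<bar> powr p * \<Phi> u) + t * (\<bar>1/t\<bar> powr p * \<Phi> v)"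
    using power_functionalD(3)[OF \<Phi> m, of t] t power_functionalD(2)[OF \<Phi> uv(1), of "1/(1-t)"]
      power_functionalD(2)[OF \<Phi> uv(2), of "1/t"] by simp
  also have "\<dots> = (1 - t) powr (1 - p) * \<Phi> u + t powr (1 - p) * \<Phi> v"
    using t by (simp add: powr_divide powr_diff)
  finally show ?thesis .
qed

lemma power_functional_add_le:
  assumes V: "fun_subspace V" and \<Phi>: "power_functional p V \<Phi>" and uv: "u \<in> V" "v \<in> V"
  shows "\<Phi> (\<lambda>x. u x + v x) \<le> 2 powr p * (\<Phi> u + \<Phi> v)"
    "\<Phi> (\<lambda>x. u x - v x) \<le> 2 powr p * (\<Phi> u + \<Phi> v)"
proof -
  have *: "\<Phi> (\<lambda>x. u x + w x) \<le> 2 powr p * (\<Phi> u + \<Phi> w)" if w: "w \<in> V" for w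
  proof -
    have c: "(1/2::real) powr (1 - p) = 2 powr p / 2" "1 - 1/2 = (1/2::real)"
      by (simp_all add: powr_divide powr_diff)
    have "\<Phi> (\<lambda>x. u x + w x) \<le> 2 powr p / 2 * \<Phi> u + 2 powr p / 2 * \<Phi> w"
      using power_functional_add_split[OF V \<Phi> uv(1) w, of "1/2"] unfolding c by simp
    also have "\<dots> = (2 powr p * (\<Phi> u + \<Phi> w)) / 2" by (simp add: field_simps)
    also have "\<dots> \<le> 2 powr p * (\<Phi> u + \<Phi> w)"
      using power_functionalD(1)[OF \<Phi>] uv w by (intro order_trans[OF divide_left_mono[of 1 2]]) auto
    finally show ?thesis .
  qed
  show "\<Phi> (\<lambda>x. u x + v x) \<le> 2 powr p * (\<Phi> u + \<Phi> v)" using * uv by auto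
  show "\<Phi> (\<lambda>x. u x - v x) \<le> 2 powr p * (\<Phi> u + \<Phi> v)"
    using *[OF fun_subspaceD(4)[OF V uv(2) uv(2), of "-1"]] power_functionalD(2)[OF \<Phi> uv(2), of "-1"] by simp
qed

text \<open>First \<open>t\<close> is taken so small that the factor (1 - t)^(1 - p) costs at most
  \<epsilon>/2 on the sublevel set of level \<open>B\<close>, then \<open>d\<close> so small that it
  pays for the factor t^(1 - p).\<close>

lemma power_functional_upper_continuous:
  assumes V: "fun_subspace V" and \<Phi>: "power_functional p V \<Phi>" and "\<epsilon> > 0" "B \<ge> 0"
  shows "\<exists>d>0. \<forall>u\<in>V. \<forall>h\<in>V. \<Phi> u \<le> B \<longrightarrow> \<Phi> h \<le> d \<longrightarrow> \<Phi> (\<lambda>x. u x + h x) \<le> \<Phi> u + \<epsilon>"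
proof -
  have "((\<lambda>t::real. ((1 - t) powr (1 - p) - 1) * B) \<longlongrightarrow> ((1 - 0) powr (1 - p) - 1) * B) (at_right 0)"
    by (intro tendsto_intros) auto
  then have "((\<lambda>t::real. ((1 - t) powr (1 - p) - 1) * B) \<longlongrightarrow> 0) (at_right 0)" by simp
  from tendstoD[OF this, of "\<epsilon>/2"] assms
  have "eventually (\<lambda>t::real. ((1 - t) powr (1 - p) - 1) * B < \<epsilon>/2) (at_right 0)"
    by (auto elim!: eventually_mono simp: abs_less_iff)
  moreover have "eventually (\<lambda>t::real. t < 1) (at_right 0)" "eventually (\<lambda>t::real. 0 < t) (at_right 0)"
    using eventually_at_right_less eventually_at_right_field[of _ "0::real"] by (auto intro: exI[of _ 1])
  ultimately have "eventually (\<lambda>t::real. ((1 - t) powr (1 - p) - 1) * B < \<epsilon>/2 \<and> 0 < t \<and> t < 1) (at_right 0)"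
    by eventually_elim auto
  then obtain t :: real where t: "((1 - t) powr (1 - p) - 1) * B < \<epsilon>/2" "0 < t" "t < 1"
    using eventually_happens'[OF trivial_limit_at_right_real] by blast
  define d where "d = \<epsilon> / 2 * t powr (p - 1)"
  have d: "d > 0" using t assms by (simp add: d_def)
  have td: "t powr (1 - p) * d = \<epsilon> / 2" using t by (simp add: d_def flip: powr_add)
  have "\<Phi> (\<lambda>x. u x + h x) \<le> \<Phi> u + \<epsilon>" if uh: "u \<in> V" "h \<in> V" "\<Phi> u \<le> B" "\<Phi> h \<le> d" for u h
  proof -
    have "((1 - t) powr (1 - p) - 1) * \<Phi> u \<le> \<epsilon> / 2"
    proof (cases "(1 - t) powr (1 - p) - 1 \<ge> 0")
      case True
      then show ?thesis using mult_left_mono[OF uh(3), of "(1 - t) powr (1 - p) - 1"] t by linarith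
    next
      case False
      then show ?thesis using mult_nonpos_nonneg[of "(1 - t) powr (1 - p) - 1" "\<Phi> u"]
          power_functionalD(1)[OF \<Phi> uh(1)] assms by linarith
    qed
    moreover have "t powr (1 - p) * \<Phi> h \<le> \<epsilon> / 2"
      using mult_left_mono[OF uh(4), of "t powr (1 - p)"] td by simp
    ultimately show ?thesis using power_functional_add_split[OF V \<Phi> uh(1,2) t(2,3)]
      by (simp add: algebra_simps)
  qed
  then show ?thesis using d by blast
qed

text \<open>The lower bound is the upper one applied to u + h and the increment -h. Adding
  \<open>h\<close> may lead out of the sublevel set of level \<open>B\<close> but, as
  \<open>e \<le> 1\<close>, not out of that of level \<open>B + 1\<close>.\<close>

lemma power_functional_continuous:
  assumes V: "fun_subspace V" and \<Phi>: "power_functional p V \<Phi>" and "\<epsilon> > 0" "B \<ge> 0"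
  shows "\<exists>d>0. \<forall>u\<in>V. \<forall>h\<in>V. \<Phi> u \<le> B \<longrightarrow> \<Phi> h \<le> d \<longrightarrow> \<bar>\<Phi> (\<lambda>x. u x + h x) - \<Phi> u\<bar> \<le> \<epsilon>"
proof -
  define e where "e = min \<epsilon> 1"
  have e: "e > 0" "e \<le> \<epsilon>" "e \<le> 1" using assms by (auto simp: e_def)
  obtain d where d: "d > 0" "\<And>u h. u \<in> V \<Longrightarrow> h \<in> V \<Longrightarrow> \<Phi> u \<le> B + 1 \<Longrightarrow> \<Phi> h \<le> d \<Longrightarrow> \<Phi> (\<lambda>x. u x + h x) \<le> \<Phi> u + e"
    using power_functional_upper_continuous[OF V \<Phi> e(1), of "B + 1"] assms by auto
  have "\<bar>\<Phi> (\<lambda>x. u x + h x) - \<Phi> u\<bar> \<le> \<epsilon>" if uh: "u \<in> V" "h \<in> V" "\<Phi> u \<le> B" "\<Phi> h \<le> d" for u h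
  proof -
    have a: "\<Phi> (\<lambda>x. u x + h x) \<le> \<Phi> u + e" using d(2)[OF uh(1,2) _ uh(4)] uh(3) by simp
    have "\<Phi> (\<lambda>x. (u x + h x) + (- 1) * h x) \<le> \<Phi> (\<lambda>x. u x + h x) + e"
      using a uh e power_functionalD(2)[OF \<Phi> uh(2), of "-1"] 
      by (intro d(2) fun_subspaceD[OF V]) (auto intro: fun_subspaceD(4)[OF V uh(2) uh(2)])
    then show ?thesis using a e by simp
  qed
  then show ?thesis using d(1) by blast
qed

lemma power_functional_tendsto:
  assumes V: "fun_subspace V" and \<Phi>: "power_functional p V \<Phi>" and uk: "\<And>k. uk k \<in> V" "u \<in> V"
    and lim: "(\<lambda>k::nat. \<Phi> (\<lambda>x. uk k x - u x)) \<longlonglongrightarrow> 0"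
  shows "(\<lambda>k. \<Phi> (uk k)) \<longlonglongrightarrow> \<Phi> u"
proof (rule LIMSEQ_I)
  fix r :: real assume "r > 0"
  obtain d where d: "d > 0" "\<And>h. h \<in> V \<Longrightarrow> \<Phi> h \<le> d \<Longrightarrow> \<bar>\<Phi> (\<lambda>x. u x + h x) - \<Phi> u\<bar> \<le> r/2"
    using power_functional_continuous[OF V \<Phi>, of "r/2" "\<Phi> u"] uk power_functionalD(1)[OF \<Phi> uk(2)] \<open>r > 0\<close> by auto
  obtain K where K: "\<And>k. k \<ge> K \<Longrightarrow> \<Phi> (\<lambda>x. uk k x - u x) < d"
    using order_tendstoD(2)[OF lim d(1)] by (auto simp: eventually_sequentially)
  have "norm (\<Phi> (uk k) - \<Phi> u) < r" if "k \<ge> K" for k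
    using d(2)[OF fun_subspaceD(3)[OF V uk(1)[of k] uk(2)]] K[OF that] \<open>r > 0\<close> by simp
  then show "\<exists>no. \<forall>k\<ge>no. norm (\<Phi> (uk k) - \<Phi> u) < r" by blast
qed

text \<open>\<open>T\<close> is linear only almost everywhere, because the weak gradient is picked
  by choice. According to the order, \<open>T\<close> will be the identity, the weighted difference
  or the weak gradient.\<close>

definition Lp_represents ::
    "'m measure \<Rightarrow> real \<Rightarrow> ('x \<Rightarrow> real) set \<Rightarrow> (('x \<Rightarrow> real) \<Rightarrow> 'm \<Rightarrow> 'v::euclidean_space)
     \<Rightarrow> (('x \<Rightarrow> real) \<Rightarrow> real) \<Rightarrow> bool" where
  "Lp_represents M p V T \<Phi> \<longleftrightarrow>
     (\<forall>u\<in>V. Lp_on M p (T u) \<and> \<Phi> u = (LINT x|M. norm (T u x) powr p)) \<and>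
     (\<forall>u\<in>V. \<forall>v\<in>V. \<forall>a b. AE x in M. T (\<lambda>x. a * u x + b * v x) x = a *\<^sub>R T u x + b *\<^sub>R T v x)"

lemma Lp_represents_lincomb:
  assumes "Lp_represents M p V T \<Phi>" "fun_subspace V" "u \<in> V" "v \<in> V" 
  shows "\<Phi> (\<lambda>x. a * u x + b * v x) = (LINT x|M. norm (a *\<^sub>R T u x + b *\<^sub>R T v x) powr p)"
proof -
  have m: "(\<lambda>x. a * u x + b * v x) \<in> V" using fun_subspaceD[OF assms(2-4)] by auto
  have [measurable]: "T u \<in> borel_measurable M" "T v \<in> borel_measurable M"
    using assms by (auto simp: Lp_represents_def Lp_on_def)
  have "\<Phi> (\<lambda>x. a * u x + b * v x) = (LINT x|M. norm (T (\<lambda>x. a * u x + b * v x) x) powr p)"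
    using assms m by (auto simp: Lp_represents_def)
  also have "\<dots> = (LINT x|M. norm (a *\<^sub>R T u x + b *\<^sub>R T v x) powr p)"
    using assms m by (intro Lp_on_AE_cong(2)[symmetric]) (auto simp: Lp_represents_def)
  finally show ?thesis .
qed

lemma Lp_represents_power_functional:
  assumes T: "Lp_represents M p V T \<Phi>" and V: "fun_subspace V" and p: "p \<ge> 1"
  shows "power_functional p V \<Phi>"
  unfolding power_functional_def
proof (intro conjI ballI allI)
  fix u assume u: "u \<in> V"
  show "0 \<le> \<Phi> u" using T u by (auto simp: Lp_represents_def)
  show "\<Phi> (\<lambda>x. c * u x) = \<bar>c\<bar> powr p * \<Phi> u" for c
    using Lp_represents_lincomb[OF T V u u, of c 0] T u by (simp add: powr_mult Lp_represents_def)
next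
  fix u v and t :: real assume uv: "u \<in> V" "v \<in> V" and t: "t \<in> {0..1}"
  have Lp: "Lp_on M p (T u)" "Lp_on M p (T v)" using T uv by (auto simp: Lp_represents_def)
  have "\<Phi> (\<lambda>x. (1-t) * u x + t * v x) = (LINT x|M. norm ((1-t) *\<^sub>R T u x + t *\<^sub>R T v x) powr p)"
    by (rule Lp_represents_lincomb[OF T V uv])
  also have "\<dots> \<le> (LINT x|M. (1-t) * norm (T u x) powr p + t * norm (T v x) powr p)"
    using Lp Lp_on_lincomb[OF p Lp] norm_powr_convex[OF p t]
    by (intro integral_mono) (auto simp: Lp_on_def)
  also have "\<dots> = (1-t) * \<Phi> u + t * \<Phi> v" using Lp T uv by (auto simp: Lp_on_def Lp_represents_def)
  finally show "\<Phi> (\<lambda>x. (1-t) * u x + t * v x) \<le> (1-t) * \<Phi> u + t * \<Phi> v" .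
qed

text \<open>The inequality is linear in the values and in the midpoint defect, so the vector
  inequality \<open>norm_powr_uniformly_convex\<close> can simply be integrated. It lets a small
  defect together with bounded values force a small difference, by one argument for all p >
  1.\<close>

definition uniformly_convex_functional :: "('x \<Rightarrow> real) set \<Rightarrow> (('x \<Rightarrow> real) \<Rightarrow> real) \<Rightarrow> bool" where
  "uniformly_convex_functional V \<Phi> \<longleftrightarrow> (\<forall>\<epsilon>>0. \<exists>C\<ge>0. \<forall>u\<in>V. \<forall>v\<in>V.
     \<Phi> (\<lambda>x. u x - v x) \<le> \<epsilon> * (\<Phi> u + \<Phi> v) + C * ((\<Phi> u + \<Phi> v) / 2 - \<Phi> (\<lambda>x. 1/2 * (u x + v x))))"

lemma Lp_represents_uniformly_convex:
  fixes T :: "('x \<Rightarrow> real) \<Rightarrow> 'm \<Rightarrow> 'v::euclidean_space"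
  assumes T: "Lp_represents M p V T \<Phi>" and V: "fun_subspace V" and p: "p > 1"
  shows "uniformly_convex_functional V \<Phi>"
  unfolding uniformly_convex_functional_def
proof (intro allI impI)
  fix \<epsilon> :: real assume "\<epsilon> > 0"
  from norm_powr_uniformly_convex[OF p this, where 'v='v]
  obtain C where C: "C \<ge> 0" and le: "\<And>a b :: 'v. norm (a - b) powr p \<le>
    \<epsilon> * (norm a powr p + norm b powr p) +
    C * ((norm a powr p + norm b powr p) / 2 - norm ((1/2) *\<^sub>R (a + b)) powr p)" by blast
  have "\<Phi> (\<lambda>x. u x - v x) \<le> \<epsilon> * (\<Phi> u + \<Phi> v) + C * ((\<Phi> u + \<Phi> v) / 2 - \<Phi> (\<lambda>x. 1/2 * (u x + v x)))"
    if uv: "u \<in> V" "v \<in> V" for u v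
  proof -
    have Lp: "Lp_on M p (T u)" "Lp_on M p (T v)" using T uv by (auto simp: Lp_represents_def)
    note i = Lp_on_lincomb[OF _ Lp, of 1 "-1", THEN Lp_on_integrable]
       Lp_on_lincomb[OF _ Lp, of "1/2" "1/2", THEN Lp_on_integrable] Lp[THEN Lp_on_integrable]
    have eq: "\<Phi> (\<lambda>x. u x - v x) = (LINT x|M. norm (T u x - T v x) powr p)"
      "\<Phi> (\<lambda>x. 1/2 * (u x + v x)) = (LINT x|M. norm ((1/2) *\<^sub>R (T u x + T v x)) powr p)"
      using Lp_represents_lincomb[OF T V uv, of 1 "-1"] Lp_represents_lincomb[OF T V uv, of "1/2" "1/2"]
      by (simp_all add: distrib_left scaleR_add_right)
    have "\<Phi> (\<lambda>x. u x - v x) \<le> (LINT x|M. \<epsilon> * (norm (T u x) powr p + norm (T v x) powr p) +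
        C * ((norm (T u x) powr p + norm (T v x) powr p) / 2 - norm ((1/2) *\<^sub>R (T u x + T v x)) powr p))"
      unfolding eq using i p by (intro integral_mono le) (auto simp: scaleR_add_right)
    also have "\<dots> = \<epsilon> * (\<Phi> u + \<Phi> v) + C * ((\<Phi> u + \<Phi> v) / 2 - \<Phi> (\<lambda>x. 1/2 * (u x + v x)))"
      unfolding eq using i p T uv by (simp add: scaleR_add_right Lp_represents_def)
    finally show ?thesis .
  qed
  then show "\<exists>C\<ge>0. \<forall>u\<in>V. \<forall>v\<in>V. \<Phi> (\<lambda>x. u x - v x) \<le> \<epsilon> * (\<Phi> u + \<Phi> v) + C * ((\<Phi> u + \<Phi> v) / 2 - \<Phi> (\<lambda>x. 1/2 * (u x + v x)))"
    using C by blast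
qed

lemma Lp_represents_has_derivative:
  assumes T: "Lp_represents M p V T \<Phi>" and V: "fun_subspace V" and p: "p > 1" and uv: "u \<in> V" "v \<in> V"
  shows "((\<lambda>t. \<Phi> (\<lambda>x. u x + t * v x)) has_real_derivative
     (p * (LINT x|M. norm (T u x) powr (p - 2) * (T u x \<bullet> T v x)))) (at 0)"
proof -
  have Lp: "Lp_on M p (T u)" "Lp_on M p (T v)" using T uv by (auto simp: Lp_represents_def)
  have eq: "\<Phi> (\<lambda>x. u x + t * v x) = (LINT x|M. norm (T u x + t *\<^sub>R T v x) powr p)" for t
    using Lp_represents_lincomb[OF T V uv, of 1 t] by simp
  have conv: "convex_on {-1..1} (\<lambda>t. norm (T u x + t *\<^sub>R T v x) powr p)" for x
  proof (rule convex_onI)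
    fix t y z :: real assume t: "0 < t" "t < 1"
    have "T u x + ((1 - t) *\<^sub>R y + t *\<^sub>R z) *\<^sub>R T v x =
       (1-t) *\<^sub>R (T u x + y *\<^sub>R T v x) + t *\<^sub>R (T u x + z *\<^sub>R T v x)"
      by (simp add: algebra_simps)
    then show "norm (T u x + ((1 - t) *\<^sub>R y + t *\<^sub>R z) *\<^sub>R T v x) powr p \<le>
       (1-t) * norm (T u x + y *\<^sub>R T v x) powr p + t * norm (T u x + z *\<^sub>R T v x) powr p"
      using norm_powr_convex[of p t "T u x + y *\<^sub>R T v x" "T u x + z *\<^sub>R T v x"] p t by simp
  qed auto
  have "((\<lambda>t. LINT x|M. norm (T u x + t *\<^sub>R T v x) powr p) has_real_derivative
     (LINT x|M. p * (norm (T u x) powr (p - 2) * (T u x \<bullet> T v x)))) (at 0)"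
    using Lp_on_lincomb[OF _ Lp, of 1, THEN Lp_on_integrable] p conv
    by (intro has_derivative_integral_convex(2) norm_powr_has_derivative_at_0) auto
  then show ?thesis unfolding eq by simp
qed

section \<open>Comparison of Gagliardo energies\<close>

text \<open>The convex function 2^(-x) lies below its chord over [0,1], which joins 1 to
  1/2.\<close>

lemma powr_two_bounds:
  fixes x :: real
  assumes "0 \<le> x" "x \<le> 1"
  shows "x / 2 \<le> 1 - 2 powr (- x)"
proof -
  have "2 powr (- x) = 2 powr ((1 - x) * 0 + x * (-1))" by simp
  also have "\<dots> \<le> (1 - x) * 2 powr 0 + x * 2 powr (-1)"
  proof -
    have "convex_on UNIV (\<lambda>x::real. exp (x * ln 2))"
      by (rule f''_ge0_imp_convex[where f' = "\<lambda>x. exp (x * ln 2) * ln 2" and f'' = "\<lambda>x. exp (x * ln 2) * ln 2 * ln 2"])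
        (auto intro!: derivative_eq_intros)
    from convex_onD[OF this, of x 0 "-1"] assms show ?thesis by (simp add: powr_def)
  qed
  finally show ?thesis by (simp add: powr_minus field_simps)
qed

lemma powr_two_upper: "1 - 2 powr (- x) \<le> (x::real)" if "x \<ge> 0"
proof -
  have "1 + (- x * ln 2) \<le> exp (- x * ln 2)" by (rule exp_ge_add_one_self)
  moreover have "x * ln 2 \<le> x * 1" using ln_2_less_1 that by (intro mult_left_mono) auto
  ultimately show ?thesis by (simp add: powr_def)
qed

text \<open>Both sides are averages of the \<open>b k\<close>, with weights (1 - q) q^k and the
  remaining mass q^n placed at \<open>c\<close>, which bounds all of them. A larger ratio moves mass
  to larger indices, where the values are larger.\<close>

lemma Abel_monotone_sum:
  fixes b :: "nat \<Rightarrow> real"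
  assumes "mono b" "0 \<le> q" "q \<le> Q" "Q < 1" "\<And>k. k < n \<Longrightarrow> b k \<le> c" "b 0 \<ge> 0" "c \<ge> 0"
  shows "(1 - q) * (\<Sum>k<n. q ^ k * b k) + q ^ n * c \<le> (1 - Q) * (\<Sum>k<n. Q ^ k * b k) + Q ^ n * c"
  using assms(5,7)
proof (induction n arbitrary: c)
  case (Suc n)
  have b0: "b n \<ge> 0" using assms(6) monoD[OF assms(1), of 0 n] by simp
  have IH: "(1 - q) * (\<Sum>k<n. q ^ k * b k) + q ^ n * b n \<le> (1 - Q) * (\<Sum>k<n. Q ^ k * b k) + Q ^ n * b n"
    using assms(1) b0 by (intro Suc.IH) (auto simp: mono_def)
  have "q ^ Suc n * (c - b n) \<le> Q ^ Suc n * (c - b n)"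
    using assms Suc.prems(1)[of n] by (intro mult_right_mono power_mono) auto
  then show ?case using IH by (simp add: algebra_simps)
qed auto

lemma Abel_monotone_suminf:
  fixes b :: "nat \<Rightarrow> ennreal"
  assumes b: "mono b" and q: "0 < q" "q \<le> Q" "Q < 1"
  shows "ennreal (1 - q) * (\<Sum>k. ennreal (q ^ k) * b k) \<le> ennreal (1 - Q) * (\<Sum>k. ennreal (Q ^ k) * b k)"
proof (cases "(\<Sum>k. ennreal (Q ^ k) * b k) = \<infinity>")
  case True then show ?thesis using q by (simp add: ennreal_mult_top)
next
  case False
  have fin: "ennreal (Q ^ k) * b k < \<infinity>" for k
    using False by (metis ennreal_suminf_lessD infinity_ennreal_def less_top)
  have "b k < \<infinity>" for k
  proof (rule ccontr)
    assume "\<not> b k < \<infinity>" then have "b k = \<infinity>" by (simp add: less_top[symmetric])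
    then show False using fin[of k] q by (simp add: ennreal_mult_top)
  qed
  then obtain \<beta> where \<beta>: "\<And>k. b k = ennreal (\<beta> k)" "\<And>k. \<beta> k \<ge> 0"
    using that[of "\<lambda>k. enn2real (b k)"] by simp
  have m: "mono \<beta>"
    using monoD[OF b] \<beta> by (intro monoI) (metis ennreal_le_iff)
  have sumQ: "summable (\<lambda>k. Q ^ k * \<beta> k)"
    by (rule summable_suminf_not_top) (use False q \<beta> in \<open>auto simp: ennreal_mult'\<close>)
  define S where "S = (1 - Q) * (\<Sum>k. Q ^ k * \<beta> k)"
  have part: "(1 - q) * (\<Sum>k<n. q ^ k * \<beta> k) \<le> S" for n
  proof -
    have geo: "summable (\<lambda>k. Q ^ (k + n))" using q by (simp add: power_add summable_mult2)
    \<comment> \<open>The mass Q^n placed at \<open>\<beta> n\<close> is at most the true tail of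
      the series, since \<beta> increases; this converts the finite statement into one about the
      full sum.\<close>
    have "Q ^ n * \<beta> n = (1 - Q) * (\<Sum>k. Q ^ (k + n) * \<beta> n)"
    proof -
      have "(\<Sum>k. Q ^ (k + n) * \<beta> n) = (\<Sum>k. Q ^ k * (Q ^ n * \<beta> n))" by (simp add: power_add mult_ac)
      also have "\<dots> = 1 / (1 - Q) * (Q ^ n * \<beta> n)"
        using q by (subst suminf_mult2[symmetric]) (auto simp: suminf_geometric)
      finally show ?thesis using q by simp
    qed
    also have "\<dots> \<le> (1 - Q) * (\<Sum>k. Q ^ (k + n) * \<beta> (k + n))"
      using q m geo sumQ by (intro mult_left_mono suminf_le summable_mult2 summable_ignore_initial_segment[of "\<lambda>k. Q ^ k * \<beta> k"])
        (auto simp: mono_def)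
    also have "(\<Sum>k. Q ^ (k + n) * \<beta> (k + n)) = (\<Sum>k. Q ^ k * \<beta> k) - (\<Sum>k<n. Q ^ k * \<beta> k)"
      by (rule suminf_minus_initial_segment[OF sumQ])
    finally have "(1 - Q) * (\<Sum>k<n. Q ^ k * \<beta> k) + Q ^ n * \<beta> n \<le> S"
      by (simp add: S_def algebra_simps)
    moreover have "(1 - q) * (\<Sum>k<n. q ^ k * \<beta> k) + q ^ n * \<beta> n \<le> (1 - Q) * (\<Sum>k<n. Q ^ k * \<beta> k) + Q ^ n * \<beta> n"
      using m q \<beta> by (intro Abel_monotone_sum) (auto simp: mono_def)
    moreover have "0 \<le> q ^ n * \<beta> n" using q \<beta> by auto
    ultimately show ?thesis by linarith
  qed
  have sumq: "summable (\<lambda>k. q ^ k * \<beta> k)"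
    using q \<beta> m by (intro summable_comparison_test[OF _ sumQ]) (auto intro!: exI[of _ 0] mult_right_mono power_mono)
  have "(\<Sum>k. q ^ k * \<beta> k) \<le> S / (1 - q)"
    using part q by (intro suminf_le_const[OF sumq]) (auto simp: field_simps)
  then have "(1 - q) * (\<Sum>k. q ^ k * \<beta> k) \<le> S" using q by (simp add: field_simps)
  moreover have "(\<Sum>k. ennreal (r ^ k) * b k) = ennreal (\<Sum>k. r ^ k * \<beta> k)" if "summable (\<lambda>k. r ^ k * \<beta> k)" "r > 0" for r
    using that \<beta> by (subst suminf_ennreal2[symmetric]) (auto simp: ennreal_mult')
  ultimately show ?thesis using sumq sumQ q \<beta>
    by (simp add: S_def ennreal_leI flip: ennreal_mult')
qed

lemma ennreal_geometric_suminf: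
  assumes "0 \<le> r" "r < 1" shows "(\<Sum>k. ennreal (r ^ k)) = ennreal (1 / (1 - r))"
  using assms suminf_geometric[of r] by (subst suminf_ennreal2) (simp_all add: summable_geometric)

section \<open>Changes of variables and dyadic shells\<close>

lemma nn_integral_lborel_scale:
  fixes f :: "'a::euclidean_space \<Rightarrow> ennreal"
  assumes [measurable]: "f \<in> borel_measurable borel" and c: "c > 0"
  shows "(\<integral>\<^sup>+x. f x \<partial>lborel) = ennreal (c ^ DIM('a)) * (\<integral>\<^sup>+x. f (c *\<^sub>R x) \<partial>lborel)"
  using c by (subst lborel_affine[of c 0])
    (auto simp: nn_integral_density nn_integral_distr nn_integral_cmult)

lemma nn_integral_lborel_translate:
  fixes f :: "'a::euclidean_space \<Rightarrow> ennreal"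
  assumes [measurable]: "f \<in> borel_measurable borel"
  shows "(\<integral>\<^sup>+x. f (x + c) \<partial>lborel) = (\<integral>\<^sup>+x. f x \<partial>lborel)"
  by (subst (2) lborel_affine[of 1 c])
    (auto simp: nn_integral_density nn_integral_distr add.commute)

text \<open>Half open, so that the dilates by powers of 2 partition the complement of the
  origin.\<close>

definition ring :: "real \<Rightarrow> 'a::euclidean_space set" where
  "ring R = {h. R \<le> norm h \<and> norm h < 2 * R}"

lemma ring_measurable [measurable]: "(ring R :: 'a::euclidean_space set) \<in> sets borel"
  unfolding ring_def by measurable

definition ring_measure :: "'a::euclidean_space itself \<Rightarrow> real \<Rightarrow> real" where
  "ring_measure _ R = measure lborel (ring R :: 'a set)"

lemma ring_measure:
  assumes "R > 0"
  shows "emeasure lborel (ring R :: 'a::euclidean_space set) = ennreal (ring_measure TYPE('a) R)"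
    "ring_measure TYPE('a) R > 0"
proof -
  have "emeasure lborel (ring R :: 'a set) \<le> emeasure lborel (cball (0::'a) (2 * R))"
    by (rule emeasure_mono) (auto simp: ring_def)
  also have "\<dots> < \<infinity>" using emeasure_bounded_finite[of "cball (0::'a) (2*R)"] by simp
  finally have fin: "emeasure lborel (ring R :: 'a set) < \<infinity>" .
  then show eq: "emeasure lborel (ring R :: 'a set) = ennreal (ring_measure TYPE('a) R)"
    by (simp add: ring_measure_def emeasure_eq_ennreal_measure)
  obtain e :: 'a where e: "e \<in> Basis" using nonempty_Basis by blast
  have "0 < emeasure lborel (ball ((3/2 * R) *\<^sub>R e) (R/2))"
    using assms by (subst emeasure_ball) (auto intro!: unit_ball_vol_pos)
  also have "\<dots> \<le> emeasure lborel (ring R :: 'a set)"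
  proof (rule emeasure_mono)
    show "ball ((3/2 * R) *\<^sub>R e) (R/2) \<subseteq> ring R"
    proof
      fix x assume x: "x \<in> ball ((3/2 * R) *\<^sub>R e) (R/2)"
      have "norm ((3/2 * R) *\<^sub>R e) = 3/2 * R" using assms e by simp
      then show "x \<in> ring R"
        using x norm_triangle_ineq3[of "(3/2 * R) *\<^sub>R e" x] by (auto simp: ring_def dist_norm)
    qed
  qed simp
  finally show "ring_measure TYPE('a) R > 0" using eq by (metis ennreal_eq_0_iff linorder_not_le order_less_irrefl)
qed

lemma ring_dyadic_inner:
  assumes "R > 0" "h \<noteq> 0" "norm h < 2 * R"
  shows "\<exists>!k::nat. 2 ^ k *\<^sub>R h \<in> ring R"
proof -
  define m where "m = (LEAST k::nat. R \<le> 2 ^ k * norm h)"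
  obtain k0 where "R / norm h < 2 ^ k0" using real_arch_pow[of 2 "R / norm h"] by auto
  then have "R \<le> 2 ^ k0 * norm h" using assms by (simp add: field_simps)
  then have m: "R \<le> 2 ^ m * norm h" unfolding m_def by (rule LeastI)
  have up: "2 ^ m * norm h < 2 * R"
  proof (cases m)
    case (Suc j)
    then have "\<not> R \<le> 2 ^ j * norm h" unfolding m_def by (metis lessI not_less_Least)
    then show ?thesis using Suc by simp
  qed (use assms in simp)
  show ?thesis
  proof (rule ex1I[of _ m])
    show "2 ^ m *\<^sub>R h \<in> ring R" using m up by (simp add: ring_def)
    fix k assume "2 ^ k *\<^sub>R h \<in> ring R"
    then have k: "R \<le> 2 ^ k * norm h" "2 ^ k * norm h < 2 * R" by (auto simp: ring_def)
    have False if "k < j" "R \<le> 2 ^ k * norm h" "2 ^ j * norm h < 2 * R" for k j :: nat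
    proof -
      have "(2::real) ^ Suc k \<le> 2 ^ j" using that by (intro power_increasing) auto
      then have "2 * (2 ^ k * norm h) \<le> 2 ^ j * norm h" by (metis mult.assoc mult_right_mono norm_ge_zero power_Suc)
      then show False using that by linarith
    qed
    then show "k = m" using k m up by (metis linorder_neqE_nat)
  qed
qed

lemma ring_dyadic_outer:
  assumes "R > 0" "R \<le> norm h"
  shows "\<exists>!k::nat. (1 / 2 ^ k) *\<^sub>R h \<in> ring R"
proof -
  define m where "m = (LEAST k::nat. norm h < 2 ^ Suc k * R)"
  obtain k0 where "norm h / R < 2 ^ k0" using real_arch_pow[of 2 "norm h / R"] by auto
  then have "norm h < 2 ^ k0 * R" using assms by (simp add: field_simps)
  then have "norm h < 2 ^ Suc k0 * R" using assms by simp
  then have m: "norm h < 2 ^ Suc m * R" unfolding m_def by (rule LeastI)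
  have lo: "2 ^ m * R \<le> norm h"
  proof (cases m)
    case (Suc j)
    then have "\<not> norm h < 2 ^ Suc j * R" unfolding m_def by (metis lessI not_less_Least)
    then show ?thesis using Suc by simp
  qed (use assms in simp)
  have eq: "(1 / 2 ^ k) *\<^sub>R h \<in> ring R \<longleftrightarrow> 2 ^ k * R \<le> norm h \<and> norm h < 2 * 2 ^ k * R" for k
    by (auto simp: ring_def field_simps)
  show ?thesis
  proof (rule ex1I[of _ m])
    show "(1 / 2 ^ m) *\<^sub>R h \<in> ring R" using m lo by (simp add: eq)
    fix k assume "(1 / 2 ^ k) *\<^sub>R h \<in> ring R"
    then have k: "2 ^ k * R \<le> norm h" "norm h < 2 * 2 ^ k * R" by (auto simp: eq)
    have False if "k < j" "2 ^ j * R \<le> norm h" "norm h < 2 * 2 ^ k * R" for k j :: nat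
    proof -
      have "(2::real) ^ Suc k \<le> 2 ^ j" using that by (intro power_increasing) auto
      then have "2 * 2 ^ k * R \<le> 2 ^ j * R" using assms by (intro mult_right_mono) auto
      then show False using that by linarith
    qed
    then show "k = m" using k m lo by (metis linorder_neqE_nat power_Suc)
  qed
qed

lemma suminf_indicator_ex1:
  assumes "\<exists>!k::nat. P k"
  shows "(\<Sum>k. x * indicator {k. P k} k) = (x::ennreal)"
proof -
  obtain m where m: "P m" "\<And>k. P k \<Longrightarrow> k = m" using assms by auto
  have "(\<Sum>k. x * indicator {k. P k} k) = (\<Sum>k\<in>{m}. x * indicator {k. P k} k)"
  proof (rule suminf_finite)
    fix n assume "n \<notin> {m}"
    then have "\<not> P n" using m(2) by blast
    then show "x * indicator {k. P k} n = 0" by simp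
  qed simp
  then show ?thesis using m(1) by simp
qed

text \<open>Each shell of inner radius R / 2^k is dilated back to \<open>ring R\<close>; the power
  of 1 / 2^k is the Jacobian of this dilation.\<close>

lemma nn_integral_dyadic_inner:
  fixes f :: "'a::euclidean_space \<Rightarrow> ennreal"
  assumes [measurable]: "f \<in> borel_measurable borel" and R: "R > 0"
  shows "(\<integral>\<^sup>+h. f h * indicator {h. h \<noteq> 0 \<and> norm h < 2 * R} h \<partial>lborel) =
    (\<Sum>k. ennreal ((1 / 2 ^ k) ^ DIM('a)) * (\<integral>\<^sup>+h. f ((1 / 2 ^ k) *\<^sub>R h) * indicator (ring R) h \<partial>lborel))"
proof -
  have "f h * indicator {h. h \<noteq> 0 \<and> norm h < 2 * R} h = (\<Sum>k::nat. f h * indicator (ring R) ((2 ^ k) *\<^sub>R h))" for h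
  proof (cases "h \<noteq> 0 \<and> norm h < 2 * R")
    case True
    from suminf_indicator_ex1[OF ring_dyadic_inner[OF R, of h], of "f h"] True show ?thesis
      by (simp add: indicator_def)
  next
    case False
    have "norm h \<le> 2 ^ k * norm h" for k :: nat
      using mult_right_mono[of 1 "2 ^ k" "norm h"] by simp
    then have "(2 ^ k) *\<^sub>R h \<notin> ring R" for k :: nat 
      using False R by (auto simp: ring_def not_less) (meson le_less_trans not_less)
    then show ?thesis using False by simp
  qed
  then have "(\<integral>\<^sup>+h. f h * indicator {h. h \<noteq> 0 \<and> norm h < 2 * R} h \<partial>lborel) =
     (\<integral>\<^sup>+h. (\<Sum>k::nat. f h * indicator (ring R) ((2 ^ k) *\<^sub>R h)) \<partial>lborel)" by simp
  also have "\<dots> = (\<Sum>k::nat. \<integral>\<^sup>+h. f h * indicator (ring R) ((2 ^ k) *\<^sub>R h) \<partial>lborel)"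
    by (rule nn_integral_suminf) measurable
  also have "\<dots> = (\<Sum>k. ennreal ((1 / 2 ^ k) ^ DIM('a)) * (\<integral>\<^sup>+h. f ((1 / 2 ^ k) *\<^sub>R h) * indicator (ring R) h \<partial>lborel))"
  proof (rule suminf_cong)
    fix k :: nat
    show "(\<integral>\<^sup>+h. f h * indicator (ring R) ((2 ^ k) *\<^sub>R h) \<partial>lborel) =
      ennreal ((1 / 2 ^ k) ^ DIM('a)) * (\<integral>\<^sup>+h. f ((1 / 2 ^ k) *\<^sub>R h) * indicator (ring R) h \<partial>lborel)"
      by (subst nn_integral_lborel_scale[where c = "1 / 2 ^ k"]) auto
  qed
  finally show ?thesis .
qed

lemma nn_integral_dyadic_outer:
  fixes f :: "'a::euclidean_space \<Rightarrow> ennreal"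
  assumes [measurable]: "f \<in> borel_measurable borel" and R: "R > 0"
  shows "(\<integral>\<^sup>+h. f h * indicator {h. R \<le> norm h} h \<partial>lborel) =
    (\<Sum>k. ennreal ((2 ^ k) ^ DIM('a)) * (\<integral>\<^sup>+h. f ((2 ^ k) *\<^sub>R h) * indicator (ring R) h \<partial>lborel))"
proof -
  have "f h * indicator {h. R \<le> norm h} h = (\<Sum>k::nat. f h * indicator (ring R) ((1 / 2 ^ k) *\<^sub>R h))" for h
  proof (cases "R \<le> norm h")
    case True
    from suminf_indicator_ex1[OF ring_dyadic_outer[OF R, of h], of "f h"] True show ?thesis
      by (simp add: indicator_def)
  next
    case False
    have "norm h / 2 ^ k \<le> norm h" for k :: nat
      using divide_left_mono[of 1 "2 ^ k" "norm h"] by simp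
    then have "(1 / 2 ^ k) *\<^sub>R h \<notin> ring R" for k :: nat 
      using False R by (auto simp: ring_def not_le) (meson le_less_trans not_less)
    then show ?thesis using False by simp
  qed
  then have "(\<integral>\<^sup>+h. f h * indicator {h. R \<le> norm h} h \<partial>lborel) =
     (\<integral>\<^sup>+h. (\<Sum>k::nat. f h * indicator (ring R) ((1 / 2 ^ k) *\<^sub>R h)) \<partial>lborel)" by simp
  also have "\<dots> = (\<Sum>k::nat. \<integral>\<^sup>+h. f h * indicator (ring R) ((1 / 2 ^ k) *\<^sub>R h) \<partial>lborel)"
    by (rule nn_integral_suminf) measurable
  also have "\<dots> = (\<Sum>k. ennreal ((2 ^ k) ^ DIM('a)) * (\<integral>\<^sup>+h. f ((2 ^ k) *\<^sub>R h) * indicator (ring R) h \<partial>lborel))"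
  proof (rule suminf_cong)
    fix k :: nat
    show "(\<integral>\<^sup>+h. f h * indicator (ring R) ((1 / 2 ^ k) *\<^sub>R h) \<partial>lborel) =
      ennreal ((2 ^ k) ^ DIM('a)) * (\<integral>\<^sup>+h. f ((2 ^ k) *\<^sub>R h) * indicator (ring R) h \<partial>lborel)"
      by (subst nn_integral_lborel_scale[where c = "2 ^ k"]) auto
  qed
  finally show ?thesis .
qed

lemma ennreal_numeral_mult: "ennreal (numeral n * x) = numeral n * ennreal x"
  by (metis ennreal_mult' ennreal_numeral zero_le_numeral)

section \<open>Shifts and the Gagliardo energy\<close>

definition shift_pow :: "real \<Rightarrow> ('a::euclidean_space \<Rightarrow> real) \<Rightarrow> 'a \<Rightarrow> ennreal" where
  "shift_pow p u h = (\<integral>\<^sup>+x. ennreal (\<bar>u (x + h) - u x\<bar> powr p) \<partial>lborel)"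

definition pow_int :: "real \<Rightarrow> ('a::euclidean_space \<Rightarrow> real) \<Rightarrow> ennreal" where
  "pow_int p u = (\<integral>\<^sup>+x. ennreal (\<bar>u x\<bar> powr p) \<partial>lborel)"

text \<open>The Gagliardo double integral after the substitution h = x - y, with the other
  integration collected into \<open>shift_pow\<close>; \<open>gag_eq_double_integral\<close> is the
  link. Only the dependence on the shift is then cut into shells.\<close>

definition gag :: "real \<Rightarrow> real \<Rightarrow> ('a::euclidean_space \<Rightarrow> real) \<Rightarrow> ennreal" where
  "gag s p u = (\<integral>\<^sup>+h. shift_pow p u h * ennreal (norm h powr - (real DIM('a) + s * p)) \<partial>lborel)"

lemma shift_pow_measurable [measurable]:
  fixes u :: "'a::euclidean_space \<Rightarrow> real"
  assumes [measurable]: "u \<in> borel_measurable borel"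
  shows "shift_pow p u \<in> borel_measurable borel"
proof -
  have "(\<lambda>h. \<integral>\<^sup>+x. ennreal (\<bar>u (x + h) - u x\<bar> powr p) \<partial>lborel) \<in> borel_measurable lborel"
    by measurable
  then show ?thesis by (simp add: shift_pow_def[abs_def])
qed

lemma gag_eq_double_integral:
  fixes u :: "'a::euclidean_space \<Rightarrow> real"
  assumes [measurable]: "u \<in> borel_measurable borel"
  shows "(\<integral>\<^sup>+z. ennreal (case z of (x, y) \<Rightarrow> \<bar>u x - u y\<bar> powr p / norm (x - y) powr (real DIM('a) + s * p)) \<partial>(lborel \<Otimes>\<^sub>M lborel))
    = gag s p u"
proof -
  have "(\<integral>\<^sup>+z. ennreal (case z of (x, y) \<Rightarrow> \<bar>u x - u y\<bar> powr p / norm (x - y) powr (real DIM('a) + s * p)) \<partial>(lborel \<Otimes>\<^sub>M lborel))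
    = (\<integral>\<^sup>+y. \<integral>\<^sup>+x. ennreal (\<bar>u x - u y\<bar> powr p / norm (x - y) powr (real DIM('a) + s * p)) \<partial>lborel \<partial>lborel)"
    by (subst lborel_pair.nn_integral_snd[symmetric]) (auto simp: case_prod_beta)
  also have "\<dots> = (\<integral>\<^sup>+y. \<integral>\<^sup>+h. ennreal (\<bar>u (h + y) - u y\<bar> powr p / norm (h + y - y) powr (real DIM('a) + s * p)) \<partial>lborel \<partial>lborel)"
    by (subst nn_integral_lborel_translate) auto
  also have "\<dots> = (\<integral>\<^sup>+y. \<integral>\<^sup>+h. ennreal (\<bar>u (y + h) - u y\<bar> powr p) * ennreal (norm h powr - (real DIM('a) + s * p)) \<partial>lborel \<partial>lborel)"
    unfolding add_diff_cancel_right' powr_minus divide_inverse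
    by (simp add: ennreal_mult add.commute)
  also have "\<dots> = (\<integral>\<^sup>+h. \<integral>\<^sup>+y. ennreal (\<bar>u (y + h) - u y\<bar> powr p) * ennreal (norm h powr - (real DIM('a) + s * p)) \<partial>lborel \<partial>lborel)"
    by (rule lborel_pair.Fubini') measurable
  also have "\<dots> = gag s p u"
    unfolding gag_def shift_pow_def by (subst nn_integral_multc) auto
  finally show ?thesis .
qed

text \<open>A shift by 2h is two shifts by h. Convexity gives each the factor 2^(p-1), and both
  integrals agree by translation invariance. The monotonicity of the shell energies rests on this
  inequality.\<close>

lemma shift_pow_double:
  fixes u :: "'a::euclidean_space \<Rightarrow> real"
  assumes [measurable]: "u \<in> borel_measurable borel" and p: "p \<ge> 1"
  shows "shift_pow p u (2 *\<^sub>R h) \<le> ennreal (2 powr p) * shift_pow p u h"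
proof -
  have pt: "\<bar>u (x + 2 *\<^sub>R h) - u x\<bar> powr p \<le>
      2 powr p / 2 * \<bar>u (x + h + h) - u (x + h)\<bar> powr p + 2 powr p / 2 * \<bar>u (x + h) - u x\<bar> powr p" for x
  proof -
    have "\<bar>a + b\<bar> powr p \<le> 2 powr p / 2 * \<bar>a\<bar> powr p + 2 powr p / 2 * \<bar>b\<bar> powr p" for a b :: real
      using norm_powr_convex[of p "1/2" "2 * a" "2 * b"] p by (simp add: abs_mult powr_mult)
    from this[of "u (x + h + h) - u (x + h)" "u (x + h) - u x"] show ?thesis
      by (simp add: scaleR_2 add.assoc)
  qed
  have "shift_pow p u (2 *\<^sub>R h) \<le> (\<integral>\<^sup>+x. ennreal (2 powr p / 2) * ennreal (\<bar>u (x + h + h) - u (x + h)\<bar> powr p)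
      + ennreal (2 powr p / 2) * ennreal (\<bar>u (x + h) - u x\<bar> powr p) \<partial>lborel)"
    unfolding shift_pow_def using pt
    by (intro nn_integral_mono) (auto simp flip: ennreal_mult ennreal_plus intro!: ennreal_leI)
  also have "\<dots> = ennreal (2 powr p / 2) * (\<integral>\<^sup>+x. ennreal (\<bar>u (x + h + h) - u (x + h)\<bar> powr p) \<partial>lborel)
      + ennreal (2 powr p / 2) * shift_pow p u h"
    unfolding shift_pow_def by (subst nn_integral_add) (auto simp: nn_integral_cmult)
  also have "(\<integral>\<^sup>+x. ennreal (\<bar>u (x + h + h) - u (x + h)\<bar> powr p) \<partial>lborel) = shift_pow p u h"
    unfolding shift_pow_def by (subst nn_integral_lborel_translate[where f = "\<lambda>x. ennreal (\<bar>u (x + h) - u x\<bar> powr p)"]) auto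
  also have "ennreal (2 powr p / 2) * shift_pow p u h + ennreal (2 powr p / 2) * shift_pow p u h = ennreal (2 powr p) * shift_pow p u h"
    by (simp flip: distrib_right ennreal_plus)
  finally show ?thesis .
qed

lemma shift_pow_le_pow_int:
  fixes u :: "'a::euclidean_space \<Rightarrow> real"
  assumes [measurable]: "u \<in> borel_measurable borel" and p: "p \<ge> 1"
  shows "shift_pow p u h \<le> ennreal (2 powr p * 2) * pow_int p u"
proof -
  have "shift_pow p u h \<le> (\<integral>\<^sup>+x. ennreal (2 powr p) * (ennreal (\<bar>u (x + h)\<bar> powr p) + ennreal (\<bar>u x\<bar> powr p)) \<partial>lborel)"
    unfolding shift_pow_def using norm_powr_add_le[OF p, of "u (_ + h)" "- u _"]
    by (intro nn_integral_mono) (auto simp flip: ennreal_mult ennreal_plus intro!: ennreal_leI)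
  also have "\<dots> = ennreal (2 powr p) * ((\<integral>\<^sup>+x. ennreal (\<bar>u (x + h)\<bar> powr p) \<partial>lborel) + pow_int p u)"
    unfolding pow_int_def by (simp add: nn_integral_cmult nn_integral_add)
  also have "(\<integral>\<^sup>+x. ennreal (\<bar>u (x + h)\<bar> powr p) \<partial>lborel) = pow_int p u"
    unfolding pow_int_def by (rule nn_integral_lborel_translate) measurable
  also have "ennreal (2 powr p) * (pow_int p u + pow_int p u) = ennreal (2 powr p * 2) * pow_int p u"
    by (simp add: ennreal_mult mult_2 mult.assoc)
  finally show ?thesis .
qed

text \<open>Beyond \<open>R\<close> the shifted and the original function have disjoint
  supports.\<close>

lemma shift_pow_far:
  fixes u :: "'a::euclidean_space \<Rightarrow> real"
  assumes [measurable]: "u \<in> borel_measurable borel"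
    and supp: "\<And>x. R / 2 \<le> norm x \<Longrightarrow> u x = 0" and h: "R \<le> norm h"
  shows "shift_pow p u h = 2 * pow_int p u"
proof -
  have z: "u (x + h) = 0 \<or> u x = 0" for x
  proof (rule ccontr)
    assume "\<not> ?thesis"
    then have "norm (x + h) < R / 2" "norm x < R/2" using supp not_less by blast+
    then show False using h norm_triangle_ineq4[of "x + h" x] by simp
  qed
  have "\<bar>u (x + h) - u x\<bar> powr p = \<bar>u (x + h)\<bar> powr p + \<bar>u x\<bar> powr p" for x
    using z[of x] by auto
  then have "shift_pow p u h = (\<integral>\<^sup>+x. ennreal (\<bar>u (x + h)\<bar> powr p) + ennreal (\<bar>u x\<bar> powr p) \<partial>lborel)"
    unfolding shift_pow_def by (simp add: ennreal_plus)
  also have "\<dots> = (\<integral>\<^sup>+x. ennreal (\<bar>u (x + h)\<bar> powr p) \<partial>lborel) + pow_int p u"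
    unfolding pow_int_def by (rule nn_integral_add) measurable
  also have "(\<integral>\<^sup>+x. ennreal (\<bar>u (x + h)\<bar> powr p) \<partial>lborel) = pow_int p u"
    unfolding pow_int_def by (rule nn_integral_lborel_translate) measurable
  finally show ?thesis by (simp add: mult_2)
qed

text \<open>The normalisation makes this monotone in \<open>k\<close> by the doubling inequality.\<close>

definition ring_energy :: "real \<Rightarrow> real \<Rightarrow> ('a::euclidean_space \<Rightarrow> real) \<Rightarrow> nat \<Rightarrow> ennreal" where
  "ring_energy R p u k = ennreal (2 powr (k * p)) *
     (\<integral>\<^sup>+h. shift_pow p u ((1 / 2 ^ k) *\<^sub>R h) * indicator (ring R) h \<partial>lborel)"

lemma mono_ring_energy:
  fixes u :: "'a::euclidean_space \<Rightarrow> real"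
  assumes [measurable]: "u \<in> borel_measurable borel" and p: "p \<ge> 1"
  shows "mono (ring_energy R p u)"
proof (rule mono_iff_le_Suc[THEN iffD2], intro allI)
  fix k
  have "shift_pow p u ((1 / 2 ^ k) *\<^sub>R h) \<le> ennreal (2 powr p) * shift_pow p u ((1 / 2 ^ Suc k) *\<^sub>R h)" for h
    using shift_pow_double[OF assms, of "(1 / 2 ^ Suc k) *\<^sub>R h"] by simp
  then have "(\<integral>\<^sup>+h. shift_pow p u ((1 / 2 ^ k) *\<^sub>R h) * indicator (ring R) h \<partial>lborel) \<le>
     (\<integral>\<^sup>+h. ennreal (2 powr p) * (shift_pow p u ((1 / 2 ^ Suc k) *\<^sub>R h) * indicator (ring R) h) \<partial>lborel)"
    by (intro nn_integral_mono) (auto simp: indicator_def)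
  also have "\<dots> = ennreal (2 powr p) * (\<integral>\<^sup>+h. shift_pow p u ((1 / 2 ^ Suc k) *\<^sub>R h) * indicator (ring R) h \<partial>lborel)"
    by (rule nn_integral_cmult) measurable
  finally have "ring_energy R p u k \<le> ennreal (2 powr (k * p)) * (ennreal (2 powr p) * (\<integral>\<^sup>+h. shift_pow p u ((1 / 2 ^ Suc k) *\<^sub>R h) * indicator (ring R) h \<partial>lborel))"
    unfolding ring_energy_def by (rule mult_left_mono) simp
  also have "\<dots> = ring_energy R p u (Suc k)"
    unfolding ring_energy_def mult.assoc[symmetric] ennreal_mult'[symmetric, OF powr_ge_zero] powr_add[symmetric]
    by (simp add: distrib_right add.commute)
  finally show "ring_energy R p u k \<le> ring_energy R p u (Suc k)" .
qed

lemma ring_powr_bounds: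
  fixes h :: "'a::euclidean_space"
  assumes "R \<ge> 1" "h \<in> ring R" "0 \<le> e" "e \<le> 2 * real N"
  shows "norm h powr - e \<le> 1" "(2 * R) powr (- 2 * real N) \<le> norm h powr - e"
proof -
  have h: "1 \<le> norm h" "norm h \<le> 2 * R" using assms by (auto simp: ring_def)
  have "norm h powr - e \<le> norm h powr 0" using h assms by (intro powr_mono) auto
  then show "norm h powr - e \<le> 1" using h by (simp split: if_splits)
  have "(2 * R) powr (- 2 * real N) \<le> (2 * R) powr - e" using assms by (intro powr_mono) auto
  also have "\<dots> \<le> norm h powr - e" using h assms by (intro powr_mono2') auto
  finally show "(2 * R) powr (- 2 * real N) \<le> norm h powr - e" .
qed

text \<open>For R \<ge> 1, a lower bound on \<open>ring R\<close> of the kernel |h|^(-e), uniform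
  over all exponents e = N + s p \<le> 2 N that occur.\<close>

definition kappa :: "'a::euclidean_space itself \<Rightarrow> real \<Rightarrow> real" where
  "kappa _ R = (2 * R) powr (- 2 * real DIM('a))"

text \<open>Dilating the k-th shell gives 2^(-k N) from the volume and 2^(k (N + s p)) from the
  kernel, together 2^(k s p). This is q^k times the factor 2^(k p) built into
  \<open>ring_energy\<close>, for q = 2^(-p (1 - s)). What is left of the kernel on the ring lies
  between \<open>kappa\<close> and 1.\<close>

lemma gag_inner_bounds:
  fixes u :: "'a::euclidean_space \<Rightarrow> real"
  assumes [measurable]: "u \<in> borel_measurable borel" and p: "1 \<le> p" "p \<le> real DIM('a)"
    and s: "0 < s" "s < 1" and R: "R \<ge> 1"
  defines "I \<equiv> (\<integral>\<^sup>+h. shift_pow p u h * ennreal (norm h powr - (real DIM('a) + s * p)) * indicator {h. h \<noteq> 0 \<and> norm h < 2 * R} h \<partial>lborel)"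
    and "S \<equiv> (\<Sum>k. ennreal ((2 powr (- p * (1 - s))) ^ k) * ring_energy R p u k)"
  shows "I \<le> S" "ennreal (kappa TYPE('a) R) * S \<le> I"
proof -
  define e where "e = real DIM('a) + s * p"
  have e: "0 \<le> e" "e \<le> 2 * real DIM('a)"
    using p s mult_mono[of s 1 p "real DIM('a)"] by (auto simp: e_def)
  have I: "I = (\<Sum>k. ennreal ((1 / 2 ^ k) ^ DIM('a)) * (\<integral>\<^sup>+h. shift_pow p u ((1 / 2 ^ k) *\<^sub>R h) * ennreal (norm ((1 / 2 ^ k) *\<^sub>R h) powr - e) * indicator (ring R) h \<partial>lborel))"
    unfolding I_def e_def[symmetric]
    by (rule nn_integral_dyadic_inner[where f = "\<lambda>h. shift_pow p u h * ennreal (norm h powr - e)"]) (use R in auto)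
  define J where "J k = (\<integral>\<^sup>+h. shift_pow p u ((1 / 2 ^ k) *\<^sub>R h) * ennreal (norm h powr - e) * indicator (ring R) h \<partial>lborel)" for k :: nat
  define K where "K k = (\<integral>\<^sup>+h. shift_pow p u ((1 / 2 ^ k) *\<^sub>R h) * indicator (ring R) h \<partial>lborel)" for k :: nat
  have two: "(2 powr (- p * (1 - s))) ^ k * 2 powr (k * p) = 2 powr (real k * s * p)" for k :: nat
    by (simp add: powr_realpow[symmetric] powr_powr algebra_simps flip: powr_add)
  have two': "ennreal ((2 powr (- p * (1 - s))) ^ k) * ennreal (2 powr (k * p)) = ennreal (2 powr (real k * s * p))" for k :: nat
    unfolding two[symmetric] by (rule ennreal_mult'[symmetric]) simp
  have pk: "(1 / 2 ^ k :: real) = 2 powr (- real k)" for k :: nat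
    by (simp add: powr_minus powr_realpow divide_inverse)
  have trm: "ennreal ((1 / 2 ^ k) ^ DIM('a)) * (\<integral>\<^sup>+h. shift_pow p u ((1 / 2 ^ k) *\<^sub>R h) * ennreal (norm ((1 / 2 ^ k) *\<^sub>R h) powr - e) * indicator (ring R) h \<partial>lborel)
     = ennreal (2 powr (real k * s * p)) * J k" for k :: nat
  proof -
    have sc: "norm ((1 / 2 ^ k) *\<^sub>R h) powr - e = 2 powr (real k * e) * norm h powr - e" for h :: 'a
      by (simp add: powr_mult powr_divide powr_minus powr_powr powr_realpow[symmetric] field_simps)
    have "(\<integral>\<^sup>+h. shift_pow p u ((1 / 2 ^ k) *\<^sub>R h) * ennreal (norm ((1 / 2 ^ k) *\<^sub>R h) powr - e) * indicator (ring R) h \<partial>lborel)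
      = (\<integral>\<^sup>+h. ennreal (2 powr (real k * e)) * (shift_pow p u ((1 / 2 ^ k) *\<^sub>R h) * ennreal (norm h powr - e) * indicator (ring R) h) \<partial>lborel)"
      unfolding sc by (simp add: ennreal_mult' mult_ac)
    also have "\<dots> = ennreal (2 powr (real k * e)) * J k"
      unfolding J_def by (rule nn_integral_cmult) measurable
    finally have "ennreal ((1 / 2 ^ k) ^ DIM('a)) * (\<integral>\<^sup>+h. shift_pow p u ((1 / 2 ^ k) *\<^sub>R h) * ennreal (norm ((1 / 2 ^ k) *\<^sub>R h) powr - e) * indicator (ring R) h \<partial>lborel)
       = ennreal ((1 / 2 ^ k) ^ DIM('a) * 2 powr (real k * e)) * J k"
      by (simp add: ennreal_mult' mult.assoc)
    also have "(1 / 2 ^ k) ^ DIM('a) * 2 powr (real k * e) = 2 powr (real k * s * p)"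
      unfolding pk powr_realpow[symmetric, OF powr_gt_zero[THEN iffD2, OF zero_neq_numeral[symmetric]]]
      by (simp add: powr_powr e_def algebra_simps flip: powr_add)
    finally show ?thesis .
  qed
  have S: "S = (\<Sum>k. ennreal (2 powr (real k * s * p)) * K k)"
    unfolding S_def ring_energy_def K_def mult.assoc[symmetric] two'[symmetric] ..
  have I': "I = (\<Sum>k. ennreal (2 powr (real k * s * p)) * J k)" unfolding I trm ..
  have "J k \<le> K k" for k
    unfolding J_def K_def
  proof (rule nn_integral_mono)
    fix h :: 'a
    show "shift_pow p u ((1 / 2 ^ k) *\<^sub>R h) * ennreal (norm h powr - e) * indicator (ring R) h \<le> shift_pow p u ((1 / 2 ^ k) *\<^sub>R h) * indicator (ring R) h"
      using ring_powr_bounds(1)[OF R _ e, of h] mult_left_mono[of "ennreal (norm h powr - e)" 1 "shift_pow p u ((1 / 2 ^ k) *\<^sub>R h)"]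
      by (auto simp: indicator_def)
  qed
  then show "I \<le> S" unfolding S I' by (intro suminf_le mult_left_mono) auto
  have "ennreal (kappa TYPE('a) R) * K k \<le> J k" for k
  proof -
    have "ennreal (kappa TYPE('a) R) * K k = (\<integral>\<^sup>+h. ennreal (kappa TYPE('a) R) * (shift_pow p u ((1 / 2 ^ k) *\<^sub>R h) * indicator (ring R) h) \<partial>lborel)"
      unfolding K_def by (rule nn_integral_cmult[symmetric]) measurable
    also have "\<dots> \<le> J k"
      unfolding J_def
    proof (rule nn_integral_mono)
      fix h :: 'a
      show "ennreal (kappa TYPE('a) R) * (shift_pow p u ((1 / 2 ^ k) *\<^sub>R h) * indicator (ring R) h) \<le> shift_pow p u ((1 / 2 ^ k) *\<^sub>R h) * ennreal (norm h powr - e) * indicator (ring R) h"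
        using ring_powr_bounds(2)[OF R _ e, of h] mult_left_mono[of "ennreal (kappa TYPE('a) R)" "ennreal (norm h powr - e)" "shift_pow p u ((1 / 2 ^ k) *\<^sub>R h)"]
        by (auto simp: indicator_def kappa_def mult.commute)
    qed
    finally show ?thesis .
  qed
  then have "ennreal (kappa TYPE('a) R) * S \<le> (\<Sum>k. ennreal (2 powr (real k * s * p)) * J k)"
    unfolding S ennreal_suminf_cmult[symmetric] mult.left_commute[of "ennreal (kappa TYPE('a) R)"]
    by (intro suminf_le mult_left_mono) auto
  then show "ennreal (kappa TYPE('a) R) * S \<le> I" unfolding I' .
qed

text \<open>For |h| \<ge> R the shift integral is the constant \<open>2 * pow_int p u\<close>, so
  only the kernel is integrated; its shells form a geometric series of ratio 2^(-s p). The
  denominator 1 - 2^(-s p) is the singularity of the energy at s = 0.\<close>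

lemma gag_outer_bounds:
  fixes u :: "'a::euclidean_space \<Rightarrow> real"
  assumes [measurable]: "u \<in> borel_measurable borel" and p: "1 \<le> p" "p \<le> real DIM('a)"
    and s: "0 < s" "s < 1" and R: "R \<ge> 1"
    and supp: "\<And>x. R / 2 \<le> norm x \<Longrightarrow> u x = 0"
  defines "I \<equiv> (\<integral>\<^sup>+h. shift_pow p u h * ennreal (norm h powr - (real DIM('a) + s * p)) * indicator {h. R \<le> norm h} h \<partial>lborel)"
    and "W \<equiv> ennreal (2 * ring_measure TYPE('a) R / (1 - 2 powr (- s * p)))"
  shows "I \<le> W * pow_int p u" "ennreal (kappa TYPE('a) R) * (W * pow_int p u) \<le> I"
proof -
  define e where "e = real DIM('a) + s * p"
  have e: "0 \<le> e" "e \<le> 2 * real DIM('a)"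
    using p s mult_mono[of s 1 p "real DIM('a)"] by (auto simp: e_def)
  have far: "shift_pow p u h = 2 * pow_int p u" if "R \<le> norm h" for h
    by (rule shift_pow_far[where R=R, OF assms(1) supp that])
  note rm = ring_measure[of R, where 'a='a]
  define w where "w = (\<integral>\<^sup>+h. ennreal (norm h powr - e) * indicator (ring R) (h::'a) \<partial>lborel)"
  have w1: "w \<le> ennreal (ring_measure TYPE('a) R)"
  proof -
    have "w \<le> (\<integral>\<^sup>+h. indicator (ring R) (h::'a) \<partial>lborel)"
      unfolding w_def
    proof (rule nn_integral_mono)
      fix h :: 'a
      show "ennreal (norm h powr - e) * indicator (ring R) h \<le> indicator (ring R) h"
        using ring_powr_bounds(1)[OF R _ e, of h] by (auto simp: indicator_def)
    qed
    then show ?thesis using rm R by simp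
  qed
  have w2: "ennreal (kappa TYPE('a) R) * ennreal (ring_measure TYPE('a) R) \<le> w"
  proof -
    have "ennreal (kappa TYPE('a) R) * ennreal (ring_measure TYPE('a) R) = (\<integral>\<^sup>+h. ennreal (kappa TYPE('a) R) * indicator (ring R) (h::'a) \<partial>lborel)"
      using rm R by (simp add: nn_integral_cmult)
    also have "\<dots> \<le> w"
      unfolding w_def
    proof (rule nn_integral_mono)
      fix h :: 'a
      show "ennreal (kappa TYPE('a) R) * indicator (ring R) h \<le> ennreal (norm h powr - e) * indicator (ring R) h"
        using ring_powr_bounds(2)[OF R _ e, of h] by (auto simp: indicator_def kappa_def)
    qed
    finally show ?thesis .
  qed
  define r where "r = 2 powr (- s * p)"
  have r: "0 < r" "r < 1" using s p by (auto simp: r_def powr_less_one)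
  have "I = (\<integral>\<^sup>+h. (2 * pow_int p u) * (ennreal (norm (h::'a) powr - e) * indicator {h. R \<le> norm h} h) \<partial>lborel)"
    unfolding I_def e_def[symmetric]
    by (intro nn_integral_cong) (auto simp: indicator_def far)
  also have "\<dots> = (2 * pow_int p u) * (\<integral>\<^sup>+h. ennreal (norm (h::'a) powr - e) * indicator {h. R \<le> norm h} h \<partial>lborel)"
    by (rule nn_integral_cmult) measurable
  also have "(\<integral>\<^sup>+h. ennreal (norm (h::'a) powr - e) * indicator {h. R \<le> norm h} h \<partial>lborel) =
     (\<Sum>k. ennreal ((2 ^ k) ^ DIM('a)) * (\<integral>\<^sup>+h. ennreal (norm ((2 ^ k) *\<^sub>R (h::'a)) powr - e) * indicator (ring R) h \<partial>lborel))"
    by (rule nn_integral_dyadic_outer) (use R in auto)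
  also have "\<dots> = (\<Sum>k. ennreal (r ^ k) * w)"
  proof (rule suminf_cong)
    fix k :: nat
    have pk: "(2 ^ k :: real) = 2 powr (real k)" by (simp add: powr_realpow)
    have "(\<integral>\<^sup>+h. ennreal (norm ((2 ^ k) *\<^sub>R (h::'a)) powr - e) * indicator (ring R) h \<partial>lborel)
      = (\<integral>\<^sup>+h. ennreal (2 powr (- real k * e)) * (ennreal (norm (h::'a) powr - e) * indicator (ring R) h) \<partial>lborel)"
      by (simp add: pk powr_mult powr_powr ennreal_mult' mult_ac)
    also have "\<dots> = ennreal (2 powr (- real k * e)) * w"
      unfolding w_def by (rule nn_integral_cmult) measurable
    finally have "ennreal ((2 ^ k) ^ DIM('a)) * (\<integral>\<^sup>+h. ennreal (norm ((2 ^ k) *\<^sub>R (h::'a)) powr - e) * indicator (ring R) h \<partial>lborel)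
       = ennreal ((2 ^ k) ^ DIM('a) * 2 powr (- real k * e)) * w" by (simp add: ennreal_mult' mult.assoc)
    also have "(2 ^ k) ^ DIM('a) * 2 powr (- real k * e) = r ^ k"
      unfolding pk r_def powr_realpow[symmetric, OF powr_gt_zero[THEN iffD2, OF zero_neq_numeral[symmetric]]]
      by (simp add: powr_powr e_def algebra_simps flip: powr_add)
    finally show "ennreal ((2 ^ k) ^ DIM('a)) * (\<integral>\<^sup>+h. ennreal (norm ((2 ^ k) *\<^sub>R (h::'a)) powr - e) * indicator (ring R) h \<partial>lborel) = ennreal (r ^ k) * w" .
  qed
  also have "\<dots> = ennreal (1 / (1 - r)) * w"
    using ennreal_geometric_suminf[of r] r by (simp only: ennreal_suminf_multc)
  finally have I: "I = 2 * pow_int p u * (ennreal (1 / (1 - r)) * w)" .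
  have W: "W = 2 * ennreal (1 / (1 - r)) * ennreal (ring_measure TYPE('a) R)"
  proof -
    have "W = ennreal (2 * (1 / (1 - r)) * ring_measure TYPE('a) R)"
      unfolding W_def r_def[symmetric] by simp
    also have "\<dots> = ennreal (2 * (1 / (1 - r))) * ennreal (ring_measure TYPE('a) R)"
      using r rm R by (intro ennreal_mult) auto
    also have "ennreal (2 * (1 / (1 - r))) = 2 * ennreal (1 / (1 - r))" by (rule ennreal_numeral_mult)
    finally show ?thesis .
  qed
  have "I \<le> 2 * pow_int p u * (ennreal (1 / (1 - r)) * ennreal (ring_measure TYPE('a) R))"
    unfolding I using w1 by (intro mult_left_mono) auto
  then show "I \<le> W * pow_int p u" unfolding W by (simp add: mult_ac)
  have "2 * pow_int p u * (ennreal (1 / (1 - r)) * (ennreal (kappa TYPE('a) R) * ennreal (ring_measure TYPE('a) R))) \<le> I"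
    unfolding I using w2 by (intro mult_left_mono) auto
  then show "ennreal (kappa TYPE('a) R) * (W * pow_int p u) \<le> I" unfolding W by (simp add: mult_ac)
qed

section \<open>Comparison of different orders\<close>

definition gag_const :: "'a::euclidean_space itself \<Rightarrow> real \<Rightarrow> real" where
  "gag_const _ R = 6 * real DIM('a) / kappa TYPE('a) R"

lemma kappa_pos: "R > 0 \<Longrightarrow> kappa TYPE('a::euclidean_space) R > 0"
  by (simp add: kappa_def)

text \<open>Used with \<open>s\<close> for the far part and with 1 - s for the near part, these
  bounds turn the geometric denominators into the two factors of s (1 - s).\<close>

lemma dyadic_ratio_bounds:
  fixes p s :: real
  assumes "1 \<le> p" "p \<le> n" "0 < s" "s < 1"
  shows "0 < 2 powr (- p * s)" "2 powr (- p * s) < 1" "s / 2 \<le> 1 - 2 powr (- p * s)" "1 - 2 powr (- p * s) \<le> n * s"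
proof -
  have "p * s > 0" using assms by auto
  then show "0 < 2 powr (- p * s)" "2 powr (- p * s) < 1" by (auto simp: powr_less_one)
  have "s \<le> p * s" using assms by simp
  then have "2 powr (- p * s) \<le> 2 powr (- s)" by (intro powr_mono) auto
  then show "s / 2 \<le> 1 - 2 powr (- p * s)" using powr_two_bounds[of s] assms by linarith
  have "1 - 2 powr (- (p * s)) \<le> p * s" using \<open>p * s > 0\<close> by (intro powr_two_upper) auto
  also have "\<dots> \<le> n * s" using assms by (intro mult_right_mono) auto
  finally show "1 - 2 powr (- p * s) \<le> n * s" by simp
qed

text \<open>The undilated ring consists of shifts that separate the supports. Hence the first term
  of the near series already knows the L^p norm.\<close>

lemma ring_energy_0:
  fixes u :: "'a::euclidean_space \<Rightarrow> real"
  assumes "u \<in> borel_measurable borel" and R: "R > 0"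
    and supp: "\<And>x. R / 2 \<le> norm x \<Longrightarrow> u x = 0"
  shows "ring_energy R p u 0 = ennreal (2 * ring_measure TYPE('a) R) * pow_int p u"
proof -
  have far: "shift_pow p u h = 2 * pow_int p u" if "R \<le> norm h" for h
    by (rule shift_pow_far[where R=R, OF assms(1) supp that])
  have "ring_energy R p u 0 = (\<integral>\<^sup>+h. 2 * pow_int p u * indicator (ring R) (h::'a) \<partial>lborel)"
    unfolding ring_energy_def
    by (auto intro!: nn_integral_cong simp: indicator_def ring_def far)
  also have "\<dots> = 2 * pow_int p u * ennreal (ring_measure TYPE('a) R)"
    using R by (simp add: nn_integral_cmult ring_measure)
  finally show ?thesis unfolding ennreal_numeral_mult by (simp only: mult_ac)
qed

text \<open>The part of the energy with \<open>\<bar>h\<bar> < 2R\<close> is \<open>\<Sum>\<^sub>k q\<^sup>k b\<^sub>k\<close> with \<open>b\<close> monotone and \<open>1 - q\<close> comparable to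
  \<open>1 - s\<close>, so the normalising factors are exactly those of the Abel summation above.\<close>

lemma gag_upper:
  fixes u :: "'a::euclidean_space \<Rightarrow> real"
  assumes u: "u \<in> borel_measurable borel" and p: "1 \<le> p" "p \<le> real DIM('a)"
    and s: "0 < s" "s < 1" and R: "R \<ge> 1"
    and supp: "\<And>x. R / 2 \<le> norm x \<Longrightarrow> u x = 0"
  defines "q \<equiv> 2 powr (- p * (1 - s))"
  shows "ennreal (s * (1 - s)) * gag s p u \<le>
     ennreal (2 * s) * (ennreal (1 - q) * (\<Sum>k. ennreal (q ^ k) * ring_energy R p u k)) +
     ennreal (4 * ring_measure TYPE('a) R) * pow_int p u"
proof -
  note [measurable] = u
  note rm = ring_measure[of R, where 'a='a]
  define S where "S = (\<Sum>k. ennreal (q ^ k) * ring_energy R p u k)"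
  let ?f = "\<lambda>h::'a. shift_pow p u h * ennreal (norm h powr - (real DIM('a) + s * p))"
  define I where "I = (\<integral>\<^sup>+h. ?f h * indicator {h. h \<noteq> 0 \<and> norm h < 2 * R} h \<partial>lborel)"
  define I' where "I' = (\<integral>\<^sup>+h. ?f h * indicator {h. R \<le> norm h} h \<partial>lborel)"
  \<comment> \<open>At the origin the kernel is \<open>0 powr _ = 0\<close>, so omitting h = 0 loses
    nothing. The two regions overlap on the ring, which is harmless for an upper bound.\<close>
  have "gag s p u \<le> (\<integral>\<^sup>+h. ?f h * indicator {h. h \<noteq> 0 \<and> norm h < 2 * R} h + ?f h * indicator {h. R \<le> norm h} h \<partial>lborel)"
    unfolding gag_def using R by (intro nn_integral_mono) (auto simp: indicator_def)
  also have "\<dots> = I + I'" unfolding I_def I'_def by (rule nn_integral_add) measurable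
  finally have g: "gag s p u \<le> I + I'" .
  have q1: "(1 - s) / 2 \<le> 1 - q" unfolding q_def using dyadic_ratio_bounds[of p "real DIM('a)" "1 - s"] p s by simp
  have r1: "s / 2 \<le> 1 - 2 powr (- s * p)" "2 powr (- s * p) < 1" using dyadic_ratio_bounds[of p "real DIM('a)" s] p s by (simp_all add: mult.commute)
  have I: "I \<le> S" unfolding I_def S_def q_def by (rule gag_inner_bounds(1)) (use p s R in auto)
  have I': "I' \<le> ennreal (2 * ring_measure TYPE('a) R / (1 - 2 powr (- s * p))) * pow_int p u"
    unfolding I'_def by (rule gag_outer_bounds(1)) (use p s R supp in auto)
  have "ennreal (s * (1 - s)) * I \<le> ennreal (s * (1 - s)) * S" using I by (rule mult_left_mono) simp
  also have "\<dots> \<le> ennreal (2 * s * (1 - q)) * S"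
    using q1 s mult_left_mono[OF q1, of "2 * s"] by (intro mult_right_mono ennreal_leI) auto
  also have "\<dots> = ennreal (2 * s) * (ennreal (1 - q) * S)" using s by (simp add: ennreal_mult' mult.assoc)
  finally have 1: "ennreal (s * (1 - s)) * I \<le> ennreal (2 * s) * (ennreal (1 - q) * S)" .
  have "ennreal (s * (1 - s)) * I' \<le> ennreal (s * (1 - s)) * (ennreal (2 * ring_measure TYPE('a) R / (1 - 2 powr (- s * p))) * pow_int p u)"
    using I' by (rule mult_left_mono) simp
  also have "\<dots> = ennreal (s * (1 - s) * (2 * ring_measure TYPE('a) R / (1 - 2 powr (- s * p)))) * pow_int p u"
    using s by (subst ennreal_mult') (auto simp: mult.assoc)
  also have "\<dots> \<le> ennreal (4 * ring_measure TYPE('a) R) * pow_int p u"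
  proof (intro mult_right_mono ennreal_leI)
    have "s * (1 - s) * (2 * ring_measure TYPE('a) R) \<le> s * 1 * (2 * ring_measure TYPE('a) R)"
      using s rm R by (intro mult_right_mono mult_left_mono) auto
    also have "\<dots> = (s / 2) * (4 * ring_measure TYPE('a) R)" by simp
    also have "\<dots> \<le> (1 - 2 powr (- s * p)) * (4 * ring_measure TYPE('a) R)"
      using r1 rm R by (intro mult_right_mono) auto
    finally show "s * (1 - s) * (2 * ring_measure TYPE('a) R / (1 - 2 powr (- s * p))) \<le> 4 * ring_measure TYPE('a) R"
      using r1 by (simp add: pos_divide_le_eq mult.commute)
  qed simp
  finally have 2: "ennreal (s * (1 - s)) * I' \<le> ennreal (4 * ring_measure TYPE('a) R) * pow_int p u" .
  have "ennreal (s * (1 - s)) * gag s p u \<le> ennreal (s * (1 - s)) * (I + I')" using g by (rule mult_left_mono) simp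
  also have "\<dots> \<le> ennreal (2 * s) * (ennreal (1 - q) * S) + ennreal (4 * ring_measure TYPE('a) R) * pow_int p u"
    unfolding distrib_left using 1 2 by (rule add_mono)
  finally show ?thesis unfolding S_def .
qed

lemma gag_inner_lower:
  fixes u :: "'a::euclidean_space \<Rightarrow> real"
  assumes u: "u \<in> borel_measurable borel" and p: "1 \<le> p" "p \<le> real DIM('a)"
    and s: "0 < s" "s < 1" and R: "R \<ge> 1"
  defines "q \<equiv> 2 powr (- p * (1 - s))"
  shows "ennreal (1 - q) * (\<Sum>k. ennreal (q ^ k) * ring_energy R p u k) \<le>
     ennreal (real DIM('a) / kappa TYPE('a) R * (1 - s)) * gag s p u"
proof -
  note [measurable] = u
  note k = kappa_pos[of R, where 'a='a]
  define S where "S = (\<Sum>k. ennreal (q ^ k) * ring_energy R p u k)"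
  define I where "I = (\<integral>\<^sup>+h. shift_pow p u h * ennreal (norm h powr - (real DIM('a) + s * p)) * indicator {h. h \<noteq> 0 \<and> norm h < 2 * R} h \<partial>lborel)"
  have "I \<le> gag s p u" unfolding I_def gag_def by (intro nn_integral_mono) (auto simp: indicator_def)
  moreover have "ennreal (kappa TYPE('a) R) * S \<le> I"
    unfolding I_def S_def q_def by (rule gag_inner_bounds(2)) (use p s R in auto)
  ultimately have le: "ennreal (kappa TYPE('a) R) * S \<le> gag s p u" by simp
  have q1: "1 - q \<le> real DIM('a) * (1 - s)" unfolding q_def using dyadic_ratio_bounds[of p "real DIM('a)" "1 - s"] p s by simp
  have "ennreal (1 - q) * S \<le> ennreal (real DIM('a) / kappa TYPE('a) R * (1 - s) * kappa TYPE('a) R) * S"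
    using q1 k R by (intro mult_right_mono ennreal_leI) auto
  also have "\<dots> = ennreal (real DIM('a) / kappa TYPE('a) R * (1 - s)) * (ennreal (kappa TYPE('a) R) * S)"
    using k R s by (subst ennreal_mult) (auto simp: mult.assoc)
  also have "\<dots> \<le> ennreal (real DIM('a) / kappa TYPE('a) R * (1 - s)) * gag s p u"
    using le by (rule mult_left_mono) simp
  finally show ?thesis unfolding S_def .
qed

text \<open>The weights (1 - q) q^k sum to 1, and no term of an increasing sequence lies below the
  first.\<close>

lemma ring_energy_0_le:
  assumes "mono b" "0 < q" "q < 1"
  shows "b 0 \<le> ennreal (1 - q) * (\<Sum>k. ennreal (q ^ k) * b k)"
proof -
  have "b 0 = ennreal (1 - q) * (ennreal (1 / (1 - q)) * b 0)"
    using assms by (simp flip: mult.assoc ennreal_mult')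
  also have "ennreal (1 / (1 - q)) * b 0 = (\<Sum>k. ennreal (q ^ k) * b 0)"
    using assms ennreal_geometric_suminf[of q] by (simp only: ennreal_suminf_multc)
  also have "ennreal (1 - q) * \<dots> \<le> ennreal (1 - q) * (\<Sum>k. ennreal (q ^ k) * b k)"
    using monoD[OF assms(1)] by (intro mult_left_mono suminf_le) auto
  finally show ?thesis .
qed

text \<open>A Poincare inequality that keeps the weight s (1 - s). For s \<ge> 1/2 the first near
  shell gives it with the factor 1 - s; for s < 1/2 the far shifts give it with the factor s. In
  each half the other factor is at least 1/2.\<close>

lemma pow_int_le_gag:
  fixes u :: "'a::euclidean_space \<Rightarrow> real"
  assumes u: "u \<in> borel_measurable borel" and p: "1 \<le> p" "p \<le> real DIM('a)"
    and s: "0 < s" "s < 1" and R: "R \<ge> 1"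
    and supp: "\<And>x. R / 2 \<le> norm x \<Longrightarrow> u x = 0"
  shows "ennreal (ring_measure TYPE('a) R) * pow_int p u \<le>
    ennreal (real DIM('a) / kappa TYPE('a) R) * (ennreal (s * (1 - s)) * gag s p u)"
proof -
  note [measurable] = u
  note k = kappa_pos[of R, where 'a='a]
  note rm = ring_measure[of R, where 'a='a]
  define c where "c = real DIM('a) / kappa TYPE('a) R"
  have c: "c > 0" using k R by (simp add: c_def)
  show ?thesis
  proof (cases "1 / 2 \<le> s")
    case True
    define q where "q = 2 powr (- p * (1 - s))"
    have q: "0 < q" "q < 1" unfolding q_def using dyadic_ratio_bounds[of p "real DIM('a)" "1 - s"] p s by simp_all
    have "ennreal (2 * ring_measure TYPE('a) R) * pow_int p u \<le> ennreal (1 - q) * (\<Sum>k. ennreal (q ^ k) * ring_energy R p u k)"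
      using ring_energy_0_le[OF mono_ring_energy[OF u p(1), where R=R] q] ring_energy_0[where R=R and p=p, OF u _ supp] R by simp
    also have "\<dots> \<le> ennreal (c * (1 - s)) * gag s p u"
      unfolding q_def c_def by (rule gag_inner_lower[OF u p s R])
    also have "\<dots> \<le> ennreal (c * (2 * (s * (1 - s)))) * gag s p u"
      using c s True mult_right_mono[of 1 "2 * s" "1 - s"] by (intro mult_right_mono ennreal_leI mult_left_mono) (auto simp: mult.assoc)
    also have "ennreal (c * (2 * (s * (1 - s)))) = 2 * (ennreal c * ennreal (s * (1 - s)))"
      using c s by (simp only: mult.left_commute[of c 2] ennreal_numeral_mult) (simp add: ennreal_mult)
    finally have "2 * (ennreal (ring_measure TYPE('a) R) * pow_int p u) \<le> 2 * (ennreal c * (ennreal (s * (1 - s)) * gag s p u))"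
      unfolding ennreal_numeral_mult by (simp only: mult.assoc)
    then show ?thesis unfolding c_def by (simp add: ennreal_mult_le_mult_iff)
  next
    case False
    define r where "r = 2 powr (- s * p)"
    have r: "r < 1" "1 - r \<le> real DIM('a) * s" unfolding r_def using dyadic_ratio_bounds[of p "real DIM('a)" s] p s by (simp_all add: mult.commute)
    define I where "I = (\<integral>\<^sup>+h. shift_pow p u h * ennreal (norm h powr - (real DIM('a) + s * p)) * indicator {h. R \<le> norm h} h \<partial>lborel)"
    have "I \<le> gag s p u" unfolding I_def gag_def by (intro nn_integral_mono) (auto simp: indicator_def)
    moreover have "ennreal (kappa TYPE('a) R) * (ennreal (2 * ring_measure TYPE('a) R / (1 - r)) * pow_int p u) \<le> I"
      unfolding I_def r_def by (rule gag_outer_bounds(2)) (use p s R supp in auto)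
    ultimately have le: "ennreal (kappa TYPE('a) R) * (ennreal (2 * ring_measure TYPE('a) R / (1 - r)) * pow_int p u) \<le> gag s p u" by simp
    have "ennreal (ring_measure TYPE('a) R) * pow_int p u \<le> ennreal ((c * (s * (1 - s))) * (kappa TYPE('a) R * (2 * ring_measure TYPE('a) R / (1 - r)))) * pow_int p u"
    proof (intro mult_right_mono ennreal_leI)
      have "(1 - r) * ring_measure TYPE('a) R \<le> real DIM('a) * s * ring_measure TYPE('a) R"
        using r rm R by (intro mult_right_mono) auto
      also have "\<dots> \<le> real DIM('a) * s * ring_measure TYPE('a) R * (2 * (1 - s))"
        using False s rm R mult_left_mono[of 1 "2 * (1 - s)" "real DIM('a) * s * ring_measure TYPE('a) R"] by simp
      also have "\<dots> = (c * (s * (1 - s))) * (kappa TYPE('a) R * (2 * ring_measure TYPE('a) R))"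
        unfolding c_def using k R by simp
      finally show "ring_measure TYPE('a) R \<le> (c * (s * (1 - s))) * (kappa TYPE('a) R * (2 * ring_measure TYPE('a) R / (1 - r)))"
        using r by (simp add: pos_le_divide_eq mult.commute)
    qed simp
    also have "\<dots> = ennreal c * (ennreal (s * (1 - s)) * (ennreal (kappa TYPE('a) R) * (ennreal (2 * ring_measure TYPE('a) R / (1 - r)) * pow_int p u)))"
    proof -
      have split: "ennreal ((a * b) * (d * e)) * L = ennreal a * (ennreal b * (ennreal d * (ennreal e * L)))"
        if "a \<ge> 0" "b \<ge> 0" "d \<ge> 0" for a b d e L
        using that by (simp add: ennreal_mult' mult.assoc)
      show ?thesis by (rule split) (use c s k R in auto)
    qed
    also have "\<dots> \<le> ennreal c * (ennreal (s * (1 - s)) * gag s p u)"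
      using le by (intro mult_left_mono) auto
    finally show ?thesis unfolding c_def .
  qed
qed

text \<open>In the near part the ratio q = 2^(-p (1 - s)) increases with \<open>s\<close>, so Abel
  summation compares two averages of the same sequence \<open>ring_energy\<close>. The far part is a
  multiple of the L^p norm, which the energy of order \<open>S\<close> controls by
  \<open>pow_int_le_gag\<close>.\<close>

theorem gag_mono:
  fixes u :: "'a::euclidean_space \<Rightarrow> real"
  assumes u: "u \<in> borel_measurable borel" and p: "1 \<le> p" "p \<le> real DIM('a)"
    and s: "0 < s" "s \<le> S" "S < 1" and R: "R \<ge> 1"
    and supp: "\<And>x. R / 2 \<le> norm x \<Longrightarrow> u x = 0"
  shows "ennreal (s * (1 - s)) * gag s p u \<le> ennreal (gag_const TYPE('a) R) * (ennreal (S * (1 - S)) * gag S p u)"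
proof -
  note k = kappa_pos[of R, where 'a='a]
  note rm = ring_measure[of R, where 'a='a]
  define c where "c = real DIM('a) / kappa TYPE('a) R"
  have c: "c > 0" using k R by (simp add: c_def)
  define A where "A q = ennreal (1 - q) * (\<Sum>k. ennreal (q ^ k) * ring_energy R p u k)" for q
  define X where "X = ennreal (S * (1 - S)) * gag S p u"
  have "2 powr (- p * (1 - s)) \<le> 2 powr (- p * (1 - S))" using s p by (intro powr_mono) auto
  then have "A (2 powr (- p * (1 - s))) \<le> A (2 powr (- p * (1 - S)))"
    unfolding A_def using dyadic_ratio_bounds[of p "real DIM('a)" "1 - S"] p s
    by (intro Abel_monotone_suminf mono_ring_energy u) auto
  also have "\<dots> \<le> ennreal (c * (1 - S)) * gag S p u"
    unfolding A_def c_def by (rule gag_inner_lower) (use u p s R in auto)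
  finally have "ennreal (2 * s) * A (2 powr (- p * (1 - s))) \<le> ennreal (2 * S) * (ennreal (c * (1 - S)) * gag S p u)"
    using s by (intro mult_mono ennreal_leI) auto
  also have "\<dots> = ennreal (2 * c) * X" unfolding X_def using s c by (simp add: ennreal_mult' mult_ac)
  finally have 1: "ennreal (2 * s) * A (2 powr (- p * (1 - s))) \<le> ennreal (2 * c) * X" .
  have "ennreal (ring_measure TYPE('a) R) * pow_int p u \<le> ennreal c * X"
    unfolding X_def c_def by (rule pow_int_le_gag) (use u p s R supp in auto)
  then have "4 * (ennreal (ring_measure TYPE('a) R) * pow_int p u) \<le> 4 * (ennreal c * X)" by (rule mult_left_mono) simp
  then have 2: "ennreal (4 * ring_measure TYPE('a) R) * pow_int p u \<le> ennreal (4 * c) * X"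
    using c rm R by (simp add: ennreal_mult' mult.assoc)
  have "ennreal (s * (1 - s)) * gag s p u \<le> ennreal (2 * s) * A (2 powr (- p * (1 - s))) + ennreal (4 * ring_measure TYPE('a) R) * pow_int p u"
    unfolding A_def by (rule gag_upper) (use u p s R supp in auto)
  also have "\<dots> \<le> ennreal (2 * c) * X + ennreal (4 * c) * X" using 1 2 by (rule add_mono)
  \<comment> \<open>The factor 6 of \<open>gag_const\<close>: 2 from the near part and 4 from the
    far part.\<close>
  also have "\<dots> = ennreal (6 * c) * X" using c by (simp flip: distrib_right ennreal_plus)
  also have "6 * c = gag_const TYPE('a) R" by (simp add: c_def gag_const_def)
  finally show ?thesis unfolding X_def .
qed

text \<open>Order 1 takes the place of \<open>S\<close>: with \<open>G\<close> the integral of |grad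
  u|^p the last hypothesis becomes \<open>shift_pow_le_grad\<close>. All normalised shell energies
  then lie below one constant, and so does their geometric average. The L^p bound comes from a
  single shift of length \<open>R\<close>, which separates the supports.\<close>

lemma gag_le_lipschitz_shift:
  fixes u :: "'a::euclidean_space \<Rightarrow> real"
  assumes u: "u \<in> borel_measurable borel" and p: "1 \<le> p" "p \<le> real DIM('a)"
    and s: "0 < s" "s < 1" and R: "R \<ge> 1"
    and supp: "\<And>x. R / 2 \<le> norm x \<Longrightarrow> u x = 0"
    and G: "\<And>h. shift_pow p u h \<le> ennreal (norm h powr p) * G"
  shows "pow_int p u \<le> ennreal ((2 * R) powr real DIM('a)) * G"
    "ennreal (s * (1 - s)) * gag s p u \<le> ennreal (6 * ring_measure TYPE('a) R * (2 * R) powr real DIM('a)) * G"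
proof -
  note rm = ring_measure[of R, where 'a='a]
  define D where "D = (2 * R) powr real DIM('a)"
  have D: "norm h powr p \<le> D" if "norm h \<le> 2 * R" for h :: 'a
  proof -
    have "norm h powr p \<le> (2 * R) powr p" using that p by (intro powr_mono2) auto
    also have "\<dots> \<le> D" unfolding D_def using R p by (intro powr_mono) auto
    finally show ?thesis .
  qed
  obtain e :: 'a where e: "e \<in> Basis" using nonempty_Basis by blast
  have "pow_int p u \<le> 2 * pow_int p u" using mult_right_mono[of 1 2 "pow_int p u"] by simp
  also have "\<dots> = shift_pow p u (R *\<^sub>R e)" using e R by (intro shift_pow_far[where R=R, symmetric, OF u supp]) auto
  also have "\<dots> \<le> ennreal (norm (R *\<^sub>R e) powr p) * G" by (rule G)
  also have "\<dots> \<le> ennreal D * G" using e R by (intro mult_right_mono ennreal_leI D) auto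
  finally show L: "pow_int p u \<le> ennreal ((2 * R) powr real DIM('a)) * G" by (simp add: D_def)
  define q where "q = 2 powr (- p * (1 - s))"
  have q: "0 < q" "q < 1" unfolding q_def using dyadic_ratio_bounds[of p "real DIM('a)" "1 - s"] p s by simp_all
  have re: "ring_energy R p u k \<le> ennreal (ring_measure TYPE('a) R * D) * G" for k
  proof -
    have "(\<integral>\<^sup>+h. shift_pow p u ((1 / 2 ^ k) *\<^sub>R h) * indicator (ring R) h \<partial>lborel) \<le>
      (\<integral>\<^sup>+h. (ennreal (2 powr (- real k * p) * D) * G) * indicator (ring R) (h::'a) \<partial>lborel)"
    proof (rule nn_integral_mono)
      fix h :: 'a
      have "shift_pow p u ((1 / 2 ^ k) *\<^sub>R h) \<le> ennreal (2 powr (- real k * p) * D) * G" if "h \<in> ring R"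
      proof -
        have "norm ((1 / 2 ^ k) *\<^sub>R h) powr p = 2 powr (- real k * p) * norm h powr p"
          by (simp add: powr_divide powr_minus powr_powr powr_realpow[symmetric] divide_inverse powr_mult inverse_powr)
        also have "\<dots> \<le> 2 powr (- real k * p) * D" using that by (intro mult_left_mono D) (auto simp: ring_def)
        finally show ?thesis using order_trans[OF G mult_right_mono[OF ennreal_leI]] by auto
      qed
      then show "shift_pow p u ((1 / 2 ^ k) *\<^sub>R h) * indicator (ring R) h \<le> ennreal (2 powr (- real k * p) * D) * G * indicator (ring R) h"
        by (auto simp: indicator_def)
    qed
    also have "\<dots> = ennreal (2 powr (- real k * p) * D) * G * ennreal (ring_measure TYPE('a) R)"
      using rm R by (simp add: nn_integral_cmult)
    finally have "ring_energy R p u k \<le> ennreal (2 powr (k * p)) * (ennreal (2 powr (- real k * p) * D) * G * ennreal (ring_measure TYPE('a) R))"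
      unfolding ring_energy_def by (rule mult_left_mono) simp
    also have "\<dots> = ennreal (2 powr (k * p) * (2 powr (- real k * p) * D) * ring_measure TYPE('a) R) * G"
      using rm R by (simp add: ennreal_mult' ennreal_mult'' D_def mult_ac)
    also have "2 powr (k * p) * (2 powr (- real k * p) * D) * ring_measure TYPE('a) R = ring_measure TYPE('a) R * D"
      by (simp flip: mult.assoc powr_add)
    finally show ?thesis .
  qed
  define B where "B = ennreal (ring_measure TYPE('a) R * D) * G"
  have "ennreal (1 - q) * (\<Sum>k. ennreal (q ^ k) * ring_energy R p u k) \<le> ennreal (1 - q) * (\<Sum>k. ennreal (q ^ k) * B)"
    using re unfolding B_def by (intro mult_left_mono suminf_le) auto
  also have "\<dots> = ennreal (1 - q) * (ennreal (1 / (1 - q)) * B)"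
    using q ennreal_geometric_suminf[of q] by (simp only: ennreal_suminf_multc)
  also have "\<dots> = B" using q by (simp flip: mult.assoc ennreal_mult')
  finally have "ennreal (2 * s) * (ennreal (1 - q) * (\<Sum>k. ennreal (q ^ k) * ring_energy R p u k)) \<le> ennreal 2 * B"
    using s by (intro mult_mono ennreal_leI) auto
  moreover have "ennreal (4 * ring_measure TYPE('a) R) * pow_int p u \<le> ennreal 4 * B"
  proof -
    have "ennreal (4 * ring_measure TYPE('a) R) * pow_int p u \<le> ennreal (4 * ring_measure TYPE('a) R) * (ennreal D * G)"
      using L unfolding D_def by (rule mult_left_mono) simp
    then show ?thesis unfolding B_def using rm R by (simp add: ennreal_mult' D_def mult.assoc)
  qed
  ultimately have "ennreal (s * (1 - s)) * gag s p u \<le> ennreal 2 * B + ennreal 4 * B"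
    using order_trans[OF gag_upper[OF u p s R supp] add_mono] unfolding q_def by blast
  also have "\<dots> = ennreal 6 * B" by (simp flip: distrib_right)
  also have "\<dots> = ennreal (6 * ring_measure TYPE('a) R * D) * G"
    unfolding B_def using rm R by (simp add: ennreal_mult' D_def mult.assoc)
  finally show "ennreal (s * (1 - s)) * gag s p u \<le> ennreal (6 * ring_measure TYPE('a) R * (2 * R) powr real DIM('a)) * G"
    by (simp add: D_def)
qed

section \<open>The normalising constant\<close>

lemma Gamma_real_bounds:
  fixes a b :: real
  assumes "0 < a" "a \<le> b"
  shows "\<exists>m>0. \<exists>M>0. \<forall>x\<in>{a..b}. m \<le> Gamma x \<and> Gamma x \<le> M"
proof -
  have c: "continuous_on {a..b} (Gamma :: real \<Rightarrow> real)"
    using assms by (intro continuous_on_Gamma) (auto elim!: nonpos_Ints_cases)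
  obtain x where x: "x \<in> {a..b}" "\<forall>y\<in>{a..b}. Gamma x \<le> Gamma y"
    using continuous_attains_inf[OF compact_Icc _ c] assms by auto
  obtain y where y: "y \<in> {a..b}" "\<forall>z\<in>{a..b}. Gamma z \<le> Gamma y"
    using continuous_attains_sup[OF compact_Icc _ c] assms by auto
  have "Gamma x > 0" "Gamma y > 0" using x(1) y(1) assms by (auto intro!: Gamma_real_pos)
  then show ?thesis using x y by (intro exI[of _ "Gamma x"] exI[of _ "Gamma y"] conjI) auto
qed

text \<open>The pole of Gamma at 0 supplies the factor 1 - s, through (1 - s) Gamma (1 - s) = Gamma
  (2 - s). The other Gamma values are taken on compact intervals of positive arguments, where Gamma
  is continuous and positive.\<close>

lemma c_const_bounds:
  fixes N :: real
  assumes N: "N \<ge> 2"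
  shows "\<exists>k>0. \<exists>K>0. \<forall>s\<in>{0<..<1}. \<forall>p\<in>{1..N}.
    k * (s * (1 - s)) \<le> c_const N s p \<and> c_const N s p \<le> K * (s * (1 - s))"
proof -
  \<comment> \<open>The argument (p s + p + N - 2) / 2 stays in this interval because 1 \<le> p
    \<le> N, N \<ge> 2 and 0 < s < 1.\<close>
  obtain m M where m: "m > 0" "M > 0" "\<And>x. x \<in> {1/2..3/2 * N} \<Longrightarrow> m \<le> Gamma x \<and> Gamma x \<le> M"
    using Gamma_real_bounds[of "1/2" "3/2 * N"] N by auto
  obtain l L :: real where l: "l > 0" "L > 0" "\<And>x. x \<in> {1..2} \<Longrightarrow> l \<le> Gamma x \<and> Gamma x \<le> L"
    using Gamma_real_bounds[of 1 "2"] by auto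
  define P where "P = pi powr (N / 2)"
  have P: "P > 0" by (simp add: P_def)
  have "m / (P * L) * (s * (1 - s)) \<le> c_const N s p \<and> c_const N s p \<le> 4 * M / (P * l) * (s * (1 - s))"
    if s: "s \<in> {0<..<1}" and p: "p \<in> {1..N}" for s p
  proof -
    have g: "Gamma (2 - s) = (1 - s) * Gamma (1 - s)"
    proof -
      have "1 - s \<notin> \<int>\<^sub>\<le>\<^sub>0" using s by (auto elim!: nonpos_Ints_cases)
      then show ?thesis using Gamma_plus1[of "1 - s"] by (simp add: algebra_simps)
    qed
    have G: "l \<le> Gamma (2 - s)" "Gamma (2 - s) \<le> L" using l(3)[of "2 - s"] s by auto
    have ps: "p * s \<le> p" using mult_left_mono[of s 1 p] p s by simp
    have "p * s \<le> N" "p * s \<ge> 0" using order_trans[OF ps] p s by auto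
    then have A: "m \<le> Gamma ((p * s + p + N - 2) / 2)" "Gamma ((p * s + p + N - 2) / 2) \<le> M"
      using m(3)[of "(p * s + p + N - 2) / 2"] p N by auto
    have t: "1 \<le> 2 powr (2 * s)" "2 powr (2 * s) \<le> (4::real)"
      using s powr_mono[of "2 * s" 2 "2::real"] by (auto simp: ge_one_powr_ge_zero)
    have gp: "Gamma (1 - s) > 0" using s by (intro Gamma_real_pos) auto
    have eq: "c_const N s p = (2 powr (2 * s) * Gamma ((p * s + p + N - 2) / 2)) / (P * Gamma (2 - s)) * (s * (1 - s))"
    proof -
      have gen: "\<sigma> * a * b / (Q * G) = (a * b) / (Q * (t * G)) * (\<sigma> * t)" if "t \<noteq> 0" for t a b \<sigma> Q G :: real
        using that by simp
      show ?thesis unfolding c_const_def g P_def[symmetric] by (rule gen) (use s in auto)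
    qed
    have "m / (P * L) \<le> (2 powr (2 * s) * Gamma ((p * s + p + N - 2) / 2)) / (P * Gamma (2 - s))"
      using mult_mono[OF t(1) A(1)] m l P G by (intro frac_le) auto
    moreover have "(2 powr (2 * s) * Gamma ((p * s + p + N - 2) / 2)) / (P * Gamma (2 - s)) \<le> 4 * M / (P * l)"
      using mult_mono[OF t(2) A(2)] m l P G A t by (intro frac_le mult_pos_pos) auto
    ultimately show ?thesis unfolding eq by (intro conjI mult_right_mono) (use s in auto)
  qed
  then show ?thesis using m l P
    by (intro exI[of _ "m / (P * L)"] conjI exI[of _ "4 * M / (P * l)"]) auto
qed

lemma c_const_pos:
  assumes "N \<ge> 2" "s \<in> {0<..<1}" "p \<in> {1..N}" shows "c_const N s p > 0"
proof -
  obtain k where k: "k > 0" "k * (s * (1 - s)) \<le> c_const N s p"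
    using c_const_bounds[OF assms(1)] assms by blast
  moreover have "k * (s * (1 - s)) > 0" using k assms by auto
  ultimately show ?thesis by linarith
qed

section \<open>Smooth functions\<close>

lemma frechet_derivative_eqI: "(f has_derivative f') (at x) \<Longrightarrow> frechet_derivative f (at x) = f'"
  using frechet_derivative_at[of f f' x] by simp

lemma C_k_SucD: "C_k (Suc k) S f \<Longrightarrow> C_k k S f"
proof (induction k arbitrary: f)
  case 0
  then show ?case
    by (auto intro!: continuous_at_imp_continuous_on differentiable_imp_continuous_within)
qed auto

lemma C_k_SucI:
  assumes "\<And>x. (f has_derivative f' x) (at x)" "\<And>b. b \<in> Basis \<Longrightarrow> C_k k UNIV (\<lambda>x. f' x b)"
  shows "C_k (Suc k) UNIV f"
  using assms by (auto simp: differentiable_def frechet_derivative_eqI[OF assms(1)])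

lemma C_k_Suc_derivative:
  assumes "C_k (Suc k) UNIV f"
  shows "(f has_derivative frechet_derivative f (at x)) (at x)"
    "b \<in> Basis \<Longrightarrow> C_k k UNIV (\<lambda>x. frechet_derivative f (at x) b)"
  using assms by (auto simp: frechet_derivative_works)

lemma C_k_const: "C_k k UNIV (\<lambda>x. c)"
proof (induction k arbitrary: c)
  case (Suc k) show ?case by (rule C_k_SucI[OF has_derivative_const Suc])
qed auto

lemma C_k_add: "C_k k UNIV f \<Longrightarrow> C_k k UNIV g \<Longrightarrow> C_k k UNIV (\<lambda>x. f x + g x)"
proof (induction k arbitrary: f g)
  case (Suc k)
  show ?case
    by (rule C_k_SucI[OF has_derivative_add[OF C_k_Suc_derivative(1)[OF Suc.prems(1)] C_k_Suc_derivative(1)[OF Suc.prems(2)]]])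
      (intro Suc.IH C_k_Suc_derivative(2) Suc.prems)
qed (auto intro: continuous_on_add)

lemma C_k_mult: "C_k k UNIV f \<Longrightarrow> C_k k UNIV g \<Longrightarrow> C_k k UNIV (\<lambda>x. f x * g x)"
proof (induction k arbitrary: f g)
  case (Suc k)
  show ?case
    by (rule C_k_SucI[OF has_derivative_mult[OF C_k_Suc_derivative(1)[OF Suc.prems(1)] C_k_Suc_derivative(1)[OF Suc.prems(2)]]])
      (intro C_k_add Suc.IH C_k_Suc_derivative(2) Suc.prems C_k_SucD)
qed (auto intro: continuous_on_mult)

lemma C_k_prod: "finite I \<Longrightarrow> (\<And>i. i \<in> I \<Longrightarrow> C_k k UNIV (f i)) \<Longrightarrow> C_k k UNIV (\<lambda>x. \<Prod>i\<in>I. f i x)"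
  by (induction I rule: finite_induct) (auto intro: C_k_mult C_k_const)

lemma smooth_on_lincomb:
  "smooth_on UNIV f \<Longrightarrow> smooth_on UNIV g \<Longrightarrow> smooth_on UNIV (\<lambda>x. a * f x + b * g x)"
  unfolding smooth_on_def by (intro allI C_k_add C_k_mult C_k_const) auto

lemma smooth_on_mult: "smooth_on UNIV f \<Longrightarrow> smooth_on UNIV g \<Longrightarrow> smooth_on UNIV (\<lambda>x. f x * g x)"
  unfolding smooth_on_def by (intro allI C_k_mult) auto

text \<open>The span of these functions is closed under differentiation, and \<open>flat 0\<close> is the standard
  smooth function that vanishes exactly on the negative half-line.\<close>

definition flat :: "nat \<Rightarrow> real \<Rightarrow> real" where
  "flat n y = (if y > 0 then exp (- 1 / y) / y ^ n else 0)"

lemma flat_has_derivative: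
  "(flat n has_real_derivative (- real n * flat (Suc n) y + flat (n + 2) y)) (at y)"
proof -
  consider "y > 0" | "y < 0" | "y = 0" by linarith
  then show ?thesis
  proof cases
    case 1
    have "((\<lambda>y. exp (- 1 / y) / y ^ n) has_real_derivative (- real n * flat (Suc n) y + flat (n + 2) y)) (at y)"
    proof (cases n)
      case 0 then show ?thesis using 1
        by (auto intro!: derivative_eq_intros simp: flat_def power2_eq_square)
    next
      case (Suc m)
      have *: "(E * (1 / y\<^sup>2) * (y * Y) - E * (c * Y)) / ((y * Y) * (y * Y)) = - c * (E / (y * (y * Y))) + E / (y * (y * (y * Y)))"
        if "Y > 0" for E Y c :: real
        using 1 that by (simp add: field_simps power2_eq_square)
      have "((\<lambda>y. exp (- 1 / y) / y ^ n) has_real_derivative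
         (exp (- 1 / y) * (1 / y\<^sup>2) * y ^ n - exp (- 1 / y) * (real n * y ^ (n - 1))) / (y ^ n * y ^ n)) (at y)"
        using 1 by (auto intro!: derivative_eq_intros simp: power2_eq_square)
      then show ?thesis using *[of "y ^ m" "exp (- 1 / y)" "real n"] 1 by (simp add: Suc flat_def)
    qed
    moreover have ev: "eventually (\<lambda>z. flat n z = exp (- 1 / z) / z ^ n) (nhds y)"
      using eventually_nhds_in_open[of "{0<..}" y] 1 by (auto elim!: eventually_mono simp: flat_def)
    ultimately show ?thesis using DERIV_cong_ev[OF refl ev refl] by simp
  next
    case 2
    have ev: "eventually (\<lambda>z. flat n z = 0) (nhds y)"
      using eventually_nhds_in_open[of "{..<0}" y] 2 by (auto elim!: eventually_mono simp: flat_def)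
    moreover have "((\<lambda>z::real. 0) has_real_derivative (- real n * flat (Suc n) y + flat (n + 2) y)) (at y)"
      using 2 by (simp add: flat_def)
    ultimately show ?thesis using DERIV_cong_ev[OF refl ev refl] by simp
  next
    case 3
    have "((\<lambda>h. flat n h / h) \<longlongrightarrow> 0) (at_right 0)"
    proof -
      \<comment> \<open>With x = 1 / h the quotient \<open>flat n h / h\<close> becomes x^(n+1) /
        exp x.\<close>
      have "((\<lambda>x::real. x ^ Suc n / exp x) \<longlongrightarrow> 0) at_top" by (rule tendsto_power_div_exp_0)
      then have "((\<lambda>x::real. (inverse x) ^ Suc n / exp (inverse x)) \<longlongrightarrow> 0) (at_right 0)"
        by (rule filterlim_compose[OF _ filterlim_inverse_at_top_right])
      moreover have "eventually (\<lambda>x::real. (inverse x) ^ Suc n / exp (inverse x) = flat n x / x) (at_right 0)"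
        using eventually_at_right_less[of "0::real"]
        by eventually_elim (simp add: flat_def exp_minus field_simps)
      ultimately show ?thesis by (rule Lim_transform_eventually)
    qed
    moreover have "((\<lambda>h. flat n h / h) \<longlongrightarrow> 0) (at_left 0)"
      by (rule Lim_transform_eventually[OF tendsto_const])
        (auto simp: eventually_at_filter flat_def)
    ultimately have "((\<lambda>h. flat n h / h) \<longlongrightarrow> 0) (at 0)" by (simp add: filterlim_at_split)
    then show ?thesis using 3 by (simp add: DERIV_def flat_def)
  qed
qed

lemma C_k_flat_inner:
  fixes v :: "'a::euclidean_space"
  shows "C_k k UNIV (\<lambda>x. flat n (x \<bullet> v + d))"
proof (induction k arbitrary: n)
  case 0
  have "isCont (flat n) y" for y using flat_has_derivative DERIV_isCont by blast
  then have "continuous_on UNIV (flat n)" by (simp add: continuous_at_imp_continuous_on)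
  then have "continuous_on UNIV (\<lambda>x. flat n (x \<bullet> v + d))"
    by (rule continuous_on_compose2) (auto intro!: continuous_intros)
  then show ?case by simp
next
  case (Suc k)
  have der: "((\<lambda>x. flat n (x \<bullet> v + d)) has_derivative
     (\<lambda>h. (h \<bullet> v) * (- real n * flat (Suc n) (x \<bullet> v + d) + flat (n + 2) (x \<bullet> v + d)))) (at x)" for x
    by (rule has_derivative_eq_rhs[OF DERIV_compose_FDERIV[OF flat_has_derivative]])
      (auto intro!: derivative_eq_intros)
  show ?case
    by (rule C_k_SucI[OF der]) (intro C_k_mult C_k_add C_k_const Suc.IH)
qed

text \<open>As \<open>m\<close> grows the functions tend to the indicator of the open box while
  staying between 0 and 1. They carry information from test functions to integrals over
  boxes.\<close>

definition box_bump :: "real \<Rightarrow> 'a::euclidean_space \<Rightarrow> 'a \<Rightarrow> 'a \<Rightarrow> real" where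
  "box_bump m a b x = (\<Prod>i\<in>Basis. flat 0 (m * (x \<bullet> i - a \<bullet> i)) * flat 0 (m * (b \<bullet> i - x \<bullet> i)))"

lemma flat_0_bounds: "0 \<le> flat 0 y" "flat 0 y \<le> 1"
  by (auto simp: flat_def)

lemma box_bump_bounds: "0 \<le> box_bump m a b x" "box_bump m a b x \<le> 1"
  unfolding box_bump_def
  by (auto intro!: prod_nonneg prod_le_1 mult_le_one simp: flat_0_bounds)

lemma box_bump_eq_0:
  assumes "x \<notin> box a b" "m > 0" shows "box_bump m a b x = 0"
proof -
  from assms obtain i where i: "i \<in> Basis" "\<not> (a \<bullet> i < x \<bullet> i \<and> x \<bullet> i < b \<bullet> i)" by (auto simp: box_def)
  then have "flat 0 (m * (x \<bullet> i - a \<bullet> i)) * flat 0 (m * (b \<bullet> i - x \<bullet> i)) = 0"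
    using assms(2) by (auto simp: flat_def zero_less_mult_iff)
  then show ?thesis unfolding box_bump_def using i by (auto intro!: prod_zero)
qed

lemma box_bump_test_function:
  assumes "m > 0" shows "box_bump m a b \<in> test_functions UNIV"
proof -
  have "C_k k UNIV (box_bump m a b)" for k
  proof -
    have "box_bump m a b = (\<lambda>x. \<Prod>i\<in>Basis. flat 0 (x \<bullet> (m *\<^sub>R i) + (- m * (a \<bullet> i))) * flat 0 (x \<bullet> ((- m) *\<^sub>R i) + m * (b \<bullet> i)))"
      by (auto simp: box_bump_def algebra_simps)
    moreover have "C_k k UNIV \<dots>" by (intro C_k_prod C_k_mult C_k_flat_inner finite_Basis)
    ultimately show ?thesis by simp
  qed
  moreover have "{x. box_bump m a b x \<noteq> 0} \<subseteq> cbox a b"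
    using box_bump_eq_0[OF _ assms] box_subset_cbox by blast
  then have "compact (closure {x. box_bump m a b x \<noteq> 0})"
    by (meson bounded_cbox bounded_subset compact_closure)
  ultimately show ?thesis by (auto simp: test_functions_def smooth_on_def)
qed

lemma box_bump_tendsto:
  "(\<lambda>k. box_bump (real (Suc k)) a b x) \<longlonglongrightarrow> indicator (box a b) x"
proof (cases "x \<in> box a b")
  case False then show ?thesis by (simp add: box_bump_eq_0)
next
  case True
  have fl: "(\<lambda>k. flat 0 (real (Suc k) * y)) \<longlonglongrightarrow> 1" if "y > 0" for y :: real
  proof -
    have "(\<lambda>k. exp (- (inverse (real (Suc k)) / y))) \<longlonglongrightarrow> exp (- (0 / y))"
      by (intro tendsto_intros LIMSEQ_inverse_real_of_nat) (use that in auto)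
    moreover have "exp (- (inverse (real (Suc k)) / y)) = flat 0 (real (Suc k) * y)" for k
      using that by (simp add: flat_def field_simps del: of_nat_Suc)
    ultimately show ?thesis by simp
  qed
  have "(\<lambda>k. box_bump (real (Suc k)) a b x) \<longlonglongrightarrow> (\<Prod>i\<in>(Basis::'a set). 1 * 1)"
    unfolding box_bump_def using True by (intro tendsto_prod tendsto_mult fl) (auto simp: box_def)
  then show ?thesis using True by simp
qed

section \<open>Test functions\<close>

lemma test_functions_lincomb:
  assumes "f \<in> test_functions \<Omega>" "g \<in> test_functions \<Omega>"
  shows "(\<lambda>x. a * f x + b * g x) \<in> test_functions \<Omega>"
proof -
  have "{x. a * f x + b * g x \<noteq> 0} \<subseteq> {x. f x \<noteq> 0} \<union> {x. g x \<noteq> 0}" by auto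
  then have sub: "closure {x. a * f x + b * g x \<noteq> 0} \<subseteq> closure {x. f x \<noteq> 0} \<union> closure {x. g x \<noteq> 0}"
    unfolding closure_Un[symmetric] by (rule closure_mono)
  have c: "compact (closure {x. f x \<noteq> 0} \<union> closure {x. g x \<noteq> 0})"
    using assms by (auto simp: test_functions_def)
  have "compact (closure {x. a * f x + b * g x \<noteq> 0})"
    using closed_Int_compact[OF closed_closure c, of "{x. a * f x + b * g x \<noteq> 0}"] sub by (simp add: Int_absorb2)
  then show ?thesis using assms sub by (auto simp: test_functions_def smooth_on_lincomb)
qed

lemma test_functions_mult:
  assumes "f \<in> test_functions \<Omega>" "g \<in> test_functions \<Omega>"
  shows "(\<lambda>x. f x * g x) \<in> test_functions \<Omega>"
proof -
  have sub: "closure {x. f x * g x \<noteq> 0} \<subseteq> closure {x. f x \<noteq> 0}"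
    by (intro closure_mono) auto
  have c: "compact (closure {x. f x \<noteq> 0})" using assms by (auto simp: test_functions_def)
  have "compact (closure {x. f x * g x \<noteq> 0})"
    using closed_Int_compact[OF closed_closure c, of "{x. f x * g x \<noteq> 0}"] sub by (simp add: Int_absorb2)
  then show ?thesis using assms sub by (auto simp: test_functions_def smooth_on_mult)
qed

lemma test_functions_0: "(\<lambda>_. 0) \<in> test_functions \<Omega>"
  by (auto simp: test_functions_def smooth_on_def C_k_const)

lemma test_functions_mono: "\<Omega> \<subseteq> \<Omega>' \<Longrightarrow> f \<in> test_functions \<Omega> \<Longrightarrow> f \<in> test_functions \<Omega>'"
  by (auto simp: test_functions_def)

lemma test_functions_outside: "f \<in> test_functions \<Omega> \<Longrightarrow> x \<notin> \<Omega> \<Longrightarrow> f x = 0"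
  using closure_subset[of "{x. f x \<noteq> 0}"] by (auto simp: test_functions_def)

definition grad :: "('a::euclidean_space \<Rightarrow> real) \<Rightarrow> 'a \<Rightarrow> 'a" where
  "grad f x = (\<Sum>b\<in>Basis. frechet_derivative f (at x) b *\<^sub>R b)"

lemma test_function_has_derivative:
  assumes "f \<in> test_functions \<Omega>"
  shows "(f has_derivative (\<lambda>h. grad f x \<bullet> h)) (at x)"
proof -
  have "C_k (Suc 0) UNIV f" using assms by (simp add: test_functions_def smooth_on_def del: C_k.simps)
  note d = C_k_Suc_derivative(1)[OF this, of x]
  have lin: "linear (frechet_derivative f (at x))" using d by (rule has_derivative_linear)
  have "frechet_derivative f (at x) h = grad f x \<bullet> h" for h
  proof -
    have "frechet_derivative f (at x) h = frechet_derivative f (at x) (\<Sum>b\<in>Basis. (h \<bullet> b) *\<^sub>R b)"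
      by (simp add: euclidean_representation)
    also have "\<dots> = grad f x \<bullet> h"
      by (simp add: linear_sum[OF lin] linear_cmul[OF lin] grad_def inner_sum_left inner_commute[of h] mult.commute)
    finally show ?thesis .
  qed
  then have "frechet_derivative f (at x) = (\<lambda>h. grad f x \<bullet> h)" by auto
  then show ?thesis using d by simp
qed

lemma frechet_derivative_test: "f \<in> test_functions \<Omega> \<Longrightarrow> frechet_derivative f (at x) h = grad f x \<bullet> h"
  by (simp add: frechet_derivative_eqI[OF test_function_has_derivative])

lemma grad_lincomb:
  assumes "f \<in> test_functions \<Omega>" "g \<in> test_functions \<Omega>"
  shows "grad (\<lambda>x. a * f x + b * g x) x = a *\<^sub>R grad f x + b *\<^sub>R grad g x"
proof -
  have "((\<lambda>x. a * f x + b * g x) has_derivative (\<lambda>h. a * (grad f x \<bullet> h) + b * (grad g x \<bullet> h))) (at x)"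
    by (intro derivative_intros test_function_has_derivative[OF assms(1)] test_function_has_derivative[OF assms(2)])
  from has_derivative_unique[OF this test_function_has_derivative[OF test_functions_lincomb[OF assms, of a b]]]
  have "grad (\<lambda>x. a * f x + b * g x) x \<bullet> h = (a *\<^sub>R grad f x + b *\<^sub>R grad g x) \<bullet> h" for h
    by (metis inner_add_left inner_scaleR_left)
  then show ?thesis using vector_eq_rdot by blast
qed

lemma grad_mult:
  assumes "f \<in> test_functions \<Omega>" "g \<in> test_functions \<Omega>"
  shows "grad (\<lambda>x. f x * g x) x \<bullet> h = f x * (grad g x \<bullet> h) + (grad f x \<bullet> h) * g x"
proof -
  have "((\<lambda>x. f x * g x) has_derivative (\<lambda>h. f x * (grad g x \<bullet> h) + (grad f x \<bullet> h) * g x)) (at x)"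
    by (intro has_derivative_mult test_function_has_derivative[OF assms(1)] test_function_has_derivative[OF assms(2)])
  from has_derivative_unique[OF this test_function_has_derivative[OF test_functions_mult[OF assms]]]
  show ?thesis by metis
qed

lemma test_function_continuous:
  assumes "f \<in> test_functions \<Omega>"
  shows "continuous_on UNIV f" "continuous_on UNIV (grad f)"
proof -
  show "continuous_on UNIV f"
    using assms C_k.simps(1) by (auto simp: test_functions_def smooth_on_def simp del: C_k.simps) 
  have "C_k (Suc 0) UNIV f" using assms by (simp add: test_functions_def smooth_on_def del: C_k.simps)
  from C_k_Suc_derivative(2)[OF this]
  show "continuous_on UNIV (grad f)"
    unfolding grad_def[abs_def] by (intro continuous_intros) simp
qed

lemma test_function_measurable:
  assumes "f \<in> test_functions \<Omega>"
  shows "f \<in> borel_measurable borel" 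
  using test_function_continuous[OF assms] borel_measurable_continuous_onI by blast

lemma grad_measurable:
  assumes "f \<in> test_functions \<Omega>"
  shows "grad f \<in> borel_measurable borel"
  using test_function_continuous[OF assms] borel_measurable_continuous_onI by blast

lemma grad_outside:
  assumes "f \<in> test_functions \<Omega>" "x \<notin> \<Omega>" shows "grad f x = 0"
proof -
  have "x \<in> - closure {x. f x \<noteq> 0}" using assms by (auto simp: test_functions_def)
  then have "eventually (\<lambda>y. y \<in> - closure {x. f x \<noteq> 0}) (nhds x)"
    by (intro eventually_nhds_in_open) auto
  then have "eventually (\<lambda>y. f y = 0) (nhds x)"
    by (rule eventually_mono) (use closure_subset[of "{x. f x \<noteq> 0}"] in auto)
  then have ev: "eventually (\<lambda>y. 0 = f y) (nhds x)" by (rule eventually_mono) simp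
  then have "eventually (\<lambda>y. 0 = f y) (at x)" unfolding eventually_at_filter by (rule eventually_mono) simp
  from has_derivative_transform_eventually[OF has_derivative_const this] eventually_nhds_x_imp_x[OF ev]
  have "(f has_derivative (\<lambda>h. 0)) (at x)" by simp
  from has_derivative_unique[OF this test_function_has_derivative[OF assms(1)]]
  show ?thesis by (metis inner_eq_zero_iff)
qed

lemma test_function_support_bounded:
  assumes "f \<in> test_functions \<Omega>"
  shows "\<exists>r>0. \<forall>x. norm x \<ge> r \<longrightarrow> f x = 0 \<and> grad f x = 0"
proof -
  let ?K = "closure {x. f x \<noteq> 0}"
  have f: "f \<in> test_functions ?K" using assms by (auto simp: test_functions_def)
  have "bounded ?K" using assms compact_imp_bounded by (auto simp: test_functions_def)
  then obtain r where r: "r > 0" "\<And>x. x \<in> ?K \<Longrightarrow> norm x < r" using bounded_pos_less by metis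
  show ?thesis
  proof (intro exI[of _ r] conjI allI impI)
    fix x :: 'a assume "r \<le> norm x"
    then have "x \<notin> ?K" using r(2)[of x] by linarith
    then show "f x = 0" "grad f x = 0" by (rule test_functions_outside[OF f], rule grad_outside[OF f])
  qed (rule r(1))
qed

lemma test_function_bounded:
  assumes "f \<in> test_functions \<Omega>"
  shows "\<exists>B>0. \<forall>x. \<bar>f x\<bar> \<le> B \<and> norm (grad f x) \<le> B"
proof -
  obtain r where r: "r > 0" "\<And>x. norm x \<ge> r \<Longrightarrow> f x = 0 \<and> grad f x = 0"
    using test_function_support_bounded[OF assms] by blast
  have "compact (f ` cball 0 r)" "compact (grad f ` cball 0 r)"
    by (intro compact_continuous_image compact_cball continuous_on_subset[OF test_function_continuous(1)[OF assms]]
        continuous_on_subset[OF test_function_continuous(2)[OF assms]] subset_UNIV)+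
  then have "bounded (f ` cball 0 r)" "bounded (grad f ` cball 0 r)" using compact_imp_bounded by auto
  then obtain A B where AB: "\<And>x. norm x \<le> r \<Longrightarrow> \<bar>f x\<bar> \<le> A" "\<And>x. norm x \<le> r \<Longrightarrow> norm (grad f x) \<le> B"
    by (fastforce simp: bounded_iff)
  have "\<bar>f x\<bar> \<le> 1 + \<bar>A\<bar> + \<bar>B\<bar> \<and> norm (grad f x) \<le> 1 + \<bar>A\<bar> + \<bar>B\<bar>" for x
    using AB[of x] r(2)[of x] by (cases "norm x \<le> r") auto
  then show ?thesis by (intro exI[of _ "1 + \<bar>A\<bar> + \<bar>B\<bar>"]) auto
qed

lemma test_function_lipschitz:
  assumes "f \<in> test_functions \<Omega>" and B: "\<And>x. norm (grad f x) \<le> B"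
  shows "\<bar>f (x + h) - f x\<bar> \<le> B * norm h"
proof -
  have "norm (f (x + h) - f x) \<le> B * norm (x + h - x)"
  proof (rule differentiable_bound[of UNIV f "\<lambda>x h. grad f x \<bullet> h"])
    show "onorm (\<lambda>h. grad f y \<bullet> h) \<le> B" for y
    proof (rule onorm_bound)
      show "0 \<le> B" using B[of 0] norm_ge_zero order_trans by blast
      show "norm (grad f y \<bullet> h) \<le> B * norm h" for h
        using Cauchy_Schwarz_ineq2[of "grad f y" h] mult_right_mono[OF B[of y], of "norm h"] by simp
    qed
  qed (auto intro: test_function_has_derivative[OF assms(1)])
  then show ?thesis by simp
qed

section \<open>Integrals and difference quotients of test functions\<close>

lemma integrable_bounded_support:
  fixes f :: "'a::euclidean_space \<Rightarrow> 'b::{banach,second_countable_topology}"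
  assumes "f \<in> borel_measurable lborel" "\<And>x. norm (f x) \<le> B" "\<And>x. norm x \<ge> r \<Longrightarrow> f x = 0"
  shows "integrable lborel f"
proof (rule Bochner_Integration.integrable_bound)
  show "integrable lborel (\<lambda>x. B * indicator (cball (0::'a) r) x)"
    using emeasure_bounded_finite[of "cball (0::'a) r"] by (auto intro!: integrable_mult_right integrable_real_indicator)
  show "AE x in lborel. norm (f x) \<le> norm (B * indicator (cball 0 r) x)"
    using assms(2,3) by (auto simp: indicator_def abs_real_def intro!: AE_I2) (smt (verit) norm_ge_zero)+
qed (use assms in auto)

text \<open>The increments are dyadic because \<open>shift_pow_le_grad\<close> reaches them by
  iterating the doubling inequality.\<close>

lemma difference_quotient_tendsto:
  assumes "f \<in> test_functions \<Omega>"
  shows "(\<lambda>k. (f (x + (1 / 2 ^ k) *\<^sub>R h) - f x) * 2 ^ k) \<longlonglongrightarrow> grad f x \<bullet> h"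
proof -
  have 1: "((\<lambda>t. f (x + t *\<^sub>R h)) has_real_derivative (grad f x \<bullet> h)) (at 0)"
  proof -
    have "((\<lambda>t. x + t *\<^sub>R h) has_derivative (\<lambda>t. t *\<^sub>R h)) (at 0)"
      by (auto intro!: derivative_eq_intros)
    from has_derivative_compose[OF this, of f "\<lambda>v. grad f x \<bullet> v"] test_function_has_derivative[OF assms, of x]
    have "((\<lambda>t. f (x + t *\<^sub>R h)) has_derivative (\<lambda>t. grad f x \<bullet> (t *\<^sub>R h))) (at 0)" by simp
    then show ?thesis by (simp add: has_field_derivative_def mult.commute[of _ "grad f x \<bullet> h"] fun_eq_iff)
  qed
  have "(\<lambda>k. (1 / 2) ^ k :: real) \<longlonglongrightarrow> 0" by (rule LIMSEQ_power_zero) simp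
  then have X: "(\<lambda>k. 1 / 2 ^ k :: real) \<longlonglongrightarrow> 0" by (simp add: power_one_over)
  have "((\<lambda>t. (f (x + t *\<^sub>R h) - f x) / t) \<longlongrightarrow> grad f x \<bullet> h) (at 0)"
    using 1 by (simp add: DERIV_def)
  then have "((\<lambda>t. (f (x + t *\<^sub>R h) - f x) / t) \<circ> (\<lambda>k. 1 / 2 ^ k)) \<longlonglongrightarrow> grad f x \<bullet> h"
    using X unfolding tendsto_at_iff_sequentially by auto
  then show ?thesis by (simp add: o_def)
qed

text \<open>The Lipschitz bound controls the quotients near the support, and far from it both values
  vanish. No increment is longer than \<open>h\<close>, so one ball serves for every
  \<open>k\<close>.\<close>

lemma difference_quotient_dominated:
  assumes f: "f \<in> test_functions \<Omega>"
  shows "\<exists>B\<ge>0. \<exists>r>0. \<forall>x k. \<bar>(f (x + (1 / 2 ^ k) *\<^sub>R h) - f x) * 2 ^ k\<bar> \<le> B * indicator (cball 0 r) x"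
proof -
  obtain r where r: "r > 0" "\<And>x. norm x \<ge> r \<Longrightarrow> f x = 0 \<and> grad f x = 0"
    using test_function_support_bounded[OF f] by blast
  obtain B where B: "B > 0" "\<And>x. \<bar>f x\<bar> \<le> B \<and> norm (grad f x) \<le> B"
    using test_function_bounded[OF f] by blast
  have "\<bar>(f (x + (1 / 2 ^ k) *\<^sub>R h) - f x) * 2 ^ k\<bar> \<le> (B * norm h) * indicator (cball 0 (r + norm h)) x" for x k
  proof (cases "norm x \<le> r + norm h")
    case True
    have "\<bar>f (x + (1 / 2 ^ k) *\<^sub>R h) - f x\<bar> * 2 ^ k \<le> B * norm ((1 / 2 ^ k) *\<^sub>R h) * 2 ^ k"
      using test_function_lipschitz[OF f, of B x "(1 / 2 ^ k) *\<^sub>R h"] B by (intro mult_right_mono) auto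
    then show ?thesis using True by (simp add: abs_mult)
  next
    case False
    have "norm ((1 / 2 ^ k) *\<^sub>R h) \<le> norm h"
      using divide_left_mono[of 1 "2 ^ k" "norm h"] by simp
    then have "norm (x + (1 / 2 ^ k) *\<^sub>R h) \<ge> r" using False norm_diff_ineq[of x "(1 / 2 ^ k) *\<^sub>R h"] by linarith
    moreover have "norm x \<ge> r" using False norm_ge_zero[of h] by linarith
    ultimately have "f (x + (1 / 2 ^ k) *\<^sub>R h) = 0" "f x = 0" using r(2) by blast+
    then show ?thesis using False by simp
  qed
  moreover have "B * norm h \<ge> 0" "r + norm h > 0" using B r by (auto intro: add_pos_nonneg)
  ultimately show ?thesis by blast
qed

lemma integral_lborel_translate:
  fixes f :: "'a::euclidean_space \<Rightarrow> real"
  assumes "f \<in> borel_measurable borel"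
  shows "(LINT x|lborel. f (x + c)) = (LINT x|lborel. f x)"
proof -
  have "(LINT x|lborel. f x) = (LINT x|distr lborel borel ((+) c). f x)" by (simp add: lborel_distr_plus)
  also have "\<dots> = (LINT x|lborel. f (c + x))" by (rule integral_distr) (use assms in auto)
  finally show ?thesis by (simp add: add.commute)
qed

text \<open>Every difference quotient has integral 0 by translation invariance, and dominated
  convergence hands this to the directional derivative.\<close>

lemma integral_grad_eq_0:
  assumes f: "f \<in> test_functions \<Omega>"
  shows "(LINT x|lborel. grad f x \<bullet> h) = 0"
proof -
  note [measurable] = test_function_measurable[OF f] grad_measurable[OF f]
  obtain B r where B: "B \<ge> 0" "r > 0" "\<And>x k. \<bar>(f (x + (1 / 2 ^ k) *\<^sub>R h) - f x) * 2 ^ k\<bar> \<le> B * indicator (cball 0 r) x"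
    using difference_quotient_dominated[OF f, of h] by blast
  obtain r' where r': "r' > 0" "\<And>x. norm x \<ge> r' \<Longrightarrow> f x = 0 \<and> grad f x = 0"
    using test_function_support_bounded[OF f] by blast
  obtain B' where B': "B' > 0" "\<And>x. \<bar>f x\<bar> \<le> B' \<and> norm (grad f x) \<le> B'"
    using test_function_bounded[OF f] by blast
  have "(\<lambda>k. LINT x|lborel. (f (x + (1 / 2 ^ k) *\<^sub>R h) - f x) * 2 ^ k) \<longlonglongrightarrow> (LINT x|lborel. grad f x \<bullet> h)"
  proof (rule integral_dominated_convergence[where w = "\<lambda>x. B * indicator (cball 0 r) x"])
    show "integrable lborel (\<lambda>x. B * indicator (cball 0 r) (x::'a))"
      using emeasure_bounded_finite[of "cball (0::'a) r"] by (auto intro!: integrable_mult_right integrable_real_indicator)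
  qed (use B difference_quotient_tendsto[OF f] in auto)
  moreover have "(LINT x|lborel. (f (x + (1 / 2 ^ k) *\<^sub>R h) - f x) * 2 ^ k) = 0" for k
  proof -
    have i: "integrable lborel f" using B' r' by (intro integrable_bounded_support[where B=B' and r=r']) auto
    have i': "integrable lborel (\<lambda>x. f (x + c))" for c
      using integrable_distr_eq[of "(+) c" lborel borel f] i lborel_distr_plus[of c] by (simp add: add.commute)
    have "(LINT x|lborel. f (x + (1 / 2 ^ k) *\<^sub>R h) - f x) = 0"
      using i i' integral_lborel_translate[of f] by simp
    then show ?thesis by simp
  qed
  ultimately show ?thesis by (simp add: LIMSEQ_const_iff)
qed

text \<open>Doubling, iterated k times, bounds the shift by \<open>h\<close> by the difference
  quotient at the scale 2^(-k). Its limit is the directional derivative along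
  \<open>h\<close>.\<close>

theorem shift_pow_le_grad:
  assumes f: "f \<in> test_functions \<Omega>" and p: "p \<ge> 1"
  shows "shift_pow p f h \<le> ennreal (norm h powr p) * (\<integral>\<^sup>+x. ennreal (norm (grad f x) powr p) \<partial>lborel)"
proof -
  note [measurable] = test_function_measurable[OF f] grad_measurable[OF f]
  let ?d = "\<lambda>k x. \<bar>(f (x + (1 / 2 ^ k) *\<^sub>R h) - f x) * 2 ^ k\<bar> powr p"
  have le: "shift_pow p f h \<le> (\<integral>\<^sup>+x. ennreal (?d k x) \<partial>lborel)" for k
  proof -
    have "shift_pow p f h \<le> ennreal ((2 powr p) ^ k) * shift_pow p f ((1 / 2 ^ k) *\<^sub>R h)"
    proof (induction k)
      case (Suc k)
      have "shift_pow p f ((1 / 2 ^ k) *\<^sub>R h) \<le> ennreal (2 powr p) * shift_pow p f ((1 / 2 ^ Suc k) *\<^sub>R h)"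
        using shift_pow_double[of f p "(1 / 2 ^ Suc k) *\<^sub>R h"] p by simp
      then have "ennreal ((2 powr p) ^ k) * shift_pow p f ((1 / 2 ^ k) *\<^sub>R h) \<le> ennreal ((2 powr p) ^ k) * (ennreal (2 powr p) * shift_pow p f ((1 / 2 ^ Suc k) *\<^sub>R h))"
        by (rule mult_left_mono) simp
      also have "\<dots> = ennreal ((2 powr p) ^ Suc k) * shift_pow p f ((1 / 2 ^ Suc k) *\<^sub>R h)"
        by (simp add: ennreal_mult' mult_ac)
      finally show ?case using Suc by (rule order_trans[rotated])
    qed simp
    also have "\<dots> = (\<integral>\<^sup>+x. ennreal ((2 powr p) ^ k) * ennreal (\<bar>f (x + (1 / 2 ^ k) *\<^sub>R h) - f x\<bar> powr p) \<partial>lborel)"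
      unfolding shift_pow_def by (rule nn_integral_cmult[symmetric]) measurable
    also have "\<dots> = (\<integral>\<^sup>+x. ennreal (?d k x) \<partial>lborel)"
    proof (rule nn_integral_cong)
      fix x
      have "(2 powr p) ^ k = (2 ^ k) powr p" by (simp add: powr_realpow[symmetric] powr_powr mult.commute)
      then show "ennreal ((2 powr p) ^ k) * ennreal (\<bar>f (x + (1 / 2 ^ k) *\<^sub>R h) - f x\<bar> powr p) = ennreal (?d k x)"
        by (simp add: abs_mult powr_mult ennreal_mult' mult.commute)
    qed
    finally show ?thesis .
  qed
  obtain B r where B: "B \<ge> 0" "r > 0" "\<And>x k. \<bar>(f (x + (1 / 2 ^ k) *\<^sub>R h) - f x) * 2 ^ k\<bar> \<le> B * indicator (cball 0 r) x"
    using difference_quotient_dominated[OF f, of h] by blast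
  have m1: "(\<lambda>x. ennreal (?d i x)) \<in> borel_measurable lborel" for i by measurable
  have m2: "(\<lambda>x. ennreal (\<bar>grad f x \<bullet> h\<bar> powr p)) \<in> borel_measurable lborel" by measurable
  have m3: "(\<lambda>x::'a. ennreal (B powr p) * indicator (cball 0 r) x) \<in> borel_measurable lborel"
    by (intro borel_measurable_times_ennreal borel_measurable_const borel_measurable_indicator) simp
  have lim: "(\<lambda>k. \<integral>\<^sup>+x. ennreal (?d k x) \<partial>lborel) \<longlonglongrightarrow> (\<integral>\<^sup>+x. ennreal (\<bar>grad f x \<bullet> h\<bar> powr p) \<partial>lborel)"
  proof (rule nn_integral_dominated_convergence[OF m1 m2 m3])
    show "(\<integral>\<^sup>+x. ennreal (B powr p) * indicator (cball (0::'a) r) x \<partial>lborel) < \<infinity>"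
      using emeasure_bounded_finite[of "cball (0::'a) r"] by (simp add: nn_integral_cmult_indicator ennreal_mult_less_top)
    show "AE x in lborel. ennreal (?d j x) \<le> ennreal (B powr p) * indicator (cball 0 r) x" for j
    proof (rule AE_I2)
      fix x
      show "ennreal (?d j x) \<le> ennreal (B powr p) * indicator (cball 0 r) x"
      proof (cases "x \<in> cball 0 r")
        case True
        then have "?d j x \<le> B powr p" using B(3)[of x j] p by (intro powr_mono2) auto
        then show ?thesis using True by (simp add: ennreal_leI)
      next
        case False then show ?thesis using B(3)[of x j] p by (simp del: mem_cball)
      qed
    qed
    show "AE x in lborel. (\<lambda>k. ennreal (?d k x)) \<longlonglongrightarrow> ennreal (\<bar>grad f x \<bullet> h\<bar> powr p)"
      using p by (intro AE_I2 tendsto_ennrealI tendsto_powr' tendsto_intros tendsto_rabs difference_quotient_tendsto[OF f]) auto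
  qed
  have "shift_pow p f h \<le> (\<integral>\<^sup>+x. ennreal (\<bar>grad f x \<bullet> h\<bar> powr p) \<partial>lborel)"
    by (rule LIMSEQ_le_const[OF lim], intro exI allI impI, rule le)
  also have "\<dots> \<le> (\<integral>\<^sup>+x. ennreal (norm h powr p) * ennreal (norm (grad f x) powr p) \<partial>lborel)"
  proof (rule nn_integral_mono)
    fix x
    have "\<bar>grad f x \<bullet> h\<bar> powr p \<le> (norm h * norm (grad f x)) powr p"
      using Cauchy_Schwarz_ineq2[of "grad f x" h] p by (intro powr_mono2) (auto simp: mult.commute)
    then show "ennreal (\<bar>grad f x \<bullet> h\<bar> powr p) \<le> ennreal (norm h powr p) * ennreal (norm (grad f x) powr p)"
      by (simp add: powr_mult ennreal_leI flip: ennreal_mult')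
  qed
  also have "\<dots> = ennreal (norm h powr p) * (\<integral>\<^sup>+x. ennreal (norm (grad f x) powr p) \<partial>lborel)"
    by (rule nn_integral_cmult) measurable
  finally show ?thesis .
qed

section \<open>Weak gradients\<close>

lemma borel_imp_lebesgue_measurable:
  "f \<in> borel_measurable borel \<Longrightarrow> f \<in> borel_measurable lebesgue"
  by (rule measurable_completion) (simp only: measurable_lborel2)

lemma AE_lebesgue_iff: "(AE x in lebesgue. P x) \<longleftrightarrow> (AE x in lborel. P x)"
  by (rule AE_completion_iff)

lemma integrable_times_bounded_support:
  fixes f \<psi> :: "'a::euclidean_space \<Rightarrow> real"
  assumes f: "locally_integrable f" and \<psi>: "\<psi> \<in> borel_measurable borel"
    and B: "\<And>x. \<bar>\<psi> x\<bar> \<le> B" and r: "\<And>x. norm x \<ge> r \<Longrightarrow> \<psi> x = 0"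
  shows "integrable lebesgue (\<lambda>x. f x * \<psi> x)"
proof -
  note [measurable] = borel_imp_lebesgue_measurable[OF \<psi>]
  have i: "integrable lebesgue (\<lambda>x. indicator (cball 0 r) x * f x)"
    using f integrable_restrict_space[of "cball 0 r" lebesgue f] by (auto simp: locally_integrable_def)
  have eq: "f x * \<psi> x = (indicator (cball 0 r) x * f x) * \<psi> x" for x
    using r[of x] by (auto simp: indicator_def)
  have "integrable lebesgue (\<lambda>x. (indicator (cball 0 r) x * f x) * \<psi> x)"
  proof (rule Bochner_Integration.integrable_bound[OF integrable_mult_right[OF i, of B]])
    show "(\<lambda>x. (indicator (cball 0 r) x * f x) * \<psi> x) \<in> borel_measurable lebesgue"
      by (intro borel_measurable_times borel_measurable_integrable[OF i]) measurable
    show "AE x in lebesgue. norm (indicator (cball 0 r) x * f x * \<psi> x) \<le> norm (B * (indicator (cball 0 r) x * f x))"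
    proof (rule AE_I2)
      fix x
      have "\<bar>indicator (cball 0 r) x * f x\<bar> * \<bar>\<psi> x\<bar> \<le> \<bar>indicator (cball 0 r) x * f x\<bar> * \<bar>B\<bar>"
        using B[of x] by (intro mult_left_mono) auto
      then show "norm (indicator (cball 0 r) x * f x * \<psi> x) \<le> norm (B * (indicator (cball 0 r) x * f x))"
        by (simp add: abs_mult mult_ac)
    qed
  qed
  then show ?thesis by (simp only: eq[symmetric])
qed

lemma locally_integrable_measurable:
  fixes f :: "'a::euclidean_space \<Rightarrow> 'b::euclidean_space"
  assumes "locally_integrable f" shows "f \<in> borel_measurable lebesgue"
proof (rule borel_measurable_LIMSEQ_metric)
  show "(\<lambda>x. indicator (cball 0 (real n)) x *\<^sub>R f x) \<in> borel_measurable lebesgue" for n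
    using assms integrable_restrict_space[of "cball 0 (real n)" lebesgue f] by (auto simp: locally_integrable_def)
  show "(\<lambda>n. indicator (cball 0 (real n)) x *\<^sub>R f x) \<longlonglongrightarrow> f x" for x
  proof (rule tendsto_eventually)
    obtain N :: nat where "norm x \<le> real N" using real_arch_simple by blast
    then show "eventually (\<lambda>n. indicator (cball 0 (real n)) x *\<^sub>R f x = f x) sequentially"
      by (intro eventually_sequentiallyI[of N]) auto
  qed
qed

lemma integrable_times_test:
  assumes f: "locally_integrable f" and \<phi>: "\<phi> \<in> test_functions \<Omega>"
  shows "integrable lebesgue (\<lambda>x. f x * \<phi> x)" "integrable lebesgue (\<lambda>x. f x * (grad \<phi> x \<bullet> b))"
proof -
  note [measurable] = test_function_measurable[OF \<phi>] grad_measurable[OF \<phi>]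
  obtain r where r: "\<And>x. norm x \<ge> r \<Longrightarrow> \<phi> x = 0 \<and> grad \<phi> x = 0"
    using test_function_support_bounded[OF \<phi>] by blast
  obtain B where B: "\<And>x. \<bar>\<phi> x\<bar> \<le> B \<and> norm (grad \<phi> x) \<le> B"
    using test_function_bounded[OF \<phi>] by blast
  show "integrable lebesgue (\<lambda>x. f x * \<phi> x)"
    by (rule integrable_times_bounded_support[OF f, where B=B and r=r]) (use B r in auto)
  have "\<bar>grad \<phi> x \<bullet> b\<bar> \<le> B * norm b" for x
    using Cauchy_Schwarz_ineq2[of "grad \<phi> x" b] mult_right_mono[of "norm (grad \<phi> x)" B "norm b"] B[of x] by simp
  then show "integrable lebesgue (\<lambda>x. f x * (grad \<phi> x \<bullet> b))"
    by (intro integrable_times_bounded_support[OF f, where B="B * norm b" and r=r]) (use r in auto)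
qed

section \<open>The fundamental lemma of the calculus of variations\<close>

lemma eventually_in_box: "\<exists>N. \<forall>n\<ge>N. x \<in> box (- (real n *\<^sub>R One)) (real n *\<^sub>R One)"
proof -
  have "x \<in> (\<Union>i::nat. box (- (real i *\<^sub>R One)) (real i *\<^sub>R One))"
    unfolding UN_box_eq_UNIV by simp
  then obtain N :: nat where N: "x \<in> box (- (real N *\<^sub>R One)) (real N *\<^sub>R One)" by blast
  have "x \<in> box (- (real n *\<^sub>R One)) (real n *\<^sub>R One)" if "n \<ge> N" for n
  proof -
    have "real N \<le> real n" using that by simp
    then show ?thesis using N by (fastforce simp: box_def)
  qed
  then show ?thesis by blast
qed

text \<open>Boxes are stable under intersection and generate the Borel sets, so the vanishing of the
  integral extends from boxes to all Borel sets by a Dynkin argument.\<close>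

lemma AE_eq_0_if_box_integrals_eq_0:
  fixes f :: "'a::euclidean_space \<Rightarrow> real"
  assumes f: "integrable lborel f" and box: "\<And>a b. (LINT x|lborel. indicator (box a b) x * f x) = 0"
  shows "AE x in lborel. f x = 0"
proof (rule sigma_finite_measure.density_zero[OF sigma_finite_lborel f])
  let ?E = "range (\<lambda>(a, b). box a b::'a set)"
  have i: "integrable lborel (\<lambda>x. indicator A x * f x)" if "A \<in> sets borel" for A
    using integrable_mult_indicator[of A lborel f] that f by simp
  \<comment> \<open>Complements in the induction need the integral over the whole space, obtained by
    exhausting it with boxes.\<close>
  have total: "(LINT x|lborel. f x) = 0"
  proof -
    let ?A = "\<lambda>n::nat. box (- (real n *\<^sub>R One)) (real n *\<^sub>R One) :: 'a set"
    have "(\<lambda>n. LINT x|lborel. indicator (?A n) x * f x) \<longlonglongrightarrow> (LINT x|lborel. f x)"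
    proof (rule integral_dominated_convergence[where w = "\<lambda>x. \<bar>f x\<bar>"])
      show "AE x in lborel. (\<lambda>n. indicator (?A n) x * f x) \<longlonglongrightarrow> f x"
      proof (rule AE_I2)
        fix x :: 'a
        obtain N where "\<And>n. n \<ge> N \<Longrightarrow> x \<in> ?A n" using eventually_in_box[of x] by blast
        then show "(\<lambda>n. indicator (?A n) x * f x) \<longlonglongrightarrow> f x"
          by (intro tendsto_eventually eventually_sequentiallyI[of N]) auto
      qed
    qed (use f i in \<open>auto simp: indicator_def\<close>)
    then show ?thesis using box by (simp add: LIMSEQ_const_iff)
  qed
  fix A :: "'a set" assume "A \<in> sets lborel"
  then have A: "A \<in> sigma_sets UNIV ?E" by (simp add: borel_eq_box)
  have sb: "B \<in> sets borel" if "B \<in> sigma_sets UNIV ?E" for B using that by (simp add: borel_eq_box)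
  have "Int_stable ?E" by (auto simp: Int_stable_def box_Int_box)
  then have "(LINT x|lborel. indicator A x * f x) = 0" using subset_UNIV[of ?E, unfolded Pow_UNIV[symmetric]] A
  proof (induction rule: sigma_sets_induct_disjoint)
    case (compl A)
    have "(LINT x|lborel. indicator (UNIV - A) x * f x) = (LINT x|lborel. f x - indicator A x * f x)"
      by (intro Bochner_Integration.integral_cong) (auto simp: indicator_def)
    also have "\<dots> = 0" using i[OF sb[OF compl(1)]] f compl(2) total by simp
    finally show ?case .
  next
    case (union A)
    have "(LINT x:(\<Union>i. A i)|lborel. f x) = (\<Sum>i. LINT x:A i|lborel. f x)"
    proof (rule lebesgue_integral_countable_add)
      show "A i \<in> sets lborel" for i using union(2) sb by auto
      show "A i \<inter> A j = {}" if "i \<noteq> j" for i j using union(1) that by (auto simp: disjoint_family_on_def)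
      show "set_integrable lborel (\<Union>i. A i) f"
        using i[of "\<Union>i. A i"] union(2) sb by (auto simp: set_integrable_def)
    qed
    then show ?case using union(3) by (simp add: set_lebesgue_integral_def)
  qed (use box in auto)
  then show "set_lebesgue_integral lborel A f = 0" by (simp add: set_lebesgue_integral_def)
qed

lemma AE_lebesgue_eq_0_if_box_integrals_eq_0:
  fixes f :: "'a::euclidean_space \<Rightarrow> real"
  assumes f: "integrable lebesgue f" and box: "\<And>a b. (LINT x|lebesgue. indicator (box a b) x * f x) = 0"
  shows "AE x in lebesgue. f x = 0"
proof -
  obtain g where g: "g \<in> borel_measurable lborel" "AE x in lborel. f x = g x"
    using completion_ex_borel_measurable_real[OF borel_measurable_integrable[OF f]] by blast
  have gl: "g \<in> borel_measurable lebesgue" using g borel_imp_lebesgue_measurable by simp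
  have ae: "AE x in lebesgue. f x = g x" using g(2) by (simp add: AE_lebesgue_iff)
  have "integrable lebesgue g" by (rule integrable_cong_AE_imp[OF f gl]) (use ae in auto)
  then have ig: "integrable lborel g" using integrable_completion[OF g(1)] by simp
  have "AE x in lborel. g x = 0"
  proof (rule AE_eq_0_if_box_integrals_eq_0[OF ig])
    fix a b :: 'a
    note [measurable] = g(1)
    have "(LINT x|lborel. indicator (box a b) x * g x) = (LINT x|lebesgue. indicator (box a b) x * g x)"
      by (rule integral_completion[symmetric]) measurable
    also have "\<dots> = (LINT x|lebesgue. indicator (box a b) x * f x)"
    proof (rule integral_cong_AE)
      show "AE x in lebesgue. indicator (box a b) x * g x = indicator (box a b) x * f x"
        using ae by eventually_elim simp
    qed (intro borel_measurable_times gl borel_measurable_integrable[OF f]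
        borel_imp_lebesgue_measurable[OF borel_measurable_indicator] borel_open open_box)+
    finally show "(LINT x|lborel. indicator (box a b) x * g x) = 0" using box by simp
  qed
  then have "AE x in lebesgue. g x = 0" by (simp add: AE_lebesgue_iff)
  then show ?thesis using ae by eventually_elim simp
qed

text \<open>Smooth bumps converge to the indicator of a box, so all box integrals vanish. As
  \<open>w\<close> is only locally integrable, the lemma on integrable functions is applied to the
  restrictions of \<open>w\<close> to growing cubes.\<close>

theorem AE_eq_0_if_test_integrals_eq_0:
  fixes w :: "'a::euclidean_space \<Rightarrow> real"
  assumes w: "locally_integrable w"
    and test: "\<And>\<phi>. \<phi> \<in> test_functions UNIV \<Longrightarrow> (LINT x|lebesgue. w x * \<phi> x) = 0"
  shows "AE x in lebesgue. w x = 0"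
proof -
  have ic: "integrable lebesgue (\<lambda>x. indicator (cbox a b) x * w x)" for a b
    using w integrable_restrict_space[of "cbox a b" lebesgue w] by (auto simp: locally_integrable_def)
  have ib: "integrable lebesgue (\<lambda>x. indicator (box a b) x * w x)" for a b
  proof -
    have "integrable lebesgue (\<lambda>x. indicator (box a b) x *\<^sub>R (indicator (cbox a b) x * w x))"
      by (rule integrable_mult_indicator[OF _ ic]) auto
    also have "(\<lambda>x. indicator (box a b) x *\<^sub>R (indicator (cbox a b) x * w x)) = (\<lambda>x. indicator (box a b) x * w x)"
      by (rule ext) (use box_subset_cbox[of a b] in \<open>auto simp: indicator_def subset_iff\<close>)
    finally show ?thesis .
  qed
  have zero: "(LINT x|lebesgue. indicator (box a b) x * w x) = 0" for a b
  proof -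
    have tf: "box_bump (real (Suc k)) a b \<in> test_functions UNIV" for k by (rule box_bump_test_function) simp
    have "(\<lambda>k. LINT x|lebesgue. w x * box_bump (real (Suc k)) a b x) \<longlonglongrightarrow> (LINT x|lebesgue. indicator (box a b) x * w x)"
    proof (rule integral_dominated_convergence[where w = "\<lambda>x. \<bar>indicator (cbox a b) x * w x\<bar>"])
      show "(\<lambda>x. indicator (box a b) x * w x) \<in> borel_measurable lebesgue" using ib by blast
      show "(\<lambda>x. w x * box_bump (real (Suc k)) a b x) \<in> borel_measurable lebesgue" for k
        using integrable_times_test(1)[OF w tf] by blast
      show "integrable lebesgue (\<lambda>x. \<bar>indicator (cbox a b) x * w x\<bar>)" using ic by simp
      show "AE x in lebesgue. (\<lambda>k. w x * box_bump (real (Suc k)) a b x) \<longlonglongrightarrow> indicator (box a b) x * w x"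
        unfolding mult.commute[of _ "w _"] by (intro AE_I2 tendsto_intros box_bump_tendsto)
      show "AE x in lebesgue. norm (w x * box_bump (real (Suc k)) a b x) \<le> \<bar>indicator (cbox a b) x * w x\<bar>" for k
      proof (rule AE_I2)
        fix x
        show "norm (w x * box_bump (real (Suc k)) a b x) \<le> \<bar>indicator (cbox a b) x * w x\<bar>"
        proof (cases "x \<in> box a b")
          case True
          then have "x \<in> cbox a b" using box_subset_cbox by blast
          then show ?thesis using mult_left_mono[OF box_bump_bounds(2), of "\<bar>w x\<bar>" "real (Suc k)" a b x] box_bump_bounds(1)[of "real (Suc k)" a b x]
            by (simp add: abs_mult)
        qed (simp add: box_bump_eq_0)
      qed
    qed
    then show ?thesis using test[OF tf] by (simp add: LIMSEQ_const_iff)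
  qed
  let ?A = "\<lambda>n::nat. box (- (real n *\<^sub>R One)) (real n *\<^sub>R One) :: 'a set"
  have "AE x in lebesgue. indicator (?A n) x * w x = 0" for n
  proof (rule AE_lebesgue_eq_0_if_box_integrals_eq_0[OF ib])
    fix a b :: 'a
    have "(LINT x|lebesgue. indicator (box a b) x * (indicator (?A n) x * w x)) =
      (LINT x|lebesgue. indicator (box a b \<inter> ?A n) x * w x)"
      by (intro Bochner_Integration.integral_cong) (auto simp: indicator_def)
    also have "\<dots> = 0" unfolding box_Int_box by (rule zero)
    finally show "(LINT x|lebesgue. indicator (box a b) x * (indicator (?A n) x * w x)) = 0" .
  qed
  then have "AE x in lebesgue. \<forall>n. indicator (?A n) x * w x = 0" unfolding AE_all_countable by blast
  then show ?thesis
  proof eventually_elim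
    case (elim x)
    obtain N where "x \<in> ?A N" using eventually_in_box[of x] by blast
    then show ?case using elim[rule_format, of N] by simp
  qed
qed

section \<open>Calculus of weak gradients\<close>

lemma has_weak_gradientD:
  assumes "has_weak_gradient u G"
  shows "locally_integrable u" "locally_integrable G"
    "\<phi> \<in> test_functions UNIV \<Longrightarrow> b \<in> Basis \<Longrightarrow>
      (LINT x|lebesgue. u x * (grad \<phi> x \<bullet> b)) = - (LINT x|lebesgue. (G x \<bullet> b) * \<phi> x)"
  using assms by (auto simp: has_weak_gradient_def frechet_derivative_test)

lemma locally_integrable_inner: "locally_integrable G \<Longrightarrow> locally_integrable (\<lambda>x. G x \<bullet> b)"
  by (auto simp: locally_integrable_def)

lemma locally_integrable_lincomb:
  "locally_integrable f \<Longrightarrow> locally_integrable g \<Longrightarrow> locally_integrable (\<lambda>x. a *\<^sub>R f x + b *\<^sub>R g x)"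
  by (auto simp: locally_integrable_def)

lemma integrable_imp_locally_integrable: "integrable lebesgue f \<Longrightarrow> locally_integrable f"
  unfolding locally_integrable_def
proof (intro allI impI)
  fix K :: "'a set" assume f: "integrable lebesgue f" and "compact K"
  then have "K \<in> sets lebesgue" by (intro lmeasurable_compact fmeasurableD)
  then show "integrable (lebesgue_on K) f"
    using integrable_mult_indicator[OF _ f] by (subst integrable_restrict_space) auto
qed

lemma has_weak_gradient_lincomb:
  assumes u: "has_weak_gradient u G" and v: "has_weak_gradient v H"
  shows "has_weak_gradient (\<lambda>x. a * u x + b * v x) (\<lambda>x. a *\<^sub>R G x + b *\<^sub>R H x)"
  unfolding has_weak_gradient_def
proof (intro conjI ballI)
  show "locally_integrable (\<lambda>x. a * u x + b * v x)"
    using locally_integrable_lincomb[OF has_weak_gradientD(1)[OF u] has_weak_gradientD(1)[OF v], of a b] by simp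
  show "locally_integrable (\<lambda>x. a *\<^sub>R G x + b *\<^sub>R H x)"
    by (rule locally_integrable_lincomb[OF has_weak_gradientD(2)[OF u] has_weak_gradientD(2)[OF v]])
  fix \<phi> :: "'a \<Rightarrow> real" and e :: 'a assume \<phi>: "\<phi> \<in> test_functions UNIV" and e: "e \<in> Basis"
  note i = integrable_times_test(2)[OF has_weak_gradientD(1)[OF u] \<phi>, of e] integrable_times_test(2)[OF has_weak_gradientD(1)[OF v] \<phi>, of e]
    integrable_times_test(1)[OF locally_integrable_inner[OF has_weak_gradientD(2)[OF u]] \<phi>, of e]
    integrable_times_test(1)[OF locally_integrable_inner[OF has_weak_gradientD(2)[OF v]] \<phi>, of e]
  have "(LINT x|lebesgue. (a * u x + b * v x) * (grad \<phi> x \<bullet> e)) =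
     a * (LINT x|lebesgue. u x * (grad \<phi> x \<bullet> e)) + b * (LINT x|lebesgue. v x * (grad \<phi> x \<bullet> e))"
    using i by (simp add: distrib_right mult.assoc)
  also have "\<dots> = - (a * (LINT x|lebesgue. (G x \<bullet> e) * \<phi> x) + b * (LINT x|lebesgue. (H x \<bullet> e) * \<phi> x))"
    using has_weak_gradientD(3)[OF u \<phi> e] has_weak_gradientD(3)[OF v \<phi> e] by simp
  also have "\<dots> = - (LINT x|lebesgue. ((a *\<^sub>R G x + b *\<^sub>R H x) \<bullet> e) * \<phi> x)"
    using i by (simp add: distrib_right mult.assoc inner_add_left)
  finally show "(LINT x|lebesgue. (a * u x + b * v x) * frechet_derivative \<phi> (at x) e) = - (LINT x|lebesgue. ((a *\<^sub>R G x + b *\<^sub>R H x) \<bullet> e) * \<phi> x)"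
    by (simp add: frechet_derivative_test[OF \<phi>])
qed

text \<open>\<open>G - H\<close> is a weak gradient of the zero function, so each of its components
  integrates to 0 against every test function.\<close>

lemma has_weak_gradient_unique:
  assumes "has_weak_gradient u G" "has_weak_gradient u H"
  shows "AE x in lebesgue. G x = H x"
proof -
  have d: "has_weak_gradient (\<lambda>x. 1 * u x + (-1) * u x) (\<lambda>x. 1 *\<^sub>R G x + (-1) *\<^sub>R H x)"
    by (rule has_weak_gradient_lincomb[OF assms])
  have "AE x in lebesgue. (1 *\<^sub>R G x + (-1) *\<^sub>R H x) \<bullet> b = 0" if b: "b \<in> Basis" for b
  proof (rule AE_eq_0_if_test_integrals_eq_0[OF locally_integrable_inner[OF has_weak_gradientD(2)[OF d]]])
    fix \<phi> :: "'a \<Rightarrow> real" assume "\<phi> \<in> test_functions UNIV"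
    from has_weak_gradientD(3)[OF d this b]
    show "(LINT x|lebesgue. ((1 *\<^sub>R G x + (-1) *\<^sub>R H x) \<bullet> b) * \<phi> x) = 0" by simp
  qed
  then have "AE x in lebesgue. \<forall>b\<in>Basis. (1 *\<^sub>R G x + (-1) *\<^sub>R H x) \<bullet> b = 0"
    by (intro AE_ball_countable[THEN iffD2]) (auto intro: countable_finite)
  then show ?thesis
  proof eventually_elim
    case (elim x)
    show ?case by (rule euclidean_eqI) (use elim in \<open>auto simp: inner_diff_left\<close>)
  qed
qed

lemma weak_gradient_AE:
  assumes "has_weak_gradient u G"
  shows "has_weak_gradient u (weak_gradient u)" "AE x in lebesgue. weak_gradient u x = G x"
proof -
  show "has_weak_gradient u (weak_gradient u)"
    unfolding weak_gradient_def by (rule someI[of "has_weak_gradient u", OF assms])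
  then show "AE x in lebesgue. weak_gradient u x = G x" using assms by (rule has_weak_gradient_unique)
qed

lemma has_weak_gradient_test:
  assumes f: "f \<in> test_functions \<Omega>"
  shows "has_weak_gradient f (grad f)"
  unfolding has_weak_gradient_def
proof (intro conjI ballI)
  note [measurable] = test_function_measurable[OF f] grad_measurable[OF f]
  have f': "f \<in> test_functions UNIV" using f test_functions_mono by blast
  obtain r where r: "\<And>x. norm x \<ge> r \<Longrightarrow> f x = 0 \<and> grad f x = 0"
    using test_function_support_bounded[OF f] by blast
  obtain B where B: "\<And>x. \<bar>f x\<bar> \<le> B \<and> norm (grad f x) \<le> B"
    using test_function_bounded[OF f] by blast
  have "integrable lborel f" "integrable lborel (grad f)"
    by (rule integrable_bounded_support[where B=B and r=r], use B r in auto)+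
  then show l: "locally_integrable f" "locally_integrable (grad f)"
    by (auto intro!: integrable_imp_locally_integrable simp: integrable_completion)
  fix \<phi> :: "'a \<Rightarrow> real" and b :: 'a assume \<phi>: "\<phi> \<in> test_functions UNIV" and b: "b \<in> Basis"
  note [measurable] = test_function_measurable[OF \<phi>] grad_measurable[OF \<phi>]
  have "0 = (LINT x|lborel. grad (\<lambda>x. f x * \<phi> x) x \<bullet> b)"
    using integral_grad_eq_0[OF test_functions_mult[OF f' \<phi>]] by simp
  also have "\<dots> = (LINT x|lebesgue. grad (\<lambda>x. f x * \<phi> x) x \<bullet> b)"
    using grad_measurable[OF test_functions_mult[OF f' \<phi>]] by (intro integral_completion[symmetric]) simp
  also have "\<dots> = (LINT x|lebesgue. f x * (grad \<phi> x \<bullet> b) + (grad f x \<bullet> b) * \<phi> x)"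
    by (simp add: grad_mult[OF f' \<phi>])
  also have "\<dots> = (LINT x|lebesgue. f x * (grad \<phi> x \<bullet> b)) + (LINT x|lebesgue. (grad f x \<bullet> b) * \<phi> x)"
    by (rule Bochner_Integration.integral_add[OF integrable_times_test(2)[OF l(1) \<phi>] integrable_times_test(1)[OF locally_integrable_inner[OF l(2)] \<phi>]])
  finally show "(LINT x|lebesgue. f x * frechet_derivative \<phi> (at x) b) = - (LINT x|lebesgue. (grad f x \<bullet> b) * \<phi> x)"
    by (simp add: frechet_derivative_test[OF \<phi>])
qed

lemma tendsto_integral_times_bounded:
  fixes f :: "nat \<Rightarrow> 'a::euclidean_space \<Rightarrow> real"
  assumes i: "\<And>k. integrable lebesgue (f k)" "integrable lebesgue g"
    and lim: "(\<lambda>k. LINT x|lebesgue. \<bar>f k x - g x\<bar>) \<longlonglongrightarrow> 0"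
    and \<psi>: "\<psi> \<in> borel_measurable borel" "\<And>x. \<bar>\<psi> x\<bar> \<le> B"
  shows "(\<lambda>k. LINT x|lebesgue. f k x * \<psi> x) \<longlonglongrightarrow> (LINT x|lebesgue. g x * \<psi> x)"
proof -
  note [measurable] = borel_imp_lebesgue_measurable[OF \<psi>(1)]
  have prod: "integrable lebesgue (\<lambda>x. h x * \<psi> x)" if h: "integrable lebesgue h" for h
  proof (rule Bochner_Integration.integrable_bound[OF integrable_mult_right[OF h, of B]])
    show "(\<lambda>x. h x * \<psi> x) \<in> borel_measurable lebesgue"
      by (intro borel_measurable_times borel_measurable_integrable[OF h]) measurable
    show "AE x in lebesgue. norm (h x * \<psi> x) \<le> norm (B * h x)"
    proof (rule AE_I2)
      fix x
      have "\<bar>h x\<bar> * \<bar>\<psi> x\<bar> \<le> \<bar>h x\<bar> * \<bar>B\<bar>" using \<psi>(2)[of x] by (intro mult_left_mono) auto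
      then show "norm (h x * \<psi> x) \<le> norm (B * h x)" by (simp add: abs_mult mult_ac)
    qed
  qed
  have "(\<lambda>k. (LINT x|lebesgue. f k x * \<psi> x) - (LINT x|lebesgue. g x * \<psi> x)) \<longlonglongrightarrow> 0"
  proof (rule Lim_null_comparison[where g = "\<lambda>k. B * (LINT x|lebesgue. \<bar>f k x - g x\<bar>)"])
    show "(\<lambda>k. B * (LINT x|lebesgue. \<bar>f k x - g x\<bar>)) \<longlonglongrightarrow> 0" using tendsto_mult_right_zero[OF lim] by simp
    show "eventually (\<lambda>k. norm ((LINT x|lebesgue. f k x * \<psi> x) - (LINT x|lebesgue. g x * \<psi> x)) \<le> B * (LINT x|lebesgue. \<bar>f k x - g x\<bar>)) sequentially"
    proof (rule always_eventually, rule allI)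
      fix k
      have "(LINT x|lebesgue. f k x * \<psi> x) - (LINT x|lebesgue. g x * \<psi> x) = (LINT x|lebesgue. (f k x - g x) * \<psi> x)"
        using prod[OF i(1)] prod[OF i(2)] by (simp add: left_diff_distrib)
      also have "norm \<dots> \<le> (LINT x|lebesgue. norm ((f k x - g x) * \<psi> x))" by (rule integral_norm_bound)
      also have "\<dots> \<le> (LINT x|lebesgue. B * \<bar>f k x - g x\<bar>)"
      proof (rule integral_mono)
        show "integrable lebesgue (\<lambda>x. norm ((f k x - g x) * \<psi> x))" using prod[of "\<lambda>x. f k x - g x"] i by simp
        show "integrable lebesgue (\<lambda>x. B * \<bar>f k x - g x\<bar>)" using i by simp
        show "norm ((f k x - g x) * \<psi> x) \<le> B * \<bar>f k x - g x\<bar>" for x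
          using mult_left_mono[OF \<psi>(2)[of x], of "\<bar>f k x - g x\<bar>"] by (simp add: abs_mult mult_ac)
      qed
      finally show "norm ((LINT x|lebesgue. f k x * \<psi> x) - (LINT x|lebesgue. g x * \<psi> x)) \<le> B * (LINT x|lebesgue. \<bar>f k x - g x\<bar>)" by simp
    qed
  qed
  then show ?thesis by (rule LIM_zero_cancel)
qed

text \<open>Both sides of the defining identity pair the functions with bounded test data, hence are
  continuous for convergence in L^1.\<close>

lemma has_weak_gradient_limit:
  assumes wg: "\<And>k. has_weak_gradient (u k) (G k)"
    and i: "\<And>k. integrable lebesgue (u k)" "\<And>k. integrable lebesgue (G k)" "integrable lebesgue v" "integrable lebesgue H"
    and lim: "(\<lambda>k. LINT x|lebesgue. \<bar>u k x - v x\<bar>) \<longlonglongrightarrow> 0" "(\<lambda>k. LINT x|lebesgue. norm (G k x - H x)) \<longlonglongrightarrow> 0"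
  shows "has_weak_gradient v H"
  unfolding has_weak_gradient_def
proof (intro conjI ballI integrable_imp_locally_integrable i)
  fix \<phi> :: "'a \<Rightarrow> real" and b :: 'a assume \<phi>: "\<phi> \<in> test_functions UNIV" and b: "b \<in> Basis"
  note [measurable] = test_function_measurable[OF \<phi>] grad_measurable[OF \<phi>]
  obtain B where B: "\<And>x. \<bar>\<phi> x\<bar> \<le> B \<and> norm (grad \<phi> x) \<le> B"
    using test_function_bounded[OF \<phi>] by blast
  have "(\<lambda>k. LINT x|lebesgue. u k x * (grad \<phi> x \<bullet> b)) \<longlonglongrightarrow> (LINT x|lebesgue. v x * (grad \<phi> x \<bullet> b))"
  proof (rule tendsto_integral_times_bounded[OF i(1,3) lim(1)])
    show "\<bar>grad \<phi> x \<bullet> b\<bar> \<le> B" for x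
      using Cauchy_Schwarz_ineq2[of "grad \<phi> x" b] B[of x] b by simp
  qed measurable
  moreover have "(\<lambda>k. LINT x|lebesgue. (G k x \<bullet> b) * \<phi> x) \<longlonglongrightarrow> (LINT x|lebesgue. (H x \<bullet> b) * \<phi> x)"
  proof (rule tendsto_integral_times_bounded)
    show "integrable lebesgue (\<lambda>x. G k x \<bullet> b)" for k using i by auto
    show "integrable lebesgue (\<lambda>x. H x \<bullet> b)" using i by auto
    show "\<bar>\<phi> x\<bar> \<le> B" for x using B by auto
    show "(\<lambda>k. LINT x|lebesgue. \<bar>G k x \<bullet> b - H x \<bullet> b\<bar>) \<longlonglongrightarrow> 0"
    proof (rule tendsto_sandwich[OF _ _ tendsto_const lim(2)])
      show "eventually (\<lambda>k. 0 \<le> (LINT x|lebesgue. \<bar>G k x \<bullet> b - H x \<bullet> b\<bar>)) sequentially" by simp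
      show "eventually (\<lambda>k. (LINT x|lebesgue. \<bar>G k x \<bullet> b - H x \<bullet> b\<bar>) \<le> (LINT x|lebesgue. norm (G k x - H x))) sequentially"
        using i b Basis_le_norm[OF b] by (intro always_eventually allI integral_mono) (auto simp flip: inner_diff_left)
    qed
  qed measurable
  then have "(\<lambda>k. LINT x|lebesgue. u k x * (grad \<phi> x \<bullet> b)) \<longlonglongrightarrow> - (LINT x|lebesgue. (H x \<bullet> b) * \<phi> x)"
    unfolding has_weak_gradientD(3)[OF wg \<phi> b] by (rule tendsto_minus)
  ultimately have "(LINT x|lebesgue. v x * (grad \<phi> x \<bullet> b)) = - (LINT x|lebesgue. (H x \<bullet> b) * \<phi> x)"
    by (rule LIMSEQ_unique)
  then show "(LINT x|lebesgue. v x * frechet_derivative \<phi> (at x) b) = - (LINT x|lebesgue. (H x \<bullet> b) * \<phi> x)"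
    by (simp add: frechet_derivative_test[OF \<phi>])
qed

lemma C_k_translate: "C_k k UNIV f \<Longrightarrow> C_k k UNIV (\<lambda>x. f (x + c))"
proof (induction k arbitrary: f)
  case 0 then show ?case by (auto intro!: continuous_on_compose2[of UNIV f] continuous_intros)
next
  case (Suc k)
  have "((\<lambda>x. f (x + c)) has_derivative frechet_derivative f (at (x + c))) (at x)" for x
  proof -
    have "((\<lambda>x. x + c) has_derivative (\<lambda>h. h)) (at x)" by (auto intro!: derivative_eq_intros)
    from has_derivative_compose[OF this C_k_Suc_derivative(1)[OF Suc.prems]] show ?thesis .
  qed
  then show ?case by (rule C_k_SucI) (intro Suc.IH C_k_Suc_derivative(2) Suc.prems)
qed

lemma test_functions_translate:
  assumes "f \<in> test_functions UNIV" shows "(\<lambda>x. f (x + c)) \<in> test_functions UNIV"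
proof -
  obtain r where r: "\<And>x. norm x \<ge> r \<Longrightarrow> f x = 0" using test_function_support_bounded[OF assms] by blast
  have "bounded {x. f (x + c) \<noteq> 0}"
  proof (rule boundedI)
    fix x assume "x \<in> {x. f (x + c) \<noteq> 0}"
    then have "norm (x + c) < r" using r[of "x + c"] by force
    then show "norm x \<le> r + norm c" using norm_triangle_ineq4[of "x + c" c] by simp
  qed
  then show ?thesis using assms by (auto simp: test_functions_def smooth_on_def C_k_translate)
qed

text \<open>The pairing of \<open>w\<close> with a translated test function does not depend on the translation,
  and it vanishes when the test function is moved off the support of \<open>w\<close>.\<close>

lemma zero_weak_gradient_imp_zero:
  fixes w :: "'a::euclidean_space \<Rightarrow> real"
  assumes wg: "has_weak_gradient w G" and G: "AE x in lebesgue. G x = 0"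
    and supp: "AE x in lebesgue. r \<le> norm x \<longrightarrow> w x = 0"
  shows "AE x in lebesgue. w x = 0"
proof (rule AE_eq_0_if_test_integrals_eq_0[OF has_weak_gradientD(1)[OF wg]])
  fix \<phi> :: "'a \<Rightarrow> real" assume \<phi>: "\<phi> \<in> test_functions UNIV"
  obtain b :: 'a where b: "b \<in> Basis" using nonempty_Basis by blast
  \<comment> \<open>Local integrability and bounded support make \<open>w\<close> integrable on the
    whole space, which supplies the majorant for differentiating \<Phi>.\<close>
  have iw: "integrable lebesgue w"
  proof -
    have i: "integrable lebesgue (\<lambda>x. indicator (cball 0 r) x * w x)"
      using has_weak_gradientD(1)[OF wg] integrable_restrict_space[of "cball 0 r" lebesgue w] by (auto simp: locally_integrable_def)
    have ae: "AE x in lebesgue. indicator (cball 0 r) x * w x = w x"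
      using supp by eventually_elim (auto simp: indicator_def)
    show ?thesis
      by (rule integrable_cong_AE_imp[OF i locally_integrable_measurable[OF has_weak_gradientD(1)[OF wg]]]) (rule ae)
  qed
  define \<Phi> where "\<Phi> t = (LINT x|lebesgue. w x * \<phi> (x + t *\<^sub>R b))" for t
  have zero: "(LINT x|lebesgue. w x * (grad \<psi> x \<bullet> b)) = 0" if \<psi>: "\<psi> \<in> test_functions UNIV" for \<psi>
  proof -
    have "(LINT x|lebesgue. (G x \<bullet> b) * \<psi> x) = (LINT (x::'a)|lebesgue. 0)"
    proof (rule integral_cong_AE)
      show "(\<lambda>x. G x \<bullet> b * \<psi> x) \<in> borel_measurable lebesgue"
        using integrable_times_test(1)[OF locally_integrable_inner[OF has_weak_gradientD(2)[OF wg]] \<psi>] by blast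
      show "AE x in lebesgue. G x \<bullet> b * \<psi> x = 0" using G by eventually_elim simp
    qed simp
    then show ?thesis using has_weak_gradientD(3)[OF wg \<psi> b] by simp
  qed
  have der: "(\<Phi> has_real_derivative 0) (at t)" for t
  proof -
    define \<psi> where "\<psi> x = \<phi> (x + t *\<^sub>R b)" for x
    have \<psi>: "\<psi> \<in> test_functions UNIV" unfolding \<psi>_def by (rule test_functions_translate[OF \<phi>])
    note [measurable] = borel_imp_lebesgue_measurable[OF test_function_measurable[OF \<psi>]]
      borel_imp_lebesgue_measurable[OF grad_measurable[OF \<psi>]] borel_measurable_integrable[OF iw]
    obtain B where B: "\<And>x. \<bar>\<psi> x\<bar> \<le> B \<and> norm (grad \<psi> x) \<le> B"
      using test_function_bounded[OF \<psi>] by blast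
    have tr: "integrable lebesgue (\<lambda>x. w x * \<psi> (x + c))" for c
      using integrable_times_test(1)[OF has_weak_gradientD(1)[OF wg] test_functions_translate[OF \<psi>]] .
    have "((\<lambda>h. (\<Phi> (t + h) - \<Phi> t) / h) \<longlongrightarrow> 0) (at 0)"
      unfolding tendsto_at_iff_sequentially o_def
    proof (intro allI impI)
      fix X :: "nat \<Rightarrow> real" assume X: "\<forall>i. X i \<in> UNIV - {0}" "X \<longlonglongrightarrow> 0"
      have "(\<lambda>k. LINT x|lebesgue. w x * ((\<psi> (x + X k *\<^sub>R b) - \<psi> x) / X k)) \<longlonglongrightarrow> (LINT x|lebesgue. w x * (grad \<psi> x \<bullet> b))"
      proof (rule integral_dominated_convergence[where w = "\<lambda>x. B * \<bar>w x\<bar>"])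
        show "(\<lambda>x. w x * (grad \<psi> x \<bullet> b)) \<in> borel_measurable lebesgue"
          using integrable_times_test(2)[OF has_weak_gradientD(1)[OF wg] \<psi>] by blast
        show "(\<lambda>x. w x * ((\<psi> (x + X k *\<^sub>R b) - \<psi> x) / X k)) \<in> borel_measurable lebesgue" for k
        proof -
          have "integrable lebesgue (\<lambda>x. (w x * \<psi> (x + X k *\<^sub>R b) - w x * \<psi> (x + 0)) / X k)"
            by (intro integrable_divide Bochner_Integration.integrable_diff tr)
          then show ?thesis by (simp add: right_diff_distrib[symmetric]) 
        qed
        show "integrable lebesgue (\<lambda>x. B * \<bar>w x\<bar>)" using iw by simp
        show "AE x in lebesgue. (\<lambda>k. w x * ((\<psi> (x + X k *\<^sub>R b) - \<psi> x) / X k)) \<longlonglongrightarrow> w x * (grad \<psi> x \<bullet> b)"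
        proof (intro AE_I2 tendsto_intros)
          fix x
          have "((\<lambda>s. x + s *\<^sub>R b) has_derivative (\<lambda>s. s *\<^sub>R b)) (at 0)"
            by (auto intro!: derivative_eq_intros)
          from has_derivative_compose[OF this, of \<psi> "\<lambda>v. grad \<psi> x \<bullet> v"] test_function_has_derivative[OF \<psi>, of x]
          have "((\<lambda>s. \<psi> (x + s *\<^sub>R b)) has_derivative (\<lambda>s. grad \<psi> x \<bullet> (s *\<^sub>R b))) (at 0)" by simp
          then have "((\<lambda>s. \<psi> (x + s *\<^sub>R b)) has_real_derivative (grad \<psi> x \<bullet> b)) (at 0)"
            by (simp add: has_field_derivative_def mult.commute[of _ "grad \<psi> x \<bullet> b"] fun_eq_iff)
          then have "((\<lambda>s. (\<psi> (x + s *\<^sub>R b) - \<psi> x) / s) \<longlongrightarrow> grad \<psi> x \<bullet> b) (at 0)" by (simp add: DERIV_def)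
          then show "(\<lambda>k. (\<psi> (x + X k *\<^sub>R b) - \<psi> x) / X k) \<longlonglongrightarrow> grad \<psi> x \<bullet> b"
            using X unfolding tendsto_at_iff_sequentially o_def by blast
        qed
        show "AE x in lebesgue. norm (w x * ((\<psi> (x + X k *\<^sub>R b) - \<psi> x) / X k)) \<le> B * \<bar>w x\<bar>" for k
        proof (rule AE_I2)
          fix x
          have "\<bar>\<psi> (x + X k *\<^sub>R b) - \<psi> x\<bar> \<le> B * \<bar>X k\<bar>"
            using test_function_lipschitz[OF \<psi>, of B x "X k *\<^sub>R b"] B b by simp
          moreover have "X k \<noteq> 0" using X by auto
          ultimately have "\<bar>(\<psi> (x + X k *\<^sub>R b) - \<psi> x) / X k\<bar> \<le> B" by (simp add: pos_divide_le_eq)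
          then show "norm (w x * ((\<psi> (x + X k *\<^sub>R b) - \<psi> x) / X k)) \<le> B * \<bar>w x\<bar>"
            using mult_left_mono[of "\<bar>(\<psi> (x + X k *\<^sub>R b) - \<psi> x) / X k\<bar>" B "\<bar>w x\<bar>"] by (simp only: real_norm_def abs_mult mult.commute)
        qed
      qed
      moreover have "(LINT x|lebesgue. w x * ((\<psi> (x + X k *\<^sub>R b) - \<psi> x) / X k)) = (\<Phi> (t + X k) - \<Phi> t) / X k" for k
      proof -
        have "(LINT x|lebesgue. w x * ((\<psi> (x + X k *\<^sub>R b) - \<psi> x) / X k)) = (LINT x|lebesgue. (w x * \<psi> (x + X k *\<^sub>R b) - w x * \<psi> (x + 0)) / X k)"
          by (intro Bochner_Integration.integral_cong refl) (simp only: times_divide_eq_right right_diff_distrib add_0_right)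
        also have "\<dots> = ((LINT x|lebesgue. w x * \<psi> (x + X k *\<^sub>R b)) - (LINT x|lebesgue. w x * \<psi> (x + 0))) / X k"
          using Bochner_Integration.integral_diff[OF tr tr, of "X k *\<^sub>R b" 0] by simp
        also have "\<dots> = (\<Phi> (t + X k) - \<Phi> t) / X k" unfolding \<Phi>_def \<psi>_def by (simp add: scaleR_add_left add_ac)
        finally show ?thesis .
      qed
      ultimately show "(\<lambda>k. (\<Phi> (t + X k) - \<Phi> t) / X k) \<longlonglongrightarrow> 0" unfolding zero[OF \<psi>] by (simp only:)
    qed
    then show ?thesis by (simp add: DERIV_def)
  qed
  obtain \<rho> where \<rho>: "\<rho> > 0" "\<And>x. norm x \<ge> \<rho> \<Longrightarrow> \<phi> x = 0" using test_function_support_bounded[OF \<phi>] by blast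
  \<comment> \<open>A shift of length \<open>T\<close> moves the support of \<phi>, which has radius
    \<rho>, off the ball of radius \<open>r\<close>.\<close>
  define T where "T = \<bar>r\<bar> + \<rho>"
  have "\<Phi> T = (LINT (x::'a)|lebesgue. (0::real))"
    unfolding \<Phi>_def
  proof (rule integral_cong_AE)
    show "(\<lambda>x. w x * \<phi> (x + T *\<^sub>R b)) \<in> borel_measurable lebesgue"
      using integrable_times_test(1)[OF has_weak_gradientD(1)[OF wg] test_functions_translate[OF \<phi>]] by blast
    show "AE x in lebesgue. w x * \<phi> (x + T *\<^sub>R b) = 0"
      using supp
    proof eventually_elim
      case (elim x)
      have "\<phi> (x + T *\<^sub>R b) = 0" if "norm x < r"
      proof (rule \<rho>(2))
        have "norm (T *\<^sub>R b) = T" using b \<rho> by (simp add: T_def)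
        then show "\<rho> \<le> norm (x + T *\<^sub>R b)" using norm_diff_ineq[of "T *\<^sub>R b" x] that by (simp add: T_def add.commute)
      qed
      then show ?case using elim by (cases "norm x < r") auto
    qed
  qed simp
  then have "\<Phi> 0 = 0" using DERIV_isconst_all[of \<Phi> 0 T] der by simp
  then show "(LINT x|lebesgue. w x * \<phi> x) = 0" by (simp add: \<Phi>_def)
qed

section \<open>Convergence in $L^p$\<close>

lemma nn_integral_fatou_bound:
  fixes f :: "nat \<Rightarrow> 'm \<Rightarrow> ennreal"
  assumes meas: "\<And>i. f i \<in> borel_measurable M"
    and lim: "AE x in M. (\<lambda>i. f i x) \<longlonglongrightarrow> g x"
    and bd: "eventually (\<lambda>i. (\<integral>\<^sup>+x. f i x \<partial>M) \<le> C) sequentially"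
  shows "(\<integral>\<^sup>+x. g x \<partial>M) \<le> C"
proof -
  have "(\<integral>\<^sup>+x. g x \<partial>M) = (\<integral>\<^sup>+x. liminf (\<lambda>i. f i x) \<partial>M)"
    using lim by (intro nn_integral_cong_AE) (auto elim!: eventually_mono simp: lim_imp_Liminf)
  also have "\<dots> \<le> liminf (\<lambda>i. \<integral>\<^sup>+x. f i x \<partial>M)" by (rule nn_integral_liminf[OF meas])
  also have "\<dots> \<le> liminf (\<lambda>i. C)" using bd by (rule Liminf_mono)
  also have "\<dots> = C" by (simp add: Liminf_const)
  finally show ?thesis .
qed

lemma Lp_on_nn_integral:
  assumes "Lp_on M p f"
  shows "(\<integral>\<^sup>+x. ennreal (norm (f x) powr p) \<partial>M) = ennreal (LINT x|M. norm (f x) powr p)"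
  using Lp_on_integrable[OF assms] by (rule nn_integral_eq_integral) simp

lemma Lp_on_iff_nn_integral:
  assumes "f \<in> borel_measurable M"
  shows "Lp_on M p f \<longleftrightarrow> (\<integral>\<^sup>+x. ennreal (norm (f x) powr p) \<partial>M) < \<infinity>"
  using assms by (auto simp: Lp_on_def integrable_iff_bounded)

lemma Lp_on_fatou:
  fixes f :: "nat \<Rightarrow> 'm \<Rightarrow> 'v::euclidean_space"
  assumes Lp: "\<And>i. Lp_on M p (f i)" and p: "p > 0"
    and lim: "AE x in M. (\<lambda>i. f i x) \<longlonglongrightarrow> g x" and g: "g \<in> borel_measurable M"
    and bd: "eventually (\<lambda>i. (LINT x|M. norm (f i x) powr p) \<le> C) sequentially"
  shows "Lp_on M p g" "(LINT x|M. norm (g x) powr p) \<le> C"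
proof -
  have le: "(\<integral>\<^sup>+x. ennreal (norm (g x) powr p) \<partial>M) \<le> ennreal C"
  proof (rule nn_integral_fatou_bound)
    show "(\<lambda>x. ennreal (norm (f i x) powr p)) \<in> borel_measurable M" for i
      using Lp_on_measurable[OF Lp[of i]] by measurable
    show "AE x in M. (\<lambda>i. ennreal (norm (f i x) powr p)) \<longlonglongrightarrow> ennreal (norm (g x) powr p)"
      using lim
    proof eventually_elim
      case (elim x)
      show ?case by (intro tendsto_ennrealI tendsto_powr' tendsto_norm elim tendsto_const) (use p in auto)
    qed
    show "eventually (\<lambda>i. (\<integral>\<^sup>+x. ennreal (norm (f i x) powr p) \<partial>M) \<le> ennreal C) sequentially"
      using bd by eventually_elim (simp add: Lp_on_nn_integral[OF Lp] ennreal_leI)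
  qed
  then show Lpg: "Lp_on M p g"
    unfolding Lp_on_iff_nn_integral[OF g] by (rule le_less_trans) simp
  from bd obtain i where "(LINT x|M. norm (f i x) powr p) \<le> C" by (auto dest: eventually_happens)
  moreover have "0 \<le> (LINT x|M. norm (f i x) powr p)" by simp
  ultimately have "C \<ge> 0" by linarith
  then show "(LINT x|M. norm (g x) powr p) \<le> C"
    using le unfolding Lp_on_nn_integral[OF Lpg] by (simp add: ennreal_le_iff)
qed

text \<open>Below \<eta> this is trivial; above \<eta> one writes x = x^(1 - p) x^p, where the first
  factor decreases in x.\<close>

lemma le_eps_powr:
  fixes x :: real
  assumes "x \<ge> 0" "\<eta> > 0" "p \<ge> 1"
  shows "x \<le> \<eta> + \<eta> powr (1 - p) * x powr p"
proof (cases "x \<le> \<eta>")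
  case True
  then show ?thesis by (intro order_trans[OF True]) simp
next
  case False
  then have x: "x > 0" using assms by simp
  have "x = x powr (1 - p) * x powr p" using x by (simp flip: powr_add)
  also have "\<dots> \<le> \<eta> powr (1 - p) * x powr p"
    using False assms by (intro mult_right_mono powr_mono2') auto
  finally show ?thesis using assms by linarith
qed

text \<open>It takes the place of Hoelder's inequality on a ball: a small \<eta> makes the volume
  term small, and then a small L^p norm makes the second term small.\<close>

lemma Lp_bounded_support_L1:
  fixes f :: "'a::euclidean_space \<Rightarrow> 'v::euclidean_space"
  assumes f: "Lp_on lebesgue p f" and p: "p \<ge> 1" and supp: "\<And>x. r \<le> norm x \<Longrightarrow> f x = 0"
  shows "integrable lebesgue f"
    "\<eta> > 0 \<Longrightarrow> (LINT x|lebesgue. norm (f x)) \<le> \<eta> * measure lebesgue (cball (0::'a) r) + \<eta> powr (1 - p) * (LINT x|lebesgue. norm (f x) powr p)"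
proof -
  have icb: "integrable lebesgue (indicator (cball (0::'a) r) :: 'a \<Rightarrow> real)"
    using emeasure_bounded_finite[of "cball (0::'a) r"] by (intro integrable_real_indicator) auto
  have bd: "norm (f x) \<le> \<eta> * indicator (cball 0 r) x + \<eta> powr (1 - p) * norm (f x) powr p" if "\<eta> > 0" for x \<eta>
    using le_eps_powr[OF norm_ge_zero[of "f x"] that p] supp[of x] by (cases "r \<le> norm x") (auto simp: indicator_def)
  have ib: "integrable lebesgue (\<lambda>x. \<eta> * indicator (cball 0 r) x + \<eta> powr (1 - p) * norm (f x) powr p)" for \<eta>
    using icb Lp_on_integrable[OF f] by auto
  show i: "integrable lebesgue f"
    by (rule Bochner_Integration.integrable_bound[OF ib[of 1] Lp_on_measurable[OF f]])
      (use bd[of 1] in \<open>auto intro!: AE_I2 order_trans[OF _ abs_ge_self]\<close>)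
  assume \<eta>: "\<eta> > 0"
  have "(LINT x|lebesgue. norm (f x)) \<le> (LINT x|lebesgue. \<eta> * indicator (cball 0 r) x + \<eta> powr (1 - p) * norm (f x) powr p)"
    using i by (intro integral_mono ib bd \<eta>) auto
  also have "\<dots> = \<eta> * measure lebesgue (cball (0::'a) r) + \<eta> powr (1 - p) * (LINT x|lebesgue. norm (f x) powr p)"
    using icb Lp_on_integrable[OF f] by simp
  finally show "(LINT x|lebesgue. norm (f x)) \<le> \<eta> * measure lebesgue (cball (0::'a) r) + \<eta> powr (1 - p) * (LINT x|lebesgue. norm (f x) powr p)" .
qed

lemma L1_small_if_Lp_small:
  fixes r p e :: real
  assumes p: "p \<ge> 1" and e: "e > 0"
  shows "\<exists>d>0. \<forall>f::'a::euclidean_space \<Rightarrow> 'v::euclidean_space. Lp_on lebesgue p f \<longrightarrow> (\<forall>x. r \<le> norm x \<longrightarrow> f x = 0) \<longrightarrow>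
     (LINT x|lebesgue. norm (f x) powr p) < d \<longrightarrow> (LINT x|lebesgue. norm (f x)) < e"
proof -
  define V where "V = measure lebesgue (cball (0::'a) r)"
  have V: "V \<ge> 0" by (simp add: V_def)
  \<comment> \<open>Half of \<open>e\<close> pays for the volume term; \<open>V + 1\<close> keeps
    the denominator positive.\<close>
  define \<eta> where "\<eta> = e / (2 * (V + 1))"
  have \<eta>: "\<eta> > 0" "\<eta> * V < e / 2" using e V by (auto simp: \<eta>_def field_simps)
  define d where "d = e / 2 * \<eta> powr (p - 1)"
  have d: "d > 0" using e \<eta> by (simp add: d_def)
  have cd: "\<eta> powr (1 - p) * d = e / 2" using \<eta> by (simp add: d_def flip: powr_add)
  have "(LINT x|lebesgue. norm (f x)) < e"
    if f: "Lp_on lebesgue p f" "\<forall>x. r \<le> norm x \<longrightarrow> f x = 0" "(LINT x|lebesgue. norm (f x) powr p) < d" for f :: "'a \<Rightarrow> 'v"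
  proof -
    have "(LINT x|lebesgue. norm (f x)) \<le> \<eta> * V + \<eta> powr (1 - p) * (LINT x|lebesgue. norm (f x) powr p)"
      unfolding V_def using Lp_bounded_support_L1(2)[OF f(1) p, of r \<eta>] f(2) \<eta>(1) by blast
    also have "\<dots> \<le> \<eta> * V + \<eta> powr (1 - p) * d" using f(3) by (intro add_left_mono mult_left_mono) auto
    finally show ?thesis using \<eta>(2) cd by linarith
  qed
  then show ?thesis using d by blast
qed

text \<open>On a fixed ball an L^p Cauchy sequence is Cauchy in L^1 and has a subsequence converging
  almost everywhere. Fatou then turns the Cauchy estimates into estimates of the distance to the
  limit.\<close>

lemma Lp_Cauchy_limit:
  fixes f :: "nat \<Rightarrow> 'a::euclidean_space \<Rightarrow> 'v::euclidean_space"
  assumes Lp: "\<And>k. Lp_on lebesgue p (f k)" and p: "p \<ge> 1" and supp: "\<And>k x. r \<le> norm x \<Longrightarrow> f k x = 0"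
    and Cauchy: "\<And>e. e > 0 \<Longrightarrow> \<exists>K. \<forall>i\<ge>K. \<forall>j\<ge>K. (LINT x|lebesgue. norm (f i x - f j x) powr p) < e"
  obtains g \<sigma> where "strict_mono (\<sigma> :: nat \<Rightarrow> nat)" "g \<in> borel_measurable lebesgue" "\<And>x. r \<le> norm x \<Longrightarrow> g x = 0"
    "AE x in lebesgue. (\<lambda>i. f (\<sigma> i) x) \<longlonglongrightarrow> g x" "Lp_on lebesgue p g"
    "(\<lambda>k. LINT x|lebesgue. norm (f k x - g x) powr p) \<longlonglongrightarrow> 0"
proof -
  have Lpd: "Lp_on lebesgue p (\<lambda>x. f i x - f j x)" for i j
    using Lp_on_lincomb[OF p Lp[of i] Lp[of j], of 1 "-1"] by simp
  have C1: "\<exists>N. \<forall>i\<ge>N. \<forall>j\<ge>N. (LINT x|lebesgue. norm (f i x - f j x)) < e" if e: "e > 0" for e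
  proof -
    obtain d where d: "d > 0" "\<And>h::'a \<Rightarrow> 'v. Lp_on lebesgue p h \<Longrightarrow> (\<And>x. r \<le> norm x \<Longrightarrow> h x = 0) \<Longrightarrow>
     (LINT x|lebesgue. norm (h x) powr p) < d \<Longrightarrow> (LINT x|lebesgue. norm (h x)) < e"
      using L1_small_if_Lp_small[OF p e, of r, where 'a='a and 'v='v] by blast
    obtain K where "\<forall>i\<ge>K. \<forall>j\<ge>K. (LINT x|lebesgue. norm (f i x - f j x) powr p) < d"
      using Cauchy[OF d(1)] by blast
    then show ?thesis using d(2)[OF Lpd] supp by (intro exI[of _ K]) auto
  qed
  have iL1: "integrable lebesgue (f k)" for k
    by (rule Lp_bounded_support_L1(1)[OF Lp p, of r]) (rule supp)
  obtain \<sigma> where \<sigma>: "strict_mono \<sigma>" "AE x in lebesgue. Cauchy (\<lambda>i. f (\<sigma> i) x)"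
    by (rule cauchy_L1_AE_cauchy_subseq[of lebesgue f, OF iL1 C1])
  \<comment> \<open>Setting the limit to 0 beyond radius \<open>r\<close> makes its support
    condition hold at every point, not only almost everywhere.\<close>
  define g where "g x = (if r \<le> norm x then 0 else lim (\<lambda>i. f (\<sigma> i) x))" for x
  have g0: "g x = 0" if "r \<le> norm x" for x using that by (simp add: g_def)
  have gm: "g \<in> borel_measurable lebesgue"
    unfolding g_def
  proof (intro measurable_If borel_measurable_lim_metric Lp_on_measurable[OF Lp])
    have "{x::'a. r \<le> norm x} \<in> sets borel" by measurable
    then show "{x \<in> space lebesgue. r \<le> norm (x::'a)} \<in> sets lebesgue" by simp
  qed simp
  have lim: "AE x in lebesgue. (\<lambda>i. f (\<sigma> i) x) \<longlonglongrightarrow> g x"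
    using \<sigma>(2)
  proof eventually_elim
    case (elim x)
    show ?case
    proof (cases "r \<le> norm x")
      case True then show ?thesis using supp g0 by simp
    next
      case False
      then show ?thesis using elim by (simp add: g_def Cauchy_convergent_iff convergent_LIMSEQ_iff)
    qed
  qed
  have close: "Lp_on lebesgue p (\<lambda>x. f k x - g x) \<and> (LINT x|lebesgue. norm (f k x - g x) powr p) \<le> e"
    if K: "\<forall>i\<ge>K. \<forall>j\<ge>K. (LINT x|lebesgue. norm (f i x - f j x) powr p) < e" "k \<ge> K" for e K k
  proof -
    have a: "AE x in lebesgue. (\<lambda>i. f k x - f (\<sigma> i) x) \<longlonglongrightarrow> f k x - g x"
      using lim by eventually_elim (intro tendsto_intros)
    have b: "(\<lambda>x. f k x - g x) \<in> borel_measurable lebesgue"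
      by (intro borel_measurable_diff Lp_on_measurable[OF Lp] gm)
    have c: "eventually (\<lambda>i. (LINT x|lebesgue. norm (f k x - f (\<sigma> i) x) powr p) \<le> e) sequentially"
    proof (rule eventually_sequentiallyI[of K])
      fix i assume "K \<le> i"
      then have "\<sigma> i \<ge> K" using seq_suble[OF \<sigma>(1), of i] by linarith
      then show "(LINT x|lebesgue. norm (f k x - f (\<sigma> i) x) powr p) \<le> e" using K by (auto intro: less_imp_le)
    qed
    show ?thesis using Lp_on_fatou[OF Lpd _ a b c] p by auto
  qed
  obtain K where "\<forall>i\<ge>K. \<forall>j\<ge>K. (LINT x|lebesgue. norm (f i x - f j x) powr p) < 1" using Cauchy[of 1] by auto
  from close[OF this, of K] have "Lp_on lebesgue p (\<lambda>x. f K x - g x)" by simp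
  from Lp_on_lincomb[OF p Lp[of K] this, of 1 "-1"] have Lpg: "Lp_on lebesgue p g" by simp
  have "(\<lambda>k. LINT x|lebesgue. norm (f k x - g x) powr p) \<longlonglongrightarrow> 0"
  proof (rule LIMSEQ_I)
    fix e :: real assume e: "e > 0"
    obtain K where K: "\<forall>i\<ge>K. \<forall>j\<ge>K. (LINT x|lebesgue. norm (f i x - f j x) powr p) < e / 2" using Cauchy[of "e/2"] e by auto
    show "\<exists>no. \<forall>n\<ge>no. norm ((LINT x|lebesgue. norm (f n x - g x) powr p) - 0) < e"
      using close[OF K] e by (intro exI[of _ K]) fastforce
  qed
  then show thesis using that \<sigma>(1) gm g0 lim Lpg by blast
qed

section \<open>The seminorms as functionals of power type\<close>

text \<open>The exceptional set is first enlarged to a Borel null set \<open>N\<close>; the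
  cylinders over \<open>N\<close> are then null for the product of the Borel measures, whose
  completion is Lebesgue measure on pairs.\<close>

lemma AE_lebesgue_fst_snd:
  assumes "AE x in lebesgue. P (x :: 'a::euclidean_space)"
  shows "AE z in (lebesgue :: ('a \<times> 'a) measure). P (fst z) \<and> P (snd z)"
proof -
  have "AE x in lborel. P x" using assms by (simp add: AE_lebesgue_iff)
  then obtain N where N: "N \<in> null_sets lborel" "{x \<in> space lborel. \<not> P x} \<subseteq> N"
    unfolding eventually_ae_filter by auto
  have Ns: "N \<in> sets lborel" "emeasure lborel N = 0" using N(1) by auto
  have U: "(UNIV :: 'a set) \<in> sets lborel" by simp
  define A B where "A = N \<times> (UNIV :: 'a set)" and "B = (UNIV :: 'a set) \<times> N"
  have "A \<in> null_sets (lborel \<Otimes>\<^sub>M lborel)"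
    unfolding A_def using lborel.emeasure_pair_measure_Times[OF Ns(1) U] Ns(2)
    by (intro null_setsI pair_measureI Ns(1) U) simp
  moreover have "B \<in> null_sets (lborel \<Otimes>\<^sub>M lborel)"
    unfolding B_def using lborel.emeasure_pair_measure_Times[OF U Ns(1)] Ns(2)
    by (intro null_setsI pair_measureI Ns(1) U) simp
  ultimately have "A \<union> B \<in> null_sets (lborel \<Otimes>\<^sub>M lborel)" by (rule null_sets.Un)
  then have "A \<union> B \<in> null_sets lborel" unfolding lborel_prod .
  moreover have "{z \<in> space (lborel :: ('a \<times> 'a) measure). \<not> (P (fst z) \<and> P (snd z))} \<subseteq> A \<union> B"
    using N(2) by (force simp: A_def B_def)
  ultimately have "AE z in (lborel :: ('a \<times> 'a) measure). P (fst z) \<and> P (snd z)"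
    unfolding eventually_ae_filter by blast
  then show ?thesis by (simp add: AE_lebesgue_iff)
qed

lemma lebesgue_measurable_borel_rep:
  assumes "u \<in> borel_measurable lebesgue"
  obtains g :: "'a::euclidean_space \<Rightarrow> real" where "g \<in> borel_measurable borel" "AE x in lebesgue. u x = g x"
proof -
  obtain g where "g \<in> borel_measurable lborel" "AE x in lborel. u x = g x"
    using completion_ex_borel_measurable_real[OF assms] by blast
  then show thesis by (intro that[of g]) (simp_all add: AE_lebesgue_iff)
qed

lemma borel_measurable_fst_snd:
  fixes g :: "'a::euclidean_space \<Rightarrow> 'b::topological_space"
  assumes "g \<in> borel_measurable borel"
  shows "(\<lambda>z::'a\<times>'a. g (fst z)) \<in> borel_measurable borel" "(\<lambda>z::'a\<times>'a. g (snd z)) \<in> borel_measurable borel"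
proof -
  have "fst \<in> borel_measurable (borel :: ('a\<times>'a) measure)" "snd \<in> borel_measurable (borel :: ('a\<times>'a) measure)"
    by (intro borel_measurable_continuous_onI continuous_intros)+
  then show "(\<lambda>z::'a\<times>'a. g (fst z)) \<in> borel_measurable borel" "(\<lambda>z::'a\<times>'a. g (snd z)) \<in> borel_measurable borel"
    using measurable_compose assms by blast+
qed

text \<open>Composition of a Lebesgue measurable function with a projection goes through a Borel
  representative, which changes the difference only on a null set of pairs.\<close>

lemma lebesgue_measurable_difference:
  fixes u :: "'a::euclidean_space \<Rightarrow> real"
  assumes "u \<in> borel_measurable lebesgue"
  shows "(\<lambda>z::'a\<times>'a. u (fst z) - u (snd z)) \<in> borel_measurable lebesgue"
proof -
  obtain g where g: "g \<in> borel_measurable borel" "AE x in lebesgue. u x = g x"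
    using lebesgue_measurable_borel_rep[OF assms] by blast
  have "(\<lambda>z::'a\<times>'a. g (fst z) - g (snd z)) \<in> borel_measurable lebesgue"
    by (intro borel_imp_lebesgue_measurable borel_measurable_diff borel_measurable_fst_snd g)
  moreover have "AE z in (lebesgue :: ('a\<times>'a) measure). g (fst z) - g (snd z) = u (fst z) - u (snd z)"
    using AE_lebesgue_fst_snd[OF g(2)] by eventually_elim simp
  ultimately show ?thesis by (rule borel_measurable_AE)
qed

definition Phi :: "real \<Rightarrow> real \<Rightarrow> (real^'n \<Rightarrow> real) \<Rightarrow> real" where
  "Phi s p u = seminorm s p u powr p"

text \<open>The domain on which \<open>Phi\<close> has its intended meaning; where the integral
  diverges, the Bochner integral is 0 by convention.\<close>

definition finite_set :: "real \<Rightarrow> real \<Rightarrow> (real^'n \<Rightarrow> real) set" where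
  "finite_set s p = {u \<in> borel_measurable lebesgue. seminorm_finite s p u}"

text \<open>With the kernel absorbed into the function, the fractional seminorm becomes an
  unweighted $L^p$ norm.\<close>

definition frac_weight :: "real \<Rightarrow> real \<Rightarrow> (real^'n) \<times> (real^'n) \<Rightarrow> real" where
  "frac_weight s p z = c_const (real CARD('n)) s p / norm (fst z - snd z) powr (real CARD('n) + s * p)"

definition frac_diff :: "real \<Rightarrow> real \<Rightarrow> (real^'n \<Rightarrow> real) \<Rightarrow> (real^'n) \<times> (real^'n) \<Rightarrow> real" where
  "frac_diff s p u z = frac_weight s p z powr (1 / p) * (u (fst z) - u (snd z))"

lemma powr_inverse_powr: "0 \<le> (a::real) \<Longrightarrow> p > 0 \<Longrightarrow> (a powr (1 / p)) powr p = a"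
  by (simp add: powr_powr)

lemma Phi_0: "p > 0 \<Longrightarrow> Phi 0 p u = (LINT x|lebesgue. norm (u x) powr p)"
  by (simp add: Phi_def seminorm_def powr_powr)

lemma Phi_1: "p > 0 \<Longrightarrow> Phi 1 p u = (LINT x|lebesgue. norm (weak_gradient u x) powr p)"
  by (simp add: Phi_def seminorm_def powr_powr)

lemma frac_weight_nonneg:
  assumes "CARD('n) \<ge> 2" "s \<in> {0<..<1}" "p \<in> {1<..<real CARD('n)}"
  shows "frac_weight s p (z :: (real^'n) \<times> (real^'n)) \<ge> 0"
  using c_const_pos[of "real CARD('n)" s p] assms by (simp add: frac_weight_def)

lemma frac_diff_powr:
  assumes "CARD('n) \<ge> 2" "s \<in> {0<..<1}" "p \<in> {1<..<real CARD('n)}"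
  shows "norm (frac_diff s p u (z :: (real^'n) \<times> (real^'n))) powr p =
    c_const (real CARD('n)) s p * (\<bar>u (fst z) - u (snd z)\<bar> powr p / norm (fst z - snd z) powr (real CARD('n) + s * p))"
proof -
  have "norm (frac_diff s p u z) powr p = (frac_weight s p z powr (1 / p)) powr p * \<bar>u (fst z) - u (snd z)\<bar> powr p"
    by (simp add: frac_diff_def abs_mult powr_mult)
  also have "(frac_weight s p z powr (1 / p)) powr p = frac_weight s p z"
    using assms frac_weight_nonneg[OF assms] by (intro powr_inverse_powr) auto
  finally show ?thesis by (simp add: frac_weight_def)
qed

lemma frac_diff_measurable:
  fixes u :: "real^'n \<Rightarrow> real"
  assumes "u \<in> borel_measurable lebesgue"
  shows "frac_diff s p u \<in> borel_measurable lebesgue"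
proof -
  have "(\<lambda>z::(real^'n) \<times> (real^'n). norm (fst z - snd z)) \<in> borel_measurable borel"
    by (intro borel_measurable_continuous_onI continuous_intros)
  then have "frac_weight s p \<in> borel_measurable (borel :: ((real^'n) \<times> (real^'n)) measure)"
    unfolding frac_weight_def[abs_def] by measurable
  then have "(\<lambda>z. frac_weight s p z powr (1 / p)) \<in> borel_measurable (lebesgue :: ((real^'n) \<times> (real^'n)) measure)"
    by (intro borel_imp_lebesgue_measurable) measurable
  then show ?thesis
    unfolding frac_diff_def[abs_def] by (intro borel_measurable_times lebesgue_measurable_difference assms)
qed

lemma Phi_frac:
  fixes u :: "real^'n \<Rightarrow> real"
  assumes "CARD('n) \<ge> 2" "s \<in> {0<..<1}" "p \<in> {1<..<real CARD('n)}"
  shows "Phi s p u = (LINT z|lebesgue. norm (frac_diff s p u z) powr p)"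
proof -
  have "c_const (real CARD('n)) s p \<ge> 0" using c_const_pos[of "real CARD('n)" s p] assms by auto
  then show ?thesis using assms unfolding frac_diff_powr[OF assms]
    by (simp add: Phi_def seminorm_def powr_powr case_prod_beta' del: times_divide_eq_right)
qed

lemma seminorm_finite_frac_iff:
  fixes u :: "real^'n \<Rightarrow> real"
  assumes a: "CARD('n) \<ge> 2" "s \<in> {0<..<1}" "p \<in> {1<..<real CARD('n)}" and u: "u \<in> borel_measurable lebesgue"
  shows "seminorm_finite s p u \<longleftrightarrow> Lp_on lebesgue p (frac_diff s p u)"
proof -
  have "c_const (real CARD('n)) s p \<noteq> 0" using c_const_pos[of "real CARD('n)" s p] a by auto
  then show ?thesis using a frac_diff_measurable[OF u]
    unfolding Lp_on_def frac_diff_powr[OF a]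
    by (simp add: seminorm_finite_def case_prod_beta' del: times_divide_eq_right)
qed

text \<open>\<open>P\<close> describes where the operator \<open>T\<close> makes sense:
  measurability, and for order 1 also the existence of a weak gradient.\<close>

lemma Lp_represents_subspaceI:
  assumes V: "\<And>u. u \<in> V \<longleftrightarrow> P u \<and> Lp_on M p (T u)" and p: "p \<ge> 1"
    and lin: "\<And>u v a b. P u \<Longrightarrow> P v \<Longrightarrow> P (\<lambda>x. a * u x + b * v x) \<and>
       T (\<lambda>x. a * u x + b * v x) \<in> borel_measurable M \<and> (AE x in M. T (\<lambda>x. a * u x + b * v x) x = a *\<^sub>R T u x + b *\<^sub>R T v x)"
    and zero: "(\<lambda>_. 0) \<in> V"
    and \<Phi>: "\<And>u. u \<in> V \<Longrightarrow> \<Phi> u = (LINT x|M. norm (T u x) powr p)"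
  shows "fun_subspace V" "Lp_represents M p V T \<Phi>"
proof -
  have "(\<lambda>x. a * u x + b * v x) \<in> V" if "u \<in> V" "v \<in> V" for u v a b
  proof -
    have l: "P (\<lambda>x. a * u x + b * v x)" "T (\<lambda>x. a * u x + b * v x) \<in> borel_measurable M"
      "AE x in M. T (\<lambda>x. a * u x + b * v x) x = a *\<^sub>R T u x + b *\<^sub>R T v x"
      using lin[of u v a b] V that by auto
    have lp: "Lp_on M p (\<lambda>x. a *\<^sub>R T u x + b *\<^sub>R T v x)" using V that by (intro Lp_on_lincomb p) auto
    have ae: "AE x in M. a *\<^sub>R T u x + b *\<^sub>R T v x = T (\<lambda>x. a * u x + b * v x) x"
      using l(3) by eventually_elim simp
    have "Lp_on M p (T (\<lambda>x. a * u x + b * v x))" by (rule Lp_on_AE_cong(1)[OF lp l(2) ae])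
    then show ?thesis using V l by auto
  qed
  then show "fun_subspace V" using zero by (auto simp: fun_subspace_def)
  show "Lp_represents M p V T \<Phi>" unfolding Lp_represents_def using V \<Phi> lin by auto
qed

lemma finite_set_0:
  assumes p: "p \<ge> 1"
  shows "fun_subspace (finite_set 0 p :: (real^'n \<Rightarrow> real) set)"
    "Lp_represents lebesgue p (finite_set 0 p) (\<lambda>u::real^'n \<Rightarrow> real. u) (Phi 0 p)"
proof -
  have V: "u \<in> finite_set 0 p \<longleftrightarrow> u \<in> borel_measurable lebesgue \<and> Lp_on lebesgue p u" for u :: "real^'n \<Rightarrow> real"
    by (auto simp: finite_set_def seminorm_finite_def Lp_on_def)
  have *: "fun_subspace (finite_set 0 p :: (real^'n \<Rightarrow> real) set) \<and> Lp_represents lebesgue p (finite_set 0 p) (\<lambda>u::real^'n \<Rightarrow> real. u) (Phi 0 p)"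
  proof (intro conjI Lp_represents_subspaceI[OF V p])
    show "(\<lambda>_. 0) \<in> (finite_set 0 p :: (real^'n \<Rightarrow> real) set)" by (simp add: V Lp_on_def)
    then show "(\<lambda>_. 0) \<in> (finite_set 0 p :: (real^'n \<Rightarrow> real) set)" .
  qed (use p in \<open>auto simp: Phi_0\<close>)
  then show "fun_subspace (finite_set 0 p :: (real^'n \<Rightarrow> real) set)"
    "Lp_represents lebesgue p (finite_set 0 p) (\<lambda>u::real^'n \<Rightarrow> real. u) (Phi 0 p)" by auto
qed

lemma finite_set_frac:
  assumes a: "CARD('n) \<ge> 2" "s \<in> {0<..<1}" "p \<in> {1<..<real CARD('n)}"
  shows "fun_subspace (finite_set s p :: (real^'n \<Rightarrow> real) set)"
    "Lp_represents lebesgue p (finite_set s p) (frac_diff s p :: (real^'n \<Rightarrow> real) \<Rightarrow> _) (Phi s p)"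
proof -
  have V: "u \<in> finite_set s p \<longleftrightarrow> u \<in> borel_measurable lebesgue \<and> Lp_on lebesgue p (frac_diff s p u)" for u :: "real^'n \<Rightarrow> real"
    using seminorm_finite_frac_iff[OF a] by (auto simp: finite_set_def)
  have p: "p \<ge> 1" using a by auto
  have z: "(\<lambda>_. 0) \<in> (finite_set s p :: (real^'n \<Rightarrow> real) set)" by (simp add: V Lp_on_def frac_diff_def[abs_def])
  have l: "(\<lambda>x. c * u x + b * v x) \<in> borel_measurable lebesgue \<and>
       frac_diff s p (\<lambda>x. c * u x + b * v x) \<in> borel_measurable lebesgue \<and>
       (AE x in lebesgue. frac_diff s p (\<lambda>x. c * u x + b * v x) x = c *\<^sub>R frac_diff s p u x + b *\<^sub>R frac_diff s p v x)"
    if uv: "u \<in> borel_measurable lebesgue" "v \<in> borel_measurable lebesgue" for u v :: "real^'n \<Rightarrow> real" and c b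
  proof -
    have m: "(\<lambda>x. c * u x + b * v x) \<in> borel_measurable lebesgue" using uv by measurable
    show ?thesis using m frac_diff_measurable[OF m] by (auto simp: frac_diff_def algebra_simps)
  qed
  show "fun_subspace (finite_set s p :: (real^'n \<Rightarrow> real) set)"
    by (rule Lp_represents_subspaceI(1)[OF V p l z Phi_frac[OF a]])
  show "Lp_represents lebesgue p (finite_set s p) (frac_diff s p :: (real^'n \<Rightarrow> real) \<Rightarrow> _) (Phi s p)"
    by (rule Lp_represents_subspaceI(2)[OF V p l z Phi_frac[OF a]])
qed

lemma weak_gradient_lincomb_AE:
  assumes "\<exists>G. has_weak_gradient u G" "\<exists>G. has_weak_gradient v G"
  shows "has_weak_gradient (\<lambda>x. a * u x + b * v x) (weak_gradient (\<lambda>x. a * u x + b * v x))"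
    "AE x in lebesgue. weak_gradient (\<lambda>x. a * u x + b * v x) x = a *\<^sub>R weak_gradient u x + b *\<^sub>R weak_gradient v x"
proof -
  have "has_weak_gradient (\<lambda>x. a * u x + b * v x) (\<lambda>x. a *\<^sub>R weak_gradient u x + b *\<^sub>R weak_gradient v x)"
    using assms by (auto intro!: has_weak_gradient_lincomb weak_gradient_AE(1))
  from weak_gradient_AE[OF this] 
  show "has_weak_gradient (\<lambda>x. a * u x + b * v x) (weak_gradient (\<lambda>x. a * u x + b * v x))"
    "AE x in lebesgue. weak_gradient (\<lambda>x. a * u x + b * v x) x = a *\<^sub>R weak_gradient u x + b *\<^sub>R weak_gradient v x" by auto
qed

lemma finite_set_1:
  assumes p: "p \<ge> 1"
  shows "fun_subspace (finite_set 1 p :: (real^'n \<Rightarrow> real) set)"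
    "Lp_represents lebesgue p (finite_set 1 p) (weak_gradient :: (real^'n \<Rightarrow> real) \<Rightarrow> _) (Phi 1 p)"
proof -
  have V: "u \<in> finite_set 1 p \<longleftrightarrow> (u \<in> borel_measurable lebesgue \<and> (\<exists>G. has_weak_gradient u G)) \<and> Lp_on lebesgue p (weak_gradient u)"
    for u :: "real^'n \<Rightarrow> real"
    using locally_integrable_measurable[OF has_weak_gradientD(2)[OF weak_gradient_AE(1)]]
    by (auto simp: finite_set_def seminorm_finite_def Lp_on_def)
  \<comment> \<open>Even for the zero function the chosen weak gradient is known only almost
    everywhere.\<close>
  have z: "(\<lambda>_. 0) \<in> (finite_set 1 p :: (real^'n \<Rightarrow> real) set)"
  proof -
    have g: "has_weak_gradient (\<lambda>_::real^'n. 0) (grad (\<lambda>_. 0))"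
      by (rule has_weak_gradient_test[OF test_functions_0[of UNIV]])
    have "grad (\<lambda>_::real^'n. 0) = (\<lambda>_. 0)"
      using grad_outside[OF test_functions_0[of "{}"]] by auto
    then have "AE x in lebesgue. weak_gradient (\<lambda>_::real^'n. 0) x = 0" using weak_gradient_AE(2)[OF g] by simp
    then have ae: "AE x in lebesgue. 0 = weak_gradient (\<lambda>_::real^'n. 0) x" by eventually_elim simp
    have me: "weak_gradient (\<lambda>_::real^'n. 0) \<in> borel_measurable lebesgue"
      using locally_integrable_measurable[OF has_weak_gradientD(2)[OF weak_gradient_AE(1)[OF g]]] .
    have lp: "Lp_on lebesgue p (\<lambda>_::real^'n. 0::real^'n)" by (simp add: Lp_on_def)
    have "Lp_on lebesgue p (weak_gradient (\<lambda>_::real^'n. 0))"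
      by (rule Lp_on_AE_cong(1)[OF lp me ae])
    then show ?thesis using g V by auto
  qed
  have l: "((\<lambda>x. a * u x + b * v x) \<in> borel_measurable lebesgue \<and> (\<exists>G. has_weak_gradient (\<lambda>x. a * u x + b * v x) G)) \<and>
       weak_gradient (\<lambda>x. a * u x + b * v x) \<in> borel_measurable lebesgue \<and>
       (AE x in lebesgue. weak_gradient (\<lambda>x. a * u x + b * v x) x = a *\<^sub>R weak_gradient u x + b *\<^sub>R weak_gradient v x)"
    if uv: "u \<in> borel_measurable lebesgue \<and> (\<exists>G. has_weak_gradient u G)" "v \<in> borel_measurable lebesgue \<and> (\<exists>G. has_weak_gradient v G)"
    for u v :: "real^'n \<Rightarrow> real" and a b
  proof -
    note w = weak_gradient_lincomb_AE[of u v a b]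
    have m: "(\<lambda>x. a * u x + b * v x) \<in> borel_measurable lebesgue" using uv by (intro borel_measurable_add borel_measurable_times borel_measurable_const) auto
    have "weak_gradient (\<lambda>x. a * u x + b * v x) \<in> borel_measurable lebesgue"
      using locally_integrable_measurable[OF has_weak_gradientD(2)[OF w(1)]] uv by blast
    then show ?thesis using m w uv by blast
  qed
  have p': "p > 0" using p by simp
  show "fun_subspace (finite_set 1 p :: (real^'n \<Rightarrow> real) set)"
    by (rule Lp_represents_subspaceI(1)[OF V p l z Phi_1[OF p']])
  show "Lp_represents lebesgue p (finite_set 1 p) (weak_gradient :: (real^'n \<Rightarrow> real) \<Rightarrow> _) (Phi 1 p)"
    by (rule Lp_represents_subspaceI(2)[OF V p l z Phi_1[OF p']])
qed

lemma order_cases: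
  assumes "s \<in> {0..1::real}" obtains "s = 0" | "s \<in> {0<..<1}" | "s = 1"
  using assms that by (cases "s = 0"; cases "s = 1") auto

theorem finite_set_properties:
  assumes a: "CARD('n) \<ge> 2" "s \<in> {0..1}" "p \<in> {1<..<real CARD('n)}"
  shows "fun_subspace (finite_set s p :: (real^'n \<Rightarrow> real) set)"
    "power_functional p (finite_set s p) (Phi s p :: (real^'n \<Rightarrow> real) \<Rightarrow> real)"
    "uniformly_convex_functional (finite_set s p) (Phi s p :: (real^'n \<Rightarrow> real) \<Rightarrow> real)"
proof -
  have p: "p > 1" "p \<ge> 1" using a by auto
  have "fun_subspace (finite_set s p :: (real^'n \<Rightarrow> real) set) \<and>
    power_functional p (finite_set s p) (Phi s p :: (real^'n \<Rightarrow> real) \<Rightarrow> real) \<and>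
    uniformly_convex_functional (finite_set s p) (Phi s p :: (real^'n \<Rightarrow> real) \<Rightarrow> real)"
    using a(2)
  proof (cases rule: order_cases)
    case 1
    note f = finite_set_0[OF p(2), where 'n='n]
    show ?thesis using f(1) Lp_represents_power_functional[OF f(2,1) p(2)] Lp_represents_uniformly_convex[OF f(2,1) p(1)] 1 by blast
  next
    case 2
    note f = finite_set_frac[OF a(1) 2 a(3)]
    show ?thesis using f(1) Lp_represents_power_functional[OF f(2,1) p(2)] Lp_represents_uniformly_convex[OF f(2,1) p(1)] by blast
  next
    case 3
    note f = finite_set_1[OF p(2), where 'n='n]
    show ?thesis using f(1) Lp_represents_power_functional[OF f(2,1) p(2)] Lp_represents_uniformly_convex[OF f(2,1) p(1)] 3 by blast
  qed
  then show "fun_subspace (finite_set s p :: (real^'n \<Rightarrow> real) set)"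
    "power_functional p (finite_set s p) (Phi s p :: (real^'n \<Rightarrow> real) \<Rightarrow> real)"
    "uniformly_convex_functional (finite_set s p) (Phi s p :: (real^'n \<Rightarrow> real) \<Rightarrow> real)" by auto
qed

lemma integral_lebesgue_on_eq:
  fixes f :: "'a::euclidean_space \<Rightarrow> real"
  assumes "\<Omega> \<in> sets lebesgue" "f \<in> borel_measurable lebesgue" "AE x in lebesgue. x \<notin> \<Omega> \<longrightarrow> f x = 0"
  shows "(LINT x|lebesgue_on \<Omega>. f x) = (LINT x|lebesgue. f x)"
proof -
  have "(LINT x|lebesgue_on \<Omega>. f x) = (LINT x|lebesgue. indicator \<Omega> x *\<^sub>R f x)"
    using assms(1) by (intro integral_restrict_space) simp
  also have "\<dots> = (LINT x|lebesgue. f x)"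
  proof (rule integral_cong_AE)
    show "AE x in lebesgue. indicator \<Omega> x *\<^sub>R f x = f x"
      using assms(3) by eventually_elim (auto simp: indicator_def)
    show "(\<lambda>x. indicator \<Omega> x *\<^sub>R f x) \<in> borel_measurable lebesgue"
      by (intro borel_measurable_scaleR borel_measurable_indicator assms)
  qed (rule assms)
  finally show ?thesis .
qed

text \<open>\<open>E_form\<close> carries the factor 1/2, which explains 2 p. For the orders 0 and 1
  it integrates over \<Omega>, while \<open>Phi\<close> integrates over the whole space; the two
  vanishing assumptions reconcile them.\<close>

theorem Phi_has_derivative:
  fixes u v :: "real^'n \<Rightarrow> real"
  assumes a: "CARD('n) \<ge> 2" "s \<in> {0..1}" "p \<in> {1<..<real CARD('n)}"
    and uv: "u \<in> finite_set s p" "v \<in> finite_set s p" and \<Omega>: "\<Omega> \<in> sets lebesgue"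
    and u0: "AE x in lebesgue. x \<notin> \<Omega> \<longrightarrow> u x = 0"
    and g0: "s = 1 \<Longrightarrow> AE x in lebesgue. x \<notin> \<Omega> \<longrightarrow> weak_gradient u x = 0"
  shows "((\<lambda>t. Phi s p (\<lambda>x. u x + t * v x)) has_real_derivative (2 * p * E_form \<Omega> s p u v)) (at 0)"
proof -
  have p: "p > 1" "p \<ge> 1" using a by auto
  show ?thesis using a(2)
  proof (cases rule: order_cases)
    case 1
    note f = finite_set_0[OF p(2), where 'n='n]
    have [measurable]: "u \<in> borel_measurable lebesgue" "v \<in> borel_measurable lebesgue" using uv by (auto simp: finite_set_def)
    have "E_form \<Omega> s p u v = 1 / 2 * (LINT x|lebesgue. \<bar>u x\<bar> powr (p - 2) * u x * v x)"
      unfolding E_form_def using 1 u0 by (simp, intro integral_lebesgue_on_eq \<Omega>) (auto elim: eventually_mono)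
    then have E: "2 * p * E_form \<Omega> s p u v = p * (LINT x|lebesgue. norm (u x) powr (p - 2) * (u x \<bullet> v x))"
      by (simp add: mult.assoc)
    have uv0: "u \<in> finite_set 0 p" "v \<in> finite_set 0 p" using uv 1 by auto
    show ?thesis unfolding E unfolding 1 by (rule Lp_represents_has_derivative[OF f(2,1) p(1) uv0])
  next
    case 2
    note f = finite_set_frac[OF a(1) 2 a(3)]
    have D: "((\<lambda>t. Phi s p (\<lambda>x. u x + t * v x)) has_real_derivative
     (p * (LINT x|lebesgue. norm (frac_diff s p u x) powr (p - 2) * (frac_diff s p u x \<bullet> frac_diff s p v x)))) (at 0)"
      by (rule Lp_represents_has_derivative[OF f(2,1) p(1) uv])
    have pt: "norm (frac_diff s p u z) powr (p - 2) * (frac_diff s p u z \<bullet> frac_diff s p v z) =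
      c_const (real CARD('n)) s p * (case z of (x, y) \<Rightarrow> \<bar>u x - u y\<bar> powr (p - 2) * (u x - u y) * (v x - v y)
             / norm (x - y) powr (real CARD('n) + s * p))" for z
    proof -
      define w where "w = frac_weight s p z powr (1 / p)"
      have w: "w \<ge> 0" "w powr p = frac_weight s p z"
        unfolding w_def using p powr_inverse_powr[OF frac_weight_nonneg[OF a(1) 2 a(3), of z], of p] by auto
      have "\<bar>w * A\<bar> powr (p - 2) * ((w * A) * (w * B)) = w powr p * (\<bar>A\<bar> powr (p - 2) * A * B)" for A B
      \<comment> \<open>The weight vanishes on the diagonal, where division by 0 gives 0.\<close>
      proof (cases "w = 0")
        case False
        then have "w powr p = w powr (p - 2) * (w * w)" using w by (simp add: powr_diff power2_eq_square)
        then show ?thesis using w(1) by (simp add: abs_mult powr_mult)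
      qed simp
      from this[of "u (fst z) - u (snd z)" "v (fst z) - v (snd z)"] show ?thesis
        unfolding frac_diff_def w_def[symmetric] w(2) by (simp add: frac_weight_def case_prod_beta)
    qed
    show ?thesis using D 2 unfolding pt by (simp add: E_form_def mult.assoc)
  next
    case 3
    note f = finite_set_1[OF p(2), where 'n='n]
    have uv1: "u \<in> finite_set 1 p" "v \<in> finite_set 1 p" using uv 3 by auto
    then have [measurable]: "weak_gradient u \<in> borel_measurable lebesgue" "weak_gradient v \<in> borel_measurable lebesgue"
      using f(2) by (auto simp: Lp_represents_def Lp_on_def)
    have "E_form \<Omega> s p u v = 1 / 2 * (LINT x|lebesgue. norm (weak_gradient u x) powr (p - 2) * (weak_gradient u x \<bullet> weak_gradient v x))"
      unfolding E_form_def using 3 g0 by (simp, intro integral_lebesgue_on_eq \<Omega>) (auto elim: eventually_mono)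
    then have E: "2 * p * E_form \<Omega> s p u v = p * (LINT x|lebesgue. norm (weak_gradient u x) powr (p - 2) * (weak_gradient u x \<bullet> weak_gradient v x))"
      by simp
    show ?thesis unfolding E unfolding 3 by (rule Lp_represents_has_derivative[OF f(2,1) p(1) uv1])
  qed
qed

section \<open>Uniform comparison of the seminorms\<close>

text \<open>The extended-valued form of \<open>Phi\<close> for orders below 1. One comparison in
  \<open>ennreal\<close> then gives both the finiteness of a lower order and its bound.\<close>

definition nn_Phi :: "real \<Rightarrow> real \<Rightarrow> (real^'n \<Rightarrow> real) \<Rightarrow> ennreal" where
  "nn_Phi s p u = (if s = 0 then (\<integral>\<^sup>+x. ennreal (norm (u x) powr p) \<partial>lebesgue)
     else (\<integral>\<^sup>+z. ennreal (norm (frac_diff s p u z) powr p) \<partial>lebesgue))"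

lemma nn_Phi_cong_AE:
  assumes "AE x in lebesgue. u x = v x"
  shows "nn_Phi s p u = nn_Phi s p v"
proof -
  have "AE z in lebesgue. frac_diff s p u z = frac_diff s p v z"
    using AE_lebesgue_fst_snd[OF assms] by eventually_elim (simp add: frac_diff_def)
  then have "(\<integral>\<^sup>+z. ennreal (norm (frac_diff s p u z) powr p) \<partial>lebesgue) = (\<integral>\<^sup>+z. ennreal (norm (frac_diff s p v z) powr p) \<partial>lebesgue)"
    by (intro nn_integral_cong_AE) (auto elim!: eventually_mono)
  moreover have "(\<integral>\<^sup>+x. ennreal (norm (u x) powr p) \<partial>lebesgue) = (\<integral>\<^sup>+x. ennreal (norm (v x) powr p) \<partial>lebesgue)"
    using assms by (intro nn_integral_cong_AE) (auto elim!: eventually_mono)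
  ultimately show ?thesis by (simp add: nn_Phi_def)
qed

lemma finite_set_iff_nn_Phi:
  fixes u :: "real^'n \<Rightarrow> real"
  assumes a: "CARD('n) \<ge> 2" "s \<in> {0..<1}" "p \<in> {1<..<real CARD('n)}"
  shows "u \<in> finite_set s p \<longleftrightarrow> u \<in> borel_measurable lebesgue \<and> nn_Phi s p u < \<infinity>"
    "u \<in> finite_set s p \<Longrightarrow> nn_Phi s p u = ennreal (Phi s p u)"
proof -
  have p: "p > 0" using a by auto
  have "(u \<in> finite_set s p \<longleftrightarrow> u \<in> borel_measurable lebesgue \<and> nn_Phi s p u < \<infinity>) \<and>
    (u \<in> finite_set s p \<longrightarrow> nn_Phi s p u = ennreal (Phi s p u))"
  proof (cases "s = 0")
    case True
    have "u \<in> finite_set s p \<longleftrightarrow> u \<in> borel_measurable lebesgue \<and> Lp_on lebesgue p u"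
      using True by (auto simp: finite_set_def seminorm_finite_def Lp_on_def)
    then show ?thesis using True Lp_on_iff_nn_integral[of u lebesgue p] Lp_on_nn_integral[of lebesgue p u] Phi_0[OF p, of u]
      by (auto simp: nn_Phi_def)
  next
    case False
    then have s: "s \<in> {0<..<1}" using a by auto
    have "u \<in> finite_set s p \<longleftrightarrow> u \<in> borel_measurable lebesgue \<and> Lp_on lebesgue p (frac_diff s p u)"
      using seminorm_finite_frac_iff[OF a(1) s a(3)] by (auto simp: finite_set_def)
    then show ?thesis using False Lp_on_iff_nn_integral[OF frac_diff_measurable, of u p s p] Lp_on_nn_integral[of lebesgue p "frac_diff s p u"] Phi_frac[OF a(1) s a(3), of u]
      by (auto simp: nn_Phi_def)
  qed
  then show "u \<in> finite_set s p \<longleftrightarrow> u \<in> borel_measurable lebesgue \<and> nn_Phi s p u < \<infinity>"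
    "u \<in> finite_set s p \<Longrightarrow> nn_Phi s p u = ennreal (Phi s p u)" by auto
qed

lemma nn_Phi_0_eq_pow_int:
  assumes [measurable]: "g \<in> borel_measurable borel" shows "nn_Phi 0 p g = pow_int p g"
  by (simp add: nn_Phi_def pow_int_def nn_integral_completion)

lemma nn_Phi_eq_gag:
  fixes g :: "real^'n \<Rightarrow> real"
  assumes a: "CARD('n) \<ge> 2" "s \<in> {0<..<1}" "p \<in> {1<..<real CARD('n)}" and g: "g \<in> borel_measurable borel"
  shows "nn_Phi s p g = ennreal (c_const (real CARD('n)) s p) * gag s p g"
proof -
  let ?F = "\<lambda>z. case z of (x, y) \<Rightarrow> \<bar>g x - g y\<bar> powr p / norm (x - y) powr (real DIM(real^'n) + s * p)"
  have c: "c_const (real CARD('n)) s p \<ge> 0" using c_const_pos[of "real CARD('n)" s p] a by auto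
  have m1: "(\<lambda>z::(real^'n) \<times> (real^'n). norm (fst z - snd z)) \<in> borel_measurable borel"
    by (intro borel_measurable_continuous_onI continuous_intros)
  note [measurable] = borel_measurable_fst_snd[OF g] m1
  have m: "?F \<in> borel_measurable borel" unfolding case_prod_beta' by measurable
  have "nn_Phi s p g = (\<integral>\<^sup>+z. ennreal (c_const (real CARD('n)) s p) * ennreal (?F z) \<partial>lebesgue)"
    using a c unfolding nn_Phi_def frac_diff_powr[OF a]
    by (simp add: ennreal_mult' case_prod_beta' del: times_divide_eq_right)
  also have "\<dots> = ennreal (c_const (real CARD('n)) s p) * (\<integral>\<^sup>+z. ennreal (?F z) \<partial>lebesgue)"
    by (rule nn_integral_cmult[OF measurable_compose[OF borel_imp_lebesgue_measurable[OF m] measurable_ennreal]])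
  also have "(\<integral>\<^sup>+z. ennreal (?F z) \<partial>lebesgue) = (\<integral>\<^sup>+z. ennreal (?F z) \<partial>(lborel \<Otimes>\<^sub>M lborel))"
    by (simp add: nn_integral_completion lborel_prod)
  also have "\<dots> = gag s p g" by (rule gag_eq_double_integral[OF g])
  finally show ?thesis .
qed

lemma ennreal_le_mult_mono:
  assumes "X \<le> ennreal a * Y" "a \<le> b" shows "X \<le> ennreal b * Y"
proof -
  have "ennreal a * Y \<le> ennreal b * Y" by (intro mult_right_mono ennreal_leI assms(2)) simp
  with assms(1) show ?thesis by (rule order_trans)
qed

text \<open>The two-sided bounds on the normalising constant translate the weight s (1 - s) of the
  energy estimates into the actual one. A single \<open>C\<close> has to serve all exponents and
  orders, because the threshold for \<gamma> is chosen before them.\<close>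

theorem seminorm_comparison:
  fixes R :: real
  assumes dim: "CARD('n) \<ge> 2" and R: "R \<ge> 1"
  shows "\<exists>C\<ge>1. (\<forall>q\<in>{1<..<real CARD('n)}. \<forall>S\<in>{0<..<1}. \<forall>t\<in>{0..S}. \<forall>u :: real^'n \<Rightarrow> real.
        u \<in> borel_measurable lebesgue \<longrightarrow> (AE x in lebesgue. R / 2 \<le> norm x \<longrightarrow> u x = 0) \<longrightarrow> nn_Phi t q u \<le> ennreal C * nn_Phi S q u) \<and>
     (\<forall>q\<in>{1<..<real CARD('n)}. \<forall>t\<in>{0..<1}. \<forall>\<phi>\<in>test_functions {x :: real^'n. norm x < R / 2}.
        nn_Phi t q \<phi> \<le> ennreal C * (\<integral>\<^sup>+x. ennreal (norm (grad \<phi> x) powr q) \<partial>lborel))"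
proof -
  obtain k K where k: "k > 0" "K > 0" and kK: "\<And>s p. s \<in> {0<..<1} \<Longrightarrow> p \<in> {1..real CARD('n)} \<Longrightarrow>
    k * (s * (1 - s)) \<le> c_const (real CARD('n)) s p \<and> c_const (real CARD('n)) s p \<le> K * (s * (1 - s))"
    using c_const_bounds[of "real CARD('n)"] dim by auto
  define gc where "gc = gag_const TYPE(real^'n) R"
  define \<omega> where "\<omega> = ring_measure TYPE(real^'n) R"
  define L where "L = real DIM(real^'n) / kappa TYPE(real^'n) R"
  define D where "D = (2 * R) powr real DIM(real^'n)"
  have kap: "kappa TYPE(real^'n) R > 0" by (rule kappa_pos) (use R in simp)
  have pos: "gc > 0" "\<omega> > 0" "L > 0" "D > 0"
    using kap ring_measure(2)[of R, where 'a="real^'n"] R by (auto simp: gc_def gag_const_def \<omega>_def L_def D_def)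
  \<comment> \<open>One summand for each case: positive \<open>t\<close> against \<open>S\<close>, t
    = 0 against \<open>S\<close>, t = 0 against the gradient, positive \<open>t\<close> against the
    gradient. The leading 1 gives \<open>C \<ge> 1\<close>.\<close>
  define C where "C = 1 + K * gc / k + L / (\<omega> * k) + D + K * (6 * \<omega> * D)"
  have C: "C \<ge> 1" "K * gc / k \<le> C" "L / (\<omega> * k) \<le> C" "D \<le> C" "K * (6 * \<omega> * D) \<le> C"
    using pos k by (auto simp: C_def intro!: add_nonneg_nonneg)
  have cS: "ennreal (S * (1 - S)) * X \<le> ennreal (1 / k) * (ennreal (c_const (real CARD('n)) S q) * X)"
    if "S \<in> {0<..<1}" "q \<in> {1<..<real CARD('n)}" for S q X
  proof -
    have "S * (1 - S) \<le> 1 / k * c_const (real CARD('n)) S q" using kK[of S q] that k by (simp add: field_simps)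
    then have "ennreal (S * (1 - S)) * X \<le> ennreal (1 / k * c_const (real CARD('n)) S q) * X"
      by (intro mult_right_mono ennreal_leI) auto
    then show ?thesis using k by (simp only: ennreal_mult' zero_le_divide_1_iff less_imp_le mult.assoc)
  qed
  have frac: "nn_Phi t q u \<le> ennreal C * nn_Phi S q u"
    if q: "q \<in> {1<..<real CARD('n)}" and S: "S \<in> {0<..<1}" and t: "t \<in> {0..S}" and u: "u \<in> borel_measurable lebesgue"
      and z: "AE x in lebesgue. R / 2 \<le> norm x \<longrightarrow> u x = 0" for q S t and u :: "real^'n \<Rightarrow> real"
  proof -
    obtain g0 where g0: "g0 \<in> borel_measurable borel" "AE x in lebesgue. u x = g0 x"
      using lebesgue_measurable_borel_rep[OF u] by blast
    \<comment> \<open>The energy estimates ask for a Borel function that vanishes at every point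
      beyond R / 2, so the representative is truncated.\<close>
    define g where "g x = (if R / 2 \<le> norm x then 0 else g0 x)" for x
    have g: "g \<in> borel_measurable borel" unfolding g_def using g0(1) by measurable
    have gz: "g x = 0" if "R / 2 \<le> norm x" for x using that by (simp add: g_def)
    have ae: "AE x in lebesgue. u x = g x" using g0(2) z by eventually_elim (auto simp: g_def)
    note q' = q[unfolded greaterThanLessThan_iff]
    have q1: "1 \<le> q" "q \<le> real DIM(real^'n)" using q by auto
    have S1: "0 < S" "S < 1" using S by auto
    define Y where "Y = ennreal (c_const (real CARD('n)) S q) * gag S q g"
    have YS: "nn_Phi S q u = Y" unfolding Y_def nn_Phi_cong_AE[OF ae] by (rule nn_Phi_eq_gag[OF dim S q g])
    show ?thesis
    proof (cases "t = 0")
      case True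
      have "ennreal \<omega> * pow_int q g \<le> ennreal L * (ennreal (S * (1 - S)) * gag S q g)"
        unfolding \<omega>_def L_def by (rule pow_int_le_gag[OF g q1 S1 R]) (rule gz)
      also have "\<dots> \<le> ennreal L * (ennreal (1 / k) * Y)" unfolding Y_def by (intro mult_left_mono cS S q) simp
      finally have "ennreal (1 / \<omega>) * (ennreal \<omega> * pow_int q g) \<le> ennreal (1 / \<omega>) * (ennreal L * (ennreal (1 / k) * Y))"
        by (rule mult_left_mono) simp
      also have "ennreal (1 / \<omega>) * (ennreal \<omega> * pow_int q g) = pow_int q g"
        using pos by (simp flip: mult.assoc ennreal_mult')
      also have "ennreal (1 / \<omega>) * (ennreal L * (ennreal (1 / k) * Y)) = ennreal (1 / \<omega> * (L * (1 / k))) * Y"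
        using pos k by (simp only: ennreal_mult' zero_le_divide_1_iff less_imp_le mult.assoc)
      finally have "pow_int q g \<le> ennreal (L / (\<omega> * k)) * Y" by simp
      then have "pow_int q g \<le> ennreal C * Y" using C(3) by (rule ennreal_le_mult_mono)
      then show ?thesis unfolding YS unfolding True nn_Phi_cong_AE[OF ae] nn_Phi_0_eq_pow_int[OF g] .
    next
      case False
      then have t1: "0 < t" "t \<le> S" "t \<in> {0<..<1}" using t S by auto
      have "nn_Phi t q u = ennreal (c_const (real CARD('n)) t q) * gag t q g"
        unfolding nn_Phi_cong_AE[OF ae] by (rule nn_Phi_eq_gag[OF dim t1(3) q g])
      also have "\<dots> \<le> ennreal (K * (t * (1 - t))) * gag t q g"
        using kK[of t q] t1 q by (intro mult_right_mono ennreal_leI) auto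
      also have "\<dots> = ennreal K * (ennreal (t * (1 - t)) * gag t q g)" using k by (simp add: ennreal_mult' mult.assoc)
      also have "\<dots> \<le> ennreal K * (ennreal gc * (ennreal (S * (1 - S)) * gag S q g))"
        unfolding gc_def by (intro mult_left_mono gag_mono[OF g q1 t1(1,2) S1(2) R] gz) auto
      also have "\<dots> \<le> ennreal K * (ennreal gc * (ennreal (1 / k) * Y))"
        unfolding Y_def by (intro mult_left_mono cS S q) auto
      also have "\<dots> = ennreal (K * (gc * (1 / k))) * Y"
        using pos k by (simp only: ennreal_mult' zero_le_divide_1_iff less_imp_le mult.assoc)
      finally have "nn_Phi t q u \<le> ennreal (K * gc / k) * Y" by simp
      then have "nn_Phi t q u \<le> ennreal C * Y" using C(2) by (rule ennreal_le_mult_mono)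
      then show ?thesis unfolding YS .
    qed
  qed
  have test: "nn_Phi t q \<phi> \<le> ennreal C * (\<integral>\<^sup>+x. ennreal (norm (grad \<phi> x) powr q) \<partial>lborel)"
    if q: "q \<in> {1<..<real CARD('n)}" and t: "t \<in> {0..<1}" and \<phi>: "\<phi> \<in> test_functions {x :: real^'n. norm x < R / 2}" for q t \<phi>
  proof -
    define G where "G = (\<integral>\<^sup>+x. ennreal (norm (grad \<phi> x) powr q) \<partial>lborel)"
    have gz: "\<phi> x = 0" if "R / 2 \<le> norm x" for x using test_functions_outside[OF \<phi>] that by auto
    have q1: "1 \<le> q" "q \<le> real DIM(real^'n)" using q by auto
    note g = test_function_measurable[OF \<phi>]
    note sh = shift_pow_le_grad[OF \<phi> q1(1), folded G_def]
    show ?thesis unfolding G_def[symmetric]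
    proof (cases "t = 0")
      case True
      have "pow_int q \<phi> \<le> ennreal D * G"
        unfolding D_def by (rule gag_le_lipschitz_shift(1)[OF g q1 _ _ R, of "1/2"]) (use gz sh in auto)
      then have "pow_int q \<phi> \<le> ennreal C * G" using C(4) by (rule ennreal_le_mult_mono)
      then show "nn_Phi t q \<phi> \<le> ennreal C * G" unfolding True nn_Phi_0_eq_pow_int[OF g] .
    next
      case False
      then have t1: "0 < t" "t < 1" "t \<in> {0<..<1}" using t by auto
      have "nn_Phi t q \<phi> = ennreal (c_const (real CARD('n)) t q) * gag t q \<phi>"
        by (rule nn_Phi_eq_gag[OF dim t1(3) q g])
      also have "\<dots> \<le> ennreal (K * (t * (1 - t))) * gag t q \<phi>"
        using kK[of t q] t1 q by (intro mult_right_mono ennreal_leI) auto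
      also have "\<dots> = ennreal K * (ennreal (t * (1 - t)) * gag t q \<phi>)" using k by (simp add: ennreal_mult' mult.assoc)
      also have "\<dots> \<le> ennreal K * (ennreal (6 * \<omega> * D) * G)"
        unfolding \<omega>_def D_def by (intro mult_left_mono gag_le_lipschitz_shift(2)[OF g q1 t1(1,2) R]) (use gz sh in auto)
      also have "\<dots> = ennreal (K * (6 * \<omega> * D)) * G" using k by (simp add: ennreal_mult' mult.assoc)
      finally have "nn_Phi t q \<phi> \<le> ennreal C * G" using C(5) by (rule ennreal_le_mult_mono)
      then show "nn_Phi t q \<phi> \<le> ennreal C * G" .
    qed
  qed
  show ?thesis using C(1) frac test by (intro exI[of _ C] conjI) blast+
qed

section \<open>The function space\<close>

text \<open>\<open>R\<close> and \<open>C\<close> are parameters constrained by assumptions rather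
  than constants obtained inside: they are to be fixed from \<Omega> before the orders and exponents
  are known.\<close>

locale mixed_problem =
  fixes \<Omega> :: "(real^'n) set" and n m :: nat and s p :: "nat \<Rightarrow> real" and R C :: real
  assumes dim: "CARD('n) \<ge> 2" and \<Omega>_sets: "\<Omega> \<in> sets lebesgue" and \<Omega>_R: "\<And>x. x \<in> \<Omega> \<Longrightarrow> norm x < R / 2"
    and n0: "n \<noteq> 0" and m0: "m \<noteq> 0"
    and s: "\<And>i. i \<in> {1..n} \<Longrightarrow> s i \<in> {0..1}" and p: "\<And>j. j \<in> {1..m} \<Longrightarrow> p j \<in> {1<..<real CARD('n)}"
    and sbar: "s_bar n s \<in> {0<..1}" and C1: "C \<ge> 1"
    and C_frac: "\<And>q S t u. q \<in> {1<..<real CARD('n)} \<Longrightarrow> S \<in> {0<..<1} \<Longrightarrow> t \<in> {0..S} \<Longrightarrow> u \<in> borel_measurable lebesgue \<Longrightarrow>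
       (AE x in lebesgue. R / 2 \<le> norm x \<longrightarrow> u x = 0) \<Longrightarrow> nn_Phi t q (u :: real^'n \<Rightarrow> real) \<le> ennreal C * nn_Phi S q u"
    and C_test: "\<And>q t \<phi>. q \<in> {1<..<real CARD('n)} \<Longrightarrow> t \<in> {0..<1} \<Longrightarrow> \<phi> \<in> test_functions {x :: real^'n. norm x < R / 2} \<Longrightarrow>
       nn_Phi t q \<phi> \<le> ennreal C * (\<integral>\<^sup>+x. ennreal (norm (grad \<phi> x) powr q) \<partial>lborel)"
begin

abbreviation "b \<equiv> s_bar n s"
abbreviation "X \<equiv> X_space n s m p \<Omega>"
abbreviation "test \<equiv> test_functions \<Omega>"

lemma s_le_b: "i \<in> {1..n} \<Longrightarrow> s i \<le> b"
  by (simp add: s_bar_def)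

lemma b_attained: "\<exists>i\<in>{1..n}. s i = b"
proof -
  have "b \<in> s ` {1..n}" unfolding s_bar_def using n0 by (intro Max_in) auto
  then show ?thesis by auto
qed

lemma test_subset: "\<phi> \<in> test \<Longrightarrow> \<phi> \<in> test_functions {x. norm x < R / 2}"
proof (rule test_functions_mono)
  show "\<Omega> \<subseteq> {x. norm x < R / 2}" using \<Omega>_R by blast
qed

lemma test_zero: "\<phi> \<in> test \<Longrightarrow> R / 2 \<le> norm x \<Longrightarrow> \<phi> x = 0 \<and> grad \<phi> x = 0"
proof -
  assume \<phi>: "\<phi> \<in> test" and "R / 2 \<le> norm x"
  then have x: "x \<notin> \<Omega>" using \<Omega>_R[of x] by linarith
  show ?thesis using test_functions_outside[OF \<phi> x] grad_outside[OF \<phi> x] by blast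
qed

lemma test_grad_Lp:
  assumes "\<phi> \<in> test" "q \<ge> 1" shows "Lp_on lebesgue q (grad \<phi>)"
proof -
  note [measurable] = test_function_measurable[OF assms(1)] grad_measurable[OF assms(1)]
  obtain B where B: "\<And>x. \<bar>\<phi> x\<bar> \<le> B \<and> norm (grad \<phi> x) \<le> B"
    using test_function_bounded[OF assms(1)] by blast
  have "integrable lborel (\<lambda>x. norm (grad \<phi> x) powr q)"
    by (rule integrable_bounded_support[where B = "B powr q" and r = "R / 2"])
      (use B test_zero[OF assms(1)] assms(2) in \<open>auto intro!: powr_mono2\<close>)
  then show ?thesis unfolding Lp_on_def
    by (auto intro!: borel_imp_lebesgue_measurable simp: integrable_completion)
qed

lemma test_Phi_1:
  assumes \<phi>: "\<phi> \<in> test" and q: "q \<in> {1<..<real CARD('n)}"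
  shows "\<phi> \<in> finite_set 1 q" "Phi 1 q \<phi> = (LINT x|lebesgue. norm (grad \<phi> x) powr q)"
    "(\<integral>\<^sup>+x. ennreal (norm (grad \<phi> x) powr q) \<partial>lborel) = ennreal (Phi 1 q \<phi>)"
proof -
  have q1: "q \<ge> 1" "q > 0" using q by auto
  note w = weak_gradient_AE[OF has_weak_gradient_test[OF \<phi>]]
  have ae: "AE x in lebesgue. grad \<phi> x = weak_gradient \<phi> x" using w(2) by eventually_elim simp
  note L = Lp_on_AE_cong[OF test_grad_Lp[OF \<phi> q1(1)] locally_integrable_measurable[OF has_weak_gradientD(2)[OF w(1)]] ae]
  show "\<phi> \<in> finite_set 1 q"
    using L(1) w(1) borel_imp_lebesgue_measurable[OF test_function_measurable[OF \<phi>]]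
    by (auto simp: finite_set_def seminorm_finite_def Lp_on_def)
  show P: "Phi 1 q \<phi> = (LINT x|lebesgue. norm (grad \<phi> x) powr q)" using L(2) Phi_1[OF q1(2), of \<phi>] by simp
  show "(\<integral>\<^sup>+x. ennreal (norm (grad \<phi> x) powr q) \<partial>lborel) = ennreal (Phi 1 q \<phi>)"
    unfolding P Lp_on_nn_integral[OF test_grad_Lp[OF \<phi> q1(1)], symmetric] by (simp add: nn_integral_completion)
qed

lemma test_finite_set:
  assumes \<phi>: "\<phi> \<in> test" and q: "q \<in> {1<..<real CARD('n)}" and t: "t \<in> {0..1}"
  shows "\<phi> \<in> finite_set t q" "Phi t q \<phi> \<le> C * Phi 1 q \<phi>"
proof -
  have "\<phi> \<in> finite_set t q \<and> Phi t q \<phi> \<le> C * Phi 1 q \<phi>"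
  proof (cases "t = 1")
    case True
    have "Phi 1 q \<phi> \<ge> 0" by (simp add: Phi_def)
    then show ?thesis using True test_Phi_1(1)[OF \<phi> q] C1 mult_right_mono[of 1 C "Phi 1 q \<phi>"] by simp
  next
    case False
    then have t1: "t \<in> {0..<1}" using t by auto
    have le: "nn_Phi t q \<phi> \<le> ennreal C * ennreal (Phi 1 q \<phi>)"
      using C_test[OF q t1 test_subset[OF \<phi>]] unfolding test_Phi_1(3)[OF \<phi> q] .
    also have "\<dots> < \<infinity>" by (simp add: ennreal_mult_less_top)
    finally have f: "\<phi> \<in> finite_set t q"
      using finite_set_iff_nn_Phi(1)[OF dim t1 q] borel_imp_lebesgue_measurable[OF test_function_measurable[OF \<phi>]] by blast
    then have "ennreal (Phi t q \<phi>) \<le> ennreal (C * Phi 1 q \<phi>)"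
      using le finite_set_iff_nn_Phi(2)[OF dim t1 q f] C1 by (simp add: ennreal_mult')
    moreover have "0 \<le> C * Phi 1 q \<phi>" using C1 by (simp add: Phi_def)
    ultimately show ?thesis using f by (simp add: ennreal_le_iff)
  qed
  then show "\<phi> \<in> finite_set t q" "Phi t q \<phi> \<le> C * Phi 1 q \<phi>" by auto
qed

lemma frac_finite_set:
  assumes u: "u \<in> finite_set S q" and q: "q \<in> {1<..<real CARD('n)}" and S: "S \<in> {0<..<1}" and t: "t \<in> {0..S}"
    and z: "AE x in lebesgue. x \<notin> \<Omega> \<longrightarrow> u x = 0"
  shows "u \<in> finite_set t q" "Phi t q u \<le> C * Phi S q u"
proof -
  have t1: "t \<in> {0..<1}" "S \<in> {0..<1}" using t S by auto
  have m: "u \<in> borel_measurable lebesgue" using u by (auto simp: finite_set_def)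
  have z': "AE x in lebesgue. R / 2 \<le> norm x \<longrightarrow> u x = 0"
    using z by eventually_elim (use \<Omega>_R in force)
  have le: "nn_Phi t q u \<le> ennreal C * nn_Phi S q u" by (rule C_frac[OF q S t m z'])
  also have "\<dots> < \<infinity>" using finite_set_iff_nn_Phi[OF dim t1(2) q] u by (simp add: ennreal_mult_less_top)
  finally show f: "u \<in> finite_set t q" using finite_set_iff_nn_Phi(1)[OF dim t1(1) q] m by blast
  then have "ennreal (Phi t q u) \<le> ennreal (C * Phi S q u)"
    using le finite_set_iff_nn_Phi(2)[OF dim t1(1) q f] finite_set_iff_nn_Phi(2)[OF dim t1(2) q u] C1 by (simp add: ennreal_mult')
  moreover have "0 \<le> C * Phi S q u" using C1 by (simp add: Phi_def)
  ultimately show "Phi t q u \<le> C * Phi S q u" by (simp add: ennreal_le_iff)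
qed

lemma test_comparison:
  assumes \<phi>: "\<phi> \<in> test" and q: "q \<in> {1<..<real CARD('n)}" and t: "t \<in> {0..S}" "S \<in> {0<..1}"
  shows "Phi t q \<phi> \<le> C * Phi S q \<phi>"
proof (cases "S = 1")
  case True then show ?thesis using test_finite_set(2)[OF \<phi> q, of t] t by simp
next
  case False
  then have S: "S \<in> {0<..<1}" using t by auto
  have f: "\<phi> \<in> finite_set S q" using test_finite_set(1)[OF \<phi> q, of S] t by auto
  show ?thesis by (rule frac_finite_set(2)[OF f q S t(1)]) (use test_functions_outside[OF \<phi>] in auto)
qed

lemma Phi_nonneg: "Phi t q u \<ge> 0" by (simp add: Phi_def)

text \<open>The abstract lemmas concern p-th powers, and the exponents \<open>p j\<close> differ;
  convergence in the norm is therefore read off pair by pair.\<close>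

lemma mu_norm_tendsto_0_iff:
  fixes w :: "nat \<Rightarrow> real^'n \<Rightarrow> real"
  shows "(\<lambda>k. mu_norm n s m p (w k)) \<longlonglongrightarrow> 0 \<longleftrightarrow> (\<forall>i\<in>{1..n}. \<forall>j\<in>{1..m}. (\<lambda>k. Phi (s i) (p j) (w k)) \<longlonglongrightarrow> 0)"
proof
  have sn: "seminorm t q v \<ge> 0" for t q and v :: "real^'n \<Rightarrow> real" by (simp add: seminorm_def)
  assume a: "(\<lambda>k. mu_norm n s m p (w k)) \<longlonglongrightarrow> 0"
  show "\<forall>i\<in>{1..n}. \<forall>j\<in>{1..m}. (\<lambda>k. Phi (s i) (p j) (w k)) \<longlonglongrightarrow> 0"
  proof (intro ballI)
    fix i j assume ij: "i \<in> {1..n}" "j \<in> {1..m}"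
    have "seminorm (s i) (p j) (w k) \<le> mu_norm n s m p (w k)" for k
    proof -
      have "seminorm (s i) (p j) (w k) \<le> (\<Sum>j=1..m. seminorm (s i) (p j) (w k))"
        using ij sn by (intro member_le_sum) auto
      also have "\<dots> \<le> mu_norm n s m p (w k)" unfolding mu_norm_def
        using ij sn by (intro member_le_sum[of i "{1..n}" "\<lambda>i. \<Sum>j=1..m. seminorm (s i) (p j) (w k)"] sum_nonneg) auto
      finally show ?thesis .
    qed
    then have "(\<lambda>k. seminorm (s i) (p j) (w k)) \<longlonglongrightarrow> 0"
      using sn by (intro tendsto_sandwich[OF _ _ tendsto_const a]) auto
    then show "(\<lambda>k. Phi (s i) (p j) (w k)) \<longlonglongrightarrow> 0"
      unfolding Phi_def using p[OF ij(2)] sn by (auto intro!: tendsto_eq_intros tendsto_powr')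
  qed
next
  assume a: "\<forall>i\<in>{1..n}. \<forall>j\<in>{1..m}. (\<lambda>k. Phi (s i) (p j) (w k)) \<longlonglongrightarrow> 0"
  have "(\<lambda>k. seminorm (s i) (p j) (w k)) \<longlonglongrightarrow> 0" if ij: "i \<in> {1..n}" "j \<in> {1..m}" for i j
  proof -
    have "(\<lambda>k. Phi (s i) (p j) (w k)) \<longlonglongrightarrow> 0" using a ij by blast
    then have "(\<lambda>k. Phi (s i) (p j) (w k) powr (1 / p j)) \<longlonglongrightarrow> 0 powr (1 / p j)"
      by (rule tendsto_powr'[OF _ tendsto_const]) (use p[OF ij(2)] in \<open>auto simp: Phi_nonneg\<close>)
    then have "(\<lambda>k. Phi (s i) (p j) (w k) powr (1 / p j)) \<longlonglongrightarrow> 0" by simp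
    moreover have "Phi (s i) (p j) (w k) powr (1 / p j) = seminorm (s i) (p j) (w k)" for k
      using p[OF ij(2)] by (simp add: Phi_def powr_powr seminorm_def)
    ultimately show ?thesis by simp
  qed
  then have "(\<lambda>k. \<Sum>i=1..n. \<Sum>j=1..m. seminorm (s i) (p j) (w k)) \<longlonglongrightarrow> (\<Sum>i=1..n. \<Sum>j=1..m. 0)"
    by (intro tendsto_sum)
  then show "(\<lambda>k. mu_norm n s m p (w k)) \<longlonglongrightarrow> 0" by (simp add: mu_norm_def)
qed

lemma X_iff:
  "u \<in> X \<longleftrightarrow> u \<in> borel_measurable lebesgue \<and> (AE x in lebesgue. x \<notin> \<Omega> \<longrightarrow> u x = 0) \<and>
     (\<forall>i\<in>{1..n}. \<forall>j\<in>{1..m}. u \<in> finite_set (s i) (p j)) \<and>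
     (\<exists>\<phi>. (\<forall>k. \<phi> k \<in> test) \<and> (\<forall>i\<in>{1..n}. \<forall>j\<in>{1..m}. (\<lambda>k. Phi (s i) (p j) (\<lambda>x. \<phi> k x - u x)) \<longlonglongrightarrow> 0))"
  unfolding X_space_def mem_Collect_eq mu_norm_tendsto_0_iff[of "\<lambda>k x. _ k x - u x"]
  by (auto simp: finite_set_def)

lemma fs: 
  assumes "t \<in> {0..1}" "q \<in> {1<..<real CARD('n)}"
  shows "fun_subspace (finite_set t q :: (real^'n \<Rightarrow> real) set)"
    "power_functional q (finite_set t q) (Phi t q :: (real^'n \<Rightarrow> real) \<Rightarrow> real)"
    "uniformly_convex_functional (finite_set t q) (Phi t q :: (real^'n \<Rightarrow> real) \<Rightarrow> real)"
  using finite_set_properties[OF dim assms] by auto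

lemma test_in_X: "\<phi> \<in> test \<Longrightarrow> \<phi> \<in> X"
proof -
  assume \<phi>: "\<phi> \<in> test"
  have "Phi (s i) (p j) (\<lambda>x. \<phi> x - \<phi> x) = 0" if "i \<in> {1..n}" "j \<in> {1..m}" for i j
    using power_functional_0[OF fs(1,2)[OF s[OF that(1)] p[OF that(2)]]] by simp
  then show ?thesis unfolding X_iff
    using \<phi> test_finite_set(1)[OF \<phi> p s] borel_imp_lebesgue_measurable[OF test_function_measurable[OF \<phi>]] test_functions_outside[OF \<phi>]
    by (auto intro!: exI[of _ "\<lambda>_. \<phi>"])
qed

lemma X_subspace: "fun_subspace X"
  unfolding fun_subspace_def
proof (intro conjI ballI allI)
  show "(\<lambda>_. 0) \<in> X" by (rule test_in_X[OF test_functions_0])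
  fix u v a c assume uv: "u \<in> X" "v \<in> X"
  obtain \<phi> where \<phi>: "\<And>k. \<phi> k \<in> test" "\<And>i j. i \<in> {1..n} \<Longrightarrow> j \<in> {1..m} \<Longrightarrow> (\<lambda>k. Phi (s i) (p j) (\<lambda>x. \<phi> k x - u x)) \<longlonglongrightarrow> 0"
    using uv(1) unfolding X_iff by blast
  obtain \<psi> where \<psi>: "\<And>k. \<psi> k \<in> test" "\<And>i j. i \<in> {1..n} \<Longrightarrow> j \<in> {1..m} \<Longrightarrow> (\<lambda>k. Phi (s i) (p j) (\<lambda>x. \<psi> k x - v x)) \<longlonglongrightarrow> 0"
    using uv(2) unfolding X_iff by blast
  have fin: "u \<in> finite_set (s i) (p j)" "v \<in> finite_set (s i) (p j)" if "i \<in> {1..n}" "j \<in> {1..m}" for i j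
    using uv that unfolding X_iff by auto
  have "(\<lambda>k. Phi (s i) (p j) (\<lambda>x. (a * \<phi> k x + c * \<psi> k x) - (a * u x + c * v x))) \<longlonglongrightarrow> 0"
    if ij: "i \<in> {1..n}" "j \<in> {1..m}" for i j
  proof (rule tendsto_sandwich[OF _ _ tendsto_const])
    note F = fs[OF s[OF ij(1)] p[OF ij(2)]]
    have d: "(\<lambda>x. \<phi> k x - u x) \<in> finite_set (s i) (p j)" "(\<lambda>x. \<psi> k x - v x) \<in> finite_set (s i) (p j)" for k
      using fun_subspaceD(3)[OF F(1)] test_finite_set(1)[OF _ p[OF ij(2)] s[OF ij(1)]] \<phi>(1) \<psi>(1) fin[OF ij] by auto
    have le: "Phi (s i) (p j) (\<lambda>x. (a * \<phi> k x + c * \<psi> k x) - (a * u x + c * v x)) \<le>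
      2 powr p j * (\<bar>a\<bar> powr p j * Phi (s i) (p j) (\<lambda>x. \<phi> k x - u x) + \<bar>c\<bar> powr p j * Phi (s i) (p j) (\<lambda>x. \<psi> k x - v x))" for k
      using power_functional_add_le(1)[OF F(1,2) fun_subspaceD(4)[OF F(1) d(1)[of k] d(1)[of k], of a] fun_subspaceD(4)[OF F(1) d(2)[of k] d(2)[of k], of c]]
      unfolding power_functionalD(2)[OF F(2) d(1)] power_functionalD(2)[OF F(2) d(2)]
      by (simp add: algebra_simps)
    then show "eventually (\<lambda>k. Phi (s i) (p j) (\<lambda>x. (a * \<phi> k x + c * \<psi> k x) - (a * u x + c * v x)) \<le>
      2 powr p j * (\<bar>a\<bar> powr p j * Phi (s i) (p j) (\<lambda>x. \<phi> k x - u x) + \<bar>c\<bar> powr p j * Phi (s i) (p j) (\<lambda>x. \<psi> k x - v x))) sequentially"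
      by simp
    show "(\<lambda>k. 2 powr p j * (\<bar>a\<bar> powr p j * Phi (s i) (p j) (\<lambda>x. \<phi> k x - u x) + \<bar>c\<bar> powr p j * Phi (s i) (p j) (\<lambda>x. \<psi> k x - v x))) \<longlonglongrightarrow> 0"
      using \<phi>(2)[OF ij] \<psi>(2)[OF ij] by (auto intro!: tendsto_eq_intros)
  qed (simp add: Phi_nonneg)
  moreover have "(\<lambda>x. a * u x + c * v x) \<in> borel_measurable lebesgue"
    using uv unfolding X_iff by (intro borel_measurable_add borel_measurable_times borel_measurable_const) auto
  moreover have "AE x in lebesgue. x \<notin> \<Omega> \<longrightarrow> a * u x + c * v x = 0"
  proof -
    have "AE x in lebesgue. x \<notin> \<Omega> \<longrightarrow> u x = 0" "AE x in lebesgue. x \<notin> \<Omega> \<longrightarrow> v x = 0"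
      using uv unfolding X_iff by auto
    then show ?thesis by eventually_elim auto
  qed
  moreover have "(\<lambda>x. a * u x + c * v x) \<in> finite_set (s i) (p j)" if ij: "i \<in> {1..n}" "j \<in> {1..m}" for i j
    by (rule fun_subspaceD(1)[OF fs(1)[OF s[OF ij(1)] p[OF ij(2)]] fin[OF ij]])
  moreover have "(\<lambda>x. a * \<phi> k x + c * \<psi> k x) \<in> test" for k by (rule test_functions_lincomb[OF \<phi>(1) \<psi>(1)])
  ultimately show "(\<lambda>x. a * u x + c * v x) \<in> X"
    unfolding X_iff by (intro conjI ballI exI[of _ "\<lambda>k x. a * \<phi> k x + c * \<psi> k x"] allI)
qed

end

section \<open>Cauchy sequences of test functions and their limits\<close>

definition cauchy_in :: "(('x \<Rightarrow> real) \<Rightarrow> real) \<Rightarrow> (nat \<Rightarrow> 'x \<Rightarrow> real) \<Rightarrow> bool" where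
  "cauchy_in \<Phi> f \<longleftrightarrow> (\<forall>e>0. \<exists>K. \<forall>i\<ge>K. \<forall>j\<ge>K. \<Phi> (\<lambda>x. f i x - f j x) < e)"

lemma cauchy_inD: "cauchy_in \<Phi> f \<Longrightarrow> e > 0 \<Longrightarrow> \<exists>K. \<forall>i\<ge>K. \<forall>j\<ge>K. \<Phi> (\<lambda>x. f i x - f j x) < e"
  by (simp add: cauchy_in_def)

lemma cauchy_in_mono:
  assumes f: "cauchy_in \<Phi> f" and C: "C > 0" and le: "\<And>i j. \<Psi> (\<lambda>x. f i x - f j x) \<le> C * \<Phi> (\<lambda>x. f i x - f j x)"
  shows "cauchy_in \<Psi> f"
  unfolding cauchy_in_def
proof (intro allI impI)
  fix e :: real assume "e > 0"
  then obtain K where K: "\<And>i j. i \<ge> K \<Longrightarrow> j \<ge> K \<Longrightarrow> \<Phi> (\<lambda>x. f i x - f j x) < e / C"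
    using cauchy_inD[OF f, of "e / C"] C by auto
  have "\<Psi> (\<lambda>x. f i x - f j x) < e" if "i \<ge> K" "j \<ge> K" for i j
    using le[of i j] K[OF that] C by (simp add: pos_less_divide_eq mult.commute)
  then show "\<exists>K. \<forall>i\<ge>K. \<forall>j\<ge>K. \<Psi> (\<lambda>x. f i x - f j x) < e" by blast
qed

lemma cauchy_in_if_convergent:
  assumes V: "fun_subspace V" and \<Phi>: "power_functional p V \<Phi>" and f: "\<And>k. f k \<in> V" "u \<in> V"
    and lim: "(\<lambda>k. \<Phi> (\<lambda>x. f k x - u x)) \<longlonglongrightarrow> 0"
  shows "cauchy_in \<Phi> f"
  unfolding cauchy_in_def
proof (intro allI impI)
  fix e :: real assume e: "e > 0"
  define d where "d = e / (2 * 2 powr p)"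
  have d: "d > 0" "2 powr p * (2 * d) = e" using e by (auto simp: d_def)
  obtain K where K: "\<And>k. k \<ge> K \<Longrightarrow> \<Phi> (\<lambda>x. f k x - u x) < d"
    using order_tendstoD(2)[OF lim d(1)] by (auto simp: eventually_sequentially)
  have "\<Phi> (\<lambda>x. f i x - f j x) < e" if "i \<ge> K" "j \<ge> K" for i j
  proof -
    have "\<Phi> (\<lambda>x. (f i x - u x) - (f j x - u x)) \<le> 2 powr p * (\<Phi> (\<lambda>x. f i x - u x) + \<Phi> (\<lambda>x. f j x - u x))"
      by (intro power_functional_add_le(2)[OF V \<Phi>] fun_subspaceD(3)[OF V] f)
    also have "\<dots> < 2 powr p * (2 * d)" using K[OF that(1)] K[OF that(2)] by (intro mult_strict_left_mono) auto
    finally show ?thesis using d(2) by simp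
  qed
  then show "\<exists>K. \<forall>i\<ge>K. \<forall>j\<ge>K. \<Phi> (\<lambda>x. f i x - f j x) < e" by blast
qed

lemma finite_set_AE_cong:
  fixes u v :: "real^'n \<Rightarrow> real"
  assumes a: "CARD('n) \<ge> 2" "s \<in> {0..<1}" "p \<in> {1<..<real CARD('n)}"
    and u: "u \<in> finite_set s p" and v: "v \<in> borel_measurable lebesgue" and ae: "AE x in lebesgue. u x = v x"
  shows "v \<in> finite_set s p" "Phi s p v = Phi s p u"
proof -
  have eq: "nn_Phi s p u = nn_Phi s p v" by (rule nn_Phi_cong_AE[OF ae])
  show f: "v \<in> finite_set s p" using u v eq unfolding finite_set_iff_nn_Phi(1)[OF a] by simp
  have "ennreal (Phi s p v) = ennreal (Phi s p u)"
    using finite_set_iff_nn_Phi(2)[OF a u] finite_set_iff_nn_Phi(2)[OF a f] eq by simp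
  then show "Phi s p v = Phi s p u" by (simp add: Phi_def)
qed

lemma finite_set_fatou:
  fixes f :: "nat \<Rightarrow> real^'n \<Rightarrow> real"
  assumes a: "CARD('n) \<ge> 2" "s \<in> {0..<1}" "p \<in> {1<..<real CARD('n)}"
    and f: "\<And>i. f i \<in> finite_set s p" and g: "g \<in> borel_measurable lebesgue"
    and lim: "AE x in lebesgue. (\<lambda>i. f i x) \<longlonglongrightarrow> g x"
    and bd: "eventually (\<lambda>i. Phi s p (f i) \<le> e) sequentially"
  shows "g \<in> finite_set s p" "Phi s p g \<le> e"
proof -
  have p: "p > 0" using a by auto
  have "g \<in> finite_set s p \<and> Phi s p g \<le> e"
  proof (cases "s = 0")
    case True
    have iff: "u \<in> finite_set s p \<longleftrightarrow> Lp_on lebesgue p u" for u :: "real^'n \<Rightarrow> real"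
      using True by (auto simp: finite_set_def seminorm_finite_def Lp_on_def)
    have Lp: "\<And>i. Lp_on lebesgue p (f i)" using f iff by blast
    have "eventually (\<lambda>i. (LINT x|lebesgue. norm (f i x) powr p) \<le> e) sequentially"
      using bd unfolding True Phi_0[OF p] .
    from Lp_on_fatou[OF Lp p lim g this] show ?thesis using iff[of g] True Phi_0[OF p, of g] by simp
  next
    case False
    then have s: "s \<in> {0<..<1}" using a by auto
    have iff: "u \<in> finite_set s p \<longleftrightarrow> u \<in> borel_measurable lebesgue \<and> Lp_on lebesgue p (frac_diff s p u)" for u :: "real^'n \<Rightarrow> real"
      using seminorm_finite_frac_iff[OF a(1) s a(3)] by (auto simp: finite_set_def)
    have Lp: "\<And>i. Lp_on lebesgue p (frac_diff s p (f i))" using f iff by blast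
    have ev: "eventually (\<lambda>i. (LINT x|lebesgue. norm (frac_diff s p (f i) x) powr p) \<le> e) sequentially"
      using bd unfolding Phi_frac[OF a(1) s a(3)] .
    have lim': "AE z in lebesgue. (\<lambda>i. frac_diff s p (f i) z) \<longlonglongrightarrow> frac_diff s p g z"
      using AE_lebesgue_fst_snd[OF lim] unfolding frac_diff_def by eventually_elim (intro tendsto_intros; simp)
    from Lp_on_fatou[OF Lp p lim' frac_diff_measurable[OF g] ev] show ?thesis
      unfolding iff Phi_frac[OF a(1) s a(3)] using g by blast
  qed
  then show "g \<in> finite_set s p" "Phi s p g \<le> e" by auto
qed

context mixed_problem
begin

lemma test_diff: "\<phi> \<in> test \<Longrightarrow> \<psi> \<in> test \<Longrightarrow> (\<lambda>x. \<phi> x - \<psi> x) \<in> test"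
  using test_functions_lincomb[of \<phi> \<Omega> \<psi> 1 "-1"] by simp

lemma test_lebesgue_measurable: "\<phi> \<in> test \<Longrightarrow> \<phi> \<in> borel_measurable lebesgue"
  by (rule borel_imp_lebesgue_measurable[OF test_function_measurable])

lemma test_Lp: "\<phi> \<in> test \<Longrightarrow> q \<in> {1<..<real CARD('n)} \<Longrightarrow> Lp_on lebesgue q \<phi>"
  using test_finite_set(1)[of \<phi> q 0] by (auto simp: finite_set_def seminorm_finite_def Lp_on_def)

lemma cauchy_lower_order:
  assumes \<phi>: "\<And>k. \<phi> k \<in> test" and q: "q \<in> {1<..<real CARD('n)}" and t: "t \<in> {0..S}" "S \<in> {0<..1}"
    and c: "cauchy_in (Phi S q) \<phi>"
  shows "cauchy_in (Phi t q) \<phi>"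
  by (rule cauchy_in_mono[OF c, of C]) (use C1 in \<open>auto intro!: test_comparison[OF test_diff[OF \<phi> \<phi>] q t]\<close>)

text \<open>One limit for all orders and exponents. Almost everywhere convergence along \<sigma>
  identifies it for orders below 1, through Fatou; convergence in L^1 identifies it for order 1,
  through the closedness of the weak gradient.\<close>

definition limit_of :: "(nat \<Rightarrow> real^'n \<Rightarrow> real) \<Rightarrow> (nat \<Rightarrow> nat) \<Rightarrow> (real^'n \<Rightarrow> real) \<Rightarrow> bool" where
  "limit_of \<phi> \<sigma> u \<longleftrightarrow> strict_mono \<sigma> \<and> u \<in> borel_measurable lebesgue \<and> (\<forall>x. R / 2 \<le> norm x \<longrightarrow> u x = 0) \<and>
     (AE x in lebesgue. (\<lambda>i. \<phi> (\<sigma> i) x) \<longlonglongrightarrow> u x) \<and> integrable lebesgue u \<and>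
     (\<lambda>k. LINT x|lebesgue. \<bar>\<phi> k x - u x\<bar>) \<longlonglongrightarrow> 0"

lemma limit_exists:
  assumes \<phi>: "\<And>k. \<phi> k \<in> test" and q: "q \<in> {1<..<real CARD('n)}" and c: "cauchy_in (Phi 0 q) \<phi>"
  shows "\<exists>\<sigma> u. limit_of \<phi> \<sigma> u"
proof -
  have q1: "q \<ge> 1" "q > 0" using q by auto
  note Lp = test_Lp[OF \<phi> q]
  have z: "\<phi> k x = 0" if "R / 2 \<le> norm x" for k x using test_zero[OF \<phi>] that by blast
  have "\<exists>K. \<forall>i\<ge>K. \<forall>j\<ge>K. (LINT x|lebesgue. norm (\<phi> i x - \<phi> j x) powr q) < e" if "e > 0" for e
    using cauchy_inD[OF c that] unfolding Phi_0[OF q1(2)] .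
  from Lp_Cauchy_limit[OF Lp q1(1) z this]
  obtain g \<sigma> where g: "strict_mono (\<sigma> :: nat \<Rightarrow> nat)" "g \<in> borel_measurable lebesgue" "\<And>x. R / 2 \<le> norm x \<Longrightarrow> g x = 0"
    "AE x in lebesgue. (\<lambda>i. \<phi> (\<sigma> i) x) \<longlonglongrightarrow> g x" "Lp_on lebesgue q g"
    "(\<lambda>k. LINT x|lebesgue. norm (\<phi> k x - g x) powr q) \<longlonglongrightarrow> 0" by blast
  have ig: "integrable lebesgue g" by (rule Lp_bounded_support_L1(1)[OF g(5) q1(1) g(3)])
  have "(\<lambda>k. LINT x|lebesgue. \<bar>\<phi> k x - g x\<bar>) \<longlonglongrightarrow> 0"
  proof (rule LIMSEQ_I)
    fix e :: real assume e: "e > 0"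
    obtain d where d: "d > 0" "\<And>h::real^'n \<Rightarrow> real. Lp_on lebesgue q h \<Longrightarrow> (\<And>x. R / 2 \<le> norm x \<Longrightarrow> h x = 0) \<Longrightarrow>
     (LINT x|lebesgue. norm (h x) powr q) < d \<Longrightarrow> (LINT x|lebesgue. norm (h x)) < e"
      using L1_small_if_Lp_small[OF q1(1) e, of "R/2", where 'a="real^'n" and 'v=real] by blast
    obtain K where K: "\<And>k. k \<ge> K \<Longrightarrow> (LINT x|lebesgue. norm (\<phi> k x - g x) powr q) < d"
      using order_tendstoD(2)[OF g(6) d(1)] by (auto simp: eventually_sequentially)
    have "(LINT x|lebesgue. norm (\<phi> k x - g x)) < e" if "k \<ge> K" for k
    proof (rule d(2))
      show "Lp_on lebesgue q (\<lambda>x. \<phi> k x - g x)" using Lp_on_lincomb[OF q1(1) Lp[of k] g(5), of 1 "-1"] by simp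
    qed (use z g(3) K[OF that] in auto)
    then show "\<exists>no. \<forall>n\<ge>no. norm ((LINT x|lebesgue. \<bar>\<phi> n x - g x\<bar>) - 0) < e" by (intro exI[of _ K]) auto
  qed
  then show ?thesis using g ig unfolding limit_of_def by blast
qed

lemma limit_outside:
  assumes \<phi>: "\<And>k. \<phi> k \<in> test" and u: "limit_of \<phi> \<sigma> u"
  shows "AE x in lebesgue. x \<notin> \<Omega> \<longrightarrow> u x = 0"
proof -
  have "AE x in lebesgue. (\<lambda>i. \<phi> (\<sigma> i) x) \<longlonglongrightarrow> u x" using u by (simp add: limit_of_def)
  then show ?thesis
  proof eventually_elim
    case (elim x)
    show ?case
    proof
      assume "x \<notin> \<Omega>"
      then have "(\<lambda>i. \<phi> (\<sigma> i) x) = (\<lambda>i. 0)" using test_functions_outside[OF \<phi>] by auto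
      then show "u x = 0" using elim by (simp add: LIMSEQ_const_iff)
    qed
  qed
qed

text \<open>Fatou along the subsequence bounds the distance from \<open>\<phi> k\<close> to
  \<open>u\<close> by the Cauchy bound.\<close>

lemma limit_frac:
  assumes \<phi>: "\<And>k. \<phi> k \<in> test" and q: "q \<in> {1<..<real CARD('n)}" and t: "t \<in> {0..<1}"
    and c: "cauchy_in (Phi t q) \<phi>" and u: "limit_of \<phi> \<sigma> u"
  shows "u \<in> finite_set t q" "(\<lambda>k. Phi t q (\<lambda>x. \<phi> k x - u x)) \<longlonglongrightarrow> 0"
proof -
  have t': "t \<in> {0..1}" using t by auto
  note F = fs[OF t' q]
  have um: "u \<in> borel_measurable lebesgue" and lim: "AE x in lebesgue. (\<lambda>i. \<phi> (\<sigma> i) x) \<longlonglongrightarrow> u x" and \<sigma>: "strict_mono \<sigma>"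
    using u by (auto simp: limit_of_def)
  have close: "(\<lambda>x. \<phi> k x - u x) \<in> finite_set t q \<and> Phi t q (\<lambda>x. \<phi> k x - u x) \<le> e"
    if K: "\<forall>i\<ge>K. \<forall>j\<ge>K. Phi t q (\<lambda>x. \<phi> i x - \<phi> j x) < e" "k \<ge> K" for e K k
  proof -
    have a: "AE x in lebesgue. (\<lambda>i. \<phi> k x - \<phi> (\<sigma> i) x) \<longlonglongrightarrow> \<phi> k x - u x"
      using lim by eventually_elim (intro tendsto_intros)
    have m: "(\<lambda>x. \<phi> k x - u x) \<in> borel_measurable lebesgue"
      by (intro borel_measurable_diff test_lebesgue_measurable \<phi> um)
    have ev: "eventually (\<lambda>i. Phi t q (\<lambda>x. \<phi> k x - \<phi> (\<sigma> i) x) \<le> e) sequentially"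
    proof (rule eventually_sequentiallyI[of K])
      fix i assume "K \<le> i"
      then have "\<sigma> i \<ge> K" using seq_suble[OF \<sigma>, of i] by linarith
      then show "Phi t q (\<lambda>x. \<phi> k x - \<phi> (\<sigma> i) x) \<le> e" using K by (auto intro: less_imp_le)
    qed
    have f: "(\<lambda>x. \<phi> k x - \<phi> (\<sigma> i) x) \<in> finite_set t q" for i
      by (rule test_finite_set(1)[OF test_diff[OF \<phi> \<phi>] q t'])
    show ?thesis using finite_set_fatou[OF dim t q f m a ev] by blast
  qed
  obtain K where "\<forall>i\<ge>K. \<forall>j\<ge>K. Phi t q (\<lambda>x. \<phi> i x - \<phi> j x) < 1" using cauchy_inD[OF c, of 1] by auto
  from close[OF this, of K] have "(\<lambda>x. \<phi> K x - u x) \<in> finite_set t q" by simp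
  from fun_subspaceD(3)[OF F(1) test_finite_set(1)[OF \<phi>[of K] q t'] this] show "u \<in> finite_set t q" by simp
  show "(\<lambda>k. Phi t q (\<lambda>x. \<phi> k x - u x)) \<longlonglongrightarrow> 0"
  proof (rule LIMSEQ_I)
    fix e :: real assume e: "e > 0"
    obtain K where K: "\<forall>i\<ge>K. \<forall>j\<ge>K. Phi t q (\<lambda>x. \<phi> i x - \<phi> j x) < e / 2" using cauchy_inD[OF c, of "e/2"] e by auto
    have "norm (Phi t q (\<lambda>x. \<phi> k x - u x) - 0) < e" if "k \<ge> K" for k
      using close[OF K that] e Phi_nonneg[of t q "\<lambda>x. \<phi> k x - u x"] by simp
    then show "\<exists>no. \<forall>k\<ge>no. norm (Phi t q (\<lambda>x. \<phi> k x - u x) - 0) < e" by blast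
  qed
qed

lemma grad_diff_test:
  assumes "\<phi> \<in> test" "\<psi> \<in> test" shows "grad (\<lambda>x. \<phi> x - \<psi> x) x = grad \<phi> x - grad \<psi> x"
  using grad_lincomb[OF assms, of 1 "-1" x] by simp

text \<open>The gradients have a limit \<open>H\<close> in L^q. On a ball they also converge in L^1,
  as do the functions, so \<open>has_weak_gradient_limit\<close> makes \<open>H\<close> a weak
  gradient of the limit fixed beforehand.\<close>

lemma limit_grad:
  assumes \<phi>: "\<And>k. \<phi> k \<in> test" and q: "q \<in> {1<..<real CARD('n)}"
    and c: "cauchy_in (Phi 1 q) \<phi>" and u: "limit_of \<phi> \<sigma> u"
  shows "u \<in> finite_set 1 q" "(\<lambda>k. Phi 1 q (\<lambda>x. \<phi> k x - u x)) \<longlonglongrightarrow> 0"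
proof -
  have q1: "q \<ge> 1" "q > 0" using q by auto
  have um: "u \<in> borel_measurable lebesgue" "integrable lebesgue u" and L1: "(\<lambda>k. LINT x|lebesgue. \<bar>\<phi> k x - u x\<bar>) \<longlonglongrightarrow> 0"
    using u by (auto simp: limit_of_def)
  note Lp = test_grad_Lp[OF \<phi> q1(1)]
  have z: "grad (\<phi> k) x = 0" if "R / 2 \<le> norm x" for k x using test_zero[OF \<phi>] that by blast
  have zz: "\<phi> k x = 0" if "R / 2 \<le> norm x" for k x using test_zero[OF \<phi>] that by blast
  have "\<exists>K. \<forall>i\<ge>K. \<forall>j\<ge>K. (LINT x|lebesgue. norm (grad (\<phi> i) x - grad (\<phi> j) x) powr q) < e" if "e > 0" for e
    using cauchy_inD[OF c that] unfolding test_Phi_1(2)[OF test_diff[OF \<phi> \<phi>] q] grad_diff_test[OF \<phi> \<phi>] .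
  from Lp_Cauchy_limit[OF Lp q1(1) z this]
  obtain H \<tau> where H: "H \<in> borel_measurable lebesgue" "\<And>x. R / 2 \<le> norm x \<Longrightarrow> H x = 0" "Lp_on lebesgue q H"
    "(\<lambda>k. LINT x|lebesgue. norm (grad (\<phi> k) x - H x) powr q) \<longlonglongrightarrow> 0" by blast
  have iH: "integrable lebesgue H" by (rule Lp_bounded_support_L1(1)[OF H(3) q1(1) H(2)])
  have LpD: "Lp_on lebesgue q (\<lambda>x. grad (\<phi> k) x - H x)" for k
    using Lp_on_lincomb[OF q1(1) Lp[of k] H(3), of 1 "-1"] by simp
  have limH: "(\<lambda>k. LINT x|lebesgue. norm (grad (\<phi> k) x - H x)) \<longlonglongrightarrow> 0"
  proof (rule LIMSEQ_I)
    fix e :: real assume e: "e > 0"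
    obtain d where d: "d > 0" "\<And>h::real^'n \<Rightarrow> real^'n. Lp_on lebesgue q h \<Longrightarrow> (\<And>x. R / 2 \<le> norm x \<Longrightarrow> h x = 0) \<Longrightarrow>
     (LINT x|lebesgue. norm (h x) powr q) < d \<Longrightarrow> (LINT x|lebesgue. norm (h x)) < e"
      using L1_small_if_Lp_small[OF q1(1) e, of "R/2", where 'a="real^'n" and 'v="real^'n"] by blast
    obtain K where K: "\<And>k. k \<ge> K \<Longrightarrow> (LINT x|lebesgue. norm (grad (\<phi> k) x - H x) powr q) < d"
      using order_tendstoD(2)[OF H(4) d(1)] by (auto simp: eventually_sequentially)
    have "(LINT x|lebesgue. norm (grad (\<phi> k) x - H x)) < e" if "k \<ge> K" for k
      by (rule d(2)[OF LpD]) (use z H(2) K[OF that] in auto)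
    then show "\<exists>no. \<forall>n\<ge>no. norm ((LINT x|lebesgue. norm (grad (\<phi> n) x - H x)) - 0) < e" by (intro exI[of _ K]) auto
  qed
  have wg: "has_weak_gradient u H"
  proof (rule has_weak_gradient_limit[OF has_weak_gradient_test[OF \<phi>] _ _ um(2) iH L1 limH])
    show "integrable lebesgue (\<phi> k)" for k
      by (rule Lp_bounded_support_L1(1)[OF test_Lp[OF \<phi> q] q1(1) zz])
    show "integrable lebesgue (grad (\<phi> k))" for k
      by (rule Lp_bounded_support_L1(1)[OF Lp q1(1) z])
  qed
  have d: "(\<lambda>x. \<phi> k x - u x) \<in> finite_set 1 q \<and> Phi 1 q (\<lambda>x. \<phi> k x - u x) = (LINT x|lebesgue. norm (grad (\<phi> k) x - H x) powr q)" for k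
  proof -
    have w: "has_weak_gradient (\<lambda>x. \<phi> k x - u x) (\<lambda>x. grad (\<phi> k) x - H x)"
      using has_weak_gradient_lincomb[OF has_weak_gradient_test[OF \<phi>[of k]] wg, of 1 "-1"] by simp
    note W = weak_gradient_AE[OF w]
    have ae: "AE x in lebesgue. grad (\<phi> k) x - H x = weak_gradient (\<lambda>x. \<phi> k x - u x) x"
      using W(2) by eventually_elim simp
    note L = Lp_on_AE_cong[OF LpD locally_integrable_measurable[OF has_weak_gradientD(2)[OF W(1)]] ae]
    have m: "(\<lambda>x. \<phi> k x - u x) \<in> borel_measurable lebesgue"
      by (intro borel_measurable_diff test_lebesgue_measurable \<phi> um)
    show ?thesis using L m w by (auto simp: finite_set_def seminorm_finite_def Lp_on_def Phi_1[OF q1(2)])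
  qed
  show "(\<lambda>k. Phi 1 q (\<lambda>x. \<phi> k x - u x)) \<longlonglongrightarrow> 0" using d H(4) by simp
  have "(\<lambda>x. \<phi> 0 x - u x) \<in> finite_set 1 q" using d by blast
  from fun_subspaceD(3)[OF fs(1)[of 1 q] test_Phi_1(1)[OF \<phi>[of 0] q] this] q show "u \<in> finite_set 1 q" by simp
qed

lemma limit_Phi:
  assumes \<phi>: "\<And>k. \<phi> k \<in> test" and q: "q \<in> {1<..<real CARD('n)}" and t: "t \<in> {0..1}"
    and c: "cauchy_in (Phi t q) \<phi>" and u: "limit_of \<phi> \<sigma> u"
  shows "u \<in> finite_set t q" "(\<lambda>k. Phi t q (\<lambda>x. \<phi> k x - u x)) \<longlonglongrightarrow> 0"
proof -
  have "u \<in> finite_set t q \<and> (\<lambda>k. Phi t q (\<lambda>x. \<phi> k x - u x)) \<longlonglongrightarrow> 0"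
  proof (cases "t = 1")
    case True then show ?thesis using limit_grad[OF \<phi> q _ u] c by blast
  next
    case False
    then have "t \<in> {0..<1}" using t by auto
    then show ?thesis using limit_frac[OF \<phi> q _ c u] by blast
  qed
  then show "u \<in> finite_set t q" "(\<lambda>k. Phi t q (\<lambda>x. \<phi> k x - u x)) \<longlonglongrightarrow> 0" by auto
qed

theorem X_complete:
  assumes \<phi>: "\<And>k. \<phi> k \<in> test"
    and c: "\<And>i j. i \<in> {1..n} \<Longrightarrow> j \<in> {1..m} \<Longrightarrow> cauchy_in (Phi (s i) (p j)) \<phi>"
  shows "\<exists>u\<in>X. \<forall>i\<in>{1..n}. \<forall>j\<in>{1..m}. (\<lambda>k. Phi (s i) (p j) (\<lambda>x. \<phi> k x - u x)) \<longlonglongrightarrow> 0"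
proof -
  obtain i0 where i0: "i0 \<in> {1..n}" "s i0 = b" using b_attained by auto
  have j0: "(1::nat) \<in> {1..m}" using m0 by simp
  \<comment> \<open>The top order is among the \<open>s i\<close> and controls order 0, so an L^p
    limit exists even when 0 is not among the \<open>s i\<close>.\<close>
  have c0: "cauchy_in (Phi 0 (p 1)) \<phi>"
    by (rule cauchy_lower_order[OF \<phi> p[OF j0] _ sbar]) (use sbar c[OF i0(1) j0] i0(2) in auto)
  obtain \<sigma> u where u: "limit_of \<phi> \<sigma> u" using limit_exists[OF \<phi> p[OF j0] c0] by blast
  have lim: "u \<in> finite_set (s i) (p j)" "(\<lambda>k. Phi (s i) (p j) (\<lambda>x. \<phi> k x - u x)) \<longlonglongrightarrow> 0"
    if "i \<in> {1..n}" "j \<in> {1..m}" for i j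
    using limit_Phi[OF \<phi> p[OF that(2)] s[OF that(1)] c[OF that] u] by auto
  have "u \<in> X" unfolding X_iff
  proof (intro conjI exI[of _ \<phi>] allI ballI)
    show "u \<in> borel_measurable lebesgue" using u by (simp add: limit_of_def)
    show "AE x in lebesgue. x \<notin> \<Omega> \<longrightarrow> u x = 0" by (rule limit_outside[OF \<phi> u])
  qed (use lim \<phi> in blast)+
  then show ?thesis using lim by blast
qed

section \<open>Lower orders on the whole function space\<close>

lemma X_approx:
  assumes "u \<in> X"
  obtains \<phi> where "\<And>k. \<phi> k \<in> test" "\<And>i j. i \<in> {1..n} \<Longrightarrow> j \<in> {1..m} \<Longrightarrow> (\<lambda>k. Phi (s i) (p j) (\<lambda>x. \<phi> k x - u x)) \<longlonglongrightarrow> 0"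
  using assms unfolding X_iff by blast

lemma X_D:
  assumes "u \<in> X"
  shows "u \<in> borel_measurable lebesgue" "AE x in lebesgue. x \<notin> \<Omega> \<longrightarrow> u x = 0"
    "i \<in> {1..n} \<Longrightarrow> j \<in> {1..m} \<Longrightarrow> u \<in> finite_set (s i) (p j)" "j \<in> {1..m} \<Longrightarrow> u \<in> finite_set b (p j)"
  using assms b_attained unfolding X_iff by auto

text \<open>If order 1 is the only one, the definition of \<open>X\<close> does not tie the
  approximating sequence to \<open>u\<close> in L^p. By the comparison for test functions the
  sequence does have an L^p limit \<open>v\<close>; then \<open>v - u\<close> has zero weak gradient
  and bounded support, so it vanishes.\<close>

lemma X_limit_approx:
  assumes u: "u \<in> X" and j: "j \<in> {1..m}" and b1: "b = 1"
  obtains \<phi> \<sigma> v where "\<And>k. \<phi> k \<in> test" "cauchy_in (Phi 1 (p j)) \<phi>" "limit_of \<phi> \<sigma> v" "AE x in lebesgue. v x = u x"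
    "(\<lambda>k. Phi 1 (p j) (\<lambda>x. \<phi> k x - u x)) \<longlonglongrightarrow> 0"
proof -
  obtain \<phi> where \<phi>: "\<And>k. \<phi> k \<in> test" "\<And>i j. i \<in> {1..n} \<Longrightarrow> j \<in> {1..m} \<Longrightarrow> (\<lambda>k. Phi (s i) (p j) (\<lambda>x. \<phi> k x - u x)) \<longlonglongrightarrow> 0"
    using X_approx[OF u] by blast
  note q = p[OF j]
  note F = fs[of 1 "p j"]
  obtain i0 where i0: "i0 \<in> {1..n}" "s i0 = 1" using b_attained b1 by auto
  have l: "(\<lambda>k. Phi 1 (p j) (\<lambda>x. \<phi> k x - u x)) \<longlonglongrightarrow> 0" using \<phi>(2)[OF i0(1) j] unfolding i0(2) .
  have u1: "u \<in> finite_set 1 (p j)" using X_D(4)[OF u j] b1 by simp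
  have c: "cauchy_in (Phi 1 (p j)) \<phi>"
    by (rule cauchy_in_if_convergent[OF F(1,2) test_Phi_1(1)[OF \<phi>(1) q] u1 l]) (use q in auto)
  have c0: "cauchy_in (Phi 0 (p j)) \<phi>" by (rule cauchy_lower_order[OF \<phi>(1) q _ _ c]) auto
  obtain \<sigma> v where v: "limit_of \<phi> \<sigma> v" using limit_exists[OF \<phi>(1) q c0] by blast
  note g = limit_grad[OF \<phi>(1) q c v]
  have P0: "Phi 1 (p j) (\<lambda>x. v x - u x) = 0"
  proof -
    have lim: "(\<lambda>k. 2 powr p j * (Phi 1 (p j) (\<lambda>x. \<phi> k x - u x) + Phi 1 (p j) (\<lambda>x. \<phi> k x - v x))) \<longlonglongrightarrow> 2 powr p j * (0 + 0)"
      by (intro tendsto_intros l g(2))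
    have "Phi 1 (p j) (\<lambda>x. (\<phi> k x - u x) - (\<phi> k x - v x)) \<le> 2 powr p j * (Phi 1 (p j) (\<lambda>x. \<phi> k x - u x) + Phi 1 (p j) (\<lambda>x. \<phi> k x - v x))" for k
    proof -
      have one: "(1::real) \<in> {0..1}" by simp
      note F1 = F(1)[OF one q]
      have "(\<lambda>x. \<phi> k x - u x) \<in> finite_set 1 (p j)" "(\<lambda>x. \<phi> k x - v x) \<in> finite_set 1 (p j)"
        by (rule fun_subspaceD(3)[OF F1 test_Phi_1(1)[OF \<phi>(1) q] u1], rule fun_subspaceD(3)[OF F1 test_Phi_1(1)[OF \<phi>(1) q] g(1)])
      then show ?thesis by (rule power_functional_add_le(2)[OF F1 F(2)[OF one q]])
    qed
    then have le: "Phi 1 (p j) (\<lambda>x. v x - u x) \<le> 2 powr p j * (Phi 1 (p j) (\<lambda>x. \<phi> k x - u x) + Phi 1 (p j) (\<lambda>x. \<phi> k x - v x))" for k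
      by simp
    have "Phi 1 (p j) (\<lambda>x. v x - u x) \<le> 2 powr p j * (0 + 0)"
      by (rule LIMSEQ_le_const[OF lim]) (use le in blast)
    then show ?thesis using Phi_nonneg[of 1 "p j" "\<lambda>x. v x - u x"] by simp
  qed
  have d: "(\<lambda>x. v x - u x) \<in> finite_set 1 (p j)" by (rule fun_subspaceD(3)[OF F(1) g(1) u1]) (use q in auto)
  have q0: "p j > 0" "p j \<ge> 1" using q by auto
  have wg: "has_weak_gradient (\<lambda>x. v x - u x) (weak_gradient (\<lambda>x. v x - u x))"
    using d by (auto simp: finite_set_def seminorm_finite_def intro: weak_gradient_AE(1))
  have "AE x in lebesgue. norm (weak_gradient (\<lambda>x. v x - u x) x) powr p j = 0"
  proof (rule integral_nonneg_eq_0_iff_AE[THEN iffD1])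
    show "integrable lebesgue (\<lambda>x. norm (weak_gradient (\<lambda>x. v x - u x) x) powr p j)"
      using d by (auto simp: finite_set_def seminorm_finite_def)
  qed (use P0 Phi_1[OF q0(1), of "\<lambda>x. v x - u x"] in auto)
  then have z: "AE x in lebesgue. weak_gradient (\<lambda>x. v x - u x) x = 0" by eventually_elim simp
  have "AE x in lebesgue. R / 2 \<le> norm x \<longrightarrow> v x - u x = 0"
    using X_D(2)[OF u]
  proof eventually_elim
    case (elim x)
    show ?case
    proof
      assume x: "R / 2 \<le> norm x"
      then have "x \<notin> \<Omega>" using \<Omega>_R[of x] by linarith
      then show "v x - u x = 0" using elim v x by (auto simp: limit_of_def)
    qed
  qed
  from zero_weak_gradient_imp_zero[OF wg z this] have "AE x in lebesgue. v x = u x" by eventually_elim simp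
  then show thesis using that \<phi>(1) c v l by blast
qed

text \<open>For b < 1 the comparison holds for every function of this support with finite top
  energy. For b = 1 it is known for test functions and passes to the limit along the approximating
  sequence.\<close>

theorem X_lower_order:
  assumes u: "u \<in> X" and j: "j \<in> {1..m}" and t: "t \<in> {0..b}"
  shows "u \<in> finite_set t (p j)" "Phi t (p j) u \<le> C * Phi b (p j) u"
proof -
  note q = p[OF j]
  have "u \<in> finite_set t (p j) \<and> Phi t (p j) u \<le> C * Phi b (p j) u"
  proof (cases "t = b")
    case True
    then show ?thesis using X_D(4)[OF u j] C1 mult_right_mono[of 1 C "Phi b (p j) u"] Phi_nonneg[of b "p j" u] by simp
  next
    case tb: False
    show ?thesis
    proof (cases "b = 1")
      case False
      then have S: "b \<in> {0<..<1}" using sbar by auto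
      show ?thesis using frac_finite_set[OF X_D(4)[OF u j] q S t X_D(2)[OF u]] by blast
    next
      case True
      obtain \<phi> \<sigma> v where \<phi>: "\<And>k. \<phi> k \<in> test" "cauchy_in (Phi 1 (p j)) \<phi>" "limit_of \<phi> \<sigma> v" "AE x in lebesgue. v x = u x"
         "(\<lambda>k. Phi 1 (p j) (\<lambda>x. \<phi> k x - u x)) \<longlonglongrightarrow> 0"
        using X_limit_approx[OF u j True] by blast
      have t1: "t \<in> {0..<1}" "t \<in> {0..1}" using t tb True by auto
      have one: "(1::real) \<in> {0<..1}" "(1::real) \<in> {0..1}" by auto
      have c: "cauchy_in (Phi t (p j)) \<phi>" by (rule cauchy_lower_order[OF \<phi>(1) q t1(2) one(1) \<phi>(2)])
      note L = limit_frac[OF \<phi>(1) q t1(1) c \<phi>(3)]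
      note A = finite_set_AE_cong[OF dim t1(1) q L(1) X_D(1)[OF u] \<phi>(4)]
      have 1: "(\<lambda>k. Phi t (p j) (\<phi> k)) \<longlonglongrightarrow> Phi t (p j) v"
        by (rule power_functional_tendsto[OF fs(1,2)[OF t1(2) q] test_finite_set(1)[OF \<phi>(1) q t1(2)] L])
      have u1: "u \<in> finite_set 1 (p j)" using X_D(4)[OF u j] True by simp
      have "(\<lambda>k. Phi 1 (p j) (\<phi> k)) \<longlonglongrightarrow> Phi 1 (p j) u"
        by (rule power_functional_tendsto[OF fs(1,2)[OF one(2) q] test_Phi_1(1)[OF \<phi>(1) q] u1 \<phi>(5)])
      then have 2: "(\<lambda>k. C * Phi 1 (p j) (\<phi> k)) \<longlonglongrightarrow> C * Phi 1 (p j) u" by (intro tendsto_intros)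
      have "Phi t (p j) v \<le> C * Phi 1 (p j) u"
        by (rule LIMSEQ_le[OF 1 2]) (use test_finite_set(2)[OF \<phi>(1) q t1(2)] in blast)
      then show ?thesis using A True by simp
    qed
  qed
  then show "u \<in> finite_set t (p j)" "Phi t (p j) u \<le> C * Phi b (p j) u" by auto
qed

text \<open>The approximating gradients vanish outside \<Omega>, so the integral of |grad u|^p there
  is at most the distance from \<open>u\<close> to each approximant.\<close>

lemma X_gradient_outside:
  assumes u: "u \<in> X" and b1: "b = 1"
  shows "AE x in lebesgue. x \<notin> \<Omega> \<longrightarrow> weak_gradient u x = 0"
proof -
  have j: "(1::nat) \<in> {1..m}" using m0 by simp
  note q = p[OF j]
  have q0: "p 1 > 0" using q by auto
  obtain \<phi> where \<phi>: "\<And>k. \<phi> k \<in> test" "\<And>i j. i \<in> {1..n} \<Longrightarrow> j \<in> {1..m} \<Longrightarrow> (\<lambda>k. Phi (s i) (p j) (\<lambda>x. \<phi> k x - u x)) \<longlonglongrightarrow> 0"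
    using X_approx[OF u] by blast
  obtain i0 where i0: "i0 \<in> {1..n}" "s i0 = 1" using b_attained b1 by auto
  have l: "(\<lambda>k. Phi 1 (p 1) (\<lambda>x. \<phi> k x - u x)) \<longlonglongrightarrow> 0" using \<phi>(2)[OF i0(1) j] unfolding i0(2) .
  have u1: "u \<in> finite_set 1 (p 1)" using X_D(4)[OF u j] b1 by simp
  have wu: "\<exists>G. has_weak_gradient u G" using u1 by (auto simp: finite_set_def seminorm_finite_def)
  have iu: "integrable lebesgue (\<lambda>x. norm (weak_gradient u x) powr p 1)" using u1 by (auto simp: finite_set_def seminorm_finite_def)
  have \<Omega>c: "- \<Omega> \<in> sets lebesgue" using \<Omega>_sets by (simp add: Compl_in_sets_lebesgue)
  have ii: "integrable lebesgue (\<lambda>x. indicator (- \<Omega>) x * norm (weak_gradient u x) powr p 1)"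
    using integrable_mult_indicator[OF \<Omega>c iu] by simp
  have le: "(LINT x|lebesgue. indicator (- \<Omega>) x * norm (weak_gradient u x) powr p 1) \<le> Phi 1 (p 1) (\<lambda>x. \<phi> k x - u x)" for k
  proof -
    have d: "(\<lambda>x. \<phi> k x - u x) \<in> finite_set 1 (p 1)"
      by (rule fun_subspaceD(3)[OF fs(1) test_Phi_1(1)[OF \<phi>(1) q] u1]) (use q in auto)
    have ae: "AE x in lebesgue. weak_gradient (\<lambda>x. \<phi> k x - u x) x = weak_gradient (\<phi> k) x - weak_gradient u x"
    proof -
      have "\<exists>G. has_weak_gradient (\<phi> k) G" using has_weak_gradient_test[OF \<phi>(1)[of k]] by blast
      from weak_gradient_lincomb_AE(2)[OF this wu, of 1 "-1"] show ?thesis by simp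
    qed
    show ?thesis unfolding Phi_1[OF q0]
    proof (rule integral_mono_AE[OF ii])
      show "integrable lebesgue (\<lambda>x. norm (weak_gradient (\<lambda>x. \<phi> k x - u x) x) powr p 1)"
        using d by (auto simp: finite_set_def seminorm_finite_def)
      show "AE x in lebesgue. indicator (- \<Omega>) x * norm (weak_gradient u x) powr p 1 \<le> norm (weak_gradient (\<lambda>x. \<phi> k x - u x) x) powr p 1"
        using ae weak_gradient_AE(2)[OF has_weak_gradient_test[OF \<phi>(1)[of k]]]
      proof eventually_elim
        case (elim x)
        then show ?case using grad_outside[OF \<phi>(1)[of k], of x] by (auto simp: indicator_def)
      qed
    qed
  qed
  have "(LINT x|lebesgue. indicator (- \<Omega>) x * norm (weak_gradient u x) powr p 1) \<le> 0"
    by (rule LIMSEQ_le_const[OF l]) (use le in blast)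
  moreover have "(LINT x|lebesgue. indicator (- \<Omega>) x * norm (weak_gradient u x) powr p 1) \<ge> 0" by simp
  ultimately have "(LINT x|lebesgue. indicator (- \<Omega>) x * norm (weak_gradient u x) powr p 1) = 0" by linarith
  then have "AE x in lebesgue. indicator (- \<Omega>) x * norm (weak_gradient u x) powr p 1 = 0"
    using integral_nonneg_eq_0_iff_AE[OF ii] by simp
  then show ?thesis by eventually_elim (auto simp: indicator_def)
qed

end

section \<open>Compactness\<close>

text \<open>Doubling the radius changes volume times kernel by the factor 2^(-\<theta>), so the
  shells form a convergent geometric series.\<close>

lemma powr_tail_finite:
  assumes \<rho>: "\<rho> > 0" and \<theta>: "\<theta> > 0"
  shows "\<exists>K\<ge>0. (\<integral>\<^sup>+h. ennreal (norm (h::'a::euclidean_space) powr - (real DIM('a) + \<theta>)) * indicator {h. \<rho> \<le> norm h} h \<partial>lborel) \<le> ennreal K"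
proof -
  define e where "e = real DIM('a) + \<theta>"
  define r where "r = 2 powr (- \<theta>)"
  have r: "0 < r" "r < 1" using \<theta> by (auto simp: r_def powr_less_one)
  note rm = ring_measure[OF \<rho>, where 'a='a]
  have e: "e > 0" using \<theta> by (simp add: e_def add_nonneg_pos)
  have trm: "ennreal ((2 ^ k) ^ DIM('a)) * (\<integral>\<^sup>+h. ennreal (norm ((2 ^ k) *\<^sub>R (h::'a)) powr - e) * indicator (ring \<rho>) h \<partial>lborel)
     \<le> ennreal (r ^ k) * ennreal (\<rho> powr - e * ring_measure TYPE('a) \<rho>)" for k :: nat
  proof -
    have pk: "(2 ^ k :: real) = 2 powr (real k)" by (simp add: powr_realpow)
    have "(\<integral>\<^sup>+h. ennreal (norm ((2 ^ k) *\<^sub>R (h::'a)) powr - e) * indicator (ring \<rho>) h \<partial>lborel)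
      \<le> (\<integral>\<^sup>+h. ennreal (2 powr (- real k * e) * \<rho> powr - e) * indicator (ring \<rho>) (h::'a) \<partial>lborel)"
    proof (rule nn_integral_mono)
      fix h :: 'a
      have "norm ((2 ^ k) *\<^sub>R h) powr - e \<le> 2 powr (- real k * e) * \<rho> powr - e" if "h \<in> ring \<rho>"
      proof -
        have "norm ((2 ^ k) *\<^sub>R h) powr - e = 2 powr (- real k * e) * norm h powr - e"
          by (simp add: pk powr_mult powr_powr)
        also have "\<dots> \<le> 2 powr (- real k * e) * \<rho> powr - e"
          using that e \<rho> by (intro mult_left_mono powr_mono2') (auto simp: ring_def)
        finally show ?thesis .
      qed
      then show "ennreal (norm ((2 ^ k) *\<^sub>R h) powr - e) * indicator (ring \<rho>) h \<le> ennreal (2 powr (- real k * e) * \<rho> powr - e) * indicator (ring \<rho>) h"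
        by (auto simp: indicator_def ennreal_leI)
    qed
    also have "\<dots> = ennreal (2 powr (- real k * e) * \<rho> powr - e) * ennreal (ring_measure TYPE('a) \<rho>)"
      using rm by (simp add: nn_integral_cmult)
    finally have "ennreal ((2 ^ k) ^ DIM('a)) * (\<integral>\<^sup>+h. ennreal (norm ((2 ^ k) *\<^sub>R (h::'a)) powr - e) * indicator (ring \<rho>) h \<partial>lborel)
       \<le> ennreal ((2 ^ k) ^ DIM('a)) * (ennreal (2 powr (- real k * e) * \<rho> powr - e) * ennreal (ring_measure TYPE('a) \<rho>))"
      by (rule mult_left_mono) simp
    also have "\<dots> = ennreal ((2 ^ k) ^ DIM('a) * 2 powr (- real k * e) * (\<rho> powr - e * ring_measure TYPE('a) \<rho>))"
      using rm by (simp add: ennreal_mult' ennreal_mult'' mult_ac)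
    also have "(2 ^ k) ^ DIM('a) * 2 powr (- real k * e) = r ^ k"
      unfolding pk r_def powr_realpow[symmetric, OF powr_gt_zero[THEN iffD2, OF zero_neq_numeral[symmetric]]]
      by (simp add: powr_powr e_def algebra_simps flip: powr_add)
    finally show ?thesis using rm r by (simp add: ennreal_mult')
  qed
  have "(\<integral>\<^sup>+h. ennreal (norm (h::'a) powr - e) * indicator {h. \<rho> \<le> norm h} h \<partial>lborel) =
     (\<Sum>k. ennreal ((2 ^ k) ^ DIM('a)) * (\<integral>\<^sup>+h. ennreal (norm ((2 ^ k) *\<^sub>R (h::'a)) powr - e) * indicator (ring \<rho>) h \<partial>lborel))"
    by (rule nn_integral_dyadic_outer) (use \<rho> in auto)
  also have "\<dots> \<le> (\<Sum>k. ennreal (r ^ k) * ennreal (\<rho> powr - e * ring_measure TYPE('a) \<rho>))"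
    by (intro suminf_le trm) auto
  also have "\<dots> = ennreal (1 / (1 - r)) * ennreal (\<rho> powr - e * ring_measure TYPE('a) \<rho>)"
    using ennreal_geometric_suminf[of r] r by (simp only: ennreal_suminf_multc)
  also have "\<dots> = ennreal (1 / (1 - r) * (\<rho> powr - e * ring_measure TYPE('a) \<rho>))"
    using r by (intro ennreal_mult'[symmetric]) simp
  finally show ?thesis using r rm unfolding e_def
    by (intro exI[of _ "1 / (1 - r) * (\<rho> powr - e * ring_measure TYPE('a) \<rho>)"]) (auto simp: e_def)
qed

text \<open>Cut at |h| = \<rho>. For smaller shifts the kernel of order \<open>t\<close> is at most
  \<rho>^((S - t) p) times that of order \<open>S\<close>; for larger ones the shift integral is
  bounded by the L^p norm and the kernel is integrable.\<close>

lemma gag_interpolation: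
  assumes p: "p \<ge> 1" and t: "0 < t" "t < S" and \<rho>: "\<rho> > 0"
  shows "\<exists>K\<ge>0. \<forall>u :: 'a::euclidean_space \<Rightarrow> real. u \<in> borel_measurable borel \<longrightarrow>
     gag t p u \<le> ennreal (\<rho> powr ((S - t) * p)) * gag S p u + ennreal K * pow_int p u"
proof -
  let ?J = "\<integral>\<^sup>+h. ennreal (norm (h::'a) powr - (real DIM('a) + t * p)) * indicator {h. \<rho> \<le> norm h} h \<partial>lborel"
  obtain K where K: "K \<ge> 0" "?J \<le> ennreal K"
    using powr_tail_finite[OF \<rho>, of "t * p", where 'a='a] p t by auto
  have "gag t p u \<le> ennreal (\<rho> powr ((S - t) * p)) * gag S p u + ennreal (2 powr p * 2 * K) * pow_int p u"
    if u: "u \<in> borel_measurable borel" for u :: "'a \<Rightarrow> real"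
  proof -
    note [measurable] = u
    let ?A = "\<lambda>h::'a. ennreal (\<rho> powr ((S - t) * p)) * (shift_pow p u h * ennreal (norm h powr - (real DIM('a) + S * p)))"
    let ?B = "\<lambda>h::'a. (ennreal (2 powr p * 2) * pow_int p u) * (ennreal (norm h powr - (real DIM('a) + t * p)) * indicator {h. \<rho> \<le> norm h} h)"
    have "gag t p u \<le> (\<integral>\<^sup>+h. ?A h + ?B h \<partial>lborel)"
      unfolding gag_def
    proof (rule nn_integral_mono)
      fix h :: 'a
      show "shift_pow p u h * ennreal (norm h powr - (real DIM('a) + t * p)) \<le> ?A h + ?B h"
      proof (cases "\<rho> \<le> norm h")
        case True
        have "shift_pow p u h * ennreal (norm h powr - (real DIM('a) + t * p)) \<le> ?B h"
          using mult_right_mono[OF shift_pow_le_pow_int[OF u p, of h], of "ennreal (norm h powr - (real DIM('a) + t * p))"] True by simp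
        then show ?thesis by (rule order_trans) simp
      next
        case False
        have "norm h powr - (real DIM('a) + t * p) \<le> \<rho> powr ((S - t) * p) * norm h powr - (real DIM('a) + S * p)"
        proof (cases "h = 0")
          case h: False
          have "norm h powr - (real DIM('a) + t * p) = norm h powr ((S - t) * p) * norm h powr - (real DIM('a) + S * p)"
            by (simp add: algebra_simps flip: powr_add)
          also have "\<dots> \<le> \<rho> powr ((S - t) * p) * norm h powr - (real DIM('a) + S * p)"
            using False t p by (intro mult_right_mono powr_mono2) auto
          finally show ?thesis .
        qed simp
        then have "ennreal (norm h powr - (real DIM('a) + t * p)) \<le> ennreal (\<rho> powr ((S - t) * p)) * ennreal (norm h powr - (real DIM('a) + S * p))"
          by (simp add: ennreal_leI flip: ennreal_mult')
        from mult_left_mono[OF this, of "shift_pow p u h"]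
        have "shift_pow p u h * ennreal (norm h powr - (real DIM('a) + t * p)) \<le> ?A h" by (simp add: mult_ac)
        then show ?thesis by (rule order_trans) simp
      qed
    qed
    also have "\<dots> = (\<integral>\<^sup>+h. ?A h \<partial>lborel) + (\<integral>\<^sup>+h. ?B h \<partial>lborel)" by (rule nn_integral_add) measurable
    also have "(\<integral>\<^sup>+h. ?A h \<partial>lborel) = ennreal (\<rho> powr ((S - t) * p)) * gag S p u"
      unfolding gag_def by (rule nn_integral_cmult) measurable
    also have "(\<integral>\<^sup>+h. ?B h \<partial>lborel) = (ennreal (2 powr p * 2) * pow_int p u) * ?J"
      by (rule nn_integral_cmult) measurable
    also have "\<dots> \<le> (ennreal (2 powr p * 2) * pow_int p u) * ennreal K" using K by (intro mult_left_mono) auto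
    also have "\<dots> = ennreal (2 powr p * 2 * K) * pow_int p u" using K by (simp add: ennreal_mult' mult_ac)
    finally show ?thesis by simp
  qed
  then show ?thesis using K by (intro exI[of _ "2 powr p * 2 * K"]) auto
qed

section \<open>Means over a grid of cubes\<close>

definition cell :: "real \<Rightarrow> int^'n \<Rightarrow> (real^'n) set" where
  "cell \<epsilon> z = {x. \<forall>i. \<lfloor>x $ i / \<epsilon>\<rfloor> = z $ i}"

lemma cell_iff:
  assumes "\<epsilon> > 0"
  shows "x \<in> cell \<epsilon> z \<longleftrightarrow> (\<forall>i. real_of_int (z $ i) * \<epsilon> \<le> x $ i \<and> x $ i < (real_of_int (z $ i) + 1) * \<epsilon>)"
  using assms by (simp add: cell_def floor_eq_iff pos_le_divide_eq pos_divide_less_eq)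

lemma cell_exists: "\<exists>z. x \<in> cell \<epsilon> z"
  by (rule exI[of _ "\<chi> i. \<lfloor>x $ i / \<epsilon>\<rfloor>"]) (simp add: cell_def)

lemma cell_unique: "x \<in> cell \<epsilon> z \<Longrightarrow> x \<in> cell \<epsilon> w \<Longrightarrow> z = w"
  by (auto simp: cell_def vec_eq_iff)

lemma cell_measurable [measurable]: "cell \<epsilon> z \<in> sets borel"
proof -
  have "(\<lambda>x::real^'n. x $ i) \<in> borel_measurable borel" for i
    by (intro borel_measurable_continuous_onI continuous_intros)
  then have [measurable]: "(\<lambda>x::real^'n. x $ i) \<in> borel_measurable borel" for i .
  have "{x \<in> space borel. \<forall>i. \<lfloor>x $ i / \<epsilon>\<rfloor> = z $ i} \<in> sets borel" by measurable
  then show ?thesis by (simp add: cell_def)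
qed

lemma emeasure_cell:
  fixes z :: "int^'n"
  assumes "\<epsilon> > 0" shows "emeasure lborel (cell \<epsilon> z) = ennreal (\<epsilon> ^ CARD('n))"
proof -
  define a b :: "real^'n" where "a = (\<chi> i. real_of_int (z $ i) * \<epsilon>)" and "b = (\<chi> i. (real_of_int (z $ i) + 1) * \<epsilon>)"
  have d: "(b - a) \<bullet> v = \<epsilon>" if "v \<in> Basis" for v
    using that by (auto simp: Basis_vec_def inner_axis a_def b_def algebra_simps)
  have le: "a \<bullet> v \<le> b \<bullet> v" if "v \<in> Basis" for v using d[OF that] assms by (simp add: inner_diff_left)
  have pr: "(\<Prod>v\<in>Basis. (b - a) \<bullet> v) = \<epsilon> ^ CARD('n)" using d by simp
  have "box a b \<subseteq> cell \<epsilon> z" "cell \<epsilon> z \<subseteq> cbox a b"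
    using assms by (auto simp: mem_box_cart cell_iff a_def b_def less_imp_le)
  then have "emeasure lborel (box a b) \<le> emeasure lborel (cell \<epsilon> z)" "emeasure lborel (cell \<epsilon> z) \<le> emeasure lborel (cbox a b)"
    by (auto intro!: emeasure_mono)
  moreover have "emeasure lborel (box a b) = ennreal (\<epsilon> ^ CARD('n))" using emeasure_lborel_box[OF le] pr by simp
  moreover have "emeasure lborel (cbox a b) = ennreal (\<epsilon> ^ CARD('n))" using emeasure_lborel_cbox[OF le] pr by simp
  ultimately show ?thesis by simp
qed

text \<open>A crude bound through the sum of the coordinates; what counts below is proportionality
  to \<epsilon>.\<close>

lemma cell_diameter:
  fixes z :: "int^'n"
  assumes "\<epsilon> > 0" "x \<in> cell \<epsilon> z" "y \<in> cell \<epsilon> z"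
  shows "norm (x - y) \<le> real CARD('n) * \<epsilon>"
proof -
  have "norm (x - y) \<le> (\<Sum>i\<in>UNIV. \<bar>(x - y) $ i\<bar>)" by (rule norm_le_l1_cart)
  also have "\<dots> \<le> (\<Sum>i\<in>(UNIV::'n set). \<epsilon>)"
  proof (rule sum_mono)
    fix i
    have "real_of_int (z $ i) * \<epsilon> \<le> x $ i" "x $ i < (real_of_int (z $ i) + 1) * \<epsilon>"
      "real_of_int (z $ i) * \<epsilon> \<le> y $ i" "y $ i < (real_of_int (z $ i) + 1) * \<epsilon>"
      using assms by (auto simp: cell_iff)
    then show "\<bar>(x - y) $ i\<bar> \<le> \<epsilon>" by (simp add: distrib_right abs_le_iff)
  qed
  finally show ?thesis by simp
qed

lemma finite_cells:
  fixes r :: real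
  assumes "\<epsilon> > 0"
  shows "finite {z :: int^'n. \<exists>x\<in>cell \<epsilon> z. norm x < r}"
proof -
  define M where "M = \<lceil>\<bar>r\<bar> / \<epsilon>\<rceil> + 1"
  have "{z :: int^'n. \<exists>x\<in>cell \<epsilon> z. norm x < r} \<subseteq> vec_lambda ` (PiE UNIV (\<lambda>_. {-M..M}))"
  proof
    fix z :: "int^'n" assume "z \<in> {z. \<exists>x\<in>cell \<epsilon> z. norm x < r}"
    then obtain x where x: "x \<in> cell \<epsilon> z" "norm x < r" by blast
    have "z $ i \<in> {-M..M}" for i
    proof -
      have "\<bar>x $ i\<bar> < r" using component_le_norm_cart[of x i] x by linarith
      then have "\<bar>x $ i\<bar> / \<epsilon> \<le> \<bar>r\<bar> / \<epsilon>" using assms by (intro divide_right_mono) auto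
      then have a: "\<bar>x $ i / \<epsilon>\<bar> \<le> \<bar>r\<bar> / \<epsilon>" using assms by simp
      have "real_of_int \<lfloor>x $ i / \<epsilon>\<rfloor> = real_of_int (z $ i)" using x by (simp add: cell_def)
      then have "real_of_int (z $ i) \<le> \<bar>r\<bar> / \<epsilon>" "- (\<bar>r\<bar> / \<epsilon>) - 1 \<le> real_of_int (z $ i)"
        using a of_int_floor_le[of "x $ i / \<epsilon>"] real_of_int_floor_gt_diff_one[of "x $ i / \<epsilon>"] unfolding abs_le_iff by linarith+
      moreover have "\<bar>r\<bar> / \<epsilon> + 1 \<le> real_of_int M" unfolding M_def by simp
      ultimately have "real_of_int (z $ i) \<le> real_of_int M" "real_of_int (- M) \<le> real_of_int (z $ i)" by linarith+
      then show ?thesis unfolding of_int_le_iff by simp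
    qed
    then have "(\<lambda>i. z $ i) \<in> PiE UNIV (\<lambda>_. {-M..M})" by auto
    moreover have "z = vec_lambda (\<lambda>i. z $ i)" by (simp add: vec_eq_iff)
    ultimately show "z \<in> vec_lambda ` (PiE UNIV (\<lambda>_. {-M..M}))" by blast
  qed
  moreover have "finite (vec_lambda ` (PiE (UNIV::'n set) (\<lambda>_. {-M..M})))" by (intro finite_imageI finite_PiE) auto
  ultimately show ?thesis by (rule finite_subset)
qed

text \<open>Integrate the tangent inequality of the power at the mean \<open>A\<close> of |v|, where
  the linear term has integral 0.\<close>

lemma Jensen_powr:
  fixes v :: "'a \<Rightarrow> real"
  assumes q: "q > 1" and i: "integrable M v" "integrable M (\<lambda>x. \<bar>v x\<bar> powr q)" and fin: "finite_measure M"
    and \<mu>: "measure M (space M) = \<mu>" "\<mu> > 0"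
  shows "\<bar>(LINT x|M. v x) / \<mu>\<bar> powr q \<le> (LINT x|M. \<bar>v x\<bar> powr q) / \<mu>"
proof -
  interpret finite_measure M by (rule fin)
  define A where "A = (LINT x|M. \<bar>v x\<bar>) / \<mu>"
  have A: "A \<ge> 0" unfolding A_def using \<mu> by (intro divide_nonneg_pos) auto
  have iv: "(LINT x|M. \<bar>v x\<bar>) = A * \<mu>" using \<mu> by (simp add: A_def)
  have "\<bar>(LINT x|M. v x)\<bar> \<le> (LINT x|M. \<bar>v x\<bar>)" using integral_norm_bound[of M v] by simp
  then have "\<bar>(LINT x|M. v x) / \<mu>\<bar> \<le> A" using \<mu> by (simp add: A_def divide_right_mono)
  then have "\<bar>(LINT x|M. v x) / \<mu>\<bar> powr q \<le> A powr q" using q by (intro powr_mono2) auto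
  also have "\<dots> \<le> (LINT x|M. \<bar>v x\<bar> powr q) / \<mu>"
  proof (cases "A = 0")
    case True then show ?thesis using \<mu> by simp
  next
    case False
    then have A: "A > 0" using A by simp
    have pt: "A powr q * (1 + q * (\<bar>v x\<bar> / A - 1)) \<le> \<bar>v x\<bar> powr q" for x
    proof -
      have eq: "A powr q * (\<bar>v x\<bar> / A) powr q = \<bar>v x\<bar> powr q" using A by (simp flip: powr_mult)
      have "1 + q * (\<bar>v x\<bar> / A - 1) \<le> (\<bar>v x\<bar> / A) powr q"
        using powr_gt_tangent[of q "\<bar>v x\<bar> / A"] A q by (cases "\<bar>v x\<bar> / A = 1") auto
      then show ?thesis unfolding eq[symmetric] by (rule mult_left_mono) simp
    qed
    have "(LINT x|M. A powr q * (1 + q * (\<bar>v x\<bar> / A - 1))) \<le> (LINT x|M. \<bar>v x\<bar> powr q)"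
      using i by (intro integral_mono pt) auto
    also have "(LINT x|M. A powr q * (1 + q * (\<bar>v x\<bar> / A - 1))) = A powr q * (\<mu> + q * ((LINT x|M. \<bar>v x\<bar>) / A - \<mu>))"
      using i \<mu> by simp
    also have "\<dots> = A powr q * \<mu>" unfolding iv using A by simp
    finally show ?thesis using \<mu> by (simp add: pos_le_divide_eq)
  qed
  finally show ?thesis .
qed

text \<open>On a small cell a function is close to its mean, and only finitely many means are involved.\<close>

lemma pow_int_le_cell_means:
  fixes w :: "real^'n \<Rightarrow> real"
  assumes w: "w \<in> borel_measurable borel" "\<And>x. \<bar>w x\<bar> \<le> B" and supp: "\<And>x. r \<le> norm x \<Longrightarrow> w x = 0"
    and q: "q > 1" and t: "t > 0" and \<epsilon>: "\<epsilon> > 0"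
  defines "Z \<equiv> {z :: int^'n. \<exists>x\<in>cell \<epsilon> z. norm x < r}" and "\<mu> \<equiv> \<epsilon> ^ CARD('n)"
  shows "pow_int q w \<le> ennreal (2 powr q * ((real CARD('n) * \<epsilon>) powr (real CARD('n) + t * q) / \<mu>)) * gag t q w
     + ennreal (\<Sum>z\<in>Z. 2 powr q * \<mu> powr (1 - q) * \<bar>LINT x|lborel. indicator (cell \<epsilon> z) x * w x\<bar> powr q)"
proof -
  note [measurable] = w(1)
  have \<mu>: "\<mu> > 0" using \<epsilon> by (simp add: \<mu>_def)
  have finZ: "finite Z" unfolding Z_def by (rule finite_cells[OF \<epsilon>])
  define e where "e = real CARD('n) + t * q"
  define D where "D = (real CARD('n) * \<epsilon>) powr e"
  define I where "I z = (LINT x|lborel. indicator (cell \<epsilon> z) x * w x)" for z :: "int^'n"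
  have em: "emeasure lborel (cell \<epsilon> z) = ennreal \<mu>" for z :: "int^'n" unfolding \<mu>_def by (rule emeasure_cell[OF \<epsilon>])
  let ?Q = "\<lambda>z. restrict_space lborel (cell \<epsilon> z :: (real^'n) set)"
  have fin: "finite_measure (?Q z)" for z
    by (intro finite_measureI) (simp add: emeasure_restrict_space space_restrict_space em)
  have mu: "measure (?Q z) (space (?Q z)) = \<mu>" for z
    using \<mu> by (simp add: space_restrict_space measure_def emeasure_restrict_space em)
  have int: "integrable (?Q z) f" if "f \<in> borel_measurable borel" "\<And>x. \<bar>f x\<bar> \<le> c" for z c and f :: "real^'n \<Rightarrow> real"
  proof (rule finite_measure.integrable_const_bound[OF fin, of _ c])
    show "f \<in> borel_measurable (?Q z)" using that(1) by (intro measurable_restrict_space1) simp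
  qed (use that in auto)
  \<comment> \<open>\<open>w x\<close> is its deviation from the mean of \<open>w\<close> over the
    cell plus that mean; Jensen bounds the power of the deviation by the mean of the powers of
    \<open>w x - w y\<close>.\<close>
  have pt: "\<bar>w x\<bar> powr q \<le> 2 powr q * ((LINT y|?Q z. \<bar>w x - w y\<bar> powr q) / \<mu>) + 2 powr q * (\<bar>I z\<bar> / \<mu>) powr q" for x z
  proof -
    have iw: "integrable (?Q z) w" by (rule int[OF w])
    have Iz: "I z = (LINT y|?Q z. w y)" unfolding I_def by (subst integral_restrict_space) auto
    have d: "(LINT y|?Q z. w x - w y) = w x * \<mu> - I z" unfolding Iz using iw mu
      by (subst Bochner_Integration.integral_diff) (auto intro!: finite_measure.integrable_const[OF fin])
    have b1: "\<bar>w x - w y\<bar> \<le> 2 * B" for y using w(2)[of x] w(2)[of y] by linarith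
    have "\<bar>(LINT y|?Q z. w x - w y) / \<mu>\<bar> powr q \<le> (LINT y|?Q z. \<bar>w x - w y\<bar> powr q) / \<mu>"
    proof (rule Jensen_powr[OF q _ _ fin mu \<mu>])
      show "integrable (?Q z) (\<lambda>y. w x - w y)" by (rule int[OF _ b1]) measurable
      show "integrable (?Q z) (\<lambda>y. \<bar>w x - w y\<bar> powr q)"
        by (rule int[of _ "(2 * B) powr q"]) (use b1 q in \<open>auto intro!: powr_mono2\<close>)
    qed
    moreover have "\<bar>w x\<bar> powr q \<le> 2 powr q * (\<bar>w x - I z / \<mu>\<bar> powr q + \<bar>I z / \<mu>\<bar> powr q)"
      using norm_powr_add_le[of q "w x - I z / \<mu>" "I z / \<mu>"] q by simp
    moreover have "w x - I z / \<mu> = (LINT y|?Q z. w x - w y) / \<mu>" unfolding d using \<mu> by (simp add: diff_divide_distrib)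
    ultimately have "\<bar>w x\<bar> powr q \<le> 2 powr q * ((LINT y|?Q z. \<bar>w x - w y\<bar> powr q) / \<mu> + \<bar>I z / \<mu>\<bar> powr q)"
      by (smt (verit) mult_left_mono powr_ge_zero)
    then show ?thesis using \<mu> by (simp add: distrib_left abs_divide)
  qed
  define G where "G x y = ennreal (\<bar>w x - w y\<bar> powr q)" for x y
  have GL: "ennreal (LINT y|?Q z. \<bar>w x - w y\<bar> powr q) = (\<integral>\<^sup>+y. indicator (cell \<epsilon> z) y * G x y \<partial>lborel)" for x z
  proof -
    have b1: "\<bar>w x - w y\<bar> \<le> 2 * B" for y using w(2)[of x] w(2)[of y] by linarith
    have "ennreal (LINT y|?Q z. \<bar>w x - w y\<bar> powr q) = (\<integral>\<^sup>+y. G x y \<partial>?Q z)"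
      unfolding G_def
      by (rule nn_integral_eq_integral[symmetric], rule int[of _ "(2 * B) powr q"]) (use b1 q in \<open>auto intro!: powr_mono2\<close>)
    also have "\<dots> = (\<integral>\<^sup>+y. indicator (cell \<epsilon> z) y * G x y \<partial>lborel)"
      by (subst nn_integral_restrict_space) (auto simp: mult.commute)
    finally show ?thesis .
  qed
  have "pow_int q w \<le> (\<integral>\<^sup>+x. (\<Sum>z\<in>Z. indicator (cell \<epsilon> z) x *
      (ennreal (2 powr q / \<mu>) * (\<integral>\<^sup>+y. indicator (cell \<epsilon> z) y * G x y \<partial>lborel) + ennreal (2 powr q * (\<bar>I z\<bar> / \<mu>) powr q))) \<partial>lborel)"
    unfolding pow_int_def
  proof (rule nn_integral_mono)
    fix x :: "real^'n"
    obtain z where z: "x \<in> cell \<epsilon> z" using cell_exists by blast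
    let ?F = "\<lambda>z. indicator (cell \<epsilon> z) x * (ennreal (2 powr q / \<mu>) * (\<integral>\<^sup>+y. indicator (cell \<epsilon> z) y * G x y \<partial>lborel) + ennreal (2 powr q * (\<bar>I z\<bar> / \<mu>) powr q))"
    show "ennreal (\<bar>w x\<bar> powr q) \<le> sum ?F Z"
    proof (cases "z \<in> Z")
      case True
      have "ennreal (\<bar>w x\<bar> powr q) \<le> ennreal (2 powr q / \<mu> * (LINT y|?Q z. \<bar>w x - w y\<bar> powr q) + 2 powr q * (\<bar>I z\<bar> / \<mu>) powr q)"
        using pt[of x z] by (intro ennreal_leI) simp
      also have "\<dots> = ?F z"
      proof -
        have split: "ennreal (c * a + d) = ennreal c * ennreal a + ennreal d" if "c \<ge> 0" "a \<ge> 0" "d \<ge> 0" for c a d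
          using that by (simp add: ennreal_mult')
        have "?F z = ennreal (2 powr q / \<mu>) * ennreal (LINT y|?Q z. \<bar>w x - w y\<bar> powr q) + ennreal (2 powr q * (\<bar>I z\<bar> / \<mu>) powr q)"
          unfolding GL using z by (simp only: indicator_simps mult_1_left)
        also have "\<dots> = ennreal (2 powr q / \<mu> * (LINT y|?Q z. \<bar>w x - w y\<bar> powr q) + 2 powr q * (\<bar>I z\<bar> / \<mu>) powr q)"
          by (rule split[symmetric]) (use \<mu> in auto)
        finally show ?thesis by (rule sym)
      qed
      also have "\<dots> \<le> sum ?F Z" by (rule member_le_sum[OF True _ finZ]) simp
      finally show ?thesis .
    next
      case False
      then have "w x = 0" using z supp[of x] by (force simp: Z_def)
      then show ?thesis by simp
    qed
  qed
  also have "\<dots> = (\<Sum>z\<in>Z. \<integral>\<^sup>+x. indicator (cell \<epsilon> z) x *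
      (ennreal (2 powr q / \<mu>) * (\<integral>\<^sup>+y. indicator (cell \<epsilon> z) y * G x y \<partial>lborel) + ennreal (2 powr q * (\<bar>I z\<bar> / \<mu>) powr q)) \<partial>lborel)"
    unfolding G_def by (rule nn_integral_sum) measurable
  also have "\<dots> = (\<Sum>z\<in>Z. ennreal (2 powr q / \<mu>) * (\<integral>\<^sup>+x. \<integral>\<^sup>+y. indicator (cell \<epsilon> z) x * indicator (cell \<epsilon> z) y * G x y \<partial>lborel \<partial>lborel) +
      ennreal (2 powr q * \<mu> powr (1 - q) * \<bar>I z\<bar> powr q))"
  proof (rule sum.cong[OF refl])
    fix z
    have "(\<integral>\<^sup>+x. indicator (cell \<epsilon> z) x *
      (ennreal (2 powr q / \<mu>) * (\<integral>\<^sup>+y. indicator (cell \<epsilon> z) y * G x y \<partial>lborel) + ennreal (2 powr q * (\<bar>I z\<bar> / \<mu>) powr q)) \<partial>lborel)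
      = (\<integral>\<^sup>+x. ennreal (2 powr q / \<mu>) * (\<integral>\<^sup>+y. indicator (cell \<epsilon> z) x * indicator (cell \<epsilon> z) y * G x y \<partial>lborel) +
        ennreal (2 powr q * (\<bar>I z\<bar> / \<mu>) powr q) * indicator (cell \<epsilon> z) x \<partial>lborel)"
    proof (rule nn_integral_cong)
      fix x :: "real^'n"
      show "indicator (cell \<epsilon> z) x *
      (ennreal (2 powr q / \<mu>) * (\<integral>\<^sup>+y. indicator (cell \<epsilon> z) y * G x y \<partial>lborel) + ennreal (2 powr q * (\<bar>I z\<bar> / \<mu>) powr q))
       = ennreal (2 powr q / \<mu>) * (\<integral>\<^sup>+y. indicator (cell \<epsilon> z) x * indicator (cell \<epsilon> z) y * G x y \<partial>lborel) +
        ennreal (2 powr q * (\<bar>I z\<bar> / \<mu>) powr q) * indicator (cell \<epsilon> z) x"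
        by (cases "x \<in> cell \<epsilon> z") auto
    qed
    also have "\<dots> = (\<integral>\<^sup>+x. ennreal (2 powr q / \<mu>) * (\<integral>\<^sup>+y. indicator (cell \<epsilon> z) x * indicator (cell \<epsilon> z) y * G x y \<partial>lborel) \<partial>lborel) +
        (\<integral>\<^sup>+x. ennreal (2 powr q * (\<bar>I z\<bar> / \<mu>) powr q) * indicator (cell \<epsilon> z) x \<partial>lborel)"
      unfolding G_def by (rule nn_integral_add) measurable
    also have "(\<integral>\<^sup>+x. ennreal (2 powr q / \<mu>) * (\<integral>\<^sup>+y. indicator (cell \<epsilon> z) x * indicator (cell \<epsilon> z) y * G x y \<partial>lborel) \<partial>lborel) =
      ennreal (2 powr q / \<mu>) * (\<integral>\<^sup>+x. \<integral>\<^sup>+y. indicator (cell \<epsilon> z) x * indicator (cell \<epsilon> z) y * G x y \<partial>lborel \<partial>lborel)"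
      unfolding G_def by (rule nn_integral_cmult) measurable
    also have "(\<integral>\<^sup>+x. ennreal (2 powr q * (\<bar>I z\<bar> / \<mu>) powr q) * indicator (cell \<epsilon> z) x \<partial>lborel) = ennreal (2 powr q * (\<bar>I z\<bar> / \<mu>) powr q) * ennreal \<mu>"
      by (subst nn_integral_cmult_indicator) (simp_all add: em)
    also have "\<dots> = ennreal (2 powr q * (\<bar>I z\<bar> / \<mu>) powr q * \<mu>)" using \<mu> by (simp add: ennreal_mult'')
    also have "2 powr q * (\<bar>I z\<bar> / \<mu>) powr q * \<mu> = 2 powr q * \<mu> powr (1 - q) * \<bar>I z\<bar> powr q"
      using \<mu> by (simp add: powr_divide powr_diff)
    finally show "(\<integral>\<^sup>+x. indicator (cell \<epsilon> z) x *
      (ennreal (2 powr q / \<mu>) * (\<integral>\<^sup>+y. indicator (cell \<epsilon> z) y * G x y \<partial>lborel) + ennreal (2 powr q * (\<bar>I z\<bar> / \<mu>) powr q)) \<partial>lborel) =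
      ennreal (2 powr q / \<mu>) * (\<integral>\<^sup>+x. \<integral>\<^sup>+y. indicator (cell \<epsilon> z) x * indicator (cell \<epsilon> z) y * G x y \<partial>lborel \<partial>lborel) +
      ennreal (2 powr q * \<mu> powr (1 - q) * \<bar>I z\<bar> powr q)" .
  qed
  also have "\<dots> = ennreal (2 powr q / \<mu>) * (\<Sum>z\<in>Z. \<integral>\<^sup>+x. \<integral>\<^sup>+y. indicator (cell \<epsilon> z) x * indicator (cell \<epsilon> z) y * G x y \<partial>lborel \<partial>lborel)
      + ennreal (\<Sum>z\<in>Z. 2 powr q * \<mu> powr (1 - q) * \<bar>I z\<bar> powr q)"
    by (simp add: sum.distrib sum_distrib_left sum_ennreal)
  also have "(\<Sum>z\<in>Z. \<integral>\<^sup>+x. \<integral>\<^sup>+y. indicator (cell \<epsilon> z) x * indicator (cell \<epsilon> z) y * G x y \<partial>lborel \<partial>lborel) \<le> ennreal D * gag t q w"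
  proof -
    let ?H = "\<lambda>x y. ennreal (\<bar>w x - w y\<bar> powr q / norm (x - y) powr (real DIM(real^'n) + t * q))"
    have "(\<Sum>z\<in>Z. \<integral>\<^sup>+x. \<integral>\<^sup>+y. indicator (cell \<epsilon> z) x * indicator (cell \<epsilon> z) y * G x y \<partial>lborel \<partial>lborel) =
      (\<integral>\<^sup>+x. (\<Sum>z\<in>Z. \<integral>\<^sup>+y. indicator (cell \<epsilon> z) x * indicator (cell \<epsilon> z) y * G x y \<partial>lborel) \<partial>lborel)"
      unfolding G_def by (rule nn_integral_sum[symmetric]) measurable
    also have "\<dots> = (\<integral>\<^sup>+x. \<integral>\<^sup>+y. (\<Sum>z\<in>Z. indicator (cell \<epsilon> z) x * indicator (cell \<epsilon> z) y * G x y) \<partial>lborel \<partial>lborel)"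
      unfolding G_def by (intro nn_integral_cong nn_integral_sum[symmetric]) measurable
    also have "\<dots> \<le> (\<integral>\<^sup>+x. \<integral>\<^sup>+y. ennreal D * ?H x y \<partial>lborel \<partial>lborel)"
    proof (intro nn_integral_mono)
      fix x y :: "real^'n"
      show "(\<Sum>z\<in>Z. indicator (cell \<epsilon> z) x * indicator (cell \<epsilon> z) y * G x y) \<le> ennreal D * ?H x y"
      proof (cases "\<exists>z\<in>Z. x \<in> cell \<epsilon> z \<and> y \<in> cell \<epsilon> z")
        case False
        then have "(\<Sum>z\<in>Z. indicator (cell \<epsilon> z) x * indicator (cell \<epsilon> z) y * G x y) = 0"
          by (intro sum.neutral) (auto simp: indicator_def)
        then show ?thesis by simp
      next
        case True
        then obtain z where z: "z \<in> Z" "x \<in> cell \<epsilon> z" "y \<in> cell \<epsilon> z" by blast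
        have "(\<Sum>z\<in>Z. indicator (cell \<epsilon> z) x * indicator (cell \<epsilon> z) y * G x y) =
          (\<Sum>z\<in>{z}. indicator (cell \<epsilon> z) x * indicator (cell \<epsilon> z) y * G x y)"
          using cell_unique[OF _ z(2)] z(1) by (intro sum.mono_neutral_right finZ) (auto simp: indicator_def)
        also have "\<dots> = G x y" using z by simp
        also have "\<dots> \<le> ennreal D * ?H x y"
        proof (cases "x = y")
          case False
          \<comment> \<open>Two points of one cell are at distance at most N \<epsilon>, so the
            kernel is at least \<open>1 / D\<close> there.\<close>
          have "norm (x - y) powr e \<le> D" unfolding D_def
            using cell_diameter[OF \<epsilon> z(2,3)] t q by (intro powr_mono2) (auto simp: e_def)
          then have "\<bar>w x - w y\<bar> powr q * norm (x - y) powr e \<le> \<bar>w x - w y\<bar> powr q * D" by (intro mult_left_mono) auto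
          then have "\<bar>w x - w y\<bar> powr q \<le> D * (\<bar>w x - w y\<bar> powr q / norm (x - y) powr e)"
            using False by (simp add: pos_le_divide_eq mult.commute)
          then show ?thesis unfolding G_def by (simp add: e_def D_def ennreal_leI flip: ennreal_mult')
        qed (use q in \<open>simp add: G_def\<close>)
        finally show ?thesis .
      qed
    qed
    also have "\<dots> = ennreal D * (\<integral>\<^sup>+x. \<integral>\<^sup>+y. ?H x y \<partial>lborel \<partial>lborel)"
      by (simp add: nn_integral_cmult)
    also have "(\<integral>\<^sup>+x. \<integral>\<^sup>+y. ?H x y \<partial>lborel \<partial>lborel) = gag t q w"
      unfolding gag_eq_double_integral[OF w(1), symmetric]
      by (subst lborel.nn_integral_fst[symmetric]) (auto simp: case_prod_beta)
    finally show ?thesis .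
  qed
  finally have "pow_int q w \<le> ennreal (2 powr q / \<mu>) * (ennreal D * gag t q w) + ennreal (\<Sum>z\<in>Z. 2 powr q * \<mu> powr (1 - q) * \<bar>I z\<bar> powr q)"
    by (simp add: mult_left_mono)
  also have "ennreal (2 powr q / \<mu>) * (ennreal D * gag t q w) = ennreal (2 powr q * (D / \<mu>)) * gag t q w"
    using \<mu> by (simp add: ennreal_mult' mult.assoc[symmetric] flip: times_divide_eq_left)
  finally show ?thesis unfolding I_def D_def e_def .
qed

text \<open>A countable product of compact intervals is compact and metrizable, hence sequentially
  compact; this replaces an explicit diagonal argument.\<close>

lemma pointwise_bounded_subsequence:
  fixes f :: "nat \<Rightarrow> 'i::countable \<Rightarrow> real"
  assumes "\<And>k i. \<bar>f k i\<bar> \<le> B"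
  obtains \<sigma> where "strict_mono (\<sigma> :: nat \<Rightarrow> nat)" "\<And>i. convergent (\<lambda>k. f (\<sigma> k) i)"
proof -
  have "compactin (product_topology (\<lambda>i::'i. euclidean) UNIV) (PiE UNIV (\<lambda>_. {-B..B}))"
    by (simp add: compactin_PiE)
  then have "compact (PiE (UNIV :: 'i set) (\<lambda>_. {-B..B}))" by (simp add: euclidean_product_topology)
  then have "seq_compact (PiE (UNIV :: 'i set) (\<lambda>_. {-B..B}))" by (simp add: compact_eq_seq_compact_metric)
  moreover have "\<forall>k. f k \<in> PiE UNIV (\<lambda>_. {-B..B})" using assms by (auto simp: abs_le_iff minus_le_iff)
  ultimately obtain l \<sigma> where \<sigma>: "strict_mono \<sigma>" "(f \<circ> \<sigma>) \<longlonglongrightarrow> l" by (rule seq_compactE)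
  have "(\<lambda>k. (f \<circ> \<sigma>) k i) \<longlonglongrightarrow> l i" for i
  proof -
    have "continuous_on UNIV (\<lambda>x::'i \<Rightarrow> real. x i)" by (rule continuous_on_product_coordinates)
    then have "isCont (\<lambda>x::'i \<Rightarrow> real. x i) l" unfolding continuous_on_eq_continuous_at[OF open_UNIV] by blast
    then show ?thesis using \<sigma>(2) by (rule isCont_tendsto_compose)
  qed
  then show thesis using that \<sigma>(1) by (auto simp: convergent_def o_def)
qed

lemma Cauchy_finite_sum_powr:
  fixes g :: "nat \<Rightarrow> 'i \<Rightarrow> real"
  assumes "finite Z" and g: "\<And>z. z \<in> Z \<Longrightarrow> Cauchy (\<lambda>k. g k z)" and q: "q > 0" and c: "c \<ge> 0" and e: "e > 0"
  shows "\<exists>K. \<forall>i\<ge>K. \<forall>j\<ge>K. (\<Sum>z\<in>Z. c * \<bar>g i z - g j z\<bar> powr q) < e"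
  using assms(1) g e
proof (induction Z arbitrary: e rule: finite_induct)
  case (insert z Z)
  obtain K where K: "\<And>i j. i \<ge> K \<Longrightarrow> j \<ge> K \<Longrightarrow> (\<Sum>z\<in>Z. c * \<bar>g i z - g j z\<bar> powr q) < e / 2"
    using insert.IH[of "e / 2"] insert.prems by auto
  \<comment> \<open>Chosen so that \<open>c * d powr q\<close> is at most \<open>e / 2\<close>; the
    denominator \<open>c + 1\<close> also covers c = 0.\<close>
  define d where "d = (e / 2 / (c + 1)) powr (1 / q)"
  have d: "d > 0" using insert.prems c by (simp add: d_def)
  have "d powr q = e / 2 / (c + 1)" unfolding d_def using q insert.prems c by (intro powr_inverse_powr) auto
  then have "c * d powr q = e / 2 * (c / (c + 1))" by simp
  also have "\<dots> \<le> e / 2 * 1" using c insert.prems by (intro mult_left_mono) (auto simp: divide_le_eq)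
  finally have cd: "c * d powr q \<le> e / 2" by simp
  obtain L where L: "\<And>i j. i \<ge> L \<Longrightarrow> j \<ge> L \<Longrightarrow> \<bar>g i z - g j z\<bar> < d"
    using metric_CauchyD[OF insert.prems(1)[of z] d] by (auto simp: dist_real_def)
  have "(\<Sum>z\<in>insert z Z. c * \<bar>g i z - g j z\<bar> powr q) < e" if "i \<ge> max K L" "j \<ge> max K L" for i j
  proof -
    have "c * \<bar>g i z - g j z\<bar> powr q \<le> c * d powr q"
      using L[of i j] that c q by (intro mult_left_mono powr_mono2) auto
    then show ?thesis using K[of i j] that insert.hyps cd by simp
  qed
  then show ?case by blast
qed auto

section \<open>Compactness for sequences of test functions\<close>

context mixed_problem
begin

lemma test_nn_Phi:
  assumes "w \<in> test" "q \<in> {1<..<real CARD('n)}" "t \<in> {0..<1}"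
  shows "nn_Phi t q w = ennreal (Phi t q w)"
  using finite_set_iff_nn_Phi(2)[OF dim assms(3,2)] test_finite_set(1)[OF assms(1,2), of t] assms(3) by simp

lemma test_gag:
  assumes "w \<in> test" "q \<in> {1<..<real CARD('n)}" "t \<in> {0<..<1}"
  shows "gag t q w = ennreal (1 / c_const (real CARD('n)) t q * Phi t q w)"
proof -
  define c where "c = c_const (real CARD('n)) t q"
  have c: "c > 0" using c_const_pos[of "real CARD('n)" t q] dim assms by (auto simp: c_def)
  have "ennreal c * gag t q w = ennreal (Phi t q w)"
    using nn_Phi_eq_gag[OF dim assms(3,2) test_function_measurable[OF assms(1)]] test_nn_Phi[OF assms(1,2), of t] assms(3) by (simp add: c_def)
  then have "ennreal (1 / c) * (ennreal c * gag t q w) = ennreal (1 / c) * ennreal (Phi t q w)" by simp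
  moreover have "ennreal (1 / c) * (ennreal c * gag t q w) = gag t q w"
    using c by (simp flip: mult.assoc ennreal_mult')
  moreover have "ennreal (1 / c) * ennreal (Phi t q w) = ennreal (1 / c * Phi t q w)"
    using c by (intro ennreal_mult'[symmetric]) simp
  ultimately show ?thesis by (simp add: c_def)
qed

lemma test_pow_int:
  assumes "w \<in> test" "q \<in> {1<..<real CARD('n)}"
  shows "pow_int q w = ennreal (Phi 0 q w)"
  using test_nn_Phi[OF assms, of 0] nn_Phi_0_eq_pow_int[OF test_function_measurable[OF assms(1)], of q] by simp

lemma Phi_interpolation:
  assumes q: "q \<in> {1<..<real CARD('n)}" and t: "0 < t" "t < S" "S < 1" and e: "e > 0"
  shows "\<exists>K\<ge>0. \<forall>w\<in>test. Phi t q w \<le> e * Phi S q w + K * Phi 0 q w"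
proof -
  have tS: "t \<in> {0<..<1}" "S \<in> {0<..<1}" using t by auto
  define ct cS where "ct = c_const (real CARD('n)) t q" and "cS = c_const (real CARD('n)) S q"
  have c: "ct > 0" "cS > 0"
    using c_const_pos[of "real CARD('n)" t q] c_const_pos[of "real CARD('n)" S q] dim q tS by (auto simp: ct_def cS_def)
  have \<theta>: "(S - t) * q > 0" using t q by auto
  \<comment> \<open>This cut makes the coefficient of the order \<open>S\<close> equal to
    \<open>e\<close> once the two normalising constants are taken into account.\<close>
  define \<rho> where "\<rho> = (e * cS / ct) powr (1 / ((S - t) * q))"
  have \<rho>: "\<rho> > 0" using e c by (simp add: \<rho>_def)
  have \<rho>p: "\<rho> powr ((S - t) * q) = e * cS / ct" unfolding \<rho>_def using e c \<theta> by (intro powr_inverse_powr) auto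
  obtain K where K: "K \<ge> 0" "\<And>u :: real^'n \<Rightarrow> real. u \<in> borel_measurable borel \<Longrightarrow>
     gag t q u \<le> ennreal (\<rho> powr ((S - t) * q)) * gag S q u + ennreal K * pow_int q u"
    using gag_interpolation[OF _ t(1,2) \<rho>, of q, where 'a="real^'n"] q by auto
  have "Phi t q w \<le> e * Phi S q w + (ct * K) * Phi 0 q w" if w: "w \<in> test" for w
  proof -
    have "ennreal (1 / ct * Phi t q w) \<le> ennreal (e * cS / ct) * ennreal (1 / cS * Phi S q w) + ennreal K * ennreal (Phi 0 q w)"
      using K(2)[OF test_function_measurable[OF w]]
      unfolding \<rho>p test_gag[OF w q tS(1)] test_gag[OF w q tS(2)] test_pow_int[OF w q] ct_def cS_def .
    also have "\<dots> = ennreal (e * cS / ct * (1 / cS * Phi S q w) + K * Phi 0 q w)"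
    proof -
      have "ennreal a * ennreal x + ennreal d * ennreal y = ennreal (a * x + d * y)"
        if "a \<ge> 0" "x \<ge> 0" "d \<ge> 0" "y \<ge> 0" for a x d y
        using that by (simp add: ennreal_mult')
      then show ?thesis using K(1) e c by (simp add: Phi_nonneg)
    qed
    finally have "1 / ct * Phi t q w \<le> e * cS / ct * (1 / cS * Phi S q w) + K * Phi 0 q w"
      by (subst (asm) ennreal_le_iff) (use K(1) e c in \<open>auto intro!: add_nonneg_nonneg mult_nonneg_nonneg simp: Phi_nonneg\<close>)
    then have "ct * (1 / ct * Phi t q w) \<le> ct * (e * cS / ct * (1 / cS * Phi S q w) + K * Phi 0 q w)"
      using c by (intro mult_left_mono) auto
    then show ?thesis using c by (simp add: distrib_left mult.assoc)
  qed
  then show ?thesis using K(1) c by (intro exI[of _ "ct * K"]) auto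
qed

text \<open>Interpolation acts between orders below 1, while \<open>b\<close> may be 1. An
  intermediate order between \<open>t\<close> and \<open>b\<close> stays bounded by the comparison,
  and the vanishing L^p norm then forces the order \<open>t\<close> to 0.\<close>

lemma Phi_lower_tendsto_0:
  assumes w: "\<And>k::nat. w k \<in> test" and q: "q \<in> {1<..<real CARD('n)}"
    and M: "\<And>k. Phi b q (w k) \<le> M" and lim: "(\<lambda>k. Phi 0 q (w k)) \<longlonglongrightarrow> 0" and t: "t \<in> {0..<b}"
  shows "(\<lambda>k. Phi t q (w k)) \<longlonglongrightarrow> 0"
proof (cases "t = 0")
  case False
  define S where "S = (t + b) / 2"
  have S: "0 < t" "t < S" "S < 1" "S \<in> {0..b}" using t sbar False by (auto simp: S_def)
  have M0: "M \<ge> 0" using M[of 0] Phi_nonneg[of b q "w 0"] by linarith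
  have SM: "Phi S q (w k) \<le> C * M" for k
    using test_comparison[OF w q S(4) sbar, of k] mult_left_mono[OF M[of k], of C] C1 by linarith
  show ?thesis
  proof (rule LIMSEQ_I)
    fix r :: real assume r: "r > 0"
    define e where "e = r / (2 * (C * M + 1))"
    have CM: "C * M \<ge> 0" using C1 M0 by simp
    have e: "e > 0" "e * (C * M) \<le> r / 2"
      using r CM by (auto simp: e_def field_simps)
    obtain K where K: "K \<ge> 0" "\<And>w. w \<in> test \<Longrightarrow> Phi t q w \<le> e * Phi S q w + K * Phi 0 q w"
      using Phi_interpolation[OF q S(1-3) e(1)] by blast
    have "(\<lambda>k. K * Phi 0 q (w k)) \<longlonglongrightarrow> K * 0" by (intro tendsto_intros lim)
    then have "eventually (\<lambda>k. K * Phi 0 q (w k) < r / 2) sequentially" using r by (intro order_tendstoD(2)) auto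
    then obtain N where N: "\<And>k. k \<ge> N \<Longrightarrow> K * Phi 0 q (w k) < r / 2" by (auto simp: eventually_sequentially)
    have "norm (Phi t q (w k) - 0) < r" if "k \<ge> N" for k
    proof -
      have "e * Phi S q (w k) \<le> e * (C * M)" using SM[of k] e(1) by (intro mult_left_mono) auto
      then have "Phi t q (w k) < r" using K(2)[OF w[of k]] N[OF that] e(2) by linarith
      then show ?thesis using Phi_nonneg[of t q "w k"] by simp
    qed
    then show "\<exists>no. \<forall>k\<ge>no. norm (Phi t q (w k) - 0) < r" by blast
  qed
qed (use lim in simp)

text \<open>At each scale 1 / (l + 1) the L^p norm of a difference is bounded by the means over
  finitely many cells plus a small multiple of a fractional energy, which is bounded. All means at
  all scales converge along one subsequence; since the means do not involve the exponent, it serves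
  every \<open>p j\<close>.\<close>

theorem Rellich:
  assumes \<phi>: "\<And>k. \<phi> k \<in> test" and M: "\<And>k j. j \<in> {1..m} \<Longrightarrow> Phi b (p j) (\<phi> k) \<le> M"
  shows "\<exists>\<sigma>. strict_mono (\<sigma> :: nat \<Rightarrow> nat) \<and> (\<forall>j\<in>{1..m}. cauchy_in (Phi 0 (p j)) (\<lambda>k. \<phi> (\<sigma> k)))"
proof -
  define N where "N = real CARD('n)"
  have N: "N > 0" by (simp add: N_def)
  \<comment> \<open>Half of \<open>b\<close> lies in (0,1) and below \<open>b\<close> even when b =
    1, so fractional estimates apply.\<close>
  define t where "t = b / 2"
  have t: "t \<in> {0<..<1}" "t \<in> {0..b}" "t > 0" using sbar by (auto simp: t_def)
  have j1: "(1::nat) \<in> {1..m}" using m0 by simp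
  have M0: "M \<ge> 0" using M[OF j1, of 0] Phi_nonneg[of b "p 1" "\<phi> 0"] by linarith
  have tM: "Phi t (p j) (\<phi> k) \<le> C * M" "Phi 0 (p j) (\<phi> k) \<le> C * M" if "j \<in> {1..m}" for j k
  proof -
    have CM: "C * Phi b (p j) (\<phi> k) \<le> C * M" using M[OF that, of k] C1 by (intro mult_left_mono) auto
    have z: "(0::real) \<in> {0..b}" using sbar by auto
    show "Phi t (p j) (\<phi> k) \<le> C * M" "Phi 0 (p j) (\<phi> k) \<le> C * M"
      by (rule order_trans[OF test_comparison[OF \<phi> p[OF that] t(2) sbar] CM],
          rule order_trans[OF test_comparison[OF \<phi> p[OF that] z sbar] CM])
  qed
  define f where "f k i = (LINT x|lborel. indicator (cell (1 / real (Suc (fst i))) (snd i)) x * \<phi> k x)" for k and i :: "nat \<times> (int^'n)"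
  have ib: "integrable lborel (\<phi> k)" for k
  proof -
    obtain B where "\<And>x. \<bar>\<phi> k x\<bar> \<le> B \<and> norm (grad (\<phi> k) x) \<le> B" using test_function_bounded[OF \<phi>] by blast
    then show ?thesis using test_function_measurable[OF \<phi>, of k] test_zero[OF \<phi>]
      by (intro integrable_bounded_support[where B=B and r="R/2"]) auto
  qed
  have ic: "integrable lborel (\<lambda>x. indicator (cell \<epsilon> z) x * \<phi> k x)" for k \<epsilon> z
    using integrable_mult_indicator[OF _ ib[of k], of "cell \<epsilon> z"] by simp
  have fb: "\<bar>f k i\<bar> \<le> measure lebesgue (cball (0::real^'n) (R / 2)) + C * M" for k i
  proof -
    have "\<bar>f k i\<bar> \<le> (LINT x|lborel. \<bar>indicator (cell (1 / real (Suc (fst i))) (snd i)) x * \<phi> k x\<bar>)"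
      unfolding f_def using integral_norm_bound[of lborel "\<lambda>x. indicator (cell (1 / real (Suc (fst i))) (snd i)) x * \<phi> k x"] by simp
    also have "\<dots> \<le> (LINT x|lborel. \<bar>\<phi> k x\<bar>)"
      by (intro integral_mono integrable_abs ic ib) (auto simp: indicator_def)
    also have "\<dots> = (LINT x|lebesgue. norm (\<phi> k x))"
      using test_function_measurable[OF \<phi>, of k] by (simp add: integral_completion)
    also have "\<dots> \<le> 1 * measure lebesgue (cball (0::real^'n) (R / 2)) + 1 powr (1 - p 1) * (LINT x|lebesgue. norm (\<phi> k x) powr p 1)"
      by (rule Lp_bounded_support_L1(2)[OF test_Lp[OF \<phi> p[OF j1]]]) (use p[OF j1] test_zero[OF \<phi>] in auto)
    also have "\<dots> \<le> measure lebesgue (cball (0::real^'n) (R / 2)) + C * M"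
      using tM(2)[OF j1, of k] p[OF j1] by (simp add: Phi_0)
    finally show ?thesis .
  qed
  obtain \<sigma> where \<sigma>: "strict_mono (\<sigma> :: nat \<Rightarrow> nat)" "\<And>i. convergent (\<lambda>k. f (\<sigma> k) i)"
    using pointwise_bounded_subsequence[of f, OF fb] by blast
  have "cauchy_in (Phi 0 (p j)) (\<lambda>k. \<phi> (\<sigma> k))" if j: "j \<in> {1..m}" for j
    unfolding cauchy_in_def
  proof (intro allI impI)
    fix e :: real assume e: "e > 0"
    define q where "q = p j"
    have q: "q \<in> {1<..<real CARD('n)}" "q > 1" "q > 0" using p[OF j] by (auto simp: q_def)
    define ct where "ct = c_const N t q"
    have ct: "ct > 0" using c_const_pos[of "real CARD('n)" t q] dim q t by (auto simp: ct_def N_def)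
    define G where "G = 1 / ct * (2 powr q * (C * M + C * M))"
    have G: "G \<ge> 0" using ct C1 M0 by (auto simp: G_def)
    define A where "A = 2 powr q * N powr (N + t * q)"
    have "(\<lambda>l. A * (inverse (real (Suc l))) powr (t * q) * G) \<longlonglongrightarrow> A * 0 powr (t * q) * G"
      by (intro tendsto_intros tendsto_powr'[OF LIMSEQ_inverse_real_of_nat tendsto_const]) (use t q in auto)
    then have "(\<lambda>l. A * (inverse (real (Suc l))) powr (t * q) * G) \<longlonglongrightarrow> 0" by simp
    then have "eventually (\<lambda>l. A * (inverse (real (Suc l))) powr (t * q) * G < e / 2) sequentially"
      using e by (intro order_tendstoD(2)) auto
    then obtain l where l: "A * (inverse (real (Suc l))) powr (t * q) * G < e / 2" by (auto simp: eventually_sequentially)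
    define \<epsilon> where "\<epsilon> = 1 / real (Suc l)"
    have \<epsilon>: "\<epsilon> > 0" "\<epsilon> = inverse (real (Suc l))" by (auto simp: \<epsilon>_def divide_inverse)
    \<comment> \<open>The volume of the cell cancels \<epsilon>^N and leaves the positive power
      \<epsilon>^(t q), which tends to 0 with the scale.\<close>
    have coef: "2 powr q * ((N * \<epsilon>) powr (N + t * q) / \<epsilon> ^ CARD('n)) = A * \<epsilon> powr (t * q)"
    proof -
      have "(N * \<epsilon>) powr (N + t * q) = N powr (N + t * q) * (\<epsilon> powr N * \<epsilon> powr (t * q))"
        using \<epsilon> N by (simp add: powr_mult powr_add)
      moreover have "\<epsilon> powr N = \<epsilon> ^ CARD('n)" using \<epsilon> by (simp add: N_def powr_realpow)
      ultimately show ?thesis using \<epsilon> by (simp add: A_def)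
    qed
    define Z where "Z = {z :: int^'n. \<exists>x\<in>cell \<epsilon> z. norm x < R / 2}"
    define c2 where "c2 = 2 powr q * (\<epsilon> ^ CARD('n)) powr (1 - q)"
    have c2: "c2 \<ge> 0" by (simp add: c2_def)
    have "\<exists>K. \<forall>i\<ge>K. \<forall>k\<ge>K. (\<Sum>z\<in>Z. c2 * \<bar>f (\<sigma> i) (l, z) - f (\<sigma> k) (l, z)\<bar> powr q) < e / 2"
    proof (rule Cauchy_finite_sum_powr)
      show "finite Z" unfolding Z_def by (rule finite_cells[OF \<epsilon>(1)])
      show "Cauchy (\<lambda>k. f (\<sigma> k) (l, z))" for z using \<sigma>(2) by (simp add: Cauchy_convergent_iff)
    qed (use q c2 e in auto)
    then obtain K where K: "\<And>i k. i \<ge> K \<Longrightarrow> k \<ge> K \<Longrightarrow> (\<Sum>z\<in>Z. c2 * \<bar>f (\<sigma> i) (l, z) - f (\<sigma> k) (l, z)\<bar> powr q) < e / 2" by blast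
    have "Phi 0 q (\<lambda>x. \<phi> (\<sigma> i) x - \<phi> (\<sigma> k) x) < e" if ik: "i \<ge> K" "k \<ge> K" for i k
    proof -
      define w where "w x = \<phi> (\<sigma> i) x - \<phi> (\<sigma> k) x" for x
      have w: "w \<in> test" unfolding w_def by (rule test_diff[OF \<phi> \<phi>])
      obtain B where B: "\<And>x. \<bar>w x\<bar> \<le> B \<and> norm (grad w x) \<le> B" using test_function_bounded[OF w] by blast
      have tt: "t \<in> {0..1}" using t by auto
      have "Phi t q w \<le> 2 powr q * (Phi t q (\<phi> (\<sigma> i)) + Phi t q (\<phi> (\<sigma> k)))"
        unfolding w_def by (intro power_functional_add_le(2)[OF fs(1,2)[OF tt q(1)]] test_finite_set(1)[OF \<phi> q(1) tt])
      also have "\<dots> \<le> 2 powr q * (C * M + C * M)"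
        using tM(1)[OF j] unfolding q_def by (intro mult_left_mono add_mono) auto
      finally have "1 / ct * Phi t q w \<le> G" unfolding G_def using ct by (intro mult_left_mono) auto
      then have gag: "gag t q w \<le> ennreal G"
        unfolding test_gag[OF w q(1) t(1)] ct_def N_def by (rule ennreal_leI)
      have If: "(LINT x|lborel. indicator (cell \<epsilon> z) x * w x) = f (\<sigma> i) (l, z) - f (\<sigma> k) (l, z)" for z
        unfolding w_def f_def fst_conv snd_conv \<epsilon>_def[symmetric] right_diff_distrib by (rule Bochner_Integration.integral_diff[OF ic ic])
      have wz: "w x = 0" if "R / 2 \<le> norm x" for x using test_zero[OF w that] by blast
      have wB: "\<bar>w x\<bar> \<le> B" for x using B by blast
      have "ennreal (Phi 0 q w) \<le> ennreal (A * \<epsilon> powr (t * q)) * gag t q w + ennreal (\<Sum>z\<in>Z. c2 * \<bar>f (\<sigma> i) (l, z) - f (\<sigma> k) (l, z)\<bar> powr q)"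
        using pow_int_le_cell_means[where r = "R / 2", OF test_function_measurable[OF w] wB wz q(2) t(3) \<epsilon>(1)]
        unfolding test_pow_int[OF w q(1)] If Z_def[symmetric] N_def[symmetric] coef c2_def[symmetric] .
      also have "\<dots> \<le> ennreal (A * \<epsilon> powr (t * q)) * ennreal G + ennreal (e / 2)"
        using K[OF ik] gag by (intro add_mono mult_left_mono ennreal_leI) auto
      also have "\<dots> = ennreal (A * \<epsilon> powr (t * q) * G + e / 2)"
        using G e by (simp add: A_def ennreal_mult' ennreal_plus)
      finally have "Phi 0 q w \<le> A * \<epsilon> powr (t * q) * G + e / 2"
        by (subst (asm) ennreal_le_iff) (use G e in \<open>auto simp: A_def intro!: add_nonneg_nonneg\<close>)
      then show ?thesis using l unfolding \<epsilon>(2) w_def by linarith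
    qed
    then show "\<exists>K. \<forall>i\<ge>K. \<forall>k\<ge>K. Phi 0 (p j) (\<lambda>x. \<phi> (\<sigma> i) x - \<phi> (\<sigma> k) x) < e" unfolding q_def by blast
  qed
  then show ?thesis using \<sigma>(1) by blast
qed

end

section \<open>The energy functional\<close>

lemma finite_uniform_index:
  assumes "finite I" and P: "\<And>i. i \<in> I \<Longrightarrow> \<exists>K::nat. \<forall>k\<ge>K. \<forall>l\<ge>K. P i k l"
  shows "\<exists>K. \<forall>i\<in>I. \<forall>k\<ge>K. \<forall>l\<ge>K. P i k l"
proof -
  obtain K where K: "\<And>i k l. i \<in> I \<Longrightarrow> k \<ge> K i \<Longrightarrow> l \<ge> K i \<Longrightarrow> P i k l" using P by metis
  have "K i \<le> sum K I" if "i \<in> I" for i using assms(1) that by (intro member_le_sum) auto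
  then show ?thesis using K by (intro exI[of _ "sum K I"]) (meson le_trans)
qed

text \<open>Convexity bounds the difference quotients to the right of 0 by \<open>f 1 - f 0\<close>,
  and they tend to 0.\<close>

lemma convex_line_min:
  fixes f :: "real \<Rightarrow> real"
  assumes conv: "\<And>t. t \<in> {0..1} \<Longrightarrow> f t \<le> (1 - t) * f 0 + t * f 1" and der: "(f has_real_derivative 0) (at 0)"
  shows "f 0 \<le> f 1"
proof -
  have "((\<lambda>h. (f h - f 0) / h) \<longlongrightarrow> 0) (at_right 0)"
    using der unfolding DERIV_def by (simp add: filterlim_at_split)
  moreover have "eventually (\<lambda>h. (f h - f 0) / h \<le> f 1 - f 0) (at_right 0)"
    unfolding eventually_at_right_field
  proof (intro exI[of _ 1] conjI allI impI)
    fix h :: real assume h: "0 < h" "h < 1"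
    then have "f h - f 0 \<le> h * (f 1 - f 0)" using conv[of h] by (simp add: algebra_simps)
    then show "(f h - f 0) / h \<le> f 1 - f 0" using h by (simp add: pos_divide_le_eq mult.commute)
  qed simp
  ultimately have "0 \<le> f 1 - f 0" by (intro tendsto_upperbound[of "\<lambda>h. (f h - f 0) / h"]) auto
  then show ?thesis by simp
qed

text \<open>The order is itself integrated against the negative measure, so the normalising constant
  must be measurable in \<open>t\<close>; the indicator confines it to the interval on which it is
  continuous.\<close>

lemma borel_measurable_c_const:
  assumes N: "N \<ge> 2" and q: "q \<in> {1<..<N}"
  shows "(\<lambda>t. indicator {0<..<1} t *\<^sub>R c_const N t q) \<in> borel_measurable borel"
proof (rule borel_measurable_continuous_on_indicator)
  have "(q * t + q + N - 2) / 2 > 0" if "t \<in> {0<..<1}" for t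
  proof -
    have "q * t > 0" using that q by (intro mult_pos_pos) auto
    then show ?thesis using q N by simp
  qed
  then have 1: "continuous_on {0<..<1} (\<lambda>t. Gamma ((q * t + q + N - 2) / 2))"
    by (intro continuous_on_compose2[OF continuous_on_Gamma[of "{0<..}"]] continuous_intros) (auto elim!: nonpos_Ints_cases)
  have 2: "continuous_on {0<..<1} (\<lambda>t::real. Gamma (1 - t))"
    by (intro continuous_on_compose2[OF continuous_on_Gamma[of "{0<..}"]] continuous_intros) (auto elim!: nonpos_Ints_cases)
  have "pi powr (N / 2) * Gamma (1 - t) \<noteq> 0" if "t \<in> {0<..<1}" for t
  proof -
    have "Gamma (1 - t) > 0" using that by (intro Gamma_real_pos) auto
    then show ?thesis by simp
  qed
  then show "continuous_on {0<..<1} (\<lambda>t. c_const N t q)"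
    unfolding c_const_def by (intro continuous_intros 1 2) auto
qed simp

text \<open>\<nu> stands for the negative measure restricted to the orders below the top one.
  \<open>\<nu>_small\<close> is the smallness condition with the threshold 1 / (2 C); the
  cardinality counts the Dirac masses at the top order.\<close>

locale mixed_problem_neg = mixed_problem \<Omega> n m s p R C
  for \<Omega> :: "(real^'n) set" and n m :: nat and s p :: "nat \<Rightarrow> real" and R C :: real +
  fixes \<nu> :: "real measure" and g :: "real^'n \<Rightarrow> real"
  assumes \<nu>_fin: "finite_measure \<nu>" and \<nu>_space: "space \<nu> = {0..<s_bar n s}"
    and \<nu>_sets: "sets \<nu> = sets (restrict_space borel {0..<s_bar n s})"
    and \<nu>_small: "2 * C * measure \<nu> (space \<nu>) \<le> real (card {i \<in> {1..n}. s i = s_bar n s})"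
    and g: "in_Lp \<Omega> (Max (p ` {1..m}) / (Max (p ` {1..m}) - 1)) g"
begin

abbreviation "P \<equiv> Max (p ` {1..m})"

lemma P_attained: "\<exists>j\<in>{1..m}. p j = P"
proof -
  have "P \<in> p ` {1..m}" using m0 by (intro Max_in) auto
  then show ?thesis by auto
qed

definition G :: "(real^'n \<Rightarrow> real) \<Rightarrow> real" where
  "G v = (LINT x|lebesgue_on \<Omega>. g x * v x)"

definition \<Gamma> :: real where "\<Gamma> = (LINT x|lebesgue_on \<Omega>. \<bar>g x\<bar> powr (P / (P - 1)))"

lemma \<Gamma>_nonneg: "\<Gamma> \<ge> 0" by (simp add: \<Gamma>_def)

text \<open>Young's inequality with a free parameter: a large \<open>l\<close> leaves only a small
  multiple of the norm, for coercivity, and a small \<open>l\<close> only a small multiple of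
  \<Gamma>, for continuity. \<open>P\<close> is the exponent to which the integrability of
  \<open>g\<close> is dual.\<close>

lemma G_bound:
  assumes v: "v \<in> X" and l: "l > 0"
  shows "integrable (lebesgue_on \<Omega>) (\<lambda>x. g x * v x)"
    "\<bar>G v\<bar> \<le> l powr (P / (P - 1)) * \<Gamma> + l powr (- P) * Phi 0 P v"
proof -
  obtain j where j: "j \<in> {1..m}" "p j = P" using P_attained by auto
  have P: "P > 1" "P \<in> {1<..<real CARD('n)}" using p[OF j(1)] j(2) by auto
  define Q where "Q = P / (P - 1)"
  have Q: "Q > 1" "1 / Q + 1 / P = 1" using P(1) by (auto simp: Q_def field_simps)
  have "v \<in> finite_set 0 P" using X_lower_order(1)[OF v j(1), of 0] sbar j(2) by auto
  then have iv: "integrable lebesgue (\<lambda>x. \<bar>v x\<bar> powr P)" and vm: "v \<in> borel_measurable lebesgue"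
    by (auto simp: finite_set_def seminorm_finite_def)
  have ivO: "integrable (lebesgue_on \<Omega>) (\<lambda>x. \<bar>v x\<bar> powr P)"
    using integrable_mult_indicator[OF \<Omega>_sets iv] \<Omega>_sets by (subst integrable_restrict_space) auto
  have le: "(LINT x|lebesgue_on \<Omega>. \<bar>v x\<bar> powr P) \<le> Phi 0 P v"
  proof -
    have "(LINT x|lebesgue_on \<Omega>. \<bar>v x\<bar> powr P) = (LINT x|lebesgue. indicator \<Omega> x *\<^sub>R \<bar>v x\<bar> powr P)"
      using \<Omega>_sets by (intro integral_restrict_space) simp
    also have "\<dots> \<le> (LINT x|lebesgue. \<bar>v x\<bar> powr P)"
      by (intro integral_mono integrable_mult_indicator \<Omega>_sets iv) (auto simp: indicator_def)
    finally show ?thesis using P(1) by (simp add: Phi_0)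
  qed
  have gm: "g \<in> borel_measurable (lebesgue_on \<Omega>)" and ig: "integrable (lebesgue_on \<Omega>) (\<lambda>x. \<bar>g x\<bar> powr Q)"
    using g by (auto simp: in_Lp_def Q_def)
  have pt: "\<bar>g x * v x\<bar> \<le> l powr Q * \<bar>g x\<bar> powr Q + l powr (- P) * \<bar>v x\<bar> powr P" for x
  proof -
    have "(l * \<bar>g x\<bar>) * (\<bar>v x\<bar> / l) \<le> (l * \<bar>g x\<bar>) powr Q / Q + (\<bar>v x\<bar> / l) powr P / P"
      using Q P l by (intro Youngs_inequality) auto
    also have "\<dots> \<le> (l * \<bar>g x\<bar>) powr Q / 1 + (\<bar>v x\<bar> / l) powr P / 1"
      using Q P by (intro add_mono divide_left_mono) auto
    also have "\<dots> = l powr Q * \<bar>g x\<bar> powr Q + l powr (- P) * \<bar>v x\<bar> powr P"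
      using l by (simp add: powr_mult powr_divide powr_minus_divide)
    finally show ?thesis using l by (simp add: abs_mult)
  qed
  have ib: "integrable (lebesgue_on \<Omega>) (\<lambda>x. l powr Q * \<bar>g x\<bar> powr Q + l powr (- P) * \<bar>v x\<bar> powr P)"
    using ig ivO by auto
  show i: "integrable (lebesgue_on \<Omega>) (\<lambda>x. g x * v x)"
  proof (rule Bochner_Integration.integrable_bound[OF ib])
    have "v \<in> borel_measurable (lebesgue_on \<Omega>)" using vm by (intro measurable_restrict_space1)
    then show "(\<lambda>x. g x * v x) \<in> borel_measurable (lebesgue_on \<Omega>)" using gm by (intro borel_measurable_times)
    show "AE x in lebesgue_on \<Omega>. norm (g x * v x) \<le> norm (l powr Q * \<bar>g x\<bar> powr Q + l powr (- P) * \<bar>v x\<bar> powr P)"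
      using pt by (intro AE_I2) (metis abs_ge_self order_trans real_norm_def)
  qed
  have "\<bar>G v\<bar> \<le> (LINT x|lebesgue_on \<Omega>. \<bar>g x * v x\<bar>)"
    unfolding G_def using integral_norm_bound[of "lebesgue_on \<Omega>" "\<lambda>x. g x * v x"] by simp
  also have "\<dots> \<le> (LINT x|lebesgue_on \<Omega>. l powr Q * \<bar>g x\<bar> powr Q + l powr (- P) * \<bar>v x\<bar> powr P)"
    by (intro integral_mono integrable_abs i ib pt)
  also have "\<dots> = l powr Q * \<Gamma> + l powr (- P) * (LINT x|lebesgue_on \<Omega>. \<bar>v x\<bar> powr P)"
    using ig ivO by (simp add: \<Gamma>_def Q_def)
  also have "\<dots> \<le> l powr Q * \<Gamma> + l powr (- P) * Phi 0 P v" using le by (intro add_left_mono mult_left_mono) auto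
  finally show "\<bar>G v\<bar> \<le> l powr (P / (P - 1)) * \<Gamma> + l powr (- P) * Phi 0 P v" by (simp add: Q_def)
qed

lemma G_lincomb:
  assumes "u \<in> X" "v \<in> X" shows "G (\<lambda>x. a * u x + c * v x) = a * G u + c * G v"
proof -
  have "G (\<lambda>x. a * u x + c * v x) = (LINT x|lebesgue_on \<Omega>. a * (g x * u x) + c * (g x * v x))"
    unfolding G_def by (intro Bochner_Integration.integral_cong) (auto simp: algebra_simps)
  also have "\<dots> = a * G u + c * G v"
    unfolding G_def using G_bound(1)[OF assms(1), of 1] G_bound(1)[OF assms(2), of 1] by simp
  finally show ?thesis .
qed

lemma t_range: "t \<in> {0..<b} \<Longrightarrow> t \<in> {0..b} \<and> t \<in> {0..<1} \<and> t \<in> {0..1}"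
  using sbar by auto

text \<open>At positive orders \<open>Phi\<close> is the normalising constant times the energy of a
  Borel representative, whose integrand is jointly measurable in order and shift, so Tonelli
  applies. Order 0 has a different definition and is split off as a single point.\<close>

lemma Phi_measurable:
  assumes u: "u \<in> X" and j: "j \<in> {1..m}"
  shows "(\<lambda>t. Phi t (p j) u) \<in> borel_measurable \<nu>"
proof -
  define q where "q = p j"
  have q: "q \<in> {1<..<real CARD('n)}" using p[OF j] by (simp add: q_def)
  obtain h where h: "h \<in> borel_measurable borel" "AE x in lebesgue. u x = h x"
    using lebesgue_measurable_borel_rep[OF X_D(1)[OF u]] by blast
  note [measurable] = h(1)
  define c where "c t = indicator {0<..<1} t *\<^sub>R c_const (real CARD('n)) t q" for t
  have [measurable]: "c \<in> borel_measurable borel"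
    unfolding c_def by (rule borel_measurable_c_const) (use dim q in auto)
  have [measurable]: "(\<lambda>t. gag t q h) \<in> borel_measurable borel"
  proof -
    have "(\<lambda>(t, x). shift_pow q h x * ennreal (norm x powr - (real DIM(real^'n) + t * q))) \<in> borel_measurable (borel \<Otimes>\<^sub>M lborel)"
      by measurable
    then have "(\<lambda>t. \<integral>\<^sup>+x. shift_pow q h x * ennreal (norm x powr - (real DIM(real^'n) + t * q)) \<partial>lborel) \<in> borel_measurable borel"
      by (rule lborel.borel_measurable_nn_integral)
    then show ?thesis unfolding gag_def .
  qed
  define F where "F t = (if t = 0 then Phi 0 q u else enn2real (ennreal (c t) * gag t q h))" for t
  have "F \<in> borel_measurable borel" unfolding F_def by measurable
  then have "F \<in> borel_measurable (restrict_space borel {0..<b})" by (rule measurable_restrict_space1)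
  then have F: "F \<in> borel_measurable \<nu>" using measurable_cong_sets[OF \<nu>_sets refl] by blast
  have "Phi t q u = F t" if t: "t \<in> space \<nu>" for t
  proof (cases "t = 0")
    case False
    have t1: "t \<in> {0..b}" "t \<in> {0..<1}" "t \<in> {0<..<1}" using t False t_range[of t] unfolding \<nu>_space by auto
    have f: "u \<in> finite_set t q" using X_lower_order(1)[OF u j t1(1)] by (simp add: q_def)
    have "ennreal (Phi t q u) = nn_Phi t q h" using finite_set_iff_nn_Phi(2)[OF dim t1(2) q f] nn_Phi_cong_AE[OF h(2)] by simp
    also have "\<dots> = ennreal (c t) * gag t q h" using nn_Phi_eq_gag[OF dim t1(3) q h(1)] t1 by (simp add: c_def)
    finally show ?thesis using False Phi_nonneg[of t q u] by (simp add: F_def) (metis enn2real_ennreal)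
  qed (simp add: F_def)
  then show ?thesis using F unfolding q_def[symmetric] by (subst measurable_cong) auto
qed

lemma Phi_integrable:
  assumes u: "u \<in> X" and j: "j \<in> {1..m}"
  shows "integrable \<nu> (\<lambda>t. Phi t (p j) u)"
proof (rule finite_measure.integrable_const_bound[OF \<nu>_fin, of _ "C * Phi b (p j) u"])
  show "AE t in \<nu>. norm (Phi t (p j) u) \<le> C * Phi b (p j) u"
    using X_lower_order(2)[OF u j] t_range by (intro AE_I2) (auto simp: \<nu>_space Phi_nonneg)
qed (rule Phi_measurable[OF u j])

definition B :: "nat \<Rightarrow> (real^'n \<Rightarrow> real) \<Rightarrow> real" where
  "B j u = (LINT t|\<nu>. Phi t (p j) u)"

lemma B_le:
  assumes u: "u \<in> X" and j: "j \<in> {1..m}"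
  shows "0 \<le> B j u" "B j u \<le> measure \<nu> (space \<nu>) * (C * Phi b (p j) u)"
proof -
  show "0 \<le> B j u" unfolding B_def by (intro integral_nonneg_AE) (simp add: Phi_nonneg)
  interpret finite_measure \<nu> by (rule \<nu>_fin)
  have "B j u \<le> (LINT t|\<nu>. C * Phi b (p j) u)" unfolding B_def
    using X_lower_order(2)[OF u j] t_range by (intro integral_mono Phi_integrable u j) (auto simp: \<nu>_space)
  then show "B j u \<le> measure \<nu> (space \<nu>) * (C * Phi b (p j) u)" by simp
qed

lemma B_power_functional:
  assumes j: "j \<in> {1..m}" shows "power_functional (p j) X (B j)"
  unfolding power_functional_def
proof (intro conjI ballI allI)
  fix u assume u: "u \<in> X"
  show "0 \<le> B j u" by (rule B_le(1)[OF u j])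
  fix c
  have "Phi t (p j) (\<lambda>x. c * u x) = \<bar>c\<bar> powr p j * Phi t (p j) u" if "t \<in> space \<nu>" for t
    using t_range[of t] that X_lower_order(1)[OF u j, of t] power_functionalD(2)[OF fs(2)[OF _ p[OF j]]] by (auto simp: \<nu>_space)
  then have "B j (\<lambda>x. c * u x) = (LINT t|\<nu>. \<bar>c\<bar> powr p j * Phi t (p j) u)"
    unfolding B_def by (intro Bochner_Integration.integral_cong) auto
  then show "B j (\<lambda>x. c * u x) = \<bar>c\<bar> powr p j * B j u" by (simp add: B_def)
next
  fix u v and \<theta> :: real assume u: "u \<in> X" and v: "v \<in> X" and \<theta>: "\<theta> \<in> {0..1}"
  have "B j (\<lambda>x. (1 - \<theta>) * u x + \<theta> * v x) \<le> (LINT t|\<nu>. (1 - \<theta>) * Phi t (p j) u + \<theta> * Phi t (p j) v)"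
    unfolding B_def
  proof (rule integral_mono)
    show "integrable \<nu> (\<lambda>t. Phi t (p j) (\<lambda>x. (1 - \<theta>) * u x + \<theta> * v x))"
      by (rule Phi_integrable[OF fun_subspaceD(1)[OF X_subspace u v] j])
    show "integrable \<nu> (\<lambda>t. (1 - \<theta>) * Phi t (p j) u + \<theta> * Phi t (p j) v)"
      using Phi_integrable[OF u j] Phi_integrable[OF v j] by simp
    fix t assume "t \<in> space \<nu>"
    then have t: "t \<in> {0..b}" "t \<in> {0..1}" using t_range[of t] by (auto simp: \<nu>_space)
    show "Phi t (p j) (\<lambda>x. (1 - \<theta>) * u x + \<theta> * v x) \<le> (1 - \<theta>) * Phi t (p j) u + \<theta> * Phi t (p j) v"
      by (rule power_functionalD(3)[OF fs(2)[OF t(2) p[OF j]] X_lower_order(1)[OF u j t(1)] X_lower_order(1)[OF v j t(1)] \<theta>])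
  qed
  also have "\<dots> = (1 - \<theta>) * B j u + \<theta> * B j v"
    unfolding B_def using Phi_integrable[OF u j] Phi_integrable[OF v j] by simp
  finally show "B j (\<lambda>x. (1 - \<theta>) * u x + \<theta> * v x) \<le> (1 - \<theta>) * B j u + \<theta> * B j v" .
qed

definition J :: "(real^'n \<Rightarrow> real) \<Rightarrow> real" where
  "J u = (\<Sum>i=1..n. \<Sum>j=1..m. 1 / (2 * p j) * Phi (s i) (p j) u) - (\<Sum>j=1..m. 1 / (2 * p j) * B j u) - G u"

lemma Phi_X: "i \<in> {1..n} \<Longrightarrow> j \<in> {1..m} \<Longrightarrow> power_functional (p j) X (Phi (s i) (p j))"
  "i \<in> {1..n} \<Longrightarrow> j \<in> {1..m} \<Longrightarrow> uniformly_convex_functional X (Phi (s i) (p j))"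
proof -
  assume ij: "i \<in> {1..n}" "j \<in> {1..m}"
  note F = fs[OF s[OF ij(1)] p[OF ij(2)]]
  have sub: "u \<in> finite_set (s i) (p j)" if "u \<in> X" for u using X_D(3)[OF that ij] .
  show "power_functional (p j) X (Phi (s i) (p j))"
    using F(2) sub unfolding power_functional_def by blast
  show "uniformly_convex_functional X (Phi (s i) (p j))"
    unfolding uniformly_convex_functional_def
  proof (intro allI impI)
    fix \<epsilon> :: real assume "\<epsilon> > 0"
    with F(3)[unfolded uniformly_convex_functional_def, rule_format, OF this]
    show "\<exists>C\<ge>0. \<forall>u\<in>X. \<forall>v\<in>X. Phi (s i) (p j) (\<lambda>x. u x - v x) \<le> \<epsilon> * (Phi (s i) (p j) u + Phi (s i) (p j) v) +
        C * ((Phi (s i) (p j) u + Phi (s i) (p j) v) / 2 - Phi (s i) (p j) (\<lambda>x. 1 / 2 * (u x + v x)))"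
      using sub by blast
  qed
qed

lemma b_sum_le:
  assumes j: "j \<in> {1..m}"
  shows "real (card {i \<in> {1..n}. s i = b}) * Phi b (p j) u \<le> (\<Sum>i=1..n. Phi (s i) (p j) u)"
    "Phi b (p j) u \<le> (\<Sum>i=1..n. Phi (s i) (p j) u)"
proof -
  have "(\<Sum>i\<in>{i \<in> {1..n}. s i = b}. Phi (s i) (p j) u) \<le> (\<Sum>i=1..n. Phi (s i) (p j) u)"
    by (intro sum_mono2) (auto simp: Phi_nonneg)
  then show *: "real (card {i \<in> {1..n}. s i = b}) * Phi b (p j) u \<le> (\<Sum>i=1..n. Phi (s i) (p j) u)" by simp
  have "{i \<in> {1..n}. s i = b} \<noteq> {}" using b_attained by blast
  then have "card {i \<in> {1..n}. s i = b} > 0" by (subst card_gt_0_iff) simp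
  then have "1 \<le> real (card {i \<in> {1..n}. s i = b})" by linarith
  then have "1 * Phi b (p j) u \<le> real (card {i \<in> {1..n}. s i = b}) * Phi b (p j) u"
    by (rule mult_right_mono) (rule Phi_nonneg)
  then show "Phi b (p j) u \<le> (\<Sum>i=1..n. Phi (s i) (p j) u)" using * by simp
qed

text \<open>By \<open>\<nu>_small\<close> the negative part \<open>B j\<close> is at most half of
  \<open>T j\<close>, and \<open>p j\<close> is at most N, so what remains is at least T j / (4 N).
  The linear term may use up half of that.\<close>

lemma J_coercive: "\<exists>k>0. \<exists>K. \<forall>u\<in>X. k * (\<Sum>i=1..n. \<Sum>j=1..m. Phi (s i) (p j) u) \<le> J u + K"
proof -
  define N where "N = real CARD('n)"
  have N: "N > 0" by (simp add: N_def)
  obtain jP where jP: "jP \<in> {1..m}" "p jP = P" using P_attained by auto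
  have P: "P > 1" using p[OF jP(1)] jP(2) by auto
  \<comment> \<open>Chosen so that l^(-P) C is 1 / (8 N), half of the coefficient left by the
    negative part.\<close>
  define l where "l = (8 * N * C) powr (1 / P)"
  have NC: "8 * N * C > 0" using N C1 by simp
  have l: "l > 0" unfolding l_def powr_gt_zero using NC by linarith
  have "l powr P = 8 * N * C" unfolding l_def using NC P by (intro powr_inverse_powr) auto
  then have lP': "l powr (- P) = 1 / (8 * N * C)" by (simp only: powr_minus_divide)
  have "C \<noteq> 0" using C1 by simp
  then have lP: "l powr (- P) * C = 1 / (8 * N)" unfolding lP' by simp
  define K where "K = l powr (P / (P - 1)) * \<Gamma>"
  have "1 / (8 * N) * (\<Sum>i=1..n. \<Sum>j=1..m. Phi (s i) (p j) u) \<le> J u + K" if u: "u \<in> X" for u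
  proof -
    define T where "T j = (\<Sum>i=1..n. Phi (s i) (p j) u)" for j
    have T: "T j \<ge> 0" for j by (simp add: T_def sum_nonneg Phi_nonneg)
    have S: "(\<Sum>i=1..n. \<Sum>j=1..m. Phi (s i) (p j) u) = (\<Sum>j=1..m. T j)" unfolding T_def by (rule sum.swap)
    have S': "(\<Sum>i=1..n. \<Sum>j=1..m. 1 / (2 * p j) * Phi (s i) (p j) u) = (\<Sum>j=1..m. 1 / (2 * p j) * T j)"
      unfolding T_def by (subst sum.swap) (simp add: sum_distrib_left)
    have "1 / (4 * N) * T j \<le> 1 / (2 * p j) * T j - 1 / (2 * p j) * B j u" if j: "j \<in> {1..m}" for j
    proof -
      have "2 * B j u \<le> (2 * C * measure \<nu> (space \<nu>)) * Phi b (p j) u" using B_le(2)[OF u j] by (simp add: mult_ac)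
      also have "\<dots> \<le> real (card {i \<in> {1..n}. s i = b}) * Phi b (p j) u"
        using \<nu>_small by (intro mult_right_mono) (auto simp: Phi_nonneg)
      also have "\<dots> \<le> T j" unfolding T_def by (rule b_sum_le(1)[OF j])
      finally have BT: "T j / 2 \<le> T j - B j u" by simp
      have pj: "p j > 1" "p j \<le> N" using p[OF j] by (auto simp: N_def)
      have "1 / (4 * N) * T j = 1 / (2 * N) * (T j / 2)" by simp
      also have "\<dots> \<le> 1 / (2 * p j) * (T j / 2)" using pj N T[of j] by (intro mult_right_mono divide_left_mono) auto
      also have "\<dots> \<le> 1 / (2 * p j) * (T j - B j u)" using BT pj by (intro mult_left_mono) auto
      finally show ?thesis by (simp only: right_diff_distrib)
    qed
    then have "(\<Sum>j=1..m. 1 / (4 * N) * T j) \<le> (\<Sum>j=1..m. 1 / (2 * p j) * T j - 1 / (2 * p j) * B j u)" by (rule sum_mono)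
    then have 1: "1 / (4 * N) * (\<Sum>j=1..m. T j) \<le> J u + G u"
      unfolding J_def S' by (simp add: sum_subtractf sum_distrib_left)
    have "Phi 0 P u \<le> C * Phi b P u" using X_lower_order(2)[OF u jP(1), of 0] sbar jP(2) by simp
    also have "\<dots> \<le> C * (\<Sum>j=1..m. T j)"
    proof (intro mult_left_mono)
      have "Phi b P u \<le> T jP" unfolding T_def using b_sum_le(2)[OF jP(1), of u] jP(2) by simp
      also have "\<dots> \<le> (\<Sum>j=1..m. T j)" using jP(1) T by (intro member_le_sum) auto
      finally show "Phi b P u \<le> (\<Sum>j=1..m. T j)" .
    qed (use C1 in simp)
    finally have "l powr (- P) * Phi 0 P u \<le> l powr (- P) * (C * (\<Sum>j=1..m. T j))" by (intro mult_left_mono) auto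
    also have "\<dots> = 1 / (8 * N) * (\<Sum>j=1..m. T j)" using lP by (simp only: mult.assoc[symmetric])
    finally have "\<bar>G u\<bar> \<le> K + 1 / (8 * N) * (\<Sum>j=1..m. T j)" using G_bound(2)[OF u l] unfolding K_def by linarith
    moreover have "1 / (4 * N) * (\<Sum>j=1..m. T j) = 1 / (8 * N) * (\<Sum>j=1..m. T j) + 1 / (8 * N) * (\<Sum>j=1..m. T j)" using N by (simp add: field_simps)
    ultimately show ?thesis unfolding S using 1 by linarith
  qed
  then show ?thesis using N by (intro exI[of _ "1 / (8 * N)"] conjI exI[of _ K]) auto
qed

lemma Phi_b_tendsto:
  assumes lim: "\<And>i j. i \<in> {1..n} \<Longrightarrow> j \<in> {1..m} \<Longrightarrow> (\<lambda>k. Phi (s i) (p j) (w k)) \<longlonglongrightarrow> 0" and j: "j \<in> {1..m}"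
  shows "(\<lambda>k. Phi b (p j) (w k)) \<longlonglongrightarrow> 0"
  using b_attained lim[OF _ j] by metis

lemma J_continuous:
  assumes uk: "\<And>k. uk k \<in> X" and u: "u \<in> X"
    and lim: "\<And>i j. i \<in> {1..n} \<Longrightarrow> j \<in> {1..m} \<Longrightarrow> (\<lambda>k::nat. Phi (s i) (p j) (\<lambda>x. uk k x - u x)) \<longlonglongrightarrow> 0"
  shows "(\<lambda>k. J (uk k)) \<longlonglongrightarrow> J u"
proof -
  have d: "(\<lambda>x. uk k x - u x) \<in> X" for k by (rule fun_subspaceD(3)[OF X_subspace uk u])
  have 1: "(\<lambda>k. Phi (s i) (p j) (uk k)) \<longlonglongrightarrow> Phi (s i) (p j) u" if "i \<in> {1..n}" "j \<in> {1..m}" for i j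
    by (rule power_functional_tendsto[OF X_subspace Phi_X(1)[OF that] uk u lim[OF that]])
  have 2: "(\<lambda>k. B j (uk k)) \<longlonglongrightarrow> B j u" if j: "j \<in> {1..m}" for j
  proof (rule power_functional_tendsto[OF X_subspace B_power_functional[OF j] uk u])
    have l: "(\<lambda>k. measure \<nu> (space \<nu>) * (C * Phi b (p j) (\<lambda>x. uk k x - u x))) \<longlonglongrightarrow> measure \<nu> (space \<nu>) * (C * 0)"
      by (intro tendsto_intros Phi_b_tendsto[of "\<lambda>k x. uk k x - u x"] lim j)
    show "(\<lambda>k. B j (\<lambda>x. uk k x - u x)) \<longlonglongrightarrow> 0"
      using l B_le[OF d j] by (intro tendsto_sandwich[OF _ _ tendsto_const l[simplified]]) auto
  qed
  have 3: "(\<lambda>k. G (uk k)) \<longlonglongrightarrow> G u"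
  proof -
    obtain jP where jP: "jP \<in> {1..m}" "p jP = P" using P_attained by auto
    have P: "P > 1" using p[OF jP(1)] jP(2) by auto
    have lP: "(\<lambda>k. Phi 0 P (\<lambda>x. uk k x - u x)) \<longlonglongrightarrow> 0"
    proof -
      have l: "(\<lambda>k. C * Phi b P (\<lambda>x. uk k x - u x)) \<longlonglongrightarrow> C * 0"
        using Phi_b_tendsto[of "\<lambda>k x. uk k x - u x", OF lim jP(1)] unfolding jP(2) by (intro tendsto_intros)
      have "Phi 0 P (\<lambda>x. uk k x - u x) \<le> C * Phi b P (\<lambda>x. uk k x - u x)" for k
        using X_lower_order(2)[OF d jP(1), of 0] sbar jP(2) by simp
      then show ?thesis by (intro tendsto_sandwich[OF _ _ tendsto_const l[simplified]]) (auto simp: Phi_nonneg)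
    qed
    have "(\<lambda>k. G (uk k) - G u) \<longlonglongrightarrow> 0"
    proof (rule LIMSEQ_I)
      fix e :: real assume e: "e > 0"
      \<comment> \<open>This \<open>l\<close> bounds the \<Gamma> term of \<open>G_bound\<close> by
        e / 2; for the same fixed \<open>l\<close> the other term tends to 0.\<close>
      define l where "l = (e / 2 / (\<Gamma> + 1)) powr (1 / (P / (P - 1)))"
      have Q: "P / (P - 1) > 0" using P by simp
      have l: "l > 0" using e \<Gamma>_nonneg by (simp add: l_def)
      have lQ: "l powr (P / (P - 1)) = e / 2 / (\<Gamma> + 1)" unfolding l_def using e \<Gamma>_nonneg Q by (intro powr_inverse_powr) auto
      have "e / 2 / (\<Gamma> + 1) * \<Gamma> = e / 2 * (\<Gamma> / (\<Gamma> + 1))" by simp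
      also have "\<dots> \<le> e / 2 * 1" using e \<Gamma>_nonneg by (intro mult_left_mono) (auto simp: divide_le_eq)
      finally have lG: "l powr (P / (P - 1)) * \<Gamma> \<le> e / 2" unfolding lQ by simp
      have "(\<lambda>k. l powr (- P) * Phi 0 P (\<lambda>x. uk k x - u x)) \<longlonglongrightarrow> l powr (- P) * 0" by (intro tendsto_intros lP)
      then have "eventually (\<lambda>k. l powr (- P) * Phi 0 P (\<lambda>x. uk k x - u x) < e / 2) sequentially"
        using e by (intro order_tendstoD(2)) auto
      then obtain K where K: "\<And>k. k \<ge> K \<Longrightarrow> l powr (- P) * Phi 0 P (\<lambda>x. uk k x - u x) < e / 2" by (auto simp: eventually_sequentially)
      have "norm (G (uk k) - G u - 0) < e" if "k \<ge> K" for k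
      proof -
        have "G (\<lambda>x. uk k x - u x) = G (uk k) - G u" using G_lincomb[OF uk[of k] u, of 1 "-1"] by simp
        then show ?thesis using G_bound(2)[OF d[of k] l] lG K[OF that] by simp
      qed
      then show "\<exists>no. \<forall>k\<ge>no. norm (G (uk k) - G u - 0) < e" by blast
    qed
    then show ?thesis by (rule LIM_zero_cancel)
  qed
  show ?thesis unfolding J_def by (intro tendsto_diff tendsto_sum tendsto_mult tendsto_const 1 2 3) auto
qed

text \<open>Otherwise some differences along two index sequences stay large in \<open>B j\<close>.
  Yet they tend to 0 at every order below the top one, and the comparison bounds them uniformly in
  the order, so dominated convergence over \<nu> gives a contradiction.\<close>

lemma B_cauchy:
  assumes \<phi>: "\<And>k. \<phi> k \<in> test" and j: "j \<in> {1..m}" and M: "\<And>k. Phi b (p j) (\<phi> k) \<le> M"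
    and c: "cauchy_in (Phi 0 (p j)) \<phi>"
  shows "cauchy_in (B j) \<phi>"
proof (rule ccontr)
  assume "\<not> ?thesis"
  then obtain e where e: "e > 0" "\<And>K. \<exists>i\<ge>K. \<exists>k\<ge>K. e \<le> B j (\<lambda>x. \<phi> i x - \<phi> k x)"
    unfolding cauchy_in_def by (auto simp: not_less)
  then obtain I L where IL: "\<And>K. I K \<ge> K" "\<And>K. L K \<ge> K" "\<And>K. e \<le> B j (\<lambda>x. \<phi> (I K) x - \<phi> (L K) x)" by metis
  define w where "w K = (\<lambda>x. \<phi> (I K) x - \<phi> (L K) x)" for K
  have w: "w K \<in> test" for K unfolding w_def by (rule test_diff[OF \<phi> \<phi>])
  note q = p[OF j]
  have bb: "b \<in> {0..1}" using sbar by auto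
  define M' where "M' = 2 powr p j * (M + M)"
  have wM: "Phi b (p j) (w K) \<le> M'" for K
  proof -
    have "Phi b (p j) (w K) \<le> 2 powr p j * (Phi b (p j) (\<phi> (I K)) + Phi b (p j) (\<phi> (L K)))"
      unfolding w_def by (intro power_functional_add_le(2)[OF fs(1,2)[OF bb q]] test_finite_set(1)[OF \<phi> q bb])
    also have "\<dots> \<le> M'" unfolding M'_def using M by (intro mult_left_mono add_mono) auto
    finally show ?thesis .
  qed
  have w0: "(\<lambda>K. Phi 0 (p j) (w K)) \<longlonglongrightarrow> 0"
  proof (rule LIMSEQ_I)
    fix r :: real assume "r > 0"
    then obtain K where K: "\<forall>i\<ge>K. \<forall>k\<ge>K. Phi 0 (p j) (\<lambda>x. \<phi> i x - \<phi> k x) < r" using cauchy_inD[OF c] by blast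
    have "norm (Phi 0 (p j) (w k) - 0) < r" if "k \<ge> K" for k
      using K IL(1)[of k] IL(2)[of k] that Phi_nonneg[of 0 "p j" "w k"] unfolding w_def by simp
    then show "\<exists>no. \<forall>k\<ge>no. norm (Phi 0 (p j) (w k) - 0) < r" by blast
  qed
  interpret finite_measure \<nu> by (rule \<nu>_fin)
  have "(\<lambda>K. LINT t|\<nu>. Phi t (p j) (w K)) \<longlonglongrightarrow> (LINT t|\<nu>. 0)"
  proof (rule integral_dominated_convergence[where w = "\<lambda>_. C * M'"])
    show "(\<lambda>t. Phi t (p j) (w K)) \<in> borel_measurable \<nu>" for K by (rule Phi_measurable[OF test_in_X[OF w] j])
    show "AE t in \<nu>. (\<lambda>K. Phi t (p j) (w K)) \<longlonglongrightarrow> 0"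
      using Phi_lower_tendsto_0[OF w q wM w0] by (intro AE_I2) (simp add: \<nu>_space)
    show "AE t in \<nu>. norm (Phi t (p j) (w K)) \<le> C * M'" for K
    proof (rule AE_I2)
      fix t assume "t \<in> space \<nu>"
      then have t: "t \<in> {0..b}" using t_range[of t] by (simp add: \<nu>_space)
      have "Phi t (p j) (w K) \<le> C * Phi b (p j) (w K)" by (rule test_comparison[OF w q t sbar])
      also have "\<dots> \<le> C * M'" using wM C1 by (intro mult_left_mono) auto
      finally show "norm (Phi t (p j) (w K)) \<le> C * M'" by (simp add: Phi_nonneg)
    qed
  qed auto
  then have "(\<lambda>K. B j (w K)) \<longlonglongrightarrow> 0" by (simp add: B_def)
  then have "eventually (\<lambda>K. B j (w K) < e) sequentially" using e(1) by (rule order_tendstoD(2))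
  then obtain K where "B j (w K) < e" by (auto dest: eventually_happens)
  then show False using IL(3)[of K] by (simp add: w_def)
qed

end

section \<open>Existence and uniqueness of minimizers\<close>

lemma sum_midpoint_gap:
  fixes c x y z :: "'i \<Rightarrow> real"
  shows "(\<Sum>j\<in>K. c j * ((x j + y j) / 2 - z j)) = ((\<Sum>j\<in>K. c j * x j) + (\<Sum>j\<in>K. c j * y j)) / 2 - (\<Sum>j\<in>K. c j * z j)"
  by (induction K rule: infinite_finite_induct) (auto simp: field_simps)

lemma power_functional_midpoint:
  assumes "power_functional p V \<Phi>" "u \<in> V" "v \<in> V"
  shows "0 \<le> (\<Phi> u + \<Phi> v) / 2 - \<Phi> (\<lambda>x. 1 / 2 * (u x + v x))"
proof -
  have "(\<lambda>x. 1 / 2 * (u x + v x)) = (\<lambda>x. (1 - 1 / 2) * u x + 1 / 2 * v x)" by (auto simp: field_simps)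
  then show ?thesis using power_functionalD(3)[OF assms, of "1 / 2"] by simp
qed

text \<open>With v = u + h the midpoint is u + h / 2, so the value at \<open>v\<close> and the value
  at the midpoint are both close to \<open>\<Phi> u\<close>, by continuity on sublevel sets.\<close>

lemma power_functional_midpoint_small:
  assumes V: "fun_subspace V" and \<Phi>: "power_functional p V \<Phi>" and p: "p > 0" and "\<epsilon> > 0" "M \<ge> 0"
  shows "\<exists>d>0. \<forall>u\<in>V. \<forall>v\<in>V. \<Phi> u \<le> M \<longrightarrow> \<Phi> (\<lambda>x. u x - v x) \<le> d \<longrightarrow>
    (\<Phi> u + \<Phi> v) / 2 - \<Phi> (\<lambda>x. 1 / 2 * (u x + v x)) \<le> \<epsilon>"
proof -
  obtain d where d: "d > 0" "\<And>u h. u \<in> V \<Longrightarrow> h \<in> V \<Longrightarrow> \<Phi> u \<le> M \<Longrightarrow> \<Phi> h \<le> d \<Longrightarrow> \<bar>\<Phi> (\<lambda>x. u x + h x) - \<Phi> u\<bar> \<le> \<epsilon> / 2"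
    using power_functional_continuous[OF V \<Phi>, of "\<epsilon> / 2" M] assms(4,5) by auto
  have "(\<Phi> u + \<Phi> v) / 2 - \<Phi> (\<lambda>x. 1 / 2 * (u x + v x)) \<le> \<epsilon>"
    if uv: "u \<in> V" "v \<in> V" and M: "\<Phi> u \<le> M" and le: "\<Phi> (\<lambda>x. u x - v x) \<le> d" for u v
  proof -
    define h where "h = (\<lambda>x. v x - u x)"
    have h: "h \<in> V" "(\<lambda>x. 1 / 2 * h x) \<in> V" unfolding h_def
      by (rule fun_subspaceD(3)[OF V uv(2,1)], rule fun_subspaceD(4)[OF V fun_subspaceD(3)[OF V uv(2,1)] uv(1)])
    have h1: "\<Phi> h \<le> d" using le power_functional_minus[OF \<Phi> V uv] by (simp add: h_def)
    have "(1 / 2 :: real) powr p \<le> 1" using p powr_mono2[of p "1 / 2" 1] by simp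
    then have "\<Phi> (\<lambda>x. 1 / 2 * h x) \<le> 1 * \<Phi> h"
      unfolding power_functionalD(2)[OF \<Phi> h(1)] using power_functionalD(1)[OF \<Phi> h(1)] by (intro mult_right_mono) auto
    then have h2: "\<Phi> (\<lambda>x. 1 / 2 * h x) \<le> d" using h1 by simp
    have eq: "(\<lambda>x. u x + h x) = v" "(\<lambda>x. u x + 1 / 2 * h x) = (\<lambda>x. 1 / 2 * (u x + v x))"
      by (auto simp: h_def field_simps)
    have "\<bar>a - c\<bar> \<le> \<epsilon> / 2 \<Longrightarrow> \<bar>m - c\<bar> \<le> \<epsilon> / 2 \<Longrightarrow> (c + a) / 2 - m \<le> \<epsilon>" for a c m :: real
      using assms(4) unfolding abs_le_iff by (simp add: field_simps)
    from this[OF d(2)[OF uv(1) h(1) M h1, unfolded eq(1)] d(2)[OF uv(1) h(2) M h2, unfolded eq(2)]] show ?thesis .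
  qed
  then show ?thesis using d(1) by blast
qed

context mixed_problem_neg
begin

text \<open>The linear term has no midpoint defect. The identity expresses the defect of the
  positive part by those of the energy and of the negative part, one small along a minimizing
  sequence and the other by compactness.\<close>

lemma J_midpoint_gap:
  assumes uv: "u \<in> X" "v \<in> X"
  shows "(\<Sum>i=1..n. \<Sum>j=1..m. 1 / (2 * p j) * ((Phi (s i) (p j) u + Phi (s i) (p j) v) / 2 - Phi (s i) (p j) (\<lambda>x. 1 / 2 * (u x + v x)))) =
    (J u + J v) / 2 - J (\<lambda>x. 1 / 2 * (u x + v x)) +
    (\<Sum>j=1..m. 1 / (2 * p j) * ((B j u + B j v) / 2 - B j (\<lambda>x. 1 / 2 * (u x + v x))))"
proof -
  define w where "w = (\<lambda>x. 1 / 2 * (u x + v x))"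
  have "w = (\<lambda>x. 1 / 2 * u x + 1 / 2 * v x)" by (auto simp: w_def field_simps)
  then have G: "G w = 1 / 2 * G u + 1 / 2 * G v" using G_lincomb[OF uv, of "1 / 2" "1 / 2"] by simp
  have 1: "(\<Sum>i=1..n. \<Sum>j=1..m. 1 / (2 * p j) * ((Phi (s i) (p j) u + Phi (s i) (p j) v) / 2 - Phi (s i) (p j) w)) =
    ((\<Sum>i=1..n. \<Sum>j=1..m. 1 / (2 * p j) * Phi (s i) (p j) u) + (\<Sum>i=1..n. \<Sum>j=1..m. 1 / (2 * p j) * Phi (s i) (p j) v)) / 2 -
    (\<Sum>i=1..n. \<Sum>j=1..m. 1 / (2 * p j) * Phi (s i) (p j) w)"
    unfolding sum_midpoint_gap
    using sum_midpoint_gap[of "\<lambda>_. 1" "\<lambda>i. \<Sum>j=1..m. 1 / (2 * p j) * Phi (s i) (p j) u" "\<lambda>i. \<Sum>j=1..m. 1 / (2 * p j) * Phi (s i) (p j) v"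
      "\<lambda>i. \<Sum>j=1..m. 1 / (2 * p j) * Phi (s i) (p j) w" "{1..n}"] by simp
  show ?thesis unfolding w_def[symmetric] 1 unfolding sum_midpoint_gap J_def G by (simp add: field_simps)
qed

text \<open>The infimum is taken over test functions, for which compactness and convergence in lower
  orders have been proved; continuity and density show at the end that it is a lower bound on all of
  \<open>X\<close>.\<close>

lemma J_minimizer: "\<exists>u\<in>X. \<forall>w\<in>X. J u \<le> J w"
proof -
  obtain k K where k: "k > 0" and K: "\<And>u. u \<in> X \<Longrightarrow> k * (\<Sum>i=1..n. \<Sum>j=1..m. Phi (s i) (p j) u) \<le> J u + K"
    using J_coercive by blast
  have low: "- K \<le> J u" if "u \<in> X" for u
  proof -
    have "0 \<le> k * (\<Sum>i=1..n. \<Sum>j=1..m. Phi (s i) (p j) u)" using k by (intro mult_nonneg_nonneg sum_nonneg) (auto simp: Phi_nonneg)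
    then show ?thesis using K[OF that] by linarith
  qed
  define \<mu> where "\<mu> = Inf (J ` test)"
  have bdd: "bdd_below (J ` test)" using low test_in_X by (intro bdd_belowI[of _ "- K"]) auto
  have ne: "J ` test \<noteq> {}" using test_functions_0 by blast
  have \<mu>: "\<mu> \<le> J w" if "w \<in> test" for w unfolding \<mu>_def using that by (intro cInf_lower bdd) auto
  have "\<exists>w\<in>test. J w < \<mu> + 1 / (real r + 1)" for r
    using cInf_lessD[OF ne, of "\<mu> + 1 / (real r + 1)"] unfolding \<mu>_def by auto
  then obtain \<psi> where \<psi>: "\<And>r. \<psi> r \<in> test" "\<And>r. J (\<psi> r) < \<mu> + 1 / (real r + 1)" by metis
  define M where "M = (\<mu> + 1 + K) / k"
  have bound: "Phi (s i) (p j) (\<psi> r) \<le> M" if ij: "i \<in> {1..n}" "j \<in> {1..m}" for i j r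
  proof -
    have "Phi (s i) (p j) (\<psi> r) \<le> (\<Sum>j=1..m. Phi (s i) (p j) (\<psi> r))"
      using ij by (intro member_le_sum) (auto simp: Phi_nonneg)
    also have "\<dots> \<le> (\<Sum>i=1..n. \<Sum>j=1..m. Phi (s i) (p j) (\<psi> r))"
      using ij by (intro member_le_sum[of i "{1..n}" "\<lambda>i. \<Sum>j=1..m. Phi (s i) (p j) (\<psi> r)"] sum_nonneg) (auto simp: Phi_nonneg)
    also have "\<dots> \<le> M"
    proof -
      have "1 / (real r + 1) \<le> 1" by simp
      then have "k * (\<Sum>i=1..n. \<Sum>j=1..m. Phi (s i) (p j) (\<psi> r)) \<le> \<mu> + 1 + K"
        using K[OF test_in_X[OF \<psi>(1)[of r]]] \<psi>(2)[of r] by linarith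
      then show ?thesis unfolding M_def using k by (simp add: pos_le_divide_eq mult.commute)
    qed
    finally show ?thesis .
  qed
  have bound_b: "Phi b (p j) (\<psi> r) \<le> M" if "j \<in> {1..m}" for j r using b_attained bound[OF _ that] by metis
  obtain \<sigma> where \<sigma>: "strict_mono (\<sigma> :: nat \<Rightarrow> nat)" and cau: "\<And>j. j \<in> {1..m} \<Longrightarrow> cauchy_in (Phi 0 (p j)) (\<lambda>r. \<psi> (\<sigma> r))"
    using Rellich[where \<phi> = \<psi> and M = M, OF \<psi>(1) bound_b] by blast
  define \<phi> where "\<phi> r = \<psi> (\<sigma> r)" for r
  have \<phi>: "\<phi> r \<in> test" "\<phi> r \<in> X" for r using \<psi>(1) test_in_X by (auto simp: \<phi>_def)
  have J\<phi>: "J (\<phi> r) < \<mu> + 1 / (real N + 1)" if "r \<ge> N" for r N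
  proof -
    have "N \<le> \<sigma> r" using seq_suble[OF \<sigma>, of r] that by linarith
    then have "1 / (real (\<sigma> r) + 1) \<le> 1 / (real N + 1)" by (intro divide_left_mono) auto
    then show ?thesis using \<psi>(2)[of "\<sigma> r"] by (simp add: \<phi>_def)
  qed
  define gap where "gap i j r l = (Phi (s i) (p j) (\<phi> r) + Phi (s i) (p j) (\<phi> l)) / 2 - Phi (s i) (p j) (\<lambda>x. 1 / 2 * (\<phi> r x + \<phi> l x))" for i j r l
  have gap0: "0 \<le> gap i j r l" if "i \<in> {1..n}" "j \<in> {1..m}" for i j r l
    unfolding gap_def by (rule power_functional_midpoint[OF Phi_X(1)[OF that] \<phi>(2) \<phi>(2)])
  have M0: "M \<ge> 0" using bound_b[of 1 0] m0 Phi_nonneg[of b "p 1" "\<psi> 0"] by (simp add: Suc_leI)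
  have gap_small: "\<exists>N. \<forall>r\<ge>N. \<forall>l\<ge>N. (\<Sum>i=1..n. \<Sum>j=1..m. 1 / (2 * p j) * gap i j r l) \<le> e" if e: "e > 0" for e
  proof -
    \<comment> \<open>The budget \<open>e\<close> is split into e / 2 for the defect of the energy
      and \<open>e2\<close> for each of the m negative terms, whose coefficients 1 / (2 p j) are at
      most 1.\<close>
    define e2 where "e2 = e / (2 * real m)"
    have e2: "e2 > 0" using e m0 by (simp add: e2_def)
    have "\<exists>N. \<forall>r\<ge>N. \<forall>l\<ge>N. (B j (\<phi> r) + B j (\<phi> l)) / 2 - B j (\<lambda>x. 1 / 2 * (\<phi> r x + \<phi> l x)) \<le> e2" if j: "j \<in> {1..m}" for j
    proof -
      define MB where "MB = measure \<nu> (space \<nu>) * (C * M)"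
      have MB: "MB \<ge> 0" unfolding MB_def using C1 M0 by simp
      have pj: "p j > 0" using p[OF j] by simp
      obtain d where d: "d > 0" "\<And>u v. u \<in> X \<Longrightarrow> v \<in> X \<Longrightarrow> B j u \<le> MB \<Longrightarrow> B j (\<lambda>x. u x - v x) \<le> d \<Longrightarrow>
          (B j u + B j v) / 2 - B j (\<lambda>x. 1 / 2 * (u x + v x)) \<le> e2"
        using power_functional_midpoint_small[OF X_subspace B_power_functional[OF j] pj e2 MB] by blast
      have "cauchy_in (B j) \<phi>"
        unfolding \<phi>_def by (rule B_cauchy[OF \<psi>(1) j bound_b[OF j] cau[OF j]])
      then obtain N where N: "\<And>r l. r \<ge> N \<Longrightarrow> l \<ge> N \<Longrightarrow> B j (\<lambda>x. \<phi> r x - \<phi> l x) < d" using cauchy_inD[OF _ d(1)] by metis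
      have bb: "B j (\<phi> r) \<le> MB" for r
      proof -
        have "B j (\<phi> r) \<le> measure \<nu> (space \<nu>) * (C * Phi b (p j) (\<phi> r))" by (rule B_le(2)[OF \<phi>(2) j])
        also have "\<dots> \<le> MB" unfolding MB_def using bound_b[OF j] C1 by (intro mult_left_mono) (auto simp: \<phi>_def)
        finally show ?thesis .
      qed
      show ?thesis
      proof (intro exI[of _ N] allI impI)
        fix r l assume "N \<le> r" "N \<le> l"
        from less_imp_le[OF N[OF this]] show "(B j (\<phi> r) + B j (\<phi> l)) / 2 - B j (\<lambda>x. 1 / 2 * (\<phi> r x + \<phi> l x)) \<le> e2"
          by (rule d(2)[OF \<phi>(2) \<phi>(2) bb])
      qed
    qed
    then have "\<exists>N. \<forall>j\<in>{1..m}. \<forall>r\<ge>N. \<forall>l\<ge>N. (B j (\<phi> r) + B j (\<phi> l)) / 2 - B j (\<lambda>x. 1 / 2 * (\<phi> r x + \<phi> l x)) \<le> e2"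
      by (intro finite_uniform_index) simp
    then obtain N1 where
      N1: "\<And>j r l. j \<in> {1..m} \<Longrightarrow> r \<ge> N1 \<Longrightarrow> l \<ge> N1 \<Longrightarrow> (B j (\<phi> r) + B j (\<phi> l)) / 2 - B j (\<lambda>x. 1 / 2 * (\<phi> r x + \<phi> l x)) \<le> e2"
      by blast
    obtain N2 where N2: "1 / (real N2 + 1) < e / 2" using nat_approx_posE[of "e / 2"] e by (auto simp: add.commute)
    have "(\<Sum>i=1..n. \<Sum>j=1..m. 1 / (2 * p j) * gap i j r l) \<le> e" if rl: "r \<ge> max N1 N2" "l \<ge> max N1 N2" for r l
    proof -
      have w: "(\<lambda>x. 1 / 2 * (\<phi> r x + \<phi> l x)) \<in> test"
        using test_functions_lincomb[OF \<phi>(1)[of r] \<phi>(1)[of l], of "1 / 2" "1 / 2"] by (simp add: add_divide_distrib)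
      have J: "(J (\<phi> r) + J (\<phi> l)) / 2 - J (\<lambda>x. 1 / 2 * (\<phi> r x + \<phi> l x)) \<le> e / 2"
      proof -
        have "r \<ge> N2" "l \<ge> N2" using rl by auto
        then have "J (\<phi> r) < \<mu> + e / 2" "J (\<phi> l) < \<mu> + e / 2" using J\<phi>[of N2] N2 by fastforce+
        then show ?thesis using \<mu>[OF w] by (simp add: field_simps)
      qed
      have "(\<Sum>j=1..m. 1 / (2 * p j) * ((B j (\<phi> r) + B j (\<phi> l)) / 2 - B j (\<lambda>x. 1 / 2 * (\<phi> r x + \<phi> l x)))) \<le> (\<Sum>j=1..m. e2)"
      proof (rule sum_mono)
        fix j assume j: "j \<in> {1..m}"
        have pj: "1 / (2 * p j) \<le> 1" "0 \<le> 1 / (2 * p j)" using p[OF j] by auto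
        have "1 / (2 * p j) * ((B j (\<phi> r) + B j (\<phi> l)) / 2 - B j (\<lambda>x. 1 / 2 * (\<phi> r x + \<phi> l x))) \<le> 1 / (2 * p j) * e2"
          using N1[OF j, of r l] rl pj by (intro mult_left_mono) auto
        also have "\<dots> \<le> 1 * e2" using pj e2 by (intro mult_right_mono) auto
        finally show "1 / (2 * p j) * ((B j (\<phi> r) + B j (\<phi> l)) / 2 - B j (\<lambda>x. 1 / 2 * (\<phi> r x + \<phi> l x))) \<le> e2" by simp
      qed
      also have "\<dots> = e / 2" using m0 by (simp add: e2_def)
      finally show ?thesis unfolding gap_def J_midpoint_gap[OF \<phi>(2) \<phi>(2)] using J by linarith
    qed
    then show ?thesis by blast
  qed
  have cauchy: "cauchy_in (Phi (s i) (p j)) \<phi>" if ij: "i \<in> {1..n}" "j \<in> {1..m}" for i j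
    unfolding cauchy_in_def
  proof (intro allI impI)
    fix e :: real assume e: "e > 0"
    have pj: "p j > 1" using p[OF ij(2)] by simp
    \<comment> \<open>On a sequence bounded by \<open>M\<close> this makes the first term of uniform
      convexity at most e / 2. It fixes \<open>D\<close>, and only then is the admissible defect
      \<open>r0\<close> chosen.\<close>
    define \<epsilon> where "\<epsilon> = e / (4 * (M + 1))"
    have \<epsilon>: "\<epsilon> > 0" using e M0 by (simp add: \<epsilon>_def)
    have "\<epsilon> * (2 * M) = e / 2 * (M / (M + 1))" using M0 by (simp add: \<epsilon>_def field_simps)
    also have "\<dots> \<le> e / 2 * 1" using M0 e by (intro mult_left_mono) auto
    finally have \<epsilon>M: "\<epsilon> * (2 * M) \<le> e / 2" by simp
    obtain D where D: "D \<ge> 0" "\<And>u v. u \<in> X \<Longrightarrow> v \<in> X \<Longrightarrow> Phi (s i) (p j) (\<lambda>x. u x - v x) \<le> \<epsilon> * (Phi (s i) (p j) u + Phi (s i) (p j) v) +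
        D * ((Phi (s i) (p j) u + Phi (s i) (p j) v) / 2 - Phi (s i) (p j) (\<lambda>x. 1 / 2 * (u x + v x)))"
      using Phi_X(2)[OF ij] \<epsilon> unfolding uniformly_convex_functional_def by blast
    define r0 where "r0 = e / (4 * (D + 1))"
    have r0: "r0 > 0" using e D(1) by (simp add: r0_def)
    have "D * r0 = e / 4 * (D / (D + 1))" using D(1) by (simp add: r0_def field_simps)
    also have "\<dots> \<le> e / 4 * 1" using D(1) e by (intro mult_left_mono) auto
    finally have Dr: "D * r0 \<le> e / 4" by simp
    \<comment> \<open>The weighted sum is pushed below \<open>r0\<close> times the weight of the
      given pair; as its summands are nonnegative, the defect of that pair is at most
      \<open>r0\<close>.\<close>
    obtain N where N: "\<And>r l. r \<ge> N \<Longrightarrow> l \<ge> N \<Longrightarrow> (\<Sum>i=1..n. \<Sum>j=1..m. 1 / (2 * p j) * gap i j r l) \<le> 1 / (2 * p j) * r0"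
      using gap_small[of "1 / (2 * p j) * r0"] r0 pj by auto
    have "Phi (s i) (p j) (\<lambda>x. \<phi> r x - \<phi> l x) < e" if rl: "r \<ge> N" "l \<ge> N" for r l
    proof -
      have nn: "0 \<le> 1 / (2 * p j) * gap i j r l" if "i \<in> {1..n}" "j \<in> {1..m}" for i j
        using gap0[OF that] p[OF that(2)] by (intro mult_nonneg_nonneg) auto
      have "1 / (2 * p j) * gap i j r l \<le> (\<Sum>j=1..m. 1 / (2 * p j) * gap i j r l)"
        using ij nn by (intro member_le_sum) auto
      also have "\<dots> \<le> (\<Sum>i=1..n. \<Sum>j=1..m. 1 / (2 * p j) * gap i j r l)"
        using ij nn by (intro member_le_sum[of i "{1..n}" "\<lambda>i. \<Sum>j=1..m. 1 / (2 * p j) * gap i j r l"] sum_nonneg) auto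
      also have "\<dots> \<le> 1 / (2 * p j) * r0" by (rule N[OF rl])
      finally have "gap i j r l \<le> r0" using pj by (simp add: divide_le_cancel)
      then have "D * gap i j r l \<le> e / 4" using Dr mult_left_mono[OF _ D(1)] by (meson order_trans)
      moreover have "\<epsilon> * (Phi (s i) (p j) (\<phi> r) + Phi (s i) (p j) (\<phi> l)) \<le> \<epsilon> * (2 * M)"
        using bound[OF ij, of "\<sigma> r"] bound[OF ij, of "\<sigma> l"] \<epsilon> unfolding \<phi>_def by (intro mult_left_mono) auto
      ultimately show ?thesis using D(2)[OF \<phi>(2)[of r] \<phi>(2)[of l]] \<epsilon>M e unfolding gap_def by linarith
    qed
    then show "\<exists>N. \<forall>r\<ge>N. \<forall>l\<ge>N. Phi (s i) (p j) (\<lambda>x. \<phi> r x - \<phi> l x) < e" by blast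
  qed
  obtain u where u: "u \<in> X" and lim: "\<And>i j. i \<in> {1..n} \<Longrightarrow> j \<in> {1..m} \<Longrightarrow> (\<lambda>k. Phi (s i) (p j) (\<lambda>x. \<phi> k x - u x)) \<longlonglongrightarrow> 0"
    using X_complete[OF \<phi>(1) cauchy] by blast
  have "(\<lambda>r. 1 / (real r + 1)) \<longlonglongrightarrow> 0"
    using LIMSEQ_inverse_real_of_nat by (simp add: inverse_eq_divide add.commute)
  then have l\<mu>: "(\<lambda>r. \<mu> + 1 / (real r + 1)) \<longlonglongrightarrow> \<mu>" by (rule tendsto_add[OF tendsto_const, of _ 0, simplified])
  have Ju: "J u \<le> \<mu>"
  proof (rule LIMSEQ_le[OF J_continuous[OF \<phi>(2) u lim] l\<mu>])
    show "\<exists>N. \<forall>r\<ge>N. J (\<phi> r) \<le> \<mu> + 1 / (real r + 1)" using less_imp_le[OF J\<phi>[OF order_refl]] by blast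
  qed
  \<comment> \<open>Every element of \<open>X\<close> is a limit of test functions, on which \<mu>
    is a lower bound.\<close>
  have "\<mu> \<le> J w" if w: "w \<in> X" for w
  proof -
    obtain \<zeta> where \<zeta>: "\<And>k. \<zeta> k \<in> test" "\<And>i j. i \<in> {1..n} \<Longrightarrow> j \<in> {1..m} \<Longrightarrow> (\<lambda>k. Phi (s i) (p j) (\<lambda>x. \<zeta> k x - w x)) \<longlonglongrightarrow> 0"
      using X_approx[OF w] by blast
    show ?thesis using \<mu>[OF \<zeta>(1)]
      by (intro LIMSEQ_le_const[OF J_continuous[where uk = \<zeta>, OF test_in_X[OF \<zeta>(1)] w \<zeta>(2)]]) auto
  qed
  then show ?thesis using u Ju by (meson order_trans)
qed

text \<open>Convexity along the line at each order justifies differentiating under the integral over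
  \<nu>. The orders integrated there are below 1, so the weak gradient enters only through the
  positive part.\<close>

lemma J_has_derivative:
  assumes u: "u \<in> X" and v: "v \<in> X"
  shows "((\<lambda>\<tau>. J (\<lambda>x. u x + \<tau> * v x)) has_real_derivative
    (\<Sum>i=1..n. \<Sum>j=1..m. E_form \<Omega> (s i) (p j) u v) - (\<Sum>j=1..m. LINT t|\<nu>. E_form \<Omega> t (p j) u v) - G v) (at 0)"
proof -
  have Phi: "((\<lambda>\<tau>. 1 / (2 * p j) * Phi (s i) (p j) (\<lambda>x. u x + \<tau> * v x)) has_real_derivative E_form \<Omega> (s i) (p j) u v) (at 0)"
    if ij: "i \<in> {1..n}" "j \<in> {1..m}" for i j
  proof -
    have pj: "p j \<noteq> 0" using p[OF ij(2)] by auto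
    \<comment> \<open>An order 1 among the \<open>s i\<close> is the top order, so b = 1.\<close>
    have g0: "AE x in lebesgue. x \<notin> \<Omega> \<longrightarrow> weak_gradient u x = 0" if "s i = 1"
      using X_gradient_outside[OF u] s_le_b[OF ij(1)] sbar that by auto
    have "((\<lambda>\<tau>. 1 / (2 * p j) * Phi (s i) (p j) (\<lambda>x. u x + \<tau> * v x)) has_real_derivative 1 / (2 * p j) * (2 * p j * E_form \<Omega> (s i) (p j) u v)) (at 0)"
      by (intro DERIV_cmult Phi_has_derivative[OF dim s[OF ij(1)] p[OF ij(2)] X_D(3)[OF u ij] X_D(3)[OF v ij] \<Omega>_sets X_D(2)[OF u] g0])
    then show ?thesis using pj by simp
  qed
  have B: "((\<lambda>\<tau>. 1 / (2 * p j) * B j (\<lambda>x. u x + \<tau> * v x)) has_real_derivative (LINT t|\<nu>. E_form \<Omega> t (p j) u v)) (at 0)"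
    if j: "j \<in> {1..m}" for j
  proof -
    note q = p[OF j]
    have pj: "p j \<noteq> 0" using q by auto
    have "((\<lambda>\<tau>. LINT t|\<nu>. Phi t (p j) (\<lambda>x. u x + \<tau> * v x)) has_real_derivative (LINT t|\<nu>. 2 * p j * E_form \<Omega> t (p j) u v)) (at 0)"
    proof (rule has_derivative_integral_convex(2))
      show "integrable \<nu> (\<lambda>t. Phi t (p j) (\<lambda>x. u x + \<tau> * v x))" for \<tau>
        by (rule Phi_integrable[OF fun_subspaceD(5)[OF X_subspace u v] j])
      fix t assume "t \<in> space \<nu>"
      then have t: "t \<in> {0..b}" "t \<in> {0..<1}" "t \<in> {0..1}" using t_range[of t] by (auto simp: \<nu>_space)
      note F = fs[OF t(3) q] and uf = X_lower_order(1)[OF u j t(1)] and vf = X_lower_order(1)[OF v j t(1)]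
      show "((\<lambda>\<tau>. Phi t (p j) (\<lambda>x. u x + \<tau> * v x)) has_real_derivative 2 * p j * E_form \<Omega> t (p j) u v) (at 0)"
        by (rule Phi_has_derivative[OF dim t(3) q uf vf \<Omega>_sets X_D(2)[OF u]]) (use t in auto)
      show "convex_on {-1..1} (\<lambda>\<tau>. Phi t (p j) (\<lambda>x. u x + \<tau> * v x))"
      proof (rule convex_onI)
        fix \<theta> y z :: real assume \<theta>: "0 < \<theta>" "\<theta> < 1"
        have eq: "(\<lambda>x. u x + ((1 - \<theta>) *\<^sub>R y + \<theta> *\<^sub>R z) * v x) = (\<lambda>x. (1 - \<theta>) * (u x + y * v x) + \<theta> * (u x + z * v x))"
          by (auto simp: algebra_simps)
        show "Phi t (p j) (\<lambda>x. u x + ((1 - \<theta>) *\<^sub>R y + \<theta> *\<^sub>R z) * v x) \<le>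
            (1 - \<theta>) * Phi t (p j) (\<lambda>x. u x + y * v x) + \<theta> * Phi t (p j) (\<lambda>x. u x + z * v x)"
          unfolding eq using \<theta> by (intro power_functionalD(3)[OF F(2)] fun_subspaceD(5)[OF F(1) uf vf]) auto
      qed simp
    qed
    then have "((\<lambda>\<tau>. 1 / (2 * p j) * B j (\<lambda>x. u x + \<tau> * v x)) has_real_derivative 1 / (2 * p j) * (LINT t|\<nu>. 2 * p j * E_form \<Omega> t (p j) u v)) (at 0)"
      unfolding B_def by (intro DERIV_cmult)
    then show ?thesis using pj by simp
  qed
  have "G (\<lambda>x. u x + \<tau> * v x) = G u + \<tau> * G v" for \<tau> using G_lincomb[OF u v, of 1 \<tau>] by simp
  then have "((\<lambda>\<tau>. G (\<lambda>x. u x + \<tau> * v x)) has_real_derivative G v) (at 0)" by (auto intro!: derivative_eq_intros)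
  then show ?thesis unfolding J_def by (intro DERIV_diff DERIV_sum Phi B)
qed

section \<open>Critical points and uniqueness\<close>

definition critical_point :: "(real^'n \<Rightarrow> real) \<Rightarrow> bool" where
  "critical_point u \<longleftrightarrow> u \<in> X \<and> (\<forall>v\<in>X.
    (\<Sum>i=1..n. \<Sum>j=1..m. E_form \<Omega> (s i) (p j) u v) - (\<Sum>j=1..m. LINT t|\<nu>. E_form \<Omega> t (p j) u v) = G v)"

lemma minimizer_critical:
  assumes u: "u \<in> X" and min: "\<And>w. w \<in> X \<Longrightarrow> J u \<le> J w"
  shows "critical_point u"
  unfolding critical_point_def
proof (intro conjI ballI u)
  fix v assume v: "v \<in> X"
  have "\<forall>\<tau>. \<bar>0 - \<tau>\<bar> < 1 \<longrightarrow> J (\<lambda>x. u x + 0 * v x) \<le> J (\<lambda>x. u x + \<tau> * v x)"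
    using min fun_subspaceD(5)[OF X_subspace u v] by simp
  from DERIV_local_min[OF J_has_derivative[OF u v] zero_less_one this]
  show "(\<Sum>i=1..n. \<Sum>j=1..m. E_form \<Omega> (s i) (p j) u v) - (\<Sum>j=1..m. LINT t|\<nu>. E_form \<Omega> t (p j) u v) = G v" by simp
qed

lemma integral_null:
  assumes "measure \<nu> (space \<nu>) = 0" shows "(LINT t|\<nu>. f t) = (0 :: real)"
proof -
  interpret finite_measure \<nu> by (rule \<nu>_fin)
  have "AE t in \<nu>. f t = 0" by (rule AE_I[of _ _ "space \<nu>"]) (use assms in \<open>auto simp: emeasure_eq_measure\<close>)
  then show ?thesis by (rule integral_eq_zero_AE)
qed

lemma critical_minimizer:
  assumes null: "measure \<nu> (space \<nu>) = 0" and u: "critical_point u" and w: "w \<in> X"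
  shows "J u \<le> J w"
proof -
  have uX: "u \<in> X" using u by (simp add: critical_point_def)
  define v where "v = (\<lambda>x. w x - u x)"
  have v: "v \<in> X" unfolding v_def by (rule fun_subspaceD(3)[OF X_subspace w uX])
  have eq1: "(\<lambda>x. u x + 1 * v x) = w" by (auto simp: v_def)
  have "J (\<lambda>x. u x + 0 * v x) \<le> J (\<lambda>x. u x + 1 * v x)"
  proof (rule convex_line_min[where f = "\<lambda>\<tau>. J (\<lambda>x. u x + \<tau> * v x)"])
    show "((\<lambda>\<tau>. J (\<lambda>x. u x + \<tau> * v x)) has_real_derivative 0) (at 0)"
      using J_has_derivative[OF uX v] u v by (simp add: critical_point_def)
    fix t :: real assume t: "t \<in> {0..1}"
    have eq: "(\<lambda>x. u x + t * v x) = (\<lambda>x. (1 - t) * u x + t * w x)" by (auto simp: v_def algebra_simps)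
    define S where "S z = (\<Sum>i=1..n. \<Sum>j=1..m. 1 / (2 * p j) * Phi (s i) (p j) z)" for z :: "real^'n \<Rightarrow> real"
    have J: "J z = S z - G z" for z by (simp add: J_def S_def B_def integral_null[OF null])
    have "S (\<lambda>x. (1 - t) * u x + t * w x) \<le>
        (\<Sum>i=1..n. \<Sum>j=1..m. (1 - t) * (1 / (2 * p j) * Phi (s i) (p j) u) + t * (1 / (2 * p j) * Phi (s i) (p j) w))"
      unfolding S_def
    proof (intro sum_mono)
      fix i j assume ij: "i \<in> {1..n}" "j \<in> {1..m}"
      have "1 / (2 * p j) * Phi (s i) (p j) (\<lambda>x. (1 - t) * u x + t * w x) \<le> 1 / (2 * p j) * ((1 - t) * Phi (s i) (p j) u + t * Phi (s i) (p j) w)"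
        using power_functionalD(3)[OF Phi_X(1)[OF ij] uX w t] p[OF ij(2)] by (intro mult_left_mono) auto
      then show "1 / (2 * p j) * Phi (s i) (p j) (\<lambda>x. (1 - t) * u x + t * w x) \<le>
        (1 - t) * (1 / (2 * p j) * Phi (s i) (p j) u) + t * (1 / (2 * p j) * Phi (s i) (p j) w)"
        by (simp only: distrib_left mult.left_commute)
    qed
    also have "\<dots> = (1 - t) * S u + t * S w" unfolding S_def by (simp only: sum.distrib sum_distrib_left)
    finally have "J (\<lambda>x. (1 - t) * u x + t * w x) \<le> (1 - t) * J u + t * J w"
      unfolding J G_lincomb[OF uX w] by (simp add: algebra_simps)
    then show "J (\<lambda>x. u x + t * v x) \<le> (1 - t) * J (\<lambda>x. u x + 0 * v x) + t * J (\<lambda>x. u x + 1 * v x)"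
      unfolding eq1 unfolding eq by simp
  qed
  then show ?thesis unfolding eq1 by simp
qed

lemma critical_unique:
  assumes null: "measure \<nu> (space \<nu>) = 0" and u: "critical_point u" and v: "critical_point v"
  shows "AE x in lebesgue. u x = v x"
proof -
  have X: "u \<in> X" "v \<in> X" using u v by (auto simp: critical_point_def)
  define w where "w = (\<lambda>x. 1 / 2 * (u x + v x))"
  have w: "w \<in> X" unfolding w_def by (rule fun_subspaceD(6)[OF X_subspace X])
  define gap where "gap i j = (Phi (s i) (p j) u + Phi (s i) (p j) v) / 2 - Phi (s i) (p j) w" for i j
  have gap0: "0 \<le> 1 / (2 * p j) * gap i j" if "i \<in> {1..n}" "j \<in> {1..m}" for i j
    using power_functional_midpoint[OF Phi_X(1)[OF that] X] p[OF that(2)] unfolding gap_def w_def by (intro mult_nonneg_nonneg) auto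
  have "(\<Sum>i=1..n. \<Sum>j=1..m. 1 / (2 * p j) * gap i j) = (J u + J v) / 2 - J w"
    unfolding gap_def w_def J_midpoint_gap[OF X] by (simp add: B_def integral_null[OF null])
  also have "\<dots> \<le> 0" using critical_minimizer[OF null u w] critical_minimizer[OF null v w] by simp
  finally have le: "(\<Sum>i=1..n. \<Sum>j=1..m. 1 / (2 * p j) * gap i j) \<le> 0" .
  have gap: "gap i j \<le> 0" if ij: "i \<in> {1..n}" "j \<in> {1..m}" for i j
  proof -
    have "1 / (2 * p j) * gap i j \<le> (\<Sum>j=1..m. 1 / (2 * p j) * gap i j)"
      using ij gap0 by (intro member_le_sum) auto
    also have "\<dots> \<le> (\<Sum>i=1..n. \<Sum>j=1..m. 1 / (2 * p j) * gap i j)"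
      using ij gap0 by (intro member_le_sum[of i "{1..n}" "\<lambda>i. \<Sum>j=1..m. 1 / (2 * p j) * gap i j"] sum_nonneg) auto
    finally have "1 / (2 * p j) * gap i j \<le> 0" using le by linarith
    then show ?thesis using p[OF ij(2)] by (simp add: divide_le_0_iff)
  qed
  define z where "z = (\<lambda>x. u x - v x)"
  have z: "z \<in> X" unfolding z_def by (rule fun_subspaceD(3)[OF X_subspace X])
  obtain i where i: "i \<in> {1..n}" "s i = b" using b_attained by blast
  have j: "1 \<in> {1..m}" using m0 by simp
  \<comment> \<open>The constant \<open>D\<close> may grow as the small parameter shrinks, but it
    multiplies a nonpositive defect and drops out.\<close>
  have "Phi (s i) (p 1) z \<le> 0"
  proof (rule field_le_epsilon)
    fix e :: real assume e: "e > 0"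
    define Y where "Y = Phi (s i) (p 1) u + Phi (s i) (p 1) v"
    have Y: "Y \<ge> 0" by (simp add: Y_def Phi_nonneg)
    have "e / (Y + 1) > 0" using Y e by simp
    then obtain D where D: "D \<ge> 0" "Phi (s i) (p 1) z \<le> e / (Y + 1) * Y + D * gap i 1"
      using Phi_X(2)[OF i(1) j] X unfolding uniformly_convex_functional_def gap_def w_def z_def Y_def by blast
    have "D * gap i 1 \<le> 0" using D(1) gap[OF i(1) j] by (rule mult_nonneg_nonpos)
    moreover have "e / (Y + 1) * Y = e * (Y / (Y + 1))" by simp
    moreover have "e * (Y / (Y + 1)) \<le> e * 1" using Y e by (intro mult_left_mono) auto
    ultimately show "Phi (s i) (p 1) z \<le> 0 + e" using D(2) by linarith
  qed
  then have "Phi b (p 1) z = 0" using i(2) Phi_nonneg[of b "p 1" z] by simp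
  \<comment> \<open>The top energy may be blind to constants, so it is traded for order 0, where
    vanishing means being 0 almost everywhere.\<close>
  then have "Phi 0 (p 1) z = 0" using X_lower_order(2)[OF z j, of 0] sbar Phi_nonneg[of 0 "p 1" z] by simp
  moreover have p1: "p 1 > 0" using p[OF j] by simp
  moreover have "integrable lebesgue (\<lambda>x. \<bar>z x\<bar> powr p 1)"
    using X_lower_order(1)[OF z j, of 0] sbar by (auto simp: finite_set_def seminorm_finite_def)
  ultimately have "AE x in lebesgue. \<bar>z x\<bar> powr p 1 = 0"
    by (subst integral_nonneg_eq_0_iff_AE[symmetric]) (auto simp: Phi_0)
  then show ?thesis by eventually_elim (simp add: z_def)
qed

end

lemma set_integral_restrict_space_eq:
  fixes f :: "'a \<Rightarrow> real"
  assumes "A \<inter> space M \<in> sets M" shows "(LINT t:A|M. f t) = (LINT t|restrict_space M A. f t)"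
  unfolding set_lebesgue_integral_def integral_restrict_space[OF assms] ..

theorem theorem1p1:
  fixes \<Omega> :: "(real^'n) set" and \<delta> \<eta> :: real
  assumes "CARD('n) \<ge> 2"
    and "open \<Omega>" and "bounded \<Omega>" and "smooth_boundary \<Omega>"
    and "\<delta> > 0" and "\<eta> > 0"
  shows "\<exists>\<gamma>\<^sub>0>0. \<forall>\<gamma>\<in>{0..\<gamma>\<^sub>0}.
    \<forall>(n::nat) (m::nat) (s :: nat \<Rightarrow> real) (p :: nat \<Rightarrow> real)
      (\<mu>neg :: real measure) (g :: real^'n \<Rightarrow> real).
      n \<noteq> 0 \<and> m \<noteq> 0 \<and>
      (\<forall>i\<in>{1..n}. s i \<in> {0..1}) \<and>
      (\<forall>j\<in>{1..m}. p j \<in> {1<..<real CARD('n)}) \<and>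
      s_bar n s \<in> {0<..1} \<and>
      sets \<mu>neg = sets (restrict_space borel {0..1}) \<and> finite_measure \<mu>neg \<and>
      measure \<mu>neg {s_bar n s..1} = 0 \<and>
      measure \<mu>neg {0..<s_bar n s} \<le> \<gamma> * measure (dirac_sum n s) {s_bar n s..1} \<and>
      measure_supp (dirac_sum m p) \<subseteq> {1 + \<delta>..real CARD('n) - \<eta>} \<and>
      in_Lp \<Omega> (Max (p ` {1..m}) / (Max (p ` {1..m}) - 1)) g
      \<longrightarrow>
      (\<exists>u. weak_solution n s m p \<mu>neg \<Omega> g u \<and>
           global_minimizer_on (X_space n s m p \<Omega>) (energy n s m p \<mu>neg \<Omega> g) u) \<and>
      ((\<forall>A\<in>sets \<mu>neg. measure \<mu>neg A = 0) \<longrightarrow>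
        (\<forall>u v. weak_solution n s m p \<mu>neg \<Omega> g u \<and> weak_solution n s m p \<mu>neg \<Omega> g v
           \<longrightarrow> (AE x in lebesgue. u x = v x)))"
proof -
  obtain r where r: "\<And>x. x \<in> \<Omega> \<Longrightarrow> norm x < r" using \<open>bounded \<Omega>\<close> bounded_pos_less[of \<Omega>] by blast
  \<comment> \<open>The energy estimates ask for R \<ge> 1 and for support in the ball of radius R /
    2.\<close>
  define R where "R = max 1 (2 * r)"
  have R: "R \<ge> 1" "\<And>x. x \<in> \<Omega> \<Longrightarrow> norm x < R / 2" using r unfolding R_def by force+
  obtain C where C: "C \<ge> 1"
    and C_frac: "\<And>q S t u. q \<in> {1<..<real CARD('n)} \<Longrightarrow> S \<in> {0<..<1} \<Longrightarrow> t \<in> {0..S} \<Longrightarrow> u \<in> borel_measurable lebesgue \<Longrightarrow>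
       (AE x in lebesgue. R / 2 \<le> norm x \<longrightarrow> u x = 0) \<Longrightarrow> nn_Phi t q (u :: real^'n \<Rightarrow> real) \<le> ennreal C * nn_Phi S q u"
    and C_test: "\<And>q t \<phi>. q \<in> {1<..<real CARD('n)} \<Longrightarrow> t \<in> {0..<1} \<Longrightarrow> \<phi> \<in> test_functions {x :: real^'n. norm x < R / 2} \<Longrightarrow>
       nn_Phi t q \<phi> \<le> ennreal C * (\<integral>\<^sup>+x. ennreal (norm (grad \<phi> x) powr q) \<partial>lborel)"
    using seminorm_comparison[OF assms(1) R(1)] by blast
  have main: "(\<exists>u. weak_solution n s m p \<mu>neg \<Omega> g u \<and> global_minimizer_on (X_space n s m p \<Omega>) (energy n s m p \<mu>neg \<Omega> g) u) \<and>
      ((\<forall>A\<in>sets \<mu>neg. measure \<mu>neg A = 0) \<longrightarrow>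
        (\<forall>u v. weak_solution n s m p \<mu>neg \<Omega> g u \<and> weak_solution n s m p \<mu>neg \<Omega> g v \<longrightarrow> (AE x in lebesgue. u x = v x)))"
    if \<gamma>: "\<gamma> \<in> {0..1 / (2 * C)}" and nm: "n \<noteq> 0" "m \<noteq> 0" and s: "\<forall>i\<in>{1..n}. s i \<in> {0..1}"
      and p: "\<forall>j\<in>{1..m}. p j \<in> {1<..<real CARD('n)}" and sb: "s_bar n s \<in> {0<..1}"
      and sets: "sets \<mu>neg = sets (restrict_space borel {0..1})" and fin: "finite_measure \<mu>neg"
      and le: "measure \<mu>neg {0..<s_bar n s} \<le> \<gamma> * measure (dirac_sum n s) {s_bar n s..1}"
      and g: "in_Lp \<Omega> (Max (p ` {1..m}) / (Max (p ` {1..m}) - 1)) g"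
    for \<gamma> n m s p \<mu>neg and g :: "real^'n \<Rightarrow> real"
  proof -
    define b where "b = s_bar n s"
    \<comment> \<open>The equation and the energy integrate over [0,b) only, so the restriction
      carries all that is used of the measure.\<close>
    define \<nu> where "\<nu> = restrict_space \<mu>neg {0..<b}"
    have sp: "space \<mu>neg = {0..1}" using sets_eq_imp_space_eq[OF sets] by (simp add: space_restrict_space)
    have "{0..<b} \<in> sets (restrict_space borel {0..1})"
      using sb unfolding b_def by (subst sets_restrict_space_iff) auto
    then have A: "{0..<b} \<in> sets \<mu>neg" using sets by simp
    then have A': "{0..<b} \<inter> space \<mu>neg \<in> sets \<mu>neg" by auto
    have \<nu>_space: "space \<nu> = {0..<b}" unfolding \<nu>_def using sb by (auto simp: space_restrict_space sp b_def)
    have "{0..<b} \<inter> ({0..1} \<inter> Y) = {0..<b} \<inter> Y" for Y using sb by (auto simp: b_def)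
    then have \<nu>_sets: "sets \<nu> = sets (restrict_space borel {0..<b})"
      unfolding \<nu>_def by (simp add: sets_restrict_space sets image_image)
    have \<nu>_meas: "measure \<nu> (space \<nu>) = measure \<mu>neg {0..<b}"
      unfolding \<nu>_space unfolding \<nu>_def by (rule measure_restrict_space[OF A']) simp
    \<comment> \<open>No \<open>s i\<close> exceeds \<open>b\<close>, so the interval picks out
      exactly the indices with \<open>s i = b\<close>.\<close>
    have "emeasure (dirac_sum n s) {b..1} = ennreal (real (card {i \<in> {1..n}. s i = b}))"
    proof -
      have "s i \<le> b" if "i \<in> {1..n}" for i using that by (simp add: b_def s_bar_def)
      then have "indicator {b..1} (s i) = (if s i = b then 1 else 0 :: ennreal)" if "i \<in> {1..n}" for i
        using s that by (fastforce simp: indicator_def)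
      then have "emeasure (dirac_sum n s) {b..1} = (\<Sum>i=1..n. if s i = b then 1 else 0)"
        by (subst emeasure_dirac_sum) auto
      then show ?thesis by (simp add: sum.If_cases Int_def ennreal_of_nat_eq_real_of_nat)
    qed
    then have card: "measure (dirac_sum n s) {b..1} = real (card {i \<in> {1..n}. s i = b})" by (simp add: measure_def)
    have small: "2 * C * measure \<nu> (space \<nu>) \<le> real (card {i \<in> {1..n}. s i = b})"
    proof -
      have "measure \<nu> (space \<nu>) \<le> \<gamma> * real (card {i \<in> {1..n}. s i = b})" using le unfolding \<nu>_meas card[symmetric] by (simp add: b_def)
      also have "\<dots> \<le> 1 / (2 * C) * real (card {i \<in> {1..n}. s i = b})" using \<gamma> by (intro mult_right_mono) auto
      finally show ?thesis using C by (simp add: field_simps)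
    qed
    interpret mixed_problem_neg \<Omega> n m s p R C \<nu> g
    proof (intro mixed_problem_neg.intro mixed_problem.intro mixed_problem_neg_axioms.intro)
      show "\<Omega> \<in> sets lebesgue" using \<open>open \<Omega>\<close> by (simp add: borel_open)
      show "finite_measure \<nu>" unfolding \<nu>_def by (rule finite_measure_restrict_space[OF fin A])
    qed (use assms(1) R nm s p sb C C_frac C_test \<nu>_space \<nu>_sets small g in \<open>auto simp: b_def\<close>)
    have int: "(LINT t:{0..<s_bar n s}|\<mu>neg. f t) = (LINT t|\<nu>. f t)" for f :: "real \<Rightarrow> real"
      using set_integral_restrict_space_eq[OF A'] by (simp add: \<nu>_def b_def)
    have en: "energy n s m p \<mu>neg \<Omega> g u = J u" for u
      unfolding energy_def int J_def B_def G_def Phi_def by simp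
    have ws: "weak_solution n s m p \<mu>neg \<Omega> g u \<longleftrightarrow> critical_point u" for u
      unfolding weak_solution_def int critical_point_def G_def ..
    obtain u where u: "u \<in> X" "\<And>w. w \<in> X \<Longrightarrow> J u \<le> J w" using J_minimizer by blast
    have "weak_solution n s m p \<mu>neg \<Omega> g u \<and> global_minimizer_on X (energy n s m p \<mu>neg \<Omega> g) u"
      using u minimizer_critical[OF u] by (simp add: ws global_minimizer_on_def en)
    moreover have "AE x in lebesgue. u x = v x"
      if null: "\<forall>A\<in>sets \<mu>neg. measure \<mu>neg A = 0" and "weak_solution n s m p \<mu>neg \<Omega> g u" "weak_solution n s m p \<mu>neg \<Omega> g v" for u v
    proof (rule critical_unique)
      show "measure \<nu> (space \<nu>) = 0" unfolding \<nu>_meas using null A by blast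
    qed (use that in \<open>auto simp: ws\<close>)
    ultimately show ?thesis by blast
  qed
  show ?thesis
  proof (intro exI[of _ "1 / (2 * C)"] conjI ballI allI impI)
    show "1 / (2 * C) > 0" using C by simp
  qed (use main in blast)+
qed

end
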